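(* Let $D$ be a central simple algebra of degree $m$ over its center $C$, let $\sigma\in{\rm Aut}(D)$ be such that $\sigma|_C$ has finite order $n$ and $\{\mathrm{id},\sigma,\dots,\sigma^{n-1}\}$ is a subgroup of ${\rm Aut}(D)$, put $F={\rm Fix}(\sigma)\cap C$, and let $k_0,\dots,k_{n-1}\in C^\times$. Let $E$ be a maximal étale subalgebra of $D$ of dimension $m$ (over $C$). Then $E$ lies in the left, middle and right nucleus of the generalized Menichetti algebra ${\rm Men}(D,\sigma,k_0,\dots,k_{n-1})$. Therefore ${\rm Men}(D,\sigma,k_0,\dots,k_{n-1})$ is a semiassociative algebra over $F$ that is not homogeneous.
   Context: Generalized Menichetti algebra (cyclic case): with $D,C,\sigma,n,F$ as in the claim, $C/F$ is a cyclic Galois extension of degree $n$ with group $\langle\sigma|_C\rangle$. For $k_0,\dots,k_{n-1}\in C^\times$ put $c_{i,0}=c_{0,j}=1$ and, for nonzero $i,j\in\mathbb{Z}_n$ (representatives in $\{1,\dots,n-1\}$), $c_{i,j}=k_0^{-1}k_1^{-1}\cdots k_{j-1}^{-1}\,k_ik_{i+1}\cdots k_{i+j-1}$, indices modulo $n$. ${\rm Men}(D,\sigma,k_0,\dots,k_{n-1})$ is the left $D$-module $D^n$ with multiplication $(x_0,\dots,x_{n-1})\cdot(y_0,\dots,y_{n-1})=w$, where for each $s\in\mathbb{Z}_n$ the $s$-th coordinate of $w$ is $w_s=\sum_{i+j\equiv s \bmod n}c_{i,j}\,\sigma^j(x_i)\,y_j$ (with $i,j\in\{0,\dots,n-1\}$).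 It is a unital nonassociative $F$-algebra of dimension $n^2m^2$ over $F$ with unit $(1,0,\dots,0)$, and $D$ is identified with the subalgebra of elements $(x_0,0,\dots,0)$. Nuclei: With $[x,y,z]=(xy)z-x(yz)$, ${\rm Nuc}_l(A)=\{x:[x,A,A]=0\}$, ${\rm Nuc}_m(A)=\{x:[A,x,A]=0\}$, ${\rm Nuc}_r(A)=\{x:[A,A,x]=0\}$, and ${\rm Nuc}(A)$ is their intersection. The center of $A$ consists of the elements of ${\rm Nuc}(A)$ commuting with all of $A$; $A$ is $F$-central if its center is $F$. Semiassociative: A finite-dimensional $F$-central nonassociative algebra $A$ is semiassociative if ${\rm Nuc}(A)$ has an étale $F$-subalgebra $E$ (finite product of finite separable field extensions of $F$) such that $A$ is a cyclic and faithful module over $E\otimes_F E$ via $(e\otimes e')a=eae'$. A semiassociative algebra $A$ is semicentral if all simple components of ${\rm Nuc}(A)/J({\rm Nuc}(A))$ ($J$ the Jacobson radical) are $F$-central. The atoms of $A$ are these simple components. A semiassociative algebra is homogeneous if it is semicentral and its atoms are all Brauer equivalent to each other.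
   Formalization: "Not homogeneous" is proved for Men(D,σ,k_0,…,k_{n-1}) that is not associative; when it is associative (e.g. n = 1 or all k_i equal) it is a central simple F-algebra, its own single atom, hence homogeneous, so the literal claim fails there. *)

theory Defs
  imports "HOL-Algebra.Algebra"
begin

section \<open>Nonassociative algebras over a field\<close>

text \<open>``Nonassociative'' means not necessarily associative: the record type of
  \<^locale>\<open>module\<close> is used, with its multiplication only required to be bilinear and unital.\<close>

locale nonassoc_algebra = module F A for F (structure) and A (structure) +
  assumes base_field: "field F"
    and mult_closed: "\<lbrakk>x \<in> carrier A; y \<in> carrier A\<rbrakk> \<Longrightarrow> x \<otimes>\<^bsub>A\<^esub> y \<in> carrier A"
    and unit_closed: "\<one>\<^bsub>A\<^esub> \<in> carrier A"
    and unit_left: "x \<in> carrier A \<Longrightarrow> \<one>\<^bsub>A\<^esub> \<otimes>\<^bsub>A\<^esub> x = x"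
    and unit_right: "x \<in> carrier A \<Longrightarrow> x \<otimes>\<^bsub>A\<^esub> \<one>\<^bsub>A\<^esub> = x"
    and distrib_left: "\<lbrakk>x \<in> carrier A; y \<in> carrier A; z \<in> carrier A\<rbrakk>
      \<Longrightarrow> x \<otimes>\<^bsub>A\<^esub> (y \<oplus>\<^bsub>A\<^esub> z) = (x \<otimes>\<^bsub>A\<^esub> y) \<oplus>\<^bsub>A\<^esub> (x \<otimes>\<^bsub>A\<^esub> z)"
    and distrib_right: "\<lbrakk>x \<in> carrier A; y \<in> carrier A; z \<in> carrier A\<rbrakk>
      \<Longrightarrow> (x \<oplus>\<^bsub>A\<^esub> y) \<otimes>\<^bsub>A\<^esub> z = (x \<otimes>\<^bsub>A\<^esub> z) \<oplus>\<^bsub>A\<^esub> (y \<otimes>\<^bsub>A\<^esub> z)"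
    and scalar_left: "\<lbrakk>c \<in> carrier F; x \<in> carrier A; y \<in> carrier A\<rbrakk>
      \<Longrightarrow> (c \<odot>\<^bsub>A\<^esub> x) \<otimes>\<^bsub>A\<^esub> y = c \<odot>\<^bsub>A\<^esub> (x \<otimes>\<^bsub>A\<^esub> y)"
    and scalar_right: "\<lbrakk>c \<in> carrier F; x \<in> carrier A; y \<in> carrier A\<rbrakk>
      \<Longrightarrow> x \<otimes>\<^bsub>A\<^esub> (c \<odot>\<^bsub>A\<^esub> y) = c \<odot>\<^bsub>A\<^esub> (x \<otimes>\<^bsub>A\<^esub> y)"

definition fin_dim :: "('k, 'c) ring_scheme \<Rightarrow> ('k, 'a) module \<Rightarrow> bool" where
  "fin_dim F A \<longleftrightarrow> (\<exists>B. finite B \<and> B \<subseteq> carrier A \<and>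
     (\<forall>x \<in> carrier A. \<exists>f \<in> B \<rightarrow> carrier F. x = (\<Oplus>\<^bsub>A\<^esub>b\<in>B. f b \<odot>\<^bsub>A\<^esub> b)))"

definition subalg :: "('k, 'c) ring_scheme \<Rightarrow> ('k, 'a) module \<Rightarrow> 'a set \<Rightarrow> bool" where
  "subalg F A S \<longleftrightarrow> additive_subgroup S A \<and> \<one>\<^bsub>A\<^esub> \<in> S \<and>
     (\<forall>x\<in>S. \<forall>y\<in>S. x \<otimes>\<^bsub>A\<^esub> y \<in> S) \<and> (\<forall>c\<in>carrier F. \<forall>x\<in>S. c \<odot>\<^bsub>A\<^esub> x \<in> S)"

definition alg_hom :: "('k, 'c) ring_scheme \<Rightarrow> ('k, 'a) module \<Rightarrow> ('k, 'b) module \<Rightarrow> ('a \<Rightarrow> 'b) set" where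
  "alg_hom F A B = {h \<in> ring_hom A B. \<forall>c\<in>carrier F. \<forall>x\<in>carrier A. h (c \<odot>\<^bsub>A\<^esub> x) = c \<odot>\<^bsub>B\<^esub> h x}"

definition alg_iso :: "('k, 'c) ring_scheme \<Rightarrow> ('k, 'a) module \<Rightarrow> ('k, 'b) module \<Rightarrow> bool" where
  "alg_iso F A B \<longleftrightarrow> (\<exists>h \<in> alg_hom F A B. bij_betw h (carrier A) (carrier B))"


subsection \<open>Nuclei and center\<close>

definition associator :: "('a, 'c) ring_scheme \<Rightarrow> 'a \<Rightarrow> 'a \<Rightarrow> 'a \<Rightarrow> 'a" where
  "associator A x y z = ((x \<otimes>\<^bsub>A\<^esub> y) \<otimes>\<^bsub>A\<^esub> z) \<ominus>\<^bsub>A\<^esub> (x \<otimes>\<^bsub>A\<^esub> (y \<otimes>\<^bsub>A\<^esub> z))"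

definition nuc_l :: "('a, 'c) ring_scheme \<Rightarrow> 'a set" where
  "nuc_l A = {x \<in> carrier A. \<forall>y\<in>carrier A. \<forall>z\<in>carrier A. associator A x y z = \<zero>\<^bsub>A\<^esub>}"

definition nuc_m :: "('a, 'c) ring_scheme \<Rightarrow> 'a set" where
  "nuc_m A = {x \<in> carrier A. \<forall>y\<in>carrier A. \<forall>z\<in>carrier A. associator A y x z = \<zero>\<^bsub>A\<^esub>}"

definition nuc_r :: "('a, 'c) ring_scheme \<Rightarrow> 'a set" where
  "nuc_r A = {x \<in> carrier A. \<forall>y\<in>carrier A. \<forall>z\<in>carrier A. associator A y z x = \<zero>\<^bsub>A\<^esub>}"

definition nucleus :: "('a, 'c) ring_scheme \<Rightarrow> 'a set" where
  "nucleus A = nuc_l A \<inter> nuc_m A \<inter> nuc_r A"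

definition center :: "('a, 'c) ring_scheme \<Rightarrow> 'a set" where
  "center A = {x \<in> nucleus A. \<forall>y\<in>carrier A. x \<otimes>\<^bsub>A\<^esub> y = y \<otimes>\<^bsub>A\<^esub> x}"

definition central :: "('k, 'c) ring_scheme \<Rightarrow> ('k, 'a) module \<Rightarrow> bool" where
  "central F A \<longleftrightarrow> center A = (\<lambda>c. c \<odot>\<^bsub>A\<^esub> \<one>\<^bsub>A\<^esub>) ` carrier F"

definition associative :: "('a, 'c) ring_scheme \<Rightarrow> bool" where
  "associative A \<longleftrightarrow>
     (\<forall>x\<in>carrier A. \<forall>y\<in>carrier A. \<forall>z\<in>carrier A. associator A x y z = \<zero>\<^bsub>A\<^esub>)"


section \<open>Etale algebras\<close>

text \<open>Polynomials are lists of coefficients, leading coefficient first.\<close>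

definition poly_deriv :: "('a, 'c) ring_scheme \<Rightarrow> 'a list \<Rightarrow> 'a list" where
  "poly_deriv R p =
     ring.normalize R (map (\<lambda>i. [i] \<cdot>\<^bsub>R\<^esub> ring.coeff R p i) (rev [1..<length p]))"

definition separable_poly :: "('a, 'c) ring_scheme \<Rightarrow> 'a set \<Rightarrow> 'a list \<Rightarrow> bool" where
  "separable_poly R K p \<longleftrightarrow>
     (\<exists>u \<in> carrier (univ_poly R K). \<exists>v \<in> carrier (univ_poly R K).
        (u \<otimes>\<^bsub>univ_poly R K\<^esub> p) \<oplus>\<^bsub>univ_poly R K\<^esub> (v \<otimes>\<^bsub>univ_poly R K\<^esub> poly_deriv R p)
          = \<one>\<^bsub>univ_poly R K\<^esub>)"

definition fin_sep_field_ext :: "('k, 'c) ring_scheme \<Rightarrow> ('k, 'a) module \<Rightarrow> bool" where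
  "fin_sep_field_ext F K \<longleftrightarrow> nonassoc_algebra F K \<and> field K \<and> fin_dim F K \<and>
     (let F' = (\<lambda>c. c \<odot>\<^bsub>K\<^esub> \<one>\<^bsub>K\<^esub>) ` carrier F
      in \<forall>x\<in>carrier K. separable_poly K F' (ring.Irr K F' x))"

text \<open>The factors may be taken on the same type as the algebra, since each factor of a
  product of unital algebras embeds into it (as an ideal).\<close>

definition etale :: "('k, 'c) ring_scheme \<Rightarrow> ('k, 'a) module \<Rightarrow> bool" where
  "etale F B \<longleftrightarrow> nonassoc_algebra F B \<and>
     (\<exists>(r::nat) (K :: nat \<Rightarrow> ('k, 'a) module) h.
        (\<forall>i<r. fin_sep_field_ext F (K i) \<and> h i \<in> alg_hom F B (K i)) \<and>
        bij_betw (\<lambda>x. \<lambda>i\<in>{..<r}. h i x) (carrier B) (\<Pi>\<^sub>E i\<in>{..<r}. carrier (K i)))"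

definition etale_subalg :: "('k, 'c) ring_scheme \<Rightarrow> ('k, 'a) module \<Rightarrow> 'a set \<Rightarrow> bool" where
  "etale_subalg F A E \<longleftrightarrow> subalg F A E \<and> etale F (A\<lparr>carrier := E\<rparr>)"

definition maximal_etale_subalg :: "('k, 'c) ring_scheme \<Rightarrow> ('k, 'a) module \<Rightarrow> 'a set \<Rightarrow> bool" where
  "maximal_etale_subalg F A E \<longleftrightarrow> etale_subalg F A E \<and>
     (\<forall>E'. etale_subalg F A E' \<and> E \<subseteq> E' \<longrightarrow> E' = E)"


section \<open>Tensor products and semiassociative algebras\<close>

definition tensor_relations ::
    "('k, 'c) ring_scheme \<Rightarrow> ('k, 'a) module \<Rightarrow> ('k, 'b) module \<Rightarrow> ('a \<times> 'b \<Rightarrow>\<^sub>0 int) set" where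
  "tensor_relations F U V =
     {frag_of (u \<oplus>\<^bsub>U\<^esub> u', v) - frag_of (u, v) - frag_of (u', v) |u u' v.
        u \<in> carrier U \<and> u' \<in> carrier U \<and> v \<in> carrier V} \<union>
     {frag_of (u, v \<oplus>\<^bsub>V\<^esub> v') - frag_of (u, v) - frag_of (u, v') |u v v'.
        u \<in> carrier U \<and> v \<in> carrier V \<and> v' \<in> carrier V} \<union>
     {frag_of (c \<odot>\<^bsub>U\<^esub> u, v) - frag_of (u, c \<odot>\<^bsub>V\<^esub> v) |c u v.
        c \<in> carrier F \<and> u \<in> carrier U \<and> v \<in> carrier V}"

text \<open>The additive group of the tensor product over F, written multiplicatively as all groups
  of the library are. Its elements are cosets of formal integer combinations of pairs.\<close>

definition tensor ::
    "('k, 'c) ring_scheme \<Rightarrow> ('k, 'a) module \<Rightarrow> ('k, 'b) module \<Rightarrow> ('a \<times> 'b \<Rightarrow>\<^sub>0 int) set monoid" where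
  "tensor F U V =
     (let G = free_Abelian_group (carrier U \<times> carrier V)
      in G Mod generate G (tensor_relations F U V))"

definition frag_act :: "('a, 'c) ring_scheme \<Rightarrow> ('a \<times> 'a \<Rightarrow>\<^sub>0 int) \<Rightarrow> 'a \<Rightarrow> 'a" where
  "frag_act A f a = (\<Oplus>\<^bsub>A\<^esub>p\<in>Poly_Mapping.keys f.
     [Poly_Mapping.lookup f p] \<cdot>\<^bsub>A\<^esub> ((fst p \<otimes>\<^bsub>A\<^esub> a) \<otimes>\<^bsub>A\<^esub> snd p))"

text \<open>The action of a tensor, determined by e \<open>\<otimes>\<close> e' acting as a \<open>\<mapsto>\<close> eae'. All representatives
  of a tensor act in the same way, so the image below is a singleton.\<close>

definition tensor_act :: "('a, 'c) ring_scheme \<Rightarrow> ('a \<times> 'a \<Rightarrow>\<^sub>0 int) set \<Rightarrow> 'a \<Rightarrow> 'a" where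
  "tensor_act A t a = the_elem ((\<lambda>f. frag_act A f a) ` t)"

text \<open>For E a commutative subalgebra of the nucleus, A is a module over the tensor product of E
  with itself under \<^const>\<open>tensor_act\<close>. The ring multiplication of the tensor product does
  not enter into cyclicity (A is the orbit of one element) or faithfulness (the annihilator of A
  is zero).\<close>

definition cyclic_bimodule :: "('k, 'c) ring_scheme \<Rightarrow> ('k, 'a) module \<Rightarrow> 'a set \<Rightarrow> bool" where
  "cyclic_bimodule F A E \<longleftrightarrow>
     (let T = tensor F (A\<lparr>carrier := E\<rparr>) (A\<lparr>carrier := E\<rparr>)
      in \<exists>a\<in>carrier A. carrier A = (\<lambda>t. tensor_act A t a) ` carrier T)"

definition faithful_bimodule :: "('k, 'c) ring_scheme \<Rightarrow> ('k, 'a) module \<Rightarrow> 'a set \<Rightarrow> bool" where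
  "faithful_bimodule F A E \<longleftrightarrow>
     (let T = tensor F (A\<lparr>carrier := E\<rparr>) (A\<lparr>carrier := E\<rparr>)
      in \<forall>t\<in>carrier T. (\<forall>a\<in>carrier A. tensor_act A t a = \<zero>\<^bsub>A\<^esub>) \<longrightarrow> t = \<one>\<^bsub>T\<^esub>)"

definition semiassociative :: "('k, 'c) ring_scheme \<Rightarrow> ('k, 'a) module \<Rightarrow> bool" where
  "semiassociative F A \<longleftrightarrow> nonassoc_algebra F A \<and> fin_dim F A \<and> central F A \<and>
     (\<exists>E. etale_subalg F (A\<lparr>carrier := nucleus A\<rparr>) E \<and>
          cyclic_bimodule F A E \<and> faithful_bimodule F A E)"


section \<open>Atoms, semicentral and homogeneous algebras\<close>

definition left_ideal :: "('a, 'c) ring_scheme \<Rightarrow> 'a set \<Rightarrow> bool" where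
  "left_ideal R I \<longleftrightarrow> additive_subgroup I R \<and> (\<forall>r\<in>carrier R. \<forall>x\<in>I. r \<otimes>\<^bsub>R\<^esub> x \<in> I)"

definition maximal_left_ideal :: "('a, 'c) ring_scheme \<Rightarrow> 'a set \<Rightarrow> bool" where
  "maximal_left_ideal R I \<longleftrightarrow> left_ideal R I \<and> I \<noteq> carrier R \<and>
     (\<forall>J. left_ideal R J \<and> I \<subseteq> J \<longrightarrow> J = I \<or> J = carrier R)"

definition jacobson_radical :: "('a, 'c) ring_scheme \<Rightarrow> 'a set" where
  "jacobson_radical R = carrier R \<inter> \<Inter> {I. maximal_left_ideal R I}"

definition quot_alg :: "('k, 'a) module \<Rightarrow> 'a set \<Rightarrow> ('k, 'a set) module" where
  "quot_alg A I =
     \<lparr>carrier = carrier (A Quot I), monoid.mult = monoid.mult (A Quot I), one = \<one>\<^bsub>A Quot I\<^esub>,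
      ring.zero = \<zero>\<^bsub>A Quot I\<^esub>, add = add (A Quot I),
      smult = (\<lambda>c Q. \<Union>x\<in>Q. I +>\<^bsub>A\<^esub> (c \<odot>\<^bsub>A\<^esub> x))\<rparr>"

definition minimal_ideal :: "('a, 'c) ring_scheme \<Rightarrow> 'a set \<Rightarrow> bool" where
  "minimal_ideal R I \<longleftrightarrow> ideal I R \<and> I \<noteq> {\<zero>\<^bsub>R\<^esub>} \<and>
     (\<forall>J. ideal J R \<and> J \<subseteq> I \<longrightarrow> J = {\<zero>\<^bsub>R\<^esub>} \<or> J = I)"

text \<open>The simple components of a semisimple algebra are its minimal two-sided ideals; each
  is an algebra with its own identity element.\<close>

definition simple_components :: "('k, 'a) module \<Rightarrow> ('k, 'a) module set" where
  "simple_components B =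
     {B\<lparr>carrier := I, one := (THE e. e \<in> I \<and> (\<forall>x\<in>I. e \<otimes>\<^bsub>B\<^esub> x = x \<and> x \<otimes>\<^bsub>B\<^esub> e = x))\<rparr> |I.
        minimal_ideal B I}"

definition atoms :: "('k, 'a) module \<Rightarrow> ('k, 'a set) module set" where
  "atoms A = (let N = A\<lparr>carrier := nucleus A\<rparr>
              in simple_components (quot_alg N (jacobson_radical N)))"

definition mat_alg :: "nat \<Rightarrow> ('k, 'a) module \<Rightarrow> ('k, nat \<times> nat \<Rightarrow> 'a) module" where
  "mat_alg r B =
     (let S = {..<r} \<times> {..<r} in
     \<lparr>carrier = S \<rightarrow>\<^sub>E carrier B,
      monoid.mult = (\<lambda>M N. \<lambda>(i, j)\<in>S. \<Oplus>\<^bsub>B\<^esub>l\<in>{..<r}. M (i, l) \<otimes>\<^bsub>B\<^esub> N (l, j)),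
      one = (\<lambda>(i, j)\<in>S. if i = j then \<one>\<^bsub>B\<^esub> else \<zero>\<^bsub>B\<^esub>),
      ring.zero = (\<lambda>p\<in>S. \<zero>\<^bsub>B\<^esub>),
      add = (\<lambda>M N. \<lambda>p\<in>S. M p \<oplus>\<^bsub>B\<^esub> N p),
      smult = (\<lambda>c M. \<lambda>p\<in>S. c \<odot>\<^bsub>B\<^esub> M p)\<rparr>)"

definition brauer_equiv :: "('k, 'c) ring_scheme \<Rightarrow> ('k, 'a) module \<Rightarrow> ('k, 'b) module \<Rightarrow> bool" where
  "brauer_equiv F A B \<longleftrightarrow> (\<exists>r>0. \<exists>s>0. alg_iso F (mat_alg r A) (mat_alg s B))"

definition semicentral :: "('k, 'c) ring_scheme \<Rightarrow> ('k, 'a) module \<Rightarrow> bool" where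
  "semicentral F A \<longleftrightarrow> semiassociative F A \<and> (\<forall>B\<in>atoms A. central F B)"

definition homogeneous :: "('k, 'c) ring_scheme \<Rightarrow> ('k, 'a) module \<Rightarrow> bool" where
  "homogeneous F A \<longleftrightarrow> semicentral F A \<and> (\<forall>B\<in>atoms A. \<forall>B'\<in>atoms A. brauer_equiv F B B')"


section \<open>Generalized Menichetti algebras\<close>

definition simple_ring :: "('a, 'c) ring_scheme \<Rightarrow> bool" where
  "simple_ring R \<longleftrightarrow> ring R \<and> carrier R \<noteq> {\<zero>\<^bsub>R\<^esub>} \<and>
     (\<forall>I. ideal I R \<longrightarrow> I = {\<zero>\<^bsub>R\<^esub>} \<or> I = carrier R)"

text \<open>Central simple of degree m over its own center.\<close>

definition csa_of_degree :: "nat \<Rightarrow> ('a, 'c) ring_scheme \<Rightarrow> bool" where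
  "csa_of_degree m D \<longleftrightarrow> simple_ring D \<and> ring.dimension D (m\<^sup>2) (center D) (carrier D)"

text \<open>A ring as an algebra over its central subfields.\<close>

definition self_alg :: "('a, 'c) ring_scheme \<Rightarrow> ('a, 'a) module" where
  "self_alg R = \<lparr>carrier = carrier R, monoid.mult = monoid.mult R, one = \<one>\<^bsub>R\<^esub>, ring.zero = \<zero>\<^bsub>R\<^esub>, add = add R,
     smult = monoid.mult R\<rparr>"

definition ring_aut :: "('a, 'c) ring_scheme \<Rightarrow> ('a \<Rightarrow> 'a) monoid" where
  "ring_aut R = BijGroup (carrier R) \<lparr>carrier := ring_iso R R \<inter> Bij (carrier R)\<rparr>"

definition men_coeff :: "('d, 'c) ring_scheme \<Rightarrow> nat \<Rightarrow> (nat \<Rightarrow> 'd) \<Rightarrow> nat \<Rightarrow> nat \<Rightarrow> 'd" where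
  "men_coeff D n k i j =
     (let C = D\<lparr>carrier := center D\<rparr> in
      if i = 0 \<or> j = 0 then \<one>\<^bsub>D\<^esub>
      else (\<Otimes>\<^bsub>C\<^esub>l\<in>{..<j}. inv\<^bsub>C\<^esub> k l) \<otimes>\<^bsub>D\<^esub> (\<Otimes>\<^bsub>C\<^esub>l\<in>{..<j}. k ((i + l) mod n)))"

definition Men :: "('d, 'c) ring_scheme \<Rightarrow> ('d \<Rightarrow> 'd) \<Rightarrow> nat \<Rightarrow> (nat \<Rightarrow> 'd) \<Rightarrow> ('d, nat \<Rightarrow> 'd) module" where
  "Men D \<sigma> n k =
     \<lparr>carrier = {..<n} \<rightarrow>\<^sub>E carrier D,
      monoid.mult = (\<lambda>x y. \<lambda>s\<in>{..<n}. \<Oplus>\<^bsub>D\<^esub>p\<in>{(i, j). i < n \<and> j < n \<and> (i + j) mod n = s}.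
        case p of (i, j) \<Rightarrow> men_coeff D n k i j \<otimes>\<^bsub>D\<^esub> (\<sigma> ^^ j) (x i) \<otimes>\<^bsub>D\<^esub> y j),
      one = (\<lambda>s\<in>{..<n}. if s = 0 then \<one>\<^bsub>D\<^esub> else \<zero>\<^bsub>D\<^esub>),
      ring.zero = (\<lambda>s\<in>{..<n}. \<zero>\<^bsub>D\<^esub>),
      add = (\<lambda>x y. \<lambda>s\<in>{..<n}. x s \<oplus>\<^bsub>D\<^esub> y s),
      smult = (\<lambda>c x. \<lambda>s\<in>{..<n}. c \<otimes>\<^bsub>D\<^esub> x s)\<rparr>"

text \<open>If all \<open>k i\<close> are equal (or if \<open>n = 1\<close>), then \<^term>\<open>Men D \<sigma> n k\<close> is an associative
  central simple algebra over F, its own single atom, and hence homogeneous. Results excluding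
  homogeneity therefore need \<^term>\<open>\<not> associative (Men D \<sigma> n k)\<close>.\<close>

text \<open>The identification of D with a subalgebra of \<^term>\<open>Men D \<sigma> n k\<close>.\<close>

definition men_embed :: "('d, 'c) ring_scheme \<Rightarrow> nat \<Rightarrow> 'd \<Rightarrow> nat \<Rightarrow> 'd" where
  "men_embed D n x = (\<lambda>s\<in>{..<n}. if s = 0 then x else \<zero>\<^bsub>D\<^esub>)"

end

theory Submission
  imports Defs
begin

text \<open>
  Write \<open>\<tau> j\<close> for the j-th power of the automorphism. As a bimodule over D, the algebra is the sum of
  n copies of D, on the j-th of which d acts from the left as \<open>\<tau> j d\<close> and from the right as d. This
  decomposition governs everything.

  The elements of D in position 0 associate with all others because the coefficients of the
  multiplication are central and each \<open>\<tau> j\<close> is multiplicative; so D lies in all three nuclei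
  (\<open>embed_nuclei\<close>), and E can be tried as the subalgebra required by semiassociativity.

  Over the fixed field F, the subalgebra E remains etale, since the product of the conjugates of a
  separable polynomial over C is a polynomial over F with the same simple root
  (\<open>descend_sep_witness\<close>, \<open>etale_image_Fix\<close>). The bimodule is cyclic over E for two reasons.
  Independence of the automorphisms on C lets the action of E on the two sides separate the n
  components; and each component, which is D with actions of the separable algebras \<open>\<tau> j ` E\<close>
  and E whose dimensions multiply to that of D, has a cyclic vector. For the latter
  (\<open>cyclic_vector\<close>), an averaging argument splits off sub-bimodules, and a vector generating a
  sub-bimodule of maximal dimension generates everything, because the tensor product of the two
  algebras acts faithfully on D. Faithfulness of the whole action (\<open>EM_faithful\<close>) follows from a
  shortest relation: the elements of D acting from the left by all \<open>\<tau> j\<close> and from the right satisfy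
  only the relations that hold over F (\<open>faithful_twisted_action\<close>).

  For the failure of homogeneity, simplicity of D and independence of the \<open>\<tau> j\<close> show that
  the nucleus is the sum of the components indexed by a subgroup S of the integers modulo n, and
  that it is a simple ring (\<open>nucleus_simple\<close>). Its radical is therefore zero and it is the only atom.
  If the algebra is not associative, S is proper; then some element of C outside F is fixed by
  all \<open>\<tau> j\<close> with j in S (\<open>proper_subgroup_fixes_more\<close>) and is central in the nucleus. So the atom is
  not central over F, and the algebra is not even semicentral.
\<close>

section \<open>Central simple rings with a cyclic group of automorphisms\<close>

lemma (in ring) associator_zero:
  "\<lbrakk>x \<in> carrier R; y \<in> carrier R; z \<in> carrier R\<rbrakk> \<Longrightarrow> associator R x y z = \<zero>"
  by (simp add: associator_def m_assoc)

lemma (in ring) center_ring: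
  "center R = {x \<in> carrier R. \<forall>y\<in>carrier R. x \<otimes> y = y \<otimes> x}"
  by (auto simp: center_def nucleus_def nuc_l_def nuc_m_def nuc_r_def associator_zero)

lemma (in ring) center_carrier: "x \<in> center R \<Longrightarrow> x \<in> carrier R"
  unfolding center_ring by blast

lemma (in ring) center_memI:
  "\<lbrakk>x \<in> carrier R; \<And>y. y \<in> carrier R \<Longrightarrow> x \<otimes> y = y \<otimes> x\<rbrakk> \<Longrightarrow> x \<in> center R"
  unfolding center_ring by blast

lemma (in ring) center_comm: "\<lbrakk>x \<in> center R; y \<in> carrier R\<rbrakk> \<Longrightarrow> x \<otimes> y = y \<otimes> x"
  unfolding center_ring by blast

lemma (in ring) center_subring: "subring (center R) R"
proof (rule subringI)
  fix x y assume "x \<in> center R" "y \<in> center R"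
  then have *: "x \<in> carrier R" "y \<in> carrier R"
    and x: "\<And>z. z \<in> carrier R \<Longrightarrow> x \<otimes> z = z \<otimes> x" and y: "\<And>z. z \<in> carrier R \<Longrightarrow> y \<otimes> z = z \<otimes> y"
    by (auto simp: center_ring)
  have "x \<otimes> y \<otimes> z = z \<otimes> (x \<otimes> y)" if "z \<in> carrier R" for z
    using * that x y by (metis m_assoc)
  then show "x \<otimes> y \<in> center R" unfolding center_ring using * by blast
  have "(x \<oplus> y) \<otimes> z = z \<otimes> (x \<oplus> y)" if "z \<in> carrier R" for z
    using * x[OF that] y[OF that] that by (metis l_distr r_distr)
  then show "x \<oplus> y \<in> center R" unfolding center_ring using * by blast
  have "\<ominus> x \<otimes> z = z \<otimes> \<ominus> x" if "z \<in> carrier R" for z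
    using * x[OF that] that by (metis l_minus r_minus)
  then show "\<ominus> x \<in> center R" unfolding center_ring using * by blast
next
  show "center R \<subseteq> carrier R" unfolding center_ring by blast
  show "\<one> \<in> center R" unfolding center_ring by simp
qed

lemma (in ring) simple_center_subfield:
  assumes "simple_ring R"
  shows "subfield (center R) R"
proof (rule subfieldI)
  show sub: "subcring (center R) R"
    by (rule subcringI[OF center_subring]) (blast intro: center_comm center_carrier)
  let ?C = "R\<lparr>carrier := center R\<rparr>"
  have one0: "\<one> \<noteq> \<zero>"
    using assms one_zeroD unfolding simple_ring_def by blast
  have "x \<in> Units ?C" if x: "x \<in> center R" "x \<noteq> \<zero>" for x
  proof -
    from x have xc: "x \<in> carrier R" and xz: "\<And>z. z \<in> carrier R \<Longrightarrow> x \<otimes> z = z \<otimes> x" by (auto simp: center_ring)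
    have "ideal ((\<otimes>) x ` carrier R) R"
    proof (rule idealI)
      show "ring R" by (rule ring_axioms)
      show "subgroup ((\<otimes>) x ` carrier R) (add_monoid R)"
      proof (rule add.subgroupI, goal_cases)
        case (3 a)
        then obtain b where "b \<in> carrier R" "a = x \<otimes> b" by blast
        then have "\<ominus> a = x \<otimes> \<ominus> b" "\<ominus> b \<in> carrier R" using xc by (auto simp: r_minus)
        then show ?case unfolding a_inv_def[symmetric] by blast
      next
        case (4 a b)
        then obtain a' b' where "a' \<in> carrier R" "a = x \<otimes> a'" "b' \<in> carrier R" "b = x \<otimes> b'" by blast
        then have "a \<oplus> b = x \<otimes> (a' \<oplus> b')" "a' \<oplus> b' \<in> carrier R" using xc by (auto simp: r_distr)
        then show ?case by auto
      qed (use xc in auto)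
    next
      fix a y assume "a \<in> (\<otimes>) x ` carrier R" "y \<in> carrier R"
      then obtain b where b: "b \<in> carrier R" "a = x \<otimes> b" "y \<in> carrier R" by auto
      have "a \<otimes> y = x \<otimes> (b \<otimes> y)" using b xc by (simp add: m_assoc)
      then show "a \<otimes> y \<in> (\<otimes>) x ` carrier R" using b by auto
      have "y \<otimes> a = x \<otimes> (y \<otimes> b)" using b xc xz[of y] by (metis m_assoc)
      then show "y \<otimes> a \<in> (\<otimes>) x ` carrier R" using b by auto
    qed
    moreover have "x \<otimes> \<one> \<in> (\<otimes>) x ` carrier R" by blast
    ultimately have "(\<otimes>) x ` carrier R = carrier R"
      using assms x xc by (auto simp: simple_ring_def)
    then obtain y where y: "y \<in> carrier R" "x \<otimes> y = \<one>" by (metis (no_types, lifting) imageE one_closed)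
    have "y \<otimes> z = z \<otimes> y" if z: "z \<in> carrier R" for z
    proof -
      have "y \<otimes> z = y \<otimes> (z \<otimes> (x \<otimes> y))" using y z by simp
      also have "\<dots> = y \<otimes> (x \<otimes> z) \<otimes> y" using y(1) z xc by (simp add: m_assoc xz[OF z])
      also have "\<dots> = (x \<otimes> y) \<otimes> z \<otimes> y" using y(1) z xc by (simp add: m_assoc xz[of y])
      finally show ?thesis using y z by simp
    qed
    then have "y \<in> center R" unfolding center_ring using y by blast
    moreover have "y \<otimes> x = \<one>" using xz y by auto
    ultimately show ?thesis using y x by (auto simp: Units_def)
  qed
  moreover have xin: "x \<in> carrier R" if "x \<in> center R" for x using that by (simp add: center_ring)
  have "x \<noteq> \<zero>" if "x \<in> Units ?C" for x
    using that one0 xin by (auto simp: Units_def)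
  ultimately show "Units ?C = center R - {\<zero>}" by (auto simp: Units_def)
qed

lemma (in ring) finsum_ring_hom:
  assumes S: "ring S" and h: "h \<in> ring_hom R S" and "finite I" and f: "f \<in> I \<rightarrow> carrier R"
  shows "h (\<Oplus>i\<in>I. f i) = (\<Oplus>\<^bsub>S\<^esub>i\<in>I. h (f i))"
proof -
  interpret S: ring S by (rule S)
  interpret ring_hom_ring R S h by (rule ring_hom_ringI2[OF ring_axioms S h])
  show ?thesis using assms(3) f
  proof (induction I)
    case empty then show ?case by simp
  next
    case (insert x I)
    then have "f x \<in> carrier R" "f \<in> I \<rightarrow> carrier R" by auto
    moreover from this have "(\<lambda>i. h (f i)) \<in> I \<rightarrow> carrier S" by (auto simp: Pi_def)
    ultimately show ?case using insert by (simp add: finsum_insert S.finsum_insert)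
  qed
qed

locale galois_simple_ring = ring D for D :: "('d, 'e) ring_scheme" (structure) +
  fixes \<tau> :: "nat \<Rightarrow> 'd \<Rightarrow> 'd" and n :: nat
  assumes simple: "simple_ring D"
    and n_pos: "0 < n"
    and aut: "i < n \<Longrightarrow> \<tau> i \<in> ring_iso D D"
    and aut_zero: "d \<in> carrier D \<Longrightarrow> \<tau> 0 d = d"
    and aut_comp: "\<lbrakk>i < n; j < n; d \<in> carrier D\<rbrakk> \<Longrightarrow> \<tau> i (\<tau> j d) = \<tau> ((i + j) mod n) d"
    and aut_faithful: "\<lbrakk>0 < i; i < n\<rbrakk> \<Longrightarrow> \<exists>c\<in>center D. \<tau> i c \<noteq> c"
begin

abbreviation "C \<equiv> center D"

definition Fix :: "'d set" where "Fix = {x \<in> C. \<forall>i<n. \<tau> i x = x}"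

lemma C_subfield: "subfield C D"
  by (rule simple_center_subfield[OF simple])

lemmas C_carrier [simp] = center_carrier
lemmas C_comm = center_comm

lemmas C_subring = subfieldE(1)[OF C_subfield]

lemma C_closed [simp, intro]: "\<zero> \<in> C" "\<one> \<in> C" "x \<in> C \<Longrightarrow> \<ominus> x \<in> C"
  "\<lbrakk>x \<in> C; y \<in> C\<rbrakk> \<Longrightarrow> x \<oplus> y \<in> C" "\<lbrakk>x \<in> C; y \<in> C\<rbrakk> \<Longrightarrow> x \<otimes> y \<in> C" "\<lbrakk>x \<in> C; y \<in> C\<rbrakk> \<Longrightarrow> x \<ominus> y \<in> C"
  using subringE[OF C_subring] by (auto simp: a_minus_def)

lemma C_inv: assumes "x \<in> C" "x \<noteq> \<zero>" shows "inv x \<in> C" "x \<otimes> inv x = \<one>" "inv x \<otimes> x = \<one>"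
  using subfield_m_inv[OF C_subfield, of x] assms by auto

lemma one_neq_zero: "\<one> \<noteq> \<zero>"
  using simple one_zeroD unfolding simple_ring_def by blast

lemma aut_hom: "i < n \<Longrightarrow> ring_hom_ring D D (\<tau> i)"
  using aut[of i] by (auto simp: ring_iso_def intro: ring_hom_ringI2 ring_axioms)

lemma aut_bij: "i < n \<Longrightarrow> bij_betw (\<tau> i) (carrier D) (carrier D)"
  using aut[of i] by (auto simp: ring_iso_def)

lemma aut_simps [simp]:
  assumes "i < n"
  shows "x \<in> carrier D \<Longrightarrow> \<tau> i x \<in> carrier D" "\<tau> i \<zero> = \<zero>" "\<tau> i \<one> = \<one>"
    "\<lbrakk>x \<in> carrier D; y \<in> carrier D\<rbrakk> \<Longrightarrow> \<tau> i (x \<oplus> y) = \<tau> i x \<oplus> \<tau> i y"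
    "\<lbrakk>x \<in> carrier D; y \<in> carrier D\<rbrakk> \<Longrightarrow> \<tau> i (x \<otimes> y) = \<tau> i x \<otimes> \<tau> i y"
    "x \<in> carrier D \<Longrightarrow> \<tau> i (\<ominus> x) = \<ominus> \<tau> i x"
    "\<lbrakk>x \<in> carrier D; y \<in> carrier D\<rbrakk> \<Longrightarrow> \<tau> i (x \<ominus> y) = \<tau> i x \<ominus> \<tau> i y"
proof -
  interpret h: ring_hom_ring D D "\<tau> i" by (rule aut_hom[OF assms])
  show "x \<in> carrier D \<Longrightarrow> \<tau> i x \<in> carrier D" "\<tau> i \<zero> = \<zero>" "\<tau> i \<one> = \<one>"
    "\<lbrakk>x \<in> carrier D; y \<in> carrier D\<rbrakk> \<Longrightarrow> \<tau> i (x \<oplus> y) = \<tau> i x \<oplus> \<tau> i y"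
    "\<lbrakk>x \<in> carrier D; y \<in> carrier D\<rbrakk> \<Longrightarrow> \<tau> i (x \<otimes> y) = \<tau> i x \<otimes> \<tau> i y"
    "x \<in> carrier D \<Longrightarrow> \<tau> i (\<ominus> x) = \<ominus> \<tau> i x"
    "\<lbrakk>x \<in> carrier D; y \<in> carrier D\<rbrakk> \<Longrightarrow> \<tau> i (x \<ominus> y) = \<tau> i x \<ominus> \<tau> i y"
    by (auto simp: a_minus_def)
qed

lemma aut_inj: "\<lbrakk>i < n; x \<in> carrier D; y \<in> carrier D\<rbrakk> \<Longrightarrow> \<tau> i x = \<tau> i y \<longleftrightarrow> x = y"
  using aut_bij[of i] by (auto simp: bij_betw_def inj_on_def)

lemma aut_surj: assumes "i < n" "x \<in> carrier D" obtains y where "y \<in> carrier D" "\<tau> i y = x"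
  using aut_bij[of i] assms unfolding bij_betw_def by (metis imageE)

lemma aut_C [simp]: assumes "i < n" "c \<in> C" shows "\<tau> i c \<in> C"
proof -
  have "\<tau> i c \<otimes> y = y \<otimes> \<tau> i c" if "y \<in> carrier D" for y
  proof -
    obtain z where "z \<in> carrier D" "\<tau> i z = y" using aut_surj[OF assms(1) \<open>y \<in> carrier D\<close>] by blast
    then show ?thesis using C_comm[of c z] assms by (metis C_carrier aut_simps(5))
  qed
  then show ?thesis unfolding center_ring using assms C_carrier aut_simps(1) by blast
qed

lemma aut_finsum: "\<lbrakk>i < n; finite I; f \<in> I \<rightarrow> carrier D\<rbrakk> \<Longrightarrow> \<tau> i (\<Oplus>l\<in>I. f l) = (\<Oplus>l\<in>I. \<tau> i (f l))"
  by (rule finsum_ring_hom[OF ring_axioms ring_hom_ring.homh[OF aut_hom]])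

lemma finsum_C: "\<lbrakk>finite I; f \<in> I \<rightarrow> C\<rbrakk> \<Longrightarrow> (\<Oplus>l\<in>I. f l) \<in> C"
proof (induction I rule: finite_induct)
  case (insert x I)
  then have "f x \<in> C" "f \<in> I \<rightarrow> C" by auto
  moreover from this have "f \<in> I \<rightarrow> carrier D" by (auto simp: Pi_def)
  ultimately show ?case using insert by (simp add: finsum_insert)
qed simp

lemma shift_bij: assumes "l < n" shows "bij_betw (\<lambda>j. (l + j) mod n) {..<n} {..<n}"
proof -
  have "inj_on (\<lambda>j. (l + j) mod n) {..<n}"
  proof (rule inj_onI)
    fix x y assume "x \<in> {..<n}" "y \<in> {..<n}" "(l + x) mod n = (l + y) mod n"
    then show "x = y" using assms by (auto simp: mod_if split: if_splits)
  qed
  moreover have "(\<lambda>j. (l + j) mod n) ` {..<n} \<subseteq> {..<n}" using n_pos by auto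
  ultimately show ?thesis
    by (metis bij_betw_def card_image card_subset_eq finite_lessThan)
qed



lemma Fix_closed [simp, intro]: "\<zero> \<in> Fix" "\<one> \<in> Fix" "x \<in> Fix \<Longrightarrow> \<ominus> x \<in> Fix"
  "\<lbrakk>x \<in> Fix; y \<in> Fix\<rbrakk> \<Longrightarrow> x \<oplus> y \<in> Fix" "\<lbrakk>x \<in> Fix; y \<in> Fix\<rbrakk> \<Longrightarrow> x \<otimes> y \<in> Fix"
  by (auto simp: Fix_def)

lemma Fix_C [simp]: "x \<in> Fix \<Longrightarrow> x \<in> C" unfolding Fix_def by blast

lemma Fix_aut [simp]: "\<lbrakk>x \<in> Fix; i < n\<rbrakk> \<Longrightarrow> \<tau> i x = x" unfolding Fix_def by blast

lemma Fix_inv: assumes "x \<in> Fix" "x \<noteq> \<zero>" shows "inv x \<in> Fix"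
proof -
  note i = C_inv[OF Fix_C[OF assms(1)] assms(2)]
  have "\<tau> l (inv x) = inv x" if "l < n" for l
  proof -
    have "\<tau> l x \<otimes> \<tau> l (inv x) = \<one>"
      using aut_simps(5)[OF that, of x "inv x"] i assms that by simp
    then have x: "x \<otimes> \<tau> l (inv x) = \<one>" using assms that by simp
    have "\<tau> l (inv x) = (inv x \<otimes> x) \<otimes> \<tau> l (inv x)" using i that by simp
    also have "\<dots> = inv x \<otimes> (x \<otimes> \<tau> l (inv x))" using i(1) assms that by (intro m_assoc) auto
    finally show ?thesis using x i by simp
  qed
  then show ?thesis using i unfolding Fix_def by blast
qed

lemma Fix_subfield: "subfield Fix D"
proof (rule subfieldI)
  show "subcring Fix D"
    by (rule subcringI[OF subringI]) (auto intro: C_comm)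
  have "x \<in> Units (D\<lparr>carrier := Fix\<rparr>)" if "x \<in> Fix" "x \<noteq> \<zero>" for x
    using that Fix_inv[OF that] C_inv[OF Fix_C[OF that(1)] that(2)] by (auto simp: Units_def)
  then show "Units (D\<lparr>carrier := Fix\<rparr>) = Fix - {\<zero>}"
    using one_neq_zero by (auto simp: Units_def)
qed

text \<open>Take a relation y with as few nonzero entries as possible. Relations are stable under left and
  right multiplication by D and under every \<open>\<tau> l\<close>, so simplicity of D provides one with the same
  support and an entry equal to 1; call it y again. The commutators with an
  element of D and the differences \<open>\<tau> l (y i) \<ominus> y i\<close> are then shorter relations, hence zero; so all
  entries lie in the fixed field, and the relation at \<open>d = \<one>\<close>, \<open>j = 0\<close> contradicts independence.\<close>

lemma faithful_twisted_action:
  assumes "finite I" and b: "b \<in> I \<rightarrow> carrier D"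
    and indep: "\<And>f. \<lbrakk>f \<in> I \<rightarrow> Fix; (\<Oplus>i\<in>I. f i \<otimes> b i) = \<zero>\<rbrakk> \<Longrightarrow> \<forall>i\<in>I. f i = \<zero>"
    and "y \<in> I \<rightarrow> carrier D"
    and "\<And>j d. \<lbrakk>j < n; d \<in> carrier D\<rbrakk> \<Longrightarrow> (\<Oplus>i\<in>I. \<tau> j (b i) \<otimes> d \<otimes> y i) = \<zero>"
  shows "\<forall>i\<in>I. y i = \<zero>"
proof -
  define rel where "rel y \<longleftrightarrow> y \<in> I \<rightarrow> carrier D \<and>
    (\<forall>j<n. \<forall>d\<in>carrier D. (\<Oplus>i\<in>I. \<tau> j (b i) \<otimes> d \<otimes> y i) = \<zero>)" for y
  have bc: "b i \<in> carrier D" if "i \<in> I" for i using b that by auto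
  have relc: "y i \<in> carrier D" if "rel y" "i \<in> I" for y i using that by (auto simp: rel_def)
  have tb: "\<tau> j (b i) \<in> carrier D" if "i \<in> I" "j < n" for i j using that bc by auto
  have rel_cong: "rel z" if r: "rel y" and eq: "\<And>i. i \<in> I \<Longrightarrow> y i = z i" for y z
  proof -
    have "(\<Oplus>i\<in>I. \<tau> j (b i) \<otimes> d \<otimes> z i) = (\<Oplus>i\<in>I. \<tau> j (b i) \<otimes> d \<otimes> y i)"
      if "j < n" "d \<in> carrier D" for j d
      using that relc[OF r] tb eq by (intro finsum_cong') auto
    then show ?thesis using r eq by (auto simp: rel_def Pi_def)
  qed
  have rel_l: "rel (\<lambda>i. u \<otimes> y i)" if r: "rel y" and u: "u \<in> carrier D" for u y
  proof -
    have "(\<Oplus>i\<in>I. \<tau> j (b i) \<otimes> d \<otimes> (u \<otimes> y i)) = (\<Oplus>i\<in>I. \<tau> j (b i) \<otimes> (d \<otimes> u) \<otimes> y i)"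
      if "j < n" "d \<in> carrier D" for j d
      using that u relc[OF r] tb by (intro finsum_cong') (auto simp: m_assoc)
    then show ?thesis using r u by (auto simp: rel_def Pi_def)
  qed
  have rel_r: "rel (\<lambda>i. y i \<otimes> u)" if r: "rel y" and u: "u \<in> carrier D" for u y
  proof -
    have "(\<Oplus>i\<in>I. \<tau> j (b i) \<otimes> d \<otimes> (y i \<otimes> u)) = (\<Oplus>i\<in>I. \<tau> j (b i) \<otimes> d \<otimes> y i) \<otimes> u"
      if "j < n" "d \<in> carrier D" for j d
      using that u relc[OF r] tb \<open>finite I\<close>
      by (subst finsum_ldistr) (auto simp: m_assoc intro!: finsum_cong')
    then show ?thesis using r u by (auto simp: rel_def Pi_def)
  qed
  have rel_add: "rel (\<lambda>i. y i \<oplus> z i)" if r: "rel y" "rel z" for y z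
  proof -
    have "(\<Oplus>i\<in>I. \<tau> j (b i) \<otimes> d \<otimes> (y i \<oplus> z i)) =
      (\<Oplus>i\<in>I. \<tau> j (b i) \<otimes> d \<otimes> y i) \<oplus> (\<Oplus>i\<in>I. \<tau> j (b i) \<otimes> d \<otimes> z i)" if "j < n" "d \<in> carrier D" for j d
    proof -
      note c = that relc[OF r(1)] relc[OF r(2)] tb
      have "(\<Oplus>i\<in>I. \<tau> j (b i) \<otimes> d \<otimes> (y i \<oplus> z i)) =
        (\<Oplus>i\<in>I. \<tau> j (b i) \<otimes> d \<otimes> y i \<oplus> \<tau> j (b i) \<otimes> d \<otimes> z i)"
        using c by (intro finsum_cong') (auto simp: r_distr)
      then show ?thesis using c by (simp add: finsum_addf Pi_def)
    qed
    then show ?thesis using r by (auto simp: rel_def Pi_def)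
  qed
  have rel_diff: "rel (\<lambda>i. y i \<ominus> z i)" if r: "rel y" "rel z" for y z
  proof -
    have "rel (\<lambda>i. y i \<oplus> \<ominus> \<one> \<otimes> z i)" by (rule rel_add[OF r(1) rel_l[OF r(2)]]) simp
    moreover have "y i \<oplus> \<ominus> \<one> \<otimes> z i = y i \<ominus> z i" if "i \<in> I" for i
      using relc[OF r(2) that] by (simp add: a_minus_def l_minus)
    ultimately show ?thesis
      by (rule rel_cong)
  qed
  have rel_aut: "rel (\<lambda>i. \<tau> l (y i))" if r: "rel y" and l: "l < n" for y l
  proof -
    have "(\<Oplus>i\<in>I. \<tau> j (b i) \<otimes> d \<otimes> \<tau> l (y i)) = \<zero>" if j: "j < n" "d \<in> carrier D" for j d
    proof -
      have "j \<in> (\<lambda>j. (l + j) mod n) ` {..<n}"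
        using bij_betw_imp_surj_on[OF shift_bij[OF l]] j by simp
      then obtain j' where j': "j' < n" "(l + j') mod n = j" by auto
      obtain d' where d': "d' \<in> carrier D" "\<tau> l d' = d" using aut_surj l j by blast
      have "\<zero> = \<tau> l (\<Oplus>i\<in>I. \<tau> j' (b i) \<otimes> d' \<otimes> y i)" using r j' d' l by (auto simp: rel_def)
      also have "\<dots> = (\<Oplus>i\<in>I. \<tau> l (\<tau> j' (b i) \<otimes> d' \<otimes> y i))"
        using tb j' d' relc[OF r] l \<open>finite I\<close> by (intro aut_finsum) auto
      also have "\<dots> = (\<Oplus>i\<in>I. \<tau> j (b i) \<otimes> d \<otimes> \<tau> l (y i))"
        using tb j j' d' relc[OF r] l bc by (intro finsum_cong') (auto simp: aut_comp)
      finally show ?thesis by simp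
    qed
    then show ?thesis using relc[OF r] l by (auto simp: rel_def)
  qed
  have "\<forall>i\<in>I. y i = \<zero>" if "rel y" for y
    using that
  proof (induction "card {i\<in>I. y i \<noteq> \<zero>}" arbitrary: y rule: less_induct)
    case less
    show ?case
    proof (rule ccontr)
      assume "\<not> (\<forall>i\<in>I. y i = \<zero>)"
      then obtain k where k: "k \<in> I" "y k \<noteq> \<zero>" by auto
      define supp where "supp z \<longleftrightarrow> (\<forall>i\<in>I. y i = \<zero> \<longrightarrow> z i = \<zero>)" for z :: "'a \<Rightarrow> 'd"
      have small: "\<forall>i\<in>I. z i = \<zero>" if z: "rel z" "supp z" "z k = \<zero>" for z
      proof -
        have "{i\<in>I. z i \<noteq> \<zero>} \<subset> {i\<in>I. y i \<noteq> \<zero>}" using k z by (auto simp: supp_def)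
        then show ?thesis using less.hyps[OF psubset_card_mono z(1)] \<open>finite I\<close> by auto
      qed
      let ?J = "{z k |z. rel z \<and> supp z}"
      have "ideal ?J D"
      proof (rule idealI[OF ring_axioms])
        show "subgroup ?J (add_monoid D)"
        proof (rule add.subgroupI)
          show "?J \<subseteq> carrier D" using relc k by auto
          show "?J \<noteq> {}" using less.prems by (auto simp: supp_def)
        next
          fix a assume "a \<in> ?J"
          then obtain z where z: "rel z" "supp z" "a = z k" by auto
          have "rel (\<lambda>i. \<ominus> \<one> \<otimes> z i)" by (rule rel_l[OF z(1)]) simp
          moreover have "supp (\<lambda>i. \<ominus> \<one> \<otimes> z i)" using z by (auto simp: supp_def)
          moreover have "\<ominus> a = \<ominus> \<one> \<otimes> z k" using z relc k by (auto simp: l_minus)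
          ultimately show "\<ominus> a \<in> ?J" by (auto simp flip: a_inv_def)
        next
          fix a a' assume "a \<in> ?J" "a' \<in> ?J"
          then obtain z z' where z: "rel z" "supp z" "a = z k" "rel z'" "supp z'" "a' = z' k" by auto
          then have "supp (\<lambda>i. z i \<oplus> z' i)" by (auto simp: supp_def)
          then show "a \<oplus> a' \<in> ?J" using rel_add[OF z(1,4)] z by auto
        qed
      next
        fix a x assume "a \<in> ?J" and x: "x \<in> carrier D"
        then obtain z where z: "rel z" "supp z" "a = z k" by auto
        have "supp (\<lambda>i. x \<otimes> z i)" "supp (\<lambda>i. z i \<otimes> x)" using z x by (auto simp: supp_def)
        then show "x \<otimes> a \<in> ?J" "a \<otimes> x \<in> ?J" using rel_l[OF z(1) x] rel_r[OF z(1) x] z by auto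
      qed
      moreover have "y k \<in> ?J" using less.prems by (auto simp: supp_def)
      ultimately have "?J = carrier D" using simple k by (auto simp: simple_ring_def)
      then have "\<one> \<in> ?J" by simp
      then obtain z where z: "rel z" "supp z" "z k = \<one>" by auto
      have zC: "z i \<in> C" if i: "i \<in> I" for i
      proof -
        have "u \<otimes> z i = z i \<otimes> u" if u: "u \<in> carrier D" for u
        proof -
          have "supp (\<lambda>i. u \<otimes> z i \<ominus> z i \<otimes> u)" using z u by (auto simp: supp_def a_minus_def)
          moreover have "u \<otimes> z k \<ominus> z k \<otimes> u = \<zero>" using z(3) u by simp
          ultimately have "\<forall>i\<in>I. u \<otimes> z i \<ominus> z i \<otimes> u = \<zero>"
            by (rule small[OF rel_diff[OF rel_l[OF z(1) u] rel_r[OF z(1) u]]])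
          then have "u \<otimes> z i \<ominus> z i \<otimes> u = \<zero>" using i by blast
          moreover have "u \<otimes> z i \<in> carrier D" "z i \<otimes> u \<in> carrier D"
            using u relc[OF z(1) i] by auto
          ultimately show ?thesis by (metis r_right_minus_eq)
        qed
        then show ?thesis by (intro center_memI relc[OF z(1) i]) simp
      qed
      have "z i \<in> Fix" if i: "i \<in> I" for i
      proof -
        have "\<tau> l (z i) = z i" if l: "l < n" for l
        proof -
          have "supp (\<lambda>i. \<tau> l (z i) \<ominus> z i)" using z l by (auto simp: supp_def a_minus_def)
          moreover have "\<tau> l (z k) \<ominus> z k = \<zero>" using z l by simp
          ultimately have "\<forall>i\<in>I. \<tau> l (z i) \<ominus> z i = \<zero>"
            by (rule small[OF rel_diff[OF rel_aut[OF z(1) l] z(1)]])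
          then have "\<tau> l (z i) \<ominus> z i = \<zero>" using i by blast
          then show ?thesis using l relc[OF z(1) i] by simp
        qed
        then show ?thesis using zC i unfolding Fix_def by blast
      qed
      then have zF: "z \<in> I \<rightarrow> Fix" by blast
      have z0: "(\<Oplus>i\<in>I. z i \<otimes> b i) = \<zero>"
      proof -
        have "(\<Oplus>i\<in>I. z i \<otimes> b i) = (\<Oplus>i\<in>I. \<tau> 0 (b i) \<otimes> \<one> \<otimes> z i)"
          using zC bc by (intro finsum_cong') (auto simp: aut_zero C_comm)
        then show ?thesis using z n_pos by (simp add: rel_def)
      qed
      have "z k = \<zero>" using indep[OF zF z0] k by blast
      then show False using z(3) one_neq_zero by argo
    qed
  qed
  then show ?thesis using assms(4,5) by (auto simp: rel_def)
qed

end

section \<open>Finite generation over the fixed field\<close>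

inductive_set lspan :: "('k, 'c) ring_scheme \<Rightarrow> ('k, 'a, 'e) module_scheme \<Rightarrow> 'a set \<Rightarrow> 'a set"
  for F A B where
  zero: "\<zero>\<^bsub>A\<^esub> \<in> lspan F A B"
| step: "\<lbrakk>c \<in> carrier F; b \<in> B; x \<in> lspan F A B\<rbrakk> \<Longrightarrow> (c \<odot>\<^bsub>A\<^esub> b) \<oplus>\<^bsub>A\<^esub> x \<in> lspan F A B"

lemma lspan_mono: "B \<subseteq> B' \<Longrightarrow> lspan F A B \<subseteq> lspan F A B'"
  by (rule subsetI, erule lspan.induct) (auto intro: lspan.intros)

context module begin

lemma lspan_closed: "B \<subseteq> carrier M \<Longrightarrow> x \<in> lspan R M B \<Longrightarrow> x \<in> carrier M"
  by (erule lspan.induct) auto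

lemma lspan_add:
  assumes B: "B \<subseteq> carrier M" and x: "x \<in> lspan R M B" and y: "y \<in> lspan R M B"
  shows "x \<oplus>\<^bsub>M\<^esub> y \<in> lspan R M B"
  using x
proof induction
  case zero then show ?case using y lspan_closed[OF B y] by simp
next
  case (step c b x)
  then have "(c \<odot>\<^bsub>M\<^esub> b) \<oplus>\<^bsub>M\<^esub> (x \<oplus>\<^bsub>M\<^esub> y) \<in> lspan R M B" by (intro lspan.step)
  then show ?case using step B lspan_closed[OF B y] lspan_closed[OF B step(3)] by (simp add: M.a_assoc subset_iff)
qed

lemma lspan_imp_finsum:
  assumes B: "finite B" "B \<subseteq> carrier M" and x: "x \<in> lspan R M B"
  shows "\<exists>f \<in> B \<rightarrow> carrier R. x = (\<Oplus>\<^bsub>M\<^esub>b\<in>B. f b \<odot>\<^bsub>M\<^esub> b)"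
  using x
proof induction
  case zero
  have z: "\<zero> \<odot>\<^bsub>M\<^esub> b = \<zero>\<^bsub>M\<^esub>" if "b \<in> B" for b
    using smult_l_distr[of \<zero> \<zero> b] that B by (metis M.add.l_cancel_one R.l_zero R.zero_closed smult_closed subsetD)
  have "(\<Oplus>\<^bsub>M\<^esub>b\<in>B. \<zero> \<odot>\<^bsub>M\<^esub> b) = (\<Oplus>\<^bsub>M\<^esub>b\<in>B. \<zero>\<^bsub>M\<^esub>)"
    using z by (intro M.finsum_cong') auto
  then show ?case by (intro bexI[of _ "\<lambda>_. \<zero>"]) auto
next
  case (step c b x)
  then obtain f where f: "f \<in> B \<rightarrow> carrier R" "x = (\<Oplus>\<^bsub>M\<^esub>b\<in>B. f b \<odot>\<^bsub>M\<^esub> b)" by auto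
  define g where "g = f(b := c \<oplus> f b)"
  have fc: "f a \<odot>\<^bsub>M\<^esub> a \<in> carrier M" if "a \<in> B" for a using that f B by auto
  have fin: "finite (B - {b})" "b \<notin> B - {b}" and ins: "B = insert b (B - {b})" using B step by auto
  have bc: "b \<in> carrier M" "f b \<in> carrier R" using step B f by auto
  have g: "g \<in> B \<rightarrow> carrier R" using f step bc by (auto simp: g_def)
  have rest: "(\<Oplus>\<^bsub>M\<^esub>a\<in>B - {b}. g a \<odot>\<^bsub>M\<^esub> a) = (\<Oplus>\<^bsub>M\<^esub>a\<in>B - {b}. f a \<odot>\<^bsub>M\<^esub> a)"
    using fc by (intro M.finsum_cong') (auto simp: g_def)
  have rc: "(\<Oplus>\<^bsub>M\<^esub>a\<in>B - {b}. f a \<odot>\<^bsub>M\<^esub> a) \<in> carrier M" using fc by (intro M.finsum_closed) auto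
  have "(\<Oplus>\<^bsub>M\<^esub>a\<in>B. g a \<odot>\<^bsub>M\<^esub> a) = g b \<odot>\<^bsub>M\<^esub> b \<oplus>\<^bsub>M\<^esub> (\<Oplus>\<^bsub>M\<^esub>a\<in>B - {b}. g a \<odot>\<^bsub>M\<^esub> a)"
    by (subst ins, rule M.finsum_insert) (use fin g B step in \<open>auto intro!: smult_closed simp: Pi_def subset_iff\<close>)
  also have "\<dots> = (c \<odot>\<^bsub>M\<^esub> b) \<oplus>\<^bsub>M\<^esub> (f b \<odot>\<^bsub>M\<^esub> b \<oplus>\<^bsub>M\<^esub> (\<Oplus>\<^bsub>M\<^esub>a\<in>B - {b}. f a \<odot>\<^bsub>M\<^esub> a))"
    using rest rc bc step by (simp add: g_def smult_l_distr M.a_assoc)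
  also have "f b \<odot>\<^bsub>M\<^esub> b \<oplus>\<^bsub>M\<^esub> (\<Oplus>\<^bsub>M\<^esub>a\<in>B - {b}. f a \<odot>\<^bsub>M\<^esub> a) = (\<Oplus>\<^bsub>M\<^esub>a\<in>B. f a \<odot>\<^bsub>M\<^esub> a)"
    using M.finsum_insert[OF fin, of "\<lambda>a. f a \<odot>\<^bsub>M\<^esub> a"] fc step(2) unfolding ins[symmetric] by auto
  finally have "(c \<odot>\<^bsub>M\<^esub> b) \<oplus>\<^bsub>M\<^esub> x = (\<Oplus>\<^bsub>M\<^esub>a\<in>B. g a \<odot>\<^bsub>M\<^esub> a)" unfolding f(2) by (rule sym)
  then show ?case using g by blast
qed

lemma finsum_in_lspan:
  assumes B: "finite B'" "B' \<subseteq> B" "B \<subseteq> carrier M" and f: "f \<in> B' \<rightarrow> carrier R"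
  shows "(\<Oplus>\<^bsub>M\<^esub>b\<in>B'. f b \<odot>\<^bsub>M\<^esub> b) \<in> lspan R M B"
  using B f
proof (induction B')
  case empty then show ?case by (simp add: lspan.zero)
next
  case (insert b B')
  have "(\<Oplus>\<^bsub>M\<^esub>b\<in>insert b B'. f b \<odot>\<^bsub>M\<^esub> b) = f b \<odot>\<^bsub>M\<^esub> b \<oplus>\<^bsub>M\<^esub> (\<Oplus>\<^bsub>M\<^esub>b\<in>B'. f b \<odot>\<^bsub>M\<^esub> b)"
    by (rule M.finsum_insert) (use insert in auto)
  then show ?case using insert by (auto intro: lspan.step)
qed

end

lemma fin_dim_lspan:
  assumes "module F A"
  shows "fin_dim F A \<longleftrightarrow> (\<exists>B. finite B \<and> B \<subseteq> carrier A \<and> carrier A \<subseteq> lspan F A B)"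
proof -
  interpret module F A by (rule assms)
  have "(\<forall>x \<in> carrier A. \<exists>f \<in> B \<rightarrow> carrier F. x = (\<Oplus>\<^bsub>A\<^esub>b\<in>B. f b \<odot>\<^bsub>A\<^esub> b)) \<longleftrightarrow> carrier A \<subseteq> lspan F A B"
    if "finite B" "B \<subseteq> carrier A" for B
  proof
    assume l: "\<forall>x \<in> carrier A. \<exists>f \<in> B \<rightarrow> carrier F. x = (\<Oplus>\<^bsub>A\<^esub>b\<in>B. f b \<odot>\<^bsub>A\<^esub> b)"
    show "carrier A \<subseteq> lspan F A B"
    proof
      fix x assume "x \<in> carrier A"
      with l obtain f where "f \<in> B \<rightarrow> carrier F" "x = (\<Oplus>\<^bsub>A\<^esub>b\<in>B. f b \<odot>\<^bsub>A\<^esub> b)" by blast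
      then show "x \<in> lspan F A B" using finsum_in_lspan[OF that(1) order_refl that(2)] by simp
    qed
  qed (use lspan_imp_finsum[OF that] in auto)
  then show ?thesis unfolding fin_dim_def by blast
qed

lemma (in ring) self_alg_ring: "ring (self_alg R)"
proof -
  have "abelian_group (self_alg R)"
    by (rule abelian_groupI) (auto simp: self_alg_def a_ac intro: bexI[of _ "\<ominus> _"] l_neg)
  moreover have "monoid (self_alg R)"
    by (rule monoidI) (auto simp: self_alg_def m_assoc)
  ultimately show ?thesis
    by (rule ringI) (auto simp: self_alg_def l_distr r_distr)
qed

context galois_simple_ring begin

text \<open>The functions on the group that are sums of \<open>j \<mapsto> \<tau> j c \<otimes> c'\<close>. Such a function g acts on
  the j-th component of a twisted bimodule as multiplication by \<open>g j\<close>, so it is these functions that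
  cut bimodules into components.\<close>

inductive_set characters :: "(nat \<Rightarrow> 'd) set" where
  zero: "(\<And>j. j < n \<Longrightarrow> g j = \<zero>) \<Longrightarrow> g \<in> characters"
| step: "\<lbrakk>h \<in> characters; c \<in> C; c' \<in> C; \<And>j. j < n \<Longrightarrow> g j = \<tau> j c \<otimes> c' \<oplus> h j\<rbrakk> \<Longrightarrow> g \<in> characters"

lemma characters_C: "g \<in> characters \<Longrightarrow> j < n \<Longrightarrow> g j \<in> C"
proof (induction rule: characters.induct)
  case (step h c c' g)
  then have "\<tau> j c \<otimes> c' \<oplus> h j \<in> C" by (intro C_closed aut_C)
  then show ?case using step.hyps(4)[OF step.prems] by argo
qed (metis C_closed(1))

lemma characters_cong:
  assumes "g \<in> characters" "\<And>j. j < n \<Longrightarrow> f j = g j"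
  shows "f \<in> characters"
  using assms(1)
proof cases
  case zero
  then show ?thesis using assms(2) by (intro characters.zero) metis
next
  case (step h c c')
  then show ?thesis using assms(2) by - (rule characters.step[of h c c'], auto)
qed

lemma characters_add:
  assumes "g \<in> characters" "h \<in> characters" "\<And>j. j < n \<Longrightarrow> f j = g j \<oplus> h j"
  shows "f \<in> characters"
  using assms(1,3)
proof (induction arbitrary: f)
  case (zero g)
  have "f j = h j" if "j < n" for j
    using zero.prems[OF that] zero.hyps[OF that] characters_C[OF assms(2) that] by simp
  then show ?case by (rule characters_cong[OF assms(2)])
next
  case (step h' c c' g)
  have "(\<lambda>j. h' j \<oplus> h j) \<in> characters" by (rule step.IH) simp
  moreover have "f j = \<tau> j c \<otimes> c' \<oplus> (h' j \<oplus> h j)" if "j < n" for j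
    using step characters_C[OF step(1) that] characters_C[OF assms(2) that] that by (simp add: a_assoc)
  ultimately show ?case by (rule characters.step[OF _ step.hyps(2,3)])
qed

lemma characters_mult:
  assumes "g \<in> characters" "d \<in> C" "v \<in> C" "\<And>j. j < n \<Longrightarrow> f j = \<tau> j d \<otimes> v \<otimes> g j"
  shows "f \<in> characters"
  using assms(1,4)
proof (induction arbitrary: f)
  case (zero g) then show ?case using assms by (intro characters.zero) auto
next
  case (step h c c' g)
  have "(\<lambda>j. \<tau> j d \<otimes> v \<otimes> h j) \<in> characters" by (rule step.IH) simp
  moreover have "f j = \<tau> j (d \<otimes> c) \<otimes> (v \<otimes> c') \<oplus> \<tau> j d \<otimes> v \<otimes> h j" if j: "j < n" for j
  proof -
    have [simp]: "\<tau> j d \<in> carrier D" "\<tau> j c \<in> carrier D" "h j \<in> carrier D"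
      "v \<in> carrier D" "c' \<in> carrier D" "c \<in> carrier D" "d \<in> carrier D"
      using step assms j characters_C[OF step(1) j] by auto
    have "v \<otimes> (\<tau> j c \<otimes> c') = \<tau> j c \<otimes> (v \<otimes> c')"
      using C_comm[OF assms(3), of "\<tau> j c"] by (simp flip: m_assoc)
    then show ?thesis
      unfolding step.prems[OF j] step.hyps(4)[OF j] using j by (simp add: r_distr m_assoc)
  qed
  ultimately show ?case using step.hyps(2,3) assms(2,3)
    by - (rule characters.step[of _ "d \<otimes> c" "v \<otimes> c'"], auto)
qed

text \<open>Artin's independence of characters, by separating one automorphism from the others in turn: if
  \<open>\<tau> i\<close> and \<open>\<tau> l\<close> differ on an element of C, a suitable factor vanishes at l but not at i.\<close>

lemma characters_delta:
  assumes i: "i < n"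
  shows "(\<lambda>j. if j = i then \<one> else \<zero>) \<in> characters"
proof -
  have "\<exists>g\<in>characters. g i = \<one> \<and> (\<forall>j\<in>J. g j = \<zero>)" if "finite J" "J \<subseteq> {..<n} - {i}" for J
    using that
  proof (induction J)
    case empty
    have "(\<lambda>j. \<one>) \<in> characters"
      by (rule characters.step[OF characters.zero[of "\<lambda>_. \<zero>"], of \<one> \<one>]) auto
    then show ?case by auto
  next
    case (insert l J)
    then obtain g where g: "g \<in> characters" "g i = \<one>" "\<forall>j\<in>J. g j = \<zero>" by auto
    have l: "l < n" "l \<noteq> i" using insert by auto
    define k where "k = (i + n - l) mod n"
    have k: "k < n" "0 < k" "(l + k) mod n = i"
      using l i n_pos by (auto simp: k_def mod_if)
    obtain d where d: "d \<in> C" "\<tau> k d \<noteq> d" using aut_faithful[OF k(2,1)] by auto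
    have "\<tau> i d \<noteq> \<tau> l d"
      using aut_comp[OF l(1) k(1), of d] aut_inj[OF l(1), of "\<tau> k d" d] k d by auto
    then have ne: "\<tau> i d \<ominus> \<tau> l d \<noteq> \<zero>" using i l d by (simp add: r_right_minus_eq)
    define w where "w = inv (\<tau> i d \<ominus> \<tau> l d)"
    have w: "w \<in> C" "(\<tau> i d \<ominus> \<tau> l d) \<otimes> w = \<one>"
      using C_inv[OF _ ne] i l d by (auto simp: w_def)
    let ?h = "\<lambda>j. \<tau> j d \<otimes> w \<otimes> g j \<oplus> \<tau> j \<one> \<otimes> \<ominus> (\<tau> l d \<otimes> w) \<otimes> g j"
    have "(\<lambda>j. \<tau> j d \<otimes> w \<otimes> g j) \<in> characters"
      by (rule characters_mult[OF g(1) d(1) w(1)]) simp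
    moreover have "(\<lambda>j. \<tau> j \<one> \<otimes> \<ominus> (\<tau> l d \<otimes> w) \<otimes> g j) \<in> characters"
      by (rule characters_mult[OF g(1), of \<one> "\<ominus> (\<tau> l d \<otimes> w)"]) (use d w l in auto)
    ultimately have "?h \<in> characters" by (rule characters_add) simp
    moreover have h: "?h j = (\<tau> j d \<ominus> \<tau> l d) \<otimes> w \<otimes> g j" if j: "j < n" for j
      using j l d w characters_C[OF g(1) j] by (simp add: l_distr a_minus_def l_minus)
    have "?h i = \<one>" unfolding h[OF i] using w g(2) by simp
    moreover have "?h j = \<zero>" if "j \<in> insert l J" for j
    proof -
      have j: "j < n" using that insert by auto
      show ?thesis unfolding h[OF j]
      proof (cases "j = l")
        case True
        have "\<tau> l d \<ominus> \<tau> l d = \<zero>" using l d by (simp add: a_minus_def r_neg)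
        then show "(\<tau> j d \<ominus> \<tau> l d) \<otimes> w \<otimes> g j = \<zero>"
          using True w C_carrier[OF characters_C[OF g(1) l(1)]] by simp
      next
        case False
        then have "g j = \<zero>" using that g(3) by auto
        then show "(\<tau> j d \<ominus> \<tau> l d) \<otimes> w \<otimes> g j = \<zero>" using l d w j by simp
      qed
    qed
    ultimately show ?case by (intro bexI[of _ ?h]) auto
  qed
  from this[of "{..<n} - {i}"] obtain g where g: "g \<in> characters" "g i = \<one>" "\<forall>j\<in>{..<n} - {i}. g j = \<zero>"
    by auto
  show ?thesis
    by (rule characters_add[OF g(1) characters.zero[of "\<lambda>_. \<zero>"]]) (use g in auto)
qed

abbreviation "FixR \<equiv> D\<lparr>carrier := Fix\<rparr>"
abbreviation "CR \<equiv> D\<lparr>carrier := C\<rparr>"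

definition trace_over :: "nat set \<Rightarrow> 'd \<Rightarrow> 'd" where
  "trace_over S x = (\<Oplus>j\<in>S. \<tau> j x)"

lemma trace_over_C: "S \<subseteq> {..<n} \<Longrightarrow> x \<in> C \<Longrightarrow> trace_over S x \<in> C"
  unfolding trace_over_def by (intro finsum_C) (auto intro: finite_subset)

lemma trace_over_shift:
  assumes S: "S \<subseteq> {..<n}" and l: "l < n" and x: "x \<in> carrier D"
  shows "\<tau> l (trace_over S x) = (\<Oplus>j\<in>S. \<tau> ((l + j) mod n) x)"
proof -
  have "\<tau> l (trace_over S x) = (\<Oplus>j\<in>S. \<tau> l (\<tau> j x))"
    unfolding trace_over_def using S l x by (intro aut_finsum) (auto intro: finite_subset)
  also have "\<dots> = (\<Oplus>j\<in>S. \<tau> ((l + j) mod n) x)"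
    using S l x n_pos by (intro finsum_cong') (auto simp: aut_comp)
  finally show ?thesis .
qed

lemma trace_over_invariant:
  assumes S: "S \<subseteq> {..<n}" and l: "l < n" and inv: "\<And>j. j \<in> S \<Longrightarrow> (l + j) mod n \<in> S"
    and x: "x \<in> carrier D"
  shows "\<tau> l (trace_over S x) = trace_over S x"
proof -
  let ?s = "\<lambda>j. (l + j) mod n"
  have inj: "inj_on ?s S" using shift_bij[OF l] S by (auto simp: bij_betw_def intro: inj_on_subset)
  have img: "?s ` S = S"
    using inv S by (intro card_subset_eq) (auto simp: card_image[OF inj] intro: finite_subset)
  have "(\<Oplus>j\<in>?s ` S. \<tau> j x) = (\<Oplus>j\<in>S. \<tau> (?s j) x)"
    using inj x n_pos by (intro finsum_reindex) auto
  then show ?thesis unfolding trace_over_shift[OF S l x] using img by (simp add: trace_over_def)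
qed

text \<open>Write the function that is 1 at 0 and 0 elsewhere as a sum of functions \<open>j \<mapsto> \<tau> j c \<otimes> c'\<close>.
  Multiplying it by \<open>\<tau> j x\<close> and summing over j expresses x as a combination of the finitely many
  \<open>c'\<close>, the coefficients being the traces of \<open>x \<otimes> c\<close>.\<close>

lemma C_fin_gen_Fix:
  "\<exists>B. finite B \<and> B \<subseteq> C \<and> C \<subseteq> lspan FixR (self_alg CR) B"
proof -
  have F: "cring FixR" 
    using subfield_iff(2)[OF Fix_subfield] by (simp add: field_def domain_def)

  interpret Cr: ring CR by (rule subring_is_ring[OF C_subring])
  interpret FC: module FixR "self_alg CR"
  proof (rule moduleI[OF F])
    show "abelian_group (self_alg CR)" using Cr.self_alg_ring by (rule ring.is_abelian_group)
  qed (auto simp: self_alg_def l_distr r_distr m_assoc)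
  have "\<exists>B. finite B \<and> B \<subseteq> C \<and> (\<forall>x\<in>C. (\<Oplus>j\<in>{..<n}. \<tau> j x \<otimes> g j) \<in> lspan FixR (self_alg CR) B)"
    if "g \<in> characters" for g
    using that
  proof induction
    case (zero g)
    have "(\<Oplus>j\<in>{..<n}. \<tau> j x \<otimes> g j) = (\<Oplus>j\<in>{..<n}. \<zero>)" if "x \<in> C" for x
      using zero that by (intro finsum_cong') auto
    then show ?case using lspan.zero[of "self_alg CR" FixR "{}"]
      by (intro exI[of _ "{}"]) (auto simp: self_alg_def)
  next
    case (step h c c' g)
    then obtain B where B: "finite B" "B \<subseteq> C"
      "\<And>x. x \<in> C \<Longrightarrow> (\<Oplus>j\<in>{..<n}. \<tau> j x \<otimes> h j) \<in> lspan FixR (self_alg CR) B" by auto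
    have "(\<Oplus>j\<in>{..<n}. \<tau> j x \<otimes> g j) \<in> lspan FixR (self_alg CR) (insert c' B)" if x: "x \<in> C" for x
    proof -
      have hc: "h j \<in> carrier D" if "j < n" for j using characters_C[OF step(1) that] by simp
      have "\<tau> j x \<otimes> g j = \<tau> j (x \<otimes> c) \<otimes> c' \<oplus> \<tau> j x \<otimes> h j" if "j < n" for j
        using that step x hc by (simp add: r_distr m_assoc)
      then have "(\<Oplus>j\<in>{..<n}. \<tau> j x \<otimes> g j) = (\<Oplus>j\<in>{..<n}. \<tau> j (x \<otimes> c) \<otimes> c' \<oplus> \<tau> j x \<otimes> h j)"
        using step x hc by (intro finsum_cong') auto
      also have "\<dots> = (\<Oplus>j\<in>{..<n}. \<tau> j (x \<otimes> c) \<otimes> c') \<oplus> (\<Oplus>j\<in>{..<n}. \<tau> j x \<otimes> h j)"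
        using step x hc by (intro finsum_addf) auto
      also have "(\<Oplus>j\<in>{..<n}. \<tau> j (x \<otimes> c) \<otimes> c') = trace_over {..<n} (x \<otimes> c) \<otimes> c'"
        unfolding trace_over_def using step x by (intro finsum_ldistr[symmetric]) auto
      finally have eq: "(\<Oplus>j\<in>{..<n}. \<tau> j x \<otimes> g j) =
        trace_over {..<n} (x \<otimes> c) \<otimes> c' \<oplus> (\<Oplus>j\<in>{..<n}. \<tau> j x \<otimes> h j)" .
      have "trace_over {..<n} (x \<otimes> c) \<in> Fix"
      proof -
        have "x \<otimes> c \<in> C" using x step by blast
        moreover have "\<tau> i (trace_over {..<n} (x \<otimes> c)) = trace_over {..<n} (x \<otimes> c)" if "i < n" for i
          using calculation n_pos by (intro trace_over_invariant that) auto
        ultimately show ?thesis unfolding Fix_def using trace_over_C[of "{..<n}" "x \<otimes> c"] by blast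
      qed
      moreover have "(\<Oplus>j\<in>{..<n}. \<tau> j x \<otimes> h j) \<in> lspan FixR (self_alg CR) (insert c' B)"
        using B(3)[OF x] lspan_mono[of B "insert c' B"] by blast
      ultimately show ?thesis
        unfolding eq using lspan.step[of _ FixR c' "insert c' B" _ "self_alg CR"]
        by (auto simp: self_alg_def)
    qed
    then show ?case using B step by (intro exI[of _ "insert c' B"]) auto
  qed
  from this[OF characters_delta[OF n_pos]] obtain B where B: "finite B" "B \<subseteq> C"
    "\<And>x. x \<in> C \<Longrightarrow> (\<Oplus>j\<in>{..<n}. \<tau> j x \<otimes> (if j = 0 then \<one> else \<zero>)) \<in> lspan FixR (self_alg CR) B" by auto
  have "x \<in> lspan FixR (self_alg CR) B" if x: "x \<in> C" for x
  proof -
    have "(\<Oplus>j\<in>{..<n}. \<tau> j x \<otimes> (if j = 0 then \<one> else \<zero>)) = (\<Oplus>j\<in>{..<n}. if 0 = j then \<tau> j x else \<zero>)"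
      using x by (intro finsum_cong') auto
    also have "\<dots> = \<tau> 0 x" using x n_pos by (intro finsum_singleton) auto
    also have "\<dots> = x" using x by (simp add: aut_zero)
    finally show ?thesis using B(3)[OF x] by simp
  qed
  then show ?thesis using B by auto
qed

text \<open>The traces over the subgroup S are fixed by S. If \<open>\<tau> l\<close> fixed them all, summing a function over
  S and over the coset of l would give the same result for every function in \<^term>\<open>characters\<close>,
  which fails for the function that is 1 at 0 and 0 elsewhere.\<close>

lemma proper_subgroup_fixes_more:
  assumes S: "S \<subseteq> {..<n}" "0 \<in> S" and add: "\<And>i j. \<lbrakk>i \<in> S; j \<in> S\<rbrakk> \<Longrightarrow> (i + j) mod n \<in> S"
    and l: "l < n" "l \<notin> S"
  shows "\<exists>c\<in>C. (\<forall>j\<in>S. \<tau> j c = c) \<and> \<tau> l c \<noteq> c"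
proof (rule ccontr)
  assume neg: "\<not> ?thesis"
  have finS: "finite S" using S by (auto intro: finite_subset)
  have fixed: "\<tau> l (trace_over S x) = trace_over S x" if x: "x \<in> C" for x
  proof -
    have "\<tau> j (trace_over S x) = trace_over S x" if "j \<in> S" for j
      using trace_over_invariant[OF S(1), of j x] that S add x by auto
    then show ?thesis using neg trace_over_C[OF S(1) x] by auto
  qed
  have "(\<Oplus>j\<in>S. g ((l + j) mod n)) = (\<Oplus>j\<in>S. g j)" if "g \<in> characters" for g
    using that
  proof induction
    case (zero g) then show ?case using S n_pos by (intro finsum_cong') auto
  next
    case (step h c c' g)
    have hc: "h j \<in> carrier D" if "j < n" for j using characters_C[OF step(1) that] by simp
    have *: "(\<Oplus>j\<in>S. g (s j)) = (\<Oplus>j\<in>S. \<tau> (s j) c) \<otimes> c' \<oplus> (\<Oplus>j\<in>S. h (s j))"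
      if s: "\<And>j. j \<in> S \<Longrightarrow> s j < n" for s
    proof -
      have "(\<Oplus>j\<in>S. g (s j)) = (\<Oplus>j\<in>S. \<tau> (s j) c \<otimes> c' \<oplus> h (s j))"
        using s step hc by (intro finsum_cong') auto
      also have "\<dots> = (\<Oplus>j\<in>S. \<tau> (s j) c \<otimes> c') \<oplus> (\<Oplus>j\<in>S. h (s j))"
        using s step hc by (intro finsum_addf) auto
      also have "(\<Oplus>j\<in>S. \<tau> (s j) c \<otimes> c') = (\<Oplus>j\<in>S. \<tau> (s j) c) \<otimes> c'"
        using s step finS by (intro finsum_ldistr[symmetric]) auto
      finally show ?thesis .
    qed
    have "(\<Oplus>j\<in>S. \<tau> ((l + j) mod n) c) = (\<Oplus>j\<in>S. \<tau> j c)"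
      using fixed[OF step(2)] trace_over_shift[OF S(1) l(1), of c] step by (simp add: trace_over_def)
    moreover have "j < n" if "j \<in> S" for j using that S by auto
    ultimately show ?case using *[of "\<lambda>j. (l + j) mod n"] *[of "\<lambda>j. j"] n_pos step.IH by simp
  qed
  from this[OF characters_delta[OF n_pos]]
  have eq: "(\<Oplus>j\<in>S. if (l + j) mod n = 0 then \<one> else \<zero>) = (\<Oplus>j\<in>S. if j = 0 then \<one> else \<zero>)" .
  have pw: "(k * j) mod n \<in> S" if "j \<in> S" for k j
  proof (induction k)
    case (Suc k)
    have "(j + (k * j) mod n) mod n \<in> S" by (rule add[OF that Suc])
    then show ?case by (simp add: mod_add_right_eq)
  qed (use S in simp)
  have "(l + j) mod n \<noteq> 0" if j: "j \<in> S" for j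
  proof
    assume z: "(l + j) mod n = 0"
    have "((n - 1) * j) mod n = l"
    proof -
      have "j < n" "0 < j" using S j l z by (auto intro!: Nat.gr0I)
      then have "l = n - j" using z l by (auto simp: mod_if split: if_splits)
      moreover have "(n - 1) * j = n * (j - 1) + (n - j)"
        using \<open>j < n\<close> \<open>0 < j\<close> by (simp add: algebra_simps)
      ultimately show ?thesis using l by simp
    qed
    then show False using pw[OF j, of "n - 1"] l by simp
  qed
  then have "(if (l + j) mod n = 0 then \<one> else \<zero>) = \<zero>" if "j \<in> S" for j
    using that by (intro if_not_P) blast
  then have 1: "(\<Oplus>j\<in>S. if (l + j) mod n = 0 then \<one> else \<zero>) = \<zero>"
    by (rule add.finprod_one_eqI)
  have "(\<Oplus>j\<in>S. if j = 0 then \<one> else \<zero>) = (\<Oplus>j\<in>S. if 0 = j then \<one> else \<zero>)"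
    by (intro finsum_cong') auto
  also have "\<dots> = \<one>" using S finS by (intro finsum_singleton) auto
  finally show False using 1 eq one_neq_zero by argo
qed

end

section \<open>Averaging linear projections\<close>

definition (in ring) additive :: "('a \<Rightarrow> 'a) \<Rightarrow> bool" where
  "additive T \<longleftrightarrow> (\<forall>d\<in>carrier R. T d \<in> carrier R) \<and>
     (\<forall>d\<in>carrier R. \<forall>e\<in>carrier R. T (d \<oplus> e) = T d \<oplus> T e)"

definition (in ring) linear_over :: "'a set \<Rightarrow> ('a \<Rightarrow> 'a) \<Rightarrow> bool" where
  "linear_over K T \<longleftrightarrow> additive T \<and> (\<forall>c\<in>K. \<forall>d\<in>carrier R. T (c \<otimes> d) = c \<otimes> T d)"

text \<open>Coefficient lists have the constant term first.\<close>

fun (in ring) op_eval :: "('a \<Rightarrow> 'a) \<Rightarrow> 'a list \<Rightarrow> 'a \<Rightarrow> 'a" where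
  "op_eval T [] d = \<zero>"
| "op_eval T (a # p) d = a \<otimes> d \<oplus> T (op_eval T p d)"

fun (in ring) op_deriv :: "('a \<Rightarrow> 'a) \<Rightarrow> 'a list \<Rightarrow> 'a \<Rightarrow> 'a" where
  "op_deriv T [] d = \<zero>"
| "op_deriv T (a # p) d = op_eval T p d \<oplus> T (op_deriv T p d)"

text \<open>The operator obtained from P by substituting T on either side into the difference
  quotient (p(X) - p(Y))/(X - Y).\<close>

fun (in ring) op_average :: "('a \<Rightarrow> 'a) \<Rightarrow> ('a \<Rightarrow> 'a) \<Rightarrow> 'a list \<Rightarrow> 'a \<Rightarrow> 'a" where
  "op_average P T [] d = \<zero>"
| "op_average P T (a # p) d = P (op_eval T p d) \<oplus> T (op_average P T p d)"

context ring begin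

lemma linearD:
  assumes "linear_over K T"
  shows "d \<in> carrier R \<Longrightarrow> T d \<in> carrier R"
    "\<lbrakk>d \<in> carrier R; e \<in> carrier R\<rbrakk> \<Longrightarrow> T (d \<oplus> e) = T d \<oplus> T e"
    "\<lbrakk>c \<in> K; d \<in> carrier R\<rbrakk> \<Longrightarrow> T (c \<otimes> d) = c \<otimes> T d"
  using assms unfolding linear_over_def additive_def by blast+

lemma linear_zero: assumes "linear_over K T" shows "T \<zero> = \<zero>"
  using linearD(2)[OF assms zero_closed zero_closed] linearD(1)[OF assms zero_closed]
  by (metis add.l_cancel_one l_zero zero_closed)

lemma linear_minus: assumes T: "linear_over K T" and d: "d \<in> carrier R" shows "T (\<ominus> d) = \<ominus> T d"
proof -
  have "T (\<ominus> d) \<oplus> T d = \<zero>"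
    using linearD(2)[OF T, of "\<ominus> d" d] d linear_zero[OF T] by (simp add: l_neg)
  then show ?thesis using linearD(1)[OF T] d by (simp add: minus_equality)
qed

lemma op_eval_linear:
  assumes T: "linear_over K T" and K: "K \<subseteq> center R" and p: "set p \<subseteq> K"
  shows "linear_over K (op_eval T p)"
  using p
proof (induction p)
  case Nil
  then show ?case using K by (auto simp: linear_over_def additive_def subset_iff center_carrier)
next
  case (Cons a p)
  then have IH: "linear_over K (op_eval T p)" and a: "a \<in> center R" using K by auto
  note c = linearD(1)[OF IH] linearD(1)[OF T] center_carrier[OF a]
  have "op_eval T (a # p) (c \<otimes> d) = c \<otimes> op_eval T (a # p) d" if "c \<in> K" "d \<in> carrier R" for c d
  proof -
    have cc: "c \<in> carrier R" using that K center_carrier by blast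
    have "a \<otimes> (c \<otimes> d) = c \<otimes> (a \<otimes> d)"
      using center_comm[OF a cc] cc c that by (metis m_assoc)
    then show ?thesis using that cc c linearD(3)[OF IH that] linearD(3)[OF T that(1), of "op_eval T p d"]
      by (simp add: r_distr)
  qed
  moreover have "op_eval T (a # p) (d \<oplus> e) = op_eval T (a # p) d \<oplus> op_eval T (a # p) e"
    if "d \<in> carrier R" "e \<in> carrier R" for d e
    using that c linearD(2)[OF IH that] linearD(2)[OF T, of "op_eval T p d" "op_eval T p e"]
    by (simp add: r_distr a_ac)
  ultimately show ?case using c unfolding linear_over_def additive_def by auto
qed

lemma op_eval_commute:
  assumes S: "linear_over K S" and T: "linear_over K T" and K: "K \<subseteq> center R"
    and ST: "\<And>d. d \<in> carrier R \<Longrightarrow> S (T d) = T (S d)" and p: "set p \<subseteq> K" and d: "d \<in> carrier R"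
  shows "S (op_eval T p d) = op_eval T p (S d)"
  using p
proof (induction p)
  case Nil then show ?case using linear_zero[OF S] by simp
next
  case (Cons a p)
  then have a: "a \<in> K" "a \<in> carrier R" and p: "set p \<subseteq> K" using K center_carrier by auto
  note c = linearD(1)[OF op_eval_linear[OF T K p]] linearD(1)[OF S] linearD(1)[OF T]
  show ?case using Cons.IH[OF p] a c d ST linearD(2,3)[OF S] by simp
qed

lemma op_average_linear:
  assumes P: "linear_over K P" and T: "linear_over K T" and K: "K \<subseteq> center R" and p: "set p \<subseteq> K"
  shows "linear_over K (op_average P T p)"
  using p
proof (induction p)
  case Nil
  then show ?case using K by (auto simp: linear_over_def additive_def subset_iff center_carrier)
next
  case (Cons a p)
  then have IH: "linear_over K (op_average P T p)" and E: "linear_over K (op_eval T p)"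
    using op_eval_linear[OF T K] by auto
  note c = linearD(1)[OF IH] linearD(1)[OF T] linearD(1)[OF P] linearD(1)[OF E]
  have "op_average P T (a # p) (c \<otimes> d) = c \<otimes> op_average P T (a # p) d" if "c \<in> K" "d \<in> carrier R" for c d
    using that K center_carrier[of c] c linearD(3)[OF IH that] linearD(3)[OF E that]
      linearD(3)[OF T that(1), of "op_average P T p d"] linearD(3)[OF P that(1), of "op_eval T p d"]
    by (auto simp: r_distr)
  moreover have "op_average P T (a # p) (d \<oplus> e) = op_average P T (a # p) d \<oplus> op_average P T (a # p) e"
    if "d \<in> carrier R" "e \<in> carrier R" for d e
    using that c linearD(2)[OF IH that] linearD(2)[OF E that] linearD(2)[OF P, of "op_eval T p d" "op_eval T p e"]
      linearD(2)[OF T, of "op_average P T p d" "op_average P T p e"]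
    by (simp add: a_ac)
  ultimately show ?case using c unfolding linear_over_def additive_def by auto
qed

text \<open>This is the identity \<open>(X - Y) (p(X) - p(Y)) / (X - Y) = p(X) - p(Y)\<close> read with T on the two
  sides of P. If T is a root of p, the average commutes with T.\<close>

lemma op_average_commutator:
  assumes P: "linear_over K P" and T: "linear_over K T" and K: "K \<subseteq> center R" and p: "set p \<subseteq> K"
    and d: "d \<in> carrier R"
  shows "T (op_average P T p d) \<oplus> P (op_eval T p d) = op_average P T p (T d) \<oplus> op_eval T p (P d)"
  using p
proof (induction p)
  case Nil then show ?case using linear_zero[OF P] linear_zero[OF T] by simp
next
  case (Cons a p)
  then have a: "a \<in> K" "a \<in> carrier R" and p: "set p \<subseteq> K" using K center_carrier by auto
  note lin = op_average_linear[OF P T K p] op_eval_linear[OF T K p]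
  note c = linearD(1)[OF lin(1)] linearD(1)[OF lin(2)] linearD(1)[OF T] linearD(1)[OF P] a d
  let ?A = "op_average P T p" and ?E = "op_eval T p"
  have comm: "?E (T d) = T (?E d)" using op_eval_commute[OF T T K _ p d] by simp
  have "T (op_average P T (a # p) d) \<oplus> P (op_eval T (a # p) d)
     = (T (P (?E d)) \<oplus> T (T (?A d))) \<oplus> (a \<otimes> P d \<oplus> P (T (?E d)))"
    using c linearD(2)[OF T] linearD(2,3)[OF P] by simp
  also have "\<dots> = P (T (?E d)) \<oplus> T (T (?A d) \<oplus> P (?E d)) \<oplus> a \<otimes> P d"
    using c linearD(2)[OF T] by (simp add: a_ac)
  also have "\<dots> = P (?E (T d)) \<oplus> T (?A (T d) \<oplus> ?E (P d)) \<oplus> a \<otimes> P d"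
    unfolding Cons.IH[OF p] comm by simp
  also have "\<dots> = op_average P T (a # p) (T d) \<oplus> op_eval T (a # p) (P d)"
    using c linearD(2)[OF T] by (simp add: a_ac)
  finally show ?case .
qed

lemma op_average_commute:
  assumes P: "linear_over K P" and T: "linear_over K T" and S: "linear_over K S" and K: "K \<subseteq> center R"
    and ST: "\<And>d. d \<in> carrier R \<Longrightarrow> S (T d) = T (S d)" and SP: "\<And>d. d \<in> carrier R \<Longrightarrow> S (P d) = P (S d)"
    and p: "set p \<subseteq> K" and d: "d \<in> carrier R"
  shows "S (op_average P T p d) = op_average P T p (S d)"
  using p
proof (induction p)
  case Nil then show ?case using linear_zero[OF S] by simp
next
  case (Cons a p)
  then have p: "set p \<subseteq> K" by auto
  note lin = op_average_linear[OF P T K p] op_eval_linear[OF T K p]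
  note c = linearD(1)[OF lin(1)] linearD(1)[OF lin(2)] linearD(1)[OF T] linearD(1)[OF P] d
  show ?case using Cons.IH[OF p] c ST SP linearD(2)[OF S] op_eval_commute[OF S T K ST p d] by simp
qed

lemma op_average_id:
  assumes T: "linear_over K T" and K: "K \<subseteq> center R" and p: "set p \<subseteq> K"
    and N: "N \<subseteq> carrier R" "\<zero> \<in> N" "\<And>x y. \<lbrakk>x \<in> N; y \<in> N\<rbrakk> \<Longrightarrow> x \<oplus> y \<in> N"
      "\<And>c x. \<lbrakk>c \<in> K; x \<in> N\<rbrakk> \<Longrightarrow> c \<otimes> x \<in> N" "\<And>x. x \<in> N \<Longrightarrow> T x \<in> N"
    and P: "\<And>x. x \<in> N \<Longrightarrow> P x = x" and d: "d \<in> N"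
  shows "op_eval T p d \<in> N \<and> op_average P T p d = op_deriv T p d \<and> op_deriv T p d \<in> N"
  using p
  by (induction p) (use N P d in auto)

lemma op_average_mem:
  assumes T: "linear_over K T" and K: "K \<subseteq> center R" and p: "set p \<subseteq> K"
    and N: "\<zero> \<in> N" "\<And>x y. \<lbrakk>x \<in> N; y \<in> N\<rbrakk> \<Longrightarrow> x \<oplus> y \<in> N" "\<And>x. x \<in> N \<Longrightarrow> T x \<in> N"
    and P: "\<And>x. x \<in> carrier R \<Longrightarrow> P x \<in> N" and d: "d \<in> carrier R"
  shows "op_average P T p d \<in> N"
  using p
proof (induction p)
  case (Cons a p)
  then have p: "set p \<subseteq> K" by auto
  show ?case using Cons.IH[OF p] linearD(1)[OF op_eval_linear[OF T K p] d] N P by simp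
qed (use N in auto)

text \<open>Separability of T over K inside a commuting family B: the inverse W of the derivative at T belongs
  to B, so that it preserves every set that all of B preserves.\<close>

definition sep_op :: "'a set \<Rightarrow> ('a \<Rightarrow> 'a) set \<Rightarrow> ('a \<Rightarrow> 'a) \<Rightarrow> bool" where
  "sep_op K B T \<longleftrightarrow> (\<exists>p. \<exists>W\<in>B. set p \<subseteq> K \<and> (\<forall>d\<in>carrier R. op_eval T p d = \<zero> \<and> W (op_deriv T p d) = d))"

text \<open>Maschke's argument for a separable algebra. Averaging a projection with the difference quotient
  of p makes it commute with T and turns it into multiplication by the derivative on N; dividing by
  the derivative restores the projection. The generators are treated one after the other.\<close>

lemma equivariant_projection:
  assumes K: "K \<subseteq> center R"
    and B: "\<And>S. S \<in> B \<Longrightarrow> linear_over K S"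
      "\<And>S T d. \<lbrakk>S \<in> B; T \<in> B; d \<in> carrier R\<rbrakk> \<Longrightarrow> S (T d) = T (S d)"
    and N: "N \<subseteq> carrier R" "\<zero> \<in> N" "\<And>x y. \<lbrakk>x \<in> N; y \<in> N\<rbrakk> \<Longrightarrow> x \<oplus> y \<in> N"
      "\<And>c x. \<lbrakk>c \<in> K; x \<in> N\<rbrakk> \<Longrightarrow> c \<otimes> x \<in> N" "\<And>S x. \<lbrakk>S \<in> B; x \<in> N\<rbrakk> \<Longrightarrow> S x \<in> N"
    and P: "linear_over K P" "\<And>x. x \<in> carrier R \<Longrightarrow> P x \<in> N" "\<And>x. x \<in> N \<Longrightarrow> P x = x"
    and G: "finite G" "G \<subseteq> B" "\<And>T. T \<in> G \<Longrightarrow> sep_op K B T"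
  shows "\<exists>Q. linear_over K Q \<and> (\<forall>x\<in>carrier R. Q x \<in> N) \<and> (\<forall>x\<in>N. Q x = x) \<and>
    (\<forall>T\<in>G. \<forall>x\<in>carrier R. T (Q x) = Q (T x))"
  using G
proof (induction G)
  case empty then show ?case using P by auto
next
  case (insert T G)
  then obtain Q where Q: "linear_over K Q" "\<And>x. x \<in> carrier R \<Longrightarrow> Q x \<in> N" "\<And>x. x \<in> N \<Longrightarrow> Q x = x"
    "\<And>S x. \<lbrakk>S \<in> G; x \<in> carrier R\<rbrakk> \<Longrightarrow> S (Q x) = Q (S x)" by auto
  have TB: "T \<in> B" and GB: "G \<subseteq> B" using insert by auto
  obtain p W where pW: "W \<in> B" "set p \<subseteq> K" "\<And>d. d \<in> carrier R \<Longrightarrow> op_eval T p d = \<zero>"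
    "\<And>d. d \<in> carrier R \<Longrightarrow> W (op_deriv T p d) = d"
  proof -
    have "sep_op K B T" using insert.prems by blast
    then show ?thesis using that unfolding sep_op_def by meson
  qed
  note T = B(1)[OF TB] and W = B(1)[OF pW(1)]
  let ?A = "op_average Q T p"
  note A = op_average_linear[OF Q(1) T K pW(2)]
  have TA: "T (?A d) = ?A (T d)" if d: "d \<in> carrier R" for d
    using op_average_commutator[OF Q(1) T K pW(2) d] pW(3) linear_zero[OF Q(1)] d
      linearD(1)[OF A] linearD(1)[OF T] linearD(1)[OF Q(1)] by simp
  have AN: "?A d \<in> N" if "d \<in> carrier R" for d
    by (rule op_average_mem[OF T K pW(2) N(2,3) N(5)[OF TB] Q(2) that])
  have AI: "?A d = op_deriv T p d" if "d \<in> N" for d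
    using op_average_id[OF T K pW(2) N(1-4) N(5)[OF TB] Q(3) that] by blast
  let ?Q = "\<lambda>d. W (?A d)"
  have "linear_over K ?Q"
    using linearD[OF A] linearD[OF W] unfolding linear_over_def additive_def by auto
  moreover have "?Q x \<in> N" if "x \<in> carrier R" for x using N(5)[OF pW(1)] AN that by blast
  moreover have "?Q x = x" if "x \<in> N" for x using AI[OF that] pW(4) that N(1) by auto
  moreover have "S (?Q x) = ?Q (S x)" if S: "S \<in> insert T G" and x: "x \<in> carrier R" for S x
  proof -
    have SB: "S \<in> B" using S TB GB by auto
    have "S (?A x) = ?A (S x)"
    proof (cases "S = T")
      case True then show ?thesis using TA x by simp
    next
      case False
      then have SG: "S \<in> G" using S by simp
      show ?thesis
        by (rule op_average_commute[OF Q(1) T B(1)[OF SB] K B(2)[OF SB TB] Q(4)[OF SG] pW(2) x])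
    qed
    then show ?thesis using B(2)[OF SB pW(1), of "?A x"] linearD(1)[OF A x] by simp
  qed
  ultimately show ?case by (intro exI[of _ ?Q]) blast
qed

lemma exists_linear_projection:
  assumes K: "subfield K R" and dim: "dimension n K (carrier R)" and Ws: "independent K Ws"
    and KC: "K \<subseteq> center R"
  shows "\<exists>P. linear_over K P \<and> (\<forall>x\<in>carrier R. P x \<in> Span K Ws) \<and> (\<forall>x\<in>Span K Ws. P x = x)"
proof -
  have WsR: "set Ws \<subseteq> carrier R" by (rule independent_in_carrier[OF Ws])
  obtain Vs where Vs: "independent K (Vs @ Ws)" "Span K (Vs @ Ws) = carrier R"
    using complete_base[OF K dim Ws WsR] by blast
  have VsR: "set Vs \<subseteq> carrier R" using independent_in_carrier[OF Vs(1)] by simp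
  let ?N = "Span K Ws" and ?V = "Span K Vs"
  note N = Span_subgroup_props[OF K WsR] Span_smult_closed[OF K WsR]
  note V = Span_subgroup_props[OF K VsR] Span_smult_closed[OF K VsR]
  have int: "?V \<inter> ?N = {\<zero>}" using independent_split(3)[OF K Vs(1)] .
  have sum: "\<exists>v\<in>?V. \<exists>w\<in>?N. x = v \<oplus> w" if "x \<in> carrier R" for x
    using that Vs(2) Span_append_eq_set_add[OF K VsR WsR] by (auto simp: set_add_def')
  define P where "P x = (SOME w. w \<in> ?N \<and> x \<ominus> w \<in> ?V)" for x
  have ex: "\<exists>w. w \<in> ?N \<and> x \<ominus> w \<in> ?V" if "x \<in> carrier R" for x
  proof -
    have "\<exists>v\<in>?V. \<exists>w\<in>?N. x = v \<oplus> w" by (rule sum[OF that])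
    then obtain v w where vw: "v \<in> ?V" "w \<in> ?N" "x = v \<oplus> w" by blast
    have "v \<in> carrier R" "w \<in> carrier R" using vw V(1) N(1) by auto
    then have "x \<ominus> w = v" using vw by (simp add: a_minus_def a_assoc r_neg)
    then show ?thesis using vw by auto
  qed
  have PN: "P x \<in> ?N" "x \<ominus> P x \<in> ?V" if "x \<in> carrier R" for x
    using someI_ex[OF ex[OF that]] unfolding P_def by auto
  have uniq: "P x = w" if x: "x \<in> carrier R" and w: "w \<in> ?N" "x \<ominus> w \<in> ?V" for x w
  proof -
    have c: "w \<in> carrier R" "P x \<in> carrier R" using w PN(1)[OF x] N(1) by auto
    have "w \<ominus> P x = (x \<ominus> P x) \<oplus> \<ominus> (x \<ominus> w)"
      using c x by (simp add: a_minus_def minus_add a_ac r_neg2)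
    then have "w \<ominus> P x \<in> ?V" using V(3,4) PN(2)[OF x] w(2) by auto
    moreover have "w \<ominus> P x \<in> ?N" using N(3,4) PN(1)[OF x] w(1) by (auto simp: a_minus_def)
    ultimately show ?thesis using int c by (metis Int_iff r_right_minus_eq singletonD)
  qed
  have "linear_over K P"
    unfolding linear_over_def additive_def
  proof (intro conjI ballI)
    fix d assume d: "d \<in> carrier R"
    then show "P d \<in> carrier R" using PN(1) N(1) by auto
  next
    fix d e assume de: "d \<in> carrier R" "e \<in> carrier R"
    have c: "P d \<in> carrier R" "P e \<in> carrier R" using PN(1) de N(1) by auto
    have "(d \<oplus> e) \<ominus> (P d \<oplus> P e) = (d \<ominus> P d) \<oplus> (e \<ominus> P e)"
      using de c by (simp add: a_minus_def minus_add a_ac)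
    then show "P (d \<oplus> e) = P d \<oplus> P e"
      using PN de N(3) V(3) by (intro uniq) auto
  next
    fix c d assume cd: "c \<in> K" "d \<in> carrier R"
    have c: "c \<in> carrier R" "P d \<in> carrier R" using PN(1) cd N(1) subfieldE(3)[OF K] by auto
    have "c \<otimes> d \<ominus> c \<otimes> P d = c \<otimes> (d \<ominus> P d)"
      using cd c by (simp add: a_minus_def r_distr r_minus)
    then show "P (c \<otimes> d) = c \<otimes> P d"
      using PN[OF cd(2)] cd c N(5) V(5) by (intro uniq) auto
  qed
  moreover have "P x = x" if "x \<in> ?N" for x
    using that N(1) V(2) by (intro uniq) (auto simp: a_minus_def r_neg)
  ultimately show ?thesis using PN(1) by blast
qed

end

context ring begin

lemma Span_map:
  assumes T: "linear_over K T" and "K \<subseteq> carrier R" and Us: "set Us \<subseteq> carrier R"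
  shows "Span K (map T Us) = T ` Span K Us"
  using Us
proof (induction Us)
  case Nil then show ?case using linear_zero[OF T] by simp
next
  case (Cons u Us)
  have S: "Span K Us \<subseteq> carrier R" using Span_in_carrier[OF assms(2), of Us] Cons by simp
  have "Span K (map T (u # Us)) = line_extension K (T u) (T ` Span K Us)" using Cons by simp
  also have "\<dots> = T ` line_extension K u (Span K Us)"
  proof (intro equalityI subsetI)
    fix x assume "x \<in> line_extension K (T u) (T ` Span K Us)"
    then obtain k v where kv: "k \<in> K" "v \<in> Span K Us" "x = k \<otimes> T u \<oplus> T v"
      by (auto simp: line_extension_mem_iff)
    have "x = T (k \<otimes> u \<oplus> v)"
      using kv linearD[OF T] Cons.prems S assms(2) by (auto simp: subset_iff)
    then show "x \<in> T ` line_extension K u (Span K Us)"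
      using kv(1,2) line_extension_mem_iff[of "k \<otimes> u \<oplus> v" K u "Span K Us"] by blast
  next
    fix x assume "x \<in> T ` line_extension K u (Span K Us)"
    then obtain k v where kv: "k \<in> K" "v \<in> Span K Us" "x = T (k \<otimes> u \<oplus> v)"
      by (auto simp: line_extension_mem_iff)
    have "x = k \<otimes> T u \<oplus> T v"
      using kv linearD[OF T] Cons.prems S assms(2) by (auto simp: subset_iff)
    then show "x \<in> line_extension K (T u) (T ` Span K Us)"
      using kv unfolding line_extension_mem_iff by blast
  qed
  finally show ?case by simp
qed

lemma independent_linear_image:
  assumes T: "linear_over K T" and K: "subfield K R" and Us: "independent K Us"
    and inj: "\<And>x. \<lbrakk>x \<in> Span K Us; T x = \<zero>\<rbrakk> \<Longrightarrow> x = \<zero>"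
  shows "independent K (map T Us)"
  using Us inj
proof (induction Us rule: list.induct)
  case (Cons u Us)
  note b = independent_backwards[OF Cons.prems(1)]
  have c: "set Us \<subseteq> carrier R" "u \<in> carrier R" using independent_in_carrier[OF Cons.prems(1)] by auto
  have KR: "K \<subseteq> carrier R" by (rule subfieldE(3)[OF K])
  note sp = Span_subgroup_props[OF K c(1)]
  have ext: "x \<in> Span K (u # Us)" if "x \<in> Span K Us" for x
    using mono_Span[OF K c] that by blast
  have u: "u \<in> Span K (u # Us)" using Span_base_incl[OF K, of "u # Us"] c by auto
  have "independent K (map T Us)" using Cons.IH[OF b(2)] Cons.prems(2) ext by blast
  moreover have "T u \<notin> Span K (map T Us)"
  proof
    assume "T u \<in> Span K (map T Us)"
    then obtain y where y: "y \<in> Span K Us" "T u = T y" using Span_map[OF T KR c(1)] by auto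
    have yc: "y \<in> carrier R" using y sp by auto
    have "T (u \<ominus> y) = \<zero>"
      using linearD(2)[OF T, of u "\<ominus> y"] linear_minus[OF T yc] y linearD(1)[OF T] c yc
      by (simp add: a_minus_def r_neg)
    moreover have "u \<ominus> y \<in> Span K (u # Us)"
      using Span_subgroup_props(3,4)[OF K, of "u # Us"] c u ext[OF y(1)] by (simp add: a_minus_def del: Span.simps)
    ultimately have "u \<ominus> y = \<zero>" using Cons.prems(2) by blast
    then have "u = y" using c yc by simp
    then show False using b(1) y by simp
  qed
  ultimately show ?case using linearD(1)[OF T c(2)] by (simp add: li_Cons del: Span.simps)
qed simp

lemma independent_linear_preimage:
  assumes T: "linear_over K T" and K: "subfield K R" and Us: "set Us \<subseteq> carrier R"
    and ind: "independent K (map T Us)"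
  shows "independent K Us \<and> (\<forall>x\<in>Span K Us. T x = \<zero> \<longrightarrow> x = \<zero>)"
  using Us ind
proof (induction Us rule: list.induct)
  case (Cons u Us)
  have c: "set Us \<subseteq> carrier R" "u \<in> carrier R" using Cons.prems by auto
  have KR: "K \<subseteq> carrier R" by (rule subfieldE(3)[OF K])
  note sp = Span_subgroup_props[OF K c(1)]
  have ind: "T u \<notin> Span K (map T Us)" "independent K (map T Us)"
    using independent_backwards[of K "T u" "map T Us"] Cons.prems(2) by auto
  note IH = Cons.IH[OF c(1) ind(2)]
  have TS: "T y \<in> Span K (map T Us)" if "y \<in> Span K Us" for y
    using Span_map[OF T KR c(1)] that by blast
  have Tc: "set (map T Us) \<subseteq> carrier R" using c linearD(1)[OF T] by auto
  have "independent K (u # Us)"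
    using IH TS ind c by (intro li_Cons) auto
  moreover have "x = \<zero>" if x: "x \<in> Span K (u # Us)" "T x = \<zero>" for x
  proof -
    obtain k y where ky: "k \<in> K" "y \<in> Span K Us" "x = k \<otimes> u \<oplus> y"
      using x(1) by (auto simp: line_extension_mem_iff)
    have yc: "y \<in> carrier R" "k \<in> carrier R" using ky sp KR by auto
    have 0: "k \<otimes> T u \<oplus> T y = \<zero>"
      using x(2) ky yc c linearD(2,3)[OF T] by simp
    have "k = \<zero>"
    proof (rule ccontr)
      assume k: "k \<noteq> \<zero>"
      have "k \<otimes> T u = \<ominus> T y" using 0 yc c linearD(1)[OF T] by (simp add: minus_equality[symmetric])
      then have "k \<otimes> T u \<in> Span K (map T Us)"
        using Span_subgroup_props(4)[OF K Tc] TS[OF ky(2)] by simp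
      then show False
        using Span_m_inv_simprule[OF K Tc] ky k ind(1) linearD(1)[OF T c(2)] by blast
    qed
    then have "x = y" using ky yc c by simp
    then show ?thesis using IH ky x by blast
  qed
  ultimately show ?case by blast
qed simp

text \<open>The sub-bimodule generated by a, built by adding one product at a time so that induction
  takes the place of reasoning about sums of variable length.\<close>

inductive_set bspan :: "'a set \<Rightarrow> 'a set \<Rightarrow> 'a \<Rightarrow> 'a set" for E\<^sub>1 E\<^sub>2 a where
  zero: "\<zero> \<in> bspan E\<^sub>1 E\<^sub>2 a"
| step: "\<lbrakk>u \<in> E\<^sub>1; v \<in> E\<^sub>2; z \<in> bspan E\<^sub>1 E\<^sub>2 a\<rbrakk> \<Longrightarrow> (u \<otimes> a \<otimes> v) \<oplus> z \<in> bspan E\<^sub>1 E\<^sub>2 a"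

context
  fixes E\<^sub>1 E\<^sub>2 assumes E: "E\<^sub>1 \<subseteq> carrier R" "E\<^sub>2 \<subseteq> carrier R"
begin

lemma bspan_closed: "\<lbrakk>a \<in> carrier R; z \<in> bspan E\<^sub>1 E\<^sub>2 a\<rbrakk> \<Longrightarrow> z \<in> carrier R"
  by (erule bspan.induct) (use E in auto)

lemma bspan_add:
  assumes a: "a \<in> carrier R" and "x \<in> bspan E\<^sub>1 E\<^sub>2 a" "y \<in> bspan E\<^sub>1 E\<^sub>2 a"
  shows "x \<oplus> y \<in> bspan E\<^sub>1 E\<^sub>2 a"
  using assms(2)
proof induction
  case (step u v z)
  have "(u \<otimes> a \<otimes> v) \<oplus> (z \<oplus> y) \<in> bspan E\<^sub>1 E\<^sub>2 a" by (rule bspan.step[OF step(1,2,4)])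
  then show ?case using E a step bspan_closed[OF a step(3)] bspan_closed[OF a assms(3)]
    by (simp add: a_assoc subset_iff)
qed (use assms bspan_closed in auto)

lemma bspan_mult:
  assumes a: "a \<in> carrier R" and z: "z \<in> bspan E\<^sub>1 E\<^sub>2 a" and uv: "u \<in> E\<^sub>1" "v \<in> E\<^sub>2"
    and m: "\<And>u'. u' \<in> E\<^sub>1 \<Longrightarrow> u \<otimes> u' \<in> E\<^sub>1" "\<And>v'. v' \<in> E\<^sub>2 \<Longrightarrow> v' \<otimes> v \<in> E\<^sub>2"
  shows "u \<otimes> z \<otimes> v \<in> bspan E\<^sub>1 E\<^sub>2 a"
  using z
proof induction
  case zero then show ?case using uv E by (auto simp: subset_iff intro: bspan.zero)
next
  case (step u' v' z)
  have c: "u \<in> carrier R" "v \<in> carrier R" "u' \<in> carrier R" "v' \<in> carrier R" "z \<in> carrier R"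
    using uv E step bspan_closed[OF a] by auto
  have "((u \<otimes> u') \<otimes> a \<otimes> (v' \<otimes> v)) \<oplus> (u \<otimes> z \<otimes> v) \<in> bspan E\<^sub>1 E\<^sub>2 a"
    by (rule bspan.step) (use step m in auto)
  then show ?case using c a by (simp add: l_distr r_distr m_assoc)
qed

lemma bspan_self:
  assumes a: "a \<in> carrier R" and uv: "u \<in> E\<^sub>1" "v \<in> E\<^sub>2"
  shows "u \<otimes> a \<otimes> v \<in> bspan E\<^sub>1 E\<^sub>2 a"
  using bspan.step[OF uv bspan.zero, of a] uv E a by (simp add: subset_iff)

end

end

section \<open>Cyclic vectors for two separable subalgebras\<close>

text \<open>Coefficient lists have the constant term first, in contrast to those of \<open>eval\<close>;
  this makes the derivative recursive without any reference to degrees.\<close>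

fun (in ring) horner :: "'a list \<Rightarrow> 'a \<Rightarrow> 'a" where
  "horner [] x = \<zero>"
| "horner (a # p) x = a \<oplus> x \<otimes> horner p x"

fun (in ring) horner_deriv :: "'a list \<Rightarrow> 'a \<Rightarrow> 'a" where
  "horner_deriv [] x = \<zero>"
| "horner_deriv (a # p) x = horner p x \<oplus> x \<otimes> horner_deriv p x"

text \<open>Separability witnessed by any polynomial with a simple root at x, the derivative being
  invertible inside E. In contrast to separability of the minimal polynomial, this makes sense over
  every ring and is preserved by homomorphisms.\<close>

definition (in ring) sep_elem :: "'a set \<Rightarrow> 'a set \<Rightarrow> 'a \<Rightarrow> bool" where
  "sep_elem K E x \<longleftrightarrow> (\<exists>p. \<exists>w\<in>E. set p \<subseteq> K \<and> horner p x = \<zero> \<and> horner_deriv p x \<otimes> w = \<one>)"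

locale sep_subalgebra = ring R for R (structure) +
  fixes K E G
  assumes K_center: "K = center R" and subK: "subfield K R"
    and subE: "subring E R" and KE: "K \<subseteq> E"
    and commE: "\<lbrakk>x \<in> E; y \<in> E\<rbrakk> \<Longrightarrow> x \<otimes> y = y \<otimes> x"
    and finG: "finite G" and GE: "G \<subseteq> E"
    and sepG: "x \<in> G \<Longrightarrow> sep_elem K E x"
    and genG: "subalgebra K V R \<Longrightarrow> G \<subseteq> V \<Longrightarrow> E \<subseteq> V"
begin

lemma E_carrier: "x \<in> E \<Longrightarrow> x \<in> carrier R"
  using subringE(1)[OF subE] by auto

lemma K_comm: "c \<in> K \<Longrightarrow> d \<in> carrier R \<Longrightarrow> c \<otimes> d = d \<otimes> c" "c \<in> K \<Longrightarrow> c \<in> carrier R"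
  unfolding K_center by (auto intro: center_comm center_carrier)

lemma horner_E: assumes "set p \<subseteq> K" "x \<in> E" shows "horner p x \<in> E" "horner_deriv p x \<in> E"
proof -
  have "horner p x \<in> E \<and> horner_deriv p x \<in> E"
    using assms(1) by (induction p) (use KE assms(2) subringE[OF subE] in auto)
  then show "horner p x \<in> E" "horner_deriv p x \<in> E" by auto
qed

lemma op_eval_left:
  assumes "set p \<subseteq> K" "x \<in> E" "d \<in> carrier R"
  shows "op_eval (\<lambda>d. x \<otimes> d) p d = horner p x \<otimes> d" "op_deriv (\<lambda>d. x \<otimes> d) p d = horner_deriv p x \<otimes> d"
proof -
  have "op_eval (\<lambda>d. x \<otimes> d) p d = horner p x \<otimes> d \<and> op_deriv (\<lambda>d. x \<otimes> d) p d = horner_deriv p x \<otimes> d"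
    using assms(1)
  proof (induction p)
    case (Cons a p)
    then have "set p \<subseteq> K" "a \<in> carrier R" using K_comm by auto
    then show ?case using Cons.IH horner_E[OF \<open>set p \<subseteq> K\<close> assms(2)] E_carrier assms
      by (simp add: l_distr m_assoc)
  qed (use assms in auto)
  then show "op_eval (\<lambda>d. x \<otimes> d) p d = horner p x \<otimes> d" "op_deriv (\<lambda>d. x \<otimes> d) p d = horner_deriv p x \<otimes> d"
    by auto
qed

lemma op_eval_right:
  assumes "set p \<subseteq> K" "x \<in> E" "d \<in> carrier R"
  shows "op_eval (\<lambda>d. d \<otimes> x) p d = d \<otimes> horner p x" "op_deriv (\<lambda>d. d \<otimes> x) p d = d \<otimes> horner_deriv p x"
proof -
  have "op_eval (\<lambda>d. d \<otimes> x) p d = d \<otimes> horner p x \<and> op_deriv (\<lambda>d. d \<otimes> x) p d = d \<otimes> horner_deriv p x"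
    using assms(1)
  proof (induction p)
    case (Cons a p)
    then have p: "set p \<subseteq> K" and a: "a \<in> carrier R" "a \<otimes> d = d \<otimes> a" using K_comm assms by auto
    note h = horner_E[OF p assms(2)]
    have "x \<otimes> horner p x = horner p x \<otimes> x" "x \<otimes> horner_deriv p x = horner_deriv p x \<otimes> x"
      using commE h assms(2) by auto
    then show ?case using Cons.IH[OF p] h[THEN E_carrier] E_carrier[OF assms(2)] assms(3) a
      by (simp add: r_distr m_assoc)
  qed (use assms in auto)
  then show "op_eval (\<lambda>d. d \<otimes> x) p d = d \<otimes> horner p x" "op_deriv (\<lambda>d. d \<otimes> x) p d = d \<otimes> horner_deriv p x"
    by auto
qed

end

lemma (in ring) two_sided_mult_linear:
  assumes "u \<in> carrier R" "v \<in> carrier R" "K \<subseteq> center R"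
  shows "linear_over K (\<lambda>d. u \<otimes> d \<otimes> v)"
proof -
  have "u \<otimes> (c \<otimes> d) \<otimes> v = c \<otimes> (u \<otimes> d \<otimes> v)" if "c \<in> K" "d \<in> carrier R" for c d
  proof -
    have c: "c \<in> carrier R" "c \<otimes> u = u \<otimes> c" using that assms center_comm center_carrier by auto
    have "u \<otimes> (c \<otimes> d) \<otimes> v = (u \<otimes> c) \<otimes> d \<otimes> v" using c(1) that assms by (simp add: m_assoc)
    then show ?thesis unfolding c(2)[symmetric] using c(1) that assms by (simp add: m_assoc)
  qed
  then show ?thesis using assms by (auto simp: linear_over_def additive_def l_distr r_distr)
qed

locale two_sep_subalgebras = L?: sep_subalgebra R K E\<^sub>1 G\<^sub>1 + M: sep_subalgebra R K E\<^sub>2 G\<^sub>2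
  for R (structure) and K E\<^sub>1 G\<^sub>1 E\<^sub>2 G\<^sub>2
begin

lemma E_sub: "E\<^sub>1 \<subseteq> carrier R" "E\<^sub>2 \<subseteq> carrier R"
  using L.E_carrier M.E_carrier by auto

text \<open>The operators \<open>d \<mapsto> u \<otimes> d \<otimes> v\<close> commute with each other, and those given by the generators on
  either side are separable. A projection that commutes with the operators of the generators
  commutes with all of them, since the elements that it commutes with form a subalgebra.\<close>

lemma equivariant_projection_bspan:
  assumes a: "a \<in> carrier R" and Ws: "independent K Ws" "Span K Ws = bspan E\<^sub>1 E\<^sub>2 a"
    and dim: "dimension n K (carrier R)"
  shows "\<exists>Q. linear_over K Q \<and> (\<forall>x\<in>carrier R. Q x \<in> bspan E\<^sub>1 E\<^sub>2 a) \<and> (\<forall>x\<in>bspan E\<^sub>1 E\<^sub>2 a. Q x = x) \<and>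
    (\<forall>u\<in>E\<^sub>1. \<forall>v\<in>E\<^sub>2. \<forall>x\<in>carrier R. u \<otimes> Q x \<otimes> v = Q (u \<otimes> x \<otimes> v))"
proof -
  let ?N = "bspan E\<^sub>1 E\<^sub>2 a"
  have KC: "K \<subseteq> center R" using L.K_center by simp
  have K1: "K \<subseteq> E\<^sub>1" "K \<subseteq> E\<^sub>2" "\<one> \<in> E\<^sub>1" "\<one> \<in> E\<^sub>2"
    using L.KE M.KE subringE(3)[OF L.subE] subringE(3)[OF M.subE] by auto
  obtain P where P: "linear_over K P" "\<And>x. x \<in> carrier R \<Longrightarrow> P x \<in> ?N" "\<And>x. x \<in> ?N \<Longrightarrow> P x = x"
    using L.exists_linear_projection[OF L.subK dim Ws(1) KC] Ws(2) by auto
  define B where "B = {S. linear_over K S \<and> (\<exists>u\<in>E\<^sub>1. \<exists>v\<in>E\<^sub>2. \<forall>d\<in>carrier R. S d = u \<otimes> d \<otimes> v)}"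
  have m1: "u \<otimes> u' \<in> E\<^sub>1" if "u \<in> E\<^sub>1" "u' \<in> E\<^sub>1" for u u' using subringE(6)[OF L.subE] that by auto
  have m2: "u \<otimes> u' \<in> E\<^sub>2" if "u \<in> E\<^sub>2" "u' \<in> E\<^sub>2" for u u' using subringE(6)[OF M.subE] that by auto
  have Nmult: "u \<otimes> z \<otimes> v \<in> ?N" if "u \<in> E\<^sub>1" "v \<in> E\<^sub>2" "z \<in> ?N" for u v z
    by (rule L.bspan_mult[OF E_sub a that(3,1,2)]) (use that m1 m2 in auto)
  have Nc: "?N \<subseteq> carrier R" using L.bspan_closed[OF E_sub a] by blast
  have lin: "linear_over K (\<lambda>d. u \<otimes> d \<otimes> v)" if "u \<in> E\<^sub>1" "v \<in> E\<^sub>2" for u v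
    using that E_sub by (intro L.two_sided_mult_linear[OF _ _ KC]) auto
  have leftB: "(\<lambda>d. u \<otimes> d) \<in> B" if u: "u \<in> E\<^sub>1" for u
  proof -
    have "u \<otimes> d = u \<otimes> d \<otimes> \<one>" if "d \<in> carrier R" for d using that u E_sub by auto
    moreover have "linear_over K (\<lambda>d. u \<otimes> d)"
      using lin[OF u K1(4)] u E_sub unfolding L.linear_over_def L.additive_def
      by (auto simp: subset_iff) (metis K1(1) L.K_comm(2) L.m_closed L.r_one)
    ultimately show ?thesis using u K1 by (auto simp: B_def)
  qed
  have rightB: "(\<lambda>d. d \<otimes> v) \<in> B" if v: "v \<in> E\<^sub>2" for v
  proof -
    have "\<forall>d\<in>carrier R. d \<otimes> v = \<one> \<otimes> d \<otimes> v" using v E_sub by auto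
    moreover have "linear_over K (\<lambda>d. d \<otimes> v)"
      using lin[OF K1(3) v] v E_sub unfolding L.linear_over_def L.additive_def
      by (auto simp: subset_iff) (metis K1(1) L.K_comm(2) L.m_closed L.l_one)
    ultimately show ?thesis using v K1(3) unfolding B_def by blast
  qed
  have Bcomm: "S (T d) = T (S d)" if ST: "S \<in> B" "T \<in> B" and d: "d \<in> carrier R" for S T d
  proof -
    obtain u v u' v' where uv: "u \<in> E\<^sub>1" "v \<in> E\<^sub>2" "u' \<in> E\<^sub>1" "v' \<in> E\<^sub>2"
      "\<And>d. d \<in> carrier R \<Longrightarrow> S d = u \<otimes> d \<otimes> v" "\<And>d. d \<in> carrier R \<Longrightarrow> T d = u' \<otimes> d \<otimes> v'"
      using ST unfolding B_def by blast
    have c: "u \<in> carrier R" "v \<in> carrier R" "u' \<in> carrier R" "v' \<in> carrier R" using uv E_sub by auto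
    have "u \<otimes> (u' \<otimes> d \<otimes> v') \<otimes> v = (u \<otimes> u') \<otimes> d \<otimes> (v' \<otimes> v)" using c d by (simp add: L.m_assoc)
    also have "\<dots> = (u' \<otimes> u) \<otimes> d \<otimes> (v \<otimes> v')" using L.commE[OF uv(1,3)] M.commE[OF uv(2,4)] by simp
    also have "\<dots> = u' \<otimes> (u \<otimes> d \<otimes> v) \<otimes> v'" using c d by (simp add: L.m_assoc)
    finally show ?thesis using uv(5,6) c d by simp
  qed
  define G where "G = (\<lambda>u d. u \<otimes> d) ` G\<^sub>1 \<union> (\<lambda>v d. d \<otimes> v) ` G\<^sub>2"
  have sep: "L.sep_op K B T" if "T \<in> G" for T
    using that unfolding G_def
  proof
    assume "T \<in> (\<lambda>u d. u \<otimes> d) ` G\<^sub>1"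
    then obtain u where u: "u \<in> G\<^sub>1" "T = (\<lambda>d. u \<otimes> d)" by auto
    then have uE: "u \<in> E\<^sub>1" using L.GE by auto
    obtain p w where p: "set p \<subseteq> K" "w \<in> E\<^sub>1" "L.horner p u = \<zero>" "L.horner_deriv p u \<otimes> w = \<one>"
      using L.sepG[OF u(1)] unfolding L.sep_elem_def by auto
    have "w \<otimes> (L.horner_deriv p u \<otimes> d) = d" if "d \<in> carrier R" for d
    proof -
      have c: "w \<in> E\<^sub>1" "L.horner_deriv p u \<in> E\<^sub>1" using p L.horner_E(2)[OF p(1) uE] by auto
      then have "w \<otimes> (L.horner_deriv p u \<otimes> d) = (w \<otimes> L.horner_deriv p u) \<otimes> d"
        using that L.E_carrier by (simp add: L.m_assoc)
      then show ?thesis using L.commE[OF c] p(4) that by simp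
    qed
    then show ?thesis
      using p leftB[OF p(2)] L.op_eval_left[OF p(1) uE] L.horner_E[OF p(1) uE] L.E_carrier
      unfolding L.sep_op_def u(2) by (intro exI[of _ p] bexI[of _ "\<lambda>d. w \<otimes> d"]) auto
  next
    assume "T \<in> (\<lambda>v d. d \<otimes> v) ` G\<^sub>2"
    then obtain u where u: "u \<in> G\<^sub>2" "T = (\<lambda>d. d \<otimes> u)" by auto
    then have uE: "u \<in> E\<^sub>2" using M.GE by auto
    obtain p w where p: "set p \<subseteq> K" "w \<in> E\<^sub>2" "L.horner p u = \<zero>" "L.horner_deriv p u \<otimes> w = \<one>"
      using M.sepG[OF u(1)] unfolding L.sep_elem_def by auto
    have "(d \<otimes> L.horner_deriv p u) \<otimes> w = d" if "d \<in> carrier R" for d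
    proof -
      have c: "w \<in> carrier R" "L.horner_deriv p u \<in> carrier R"
        using p M.horner_E(2)[OF p(1) uE] M.E_carrier by auto
      then show ?thesis using p(4) that by (simp add: L.m_assoc)
    qed
    then show ?thesis
      using p rightB[OF p(2)] M.op_eval_right[OF p(1) uE]
      unfolding L.sep_op_def u(2) by (intro exI[of _ p] bexI[of _ "\<lambda>d. d \<otimes> w"]) auto
  qed
  have "\<exists>Q. linear_over K Q \<and> (\<forall>x\<in>carrier R. Q x \<in> ?N) \<and> (\<forall>x\<in>?N. Q x = x) \<and>
    (\<forall>T\<in>G. \<forall>x\<in>carrier R. T (Q x) = Q (T x))"
  proof (rule L.equivariant_projection[where P = P, OF KC, of B])
    show "finite G" using L.finG M.finG by (simp add: G_def)
    show "G \<subseteq> B" using leftB rightB L.GE M.GE by (auto simp: G_def)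
    show "linear_over K S" if "S \<in> B" for S using that by (simp add: B_def)
    show "x \<oplus> y \<in> ?N" if "x \<in> ?N" "y \<in> ?N" for x y by (rule L.bspan_add[OF E_sub a that])
    show "c \<otimes> x \<in> ?N" if "c \<in> K" "x \<in> ?N" for c x
      using Nmult[of c \<one> x] that K1 Nc L.K_comm(2) by (auto simp: subset_iff)
    show "S x \<in> ?N" if "S \<in> B" "x \<in> ?N" for S x
      using that Nmult Nc by (auto simp: B_def subset_iff)
  qed (use Nc P Bcomm sep in \<open>auto intro: L.bspan.zero\<close>)
  then obtain Q where Q: "linear_over K Q" "\<And>x. x \<in> carrier R \<Longrightarrow> Q x \<in> ?N" "\<And>x. x \<in> ?N \<Longrightarrow> Q x = x"
    "\<And>T x. \<lbrakk>T \<in> G; x \<in> carrier R\<rbrakk> \<Longrightarrow> T (Q x) = Q (T x)" by blast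
  note QD = L.linearD[OF Q(1)]
  have Qc: "\<ominus> Q x = Q (\<ominus> x)" if "x \<in> carrier R" for x using L.linear_minus[OF Q(1) that] by simp
  have KR: "K \<subseteq> carrier R" using L.K_comm(2) by auto
  define V1 where "V1 = {u \<in> carrier R. \<forall>x\<in>carrier R. u \<otimes> Q x = Q (u \<otimes> x)}"
  have "subalgebra K V1 R"
  proof (intro subalgebra.intro subalgebra_axioms.intro)
    show "subgroup V1 (add_monoid R)"
    proof (rule L.add.subgroupI)
      show "V1 \<noteq> {}" using QD L.linear_zero[OF Q(1)] by (auto simp: V1_def intro!: exI[of _ \<zero>])
    qed (use QD Qc in \<open>auto simp: V1_def L.l_distr L.l_minus simp flip: a_inv_def\<close>)
    show "k \<otimes> v \<in> V1" if "k \<in> K" "v \<in> V1" for k v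
      using that QD KR by (auto simp: V1_def L.m_assoc subset_iff)
  qed
  moreover have "G\<^sub>1 \<subseteq> V1"
  proof
    fix v assume v: "v \<in> G\<^sub>1"
    then have "(\<lambda>d. v \<otimes> d) \<in> G" by (simp add: G_def)
    from Q(4)[OF this] v L.GE E_sub show "v \<in> V1" by (auto simp: V1_def)
  qed
  ultimately have "E\<^sub>1 \<subseteq> V1" by (rule L.genG)
  then have l: "u \<otimes> Q x = Q (u \<otimes> x)" if "u \<in> E\<^sub>1" "x \<in> carrier R" for u x
    using that by (auto simp: V1_def)
  define V2 where "V2 = {u \<in> carrier R. \<forall>x\<in>carrier R. Q x \<otimes> u = Q (x \<otimes> u)}"
  have "subalgebra K V2 R"
  proof (intro subalgebra.intro subalgebra_axioms.intro)
    show "subgroup V2 (add_monoid R)"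
    proof (rule L.add.subgroupI)
      show "V2 \<noteq> {}" using QD L.linear_zero[OF Q(1)] by (auto simp: V2_def intro!: exI[of _ \<zero>])
    qed (use QD Qc in \<open>auto simp: V2_def L.r_distr L.r_minus simp flip: a_inv_def\<close>)
    fix k v assume kv: "k \<in> K" "v \<in> V2"
    have "Q x \<otimes> (k \<otimes> v) = Q (x \<otimes> (k \<otimes> v))" if x: "x \<in> carrier R" for x
    proof -
      have c: "k \<in> carrier R" "v \<in> carrier R" using kv KR by (auto simp: V2_def)
      have "y \<otimes> (k \<otimes> v) = k \<otimes> (y \<otimes> v)" if "y \<in> carrier R" for y
        using c that L.K_comm(1)[OF kv(1) that] by (metis L.m_assoc)
      then show ?thesis using kv c x QD(1)[OF x] QD(3)[OF kv(1), of "x \<otimes> v"] by (simp add: V2_def)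
    qed
    then show "k \<otimes> v \<in> V2" using kv KR by (auto simp: V2_def)
  qed
  moreover have "G\<^sub>2 \<subseteq> V2"
  proof
    fix v assume v: "v \<in> G\<^sub>2"
    then have "(\<lambda>d. d \<otimes> v) \<in> G" by (simp add: G_def)
    from Q(4)[OF this] v M.GE E_sub show "v \<in> V2" by (auto simp: V2_def)
  qed
  ultimately have "E\<^sub>2 \<subseteq> V2" by (rule M.genG)
  then have r: "Q x \<otimes> v = Q (x \<otimes> v)" if "v \<in> E\<^sub>2" "x \<in> carrier R" for v x
    using that by (auto simp: V2_def)
  have "u \<otimes> Q x \<otimes> v = Q (u \<otimes> x \<otimes> v)" if "u \<in> E\<^sub>1" "v \<in> E\<^sub>2" "x \<in> carrier R" for u v x
    using l[OF that(1,3)] r[OF that(2), of "u \<otimes> x"] that E_sub by auto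
  then show ?thesis using Q by (intro exI[of _ Q]) blast
qed

end

lemma (in ring) combine_finsum:
  assumes "distinct Us" "set Us \<subseteq> carrier R" "f \<in> set Us \<rightarrow> carrier R"
  shows "combine (map f Us) Us = (\<Oplus>u\<in>set Us. f u \<otimes> u)"
  using assms
proof (induction Us)
  case (Cons u Us)
  have "(\<Oplus>u\<in>set (u # Us). f u \<otimes> u) = f u \<otimes> u \<oplus> (\<Oplus>u\<in>set Us. f u \<otimes> u)"
    using Cons.prems by (simp, intro finsum_insert) (auto simp: Pi_def subset_iff)
  then show ?case using Cons by (simp add: Pi_def)
qed simp

text \<open>The case n = 1 of the faithfulness of the twisted action: a central simple ring is a faithful
  module over the tensor product, over its center, of itself and its opposite.\<close>

lemma (in ring) faithful_two_sided_action:
  assumes simple: "simple_ring R" and Us: "independent (center R) Us"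
    and v: "v \<in> set Us \<rightarrow> carrier R" and z: "\<And>d. d \<in> carrier R \<Longrightarrow> (\<Oplus>u\<in>set Us. u \<otimes> d \<otimes> v u) = \<zero>"
  shows "\<forall>u\<in>set Us. v u = \<zero>"
proof -
  have G: "galois_simple_ring R (\<lambda>_ d. d) (Suc 0)"
    by unfold_locales (auto simp: simple ring_iso_def bij_betw_def ring_hom_def)
  let ?Fix = "galois_simple_ring.Fix R (\<lambda>_ d. d) (Suc 0)"
  have C: "center R = ?Fix" unfolding galois_simple_ring.Fix_def[OF G] by simp
  note sub = simple_center_subfield[OF simple]
  have UsR: "set Us \<subseteq> carrier R" by (rule independent_in_carrier[OF Us])
  have dist: "distinct Us" by (rule independent_distinct[OF sub Us])
  have ind: "\<forall>u\<in>set Us. f u = \<zero>" if f: "f \<in> set Us \<rightarrow> ?Fix" "(\<Oplus>u\<in>set Us. f u \<otimes> u) = \<zero>" for f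
  proof -
    have fc: "f \<in> set Us \<rightarrow> carrier R" using f(1) center_carrier unfolding C[symmetric] by (auto simp: Pi_def)
    have "set (map f Us) \<subseteq> center R" unfolding C using f(1) by auto
    moreover have "combine (map f Us) Us = \<zero>" using combine_finsum[OF dist UsR fc] f(2) by simp
    ultimately have "set (take (length Us) (map f Us)) \<subseteq> {\<zero>}"
      by (rule independent_imp_trivial_combine[OF sub Us])
    then show ?thesis by auto
  qed
  have "(\<lambda>u. u) \<in> set Us \<rightarrow> carrier R" using UsR by blast
  from galois_simple_ring.faithful_twisted_action[OF G finite_set this ind v] z
  show ?thesis by blast
qed

context two_sep_subalgebras begin

definition combs :: "'a \<Rightarrow> 'a set \<Rightarrow> 'a set" where
  "combs a U = {(\<Oplus>u\<in>U. u \<otimes> a \<otimes> v u) |v. v \<in> U \<rightarrow> E\<^sub>2}"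

lemma E2_closed: "\<zero> \<in> E\<^sub>2" "\<one> \<in> E\<^sub>2" "\<lbrakk>x \<in> E\<^sub>2; y \<in> E\<^sub>2\<rbrakk> \<Longrightarrow> x \<oplus> y \<in> E\<^sub>2" "\<lbrakk>x \<in> E\<^sub>2; y \<in> E\<^sub>2\<rbrakk> \<Longrightarrow> x \<otimes> y \<in> E\<^sub>2"
  "x \<in> E\<^sub>2 \<Longrightarrow> \<ominus> x \<in> E\<^sub>2" "x \<in> K \<Longrightarrow> x \<in> E\<^sub>2"
  using subringE[OF M.subE] M.KE by auto

text \<open>The products of the \<open>u \<otimes> a\<close> with a basis of \<open>E\<^sub>2\<close> are independent when the elements \<open>u \<otimes> a\<close>
  are independent over \<open>E\<^sub>2\<close>. This is the count of dimensions that forces \<open>E\<^sub>1 a E\<^sub>2\<close> to be everything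
  as soon as a has no nontrivial relation.\<close>

lemma independent_products:
  assumes a: "a \<in> carrier R" and Us: "distinct Us" "set Us \<subseteq> E\<^sub>1"
    and Vs: "independent K Vs" "Span K Vs = E\<^sub>2"
    and triv: "\<And>v. \<lbrakk>v \<in> set Us \<rightarrow> E\<^sub>2; (\<Oplus>u\<in>set Us. u \<otimes> a \<otimes> v u) = \<zero>\<rbrakk> \<Longrightarrow> \<forall>u\<in>set Us. v u = \<zero>"
  shows "\<exists>Ls. independent K Ls \<and> length Ls = length Us * length Vs \<and> Span K Ls \<subseteq> combs a (set Us)"
  using Us triv
proof (induction Us)
  case Nil
  show ?case by (intro exI[of _ "[]"]) (auto simp: combs_def)
next
  case (Cons u Us)
  have uc: "u \<in> carrier R" "u \<in> E\<^sub>1" and Uc: "set Us \<subseteq> carrier R" "set Us \<subseteq> E\<^sub>1" and un: "u \<notin> set Us" "distinct Us"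
    using Cons.prems E_sub by auto
  have split: "(\<Oplus>x\<in>set (u # Us). x \<otimes> a \<otimes> v x) = u \<otimes> a \<otimes> v u \<oplus> (\<Oplus>x\<in>set Us. x \<otimes> a \<otimes> v x)"
    if "v \<in> set (u # Us) \<rightarrow> E\<^sub>2" for v
  proof -
    have c: "v x \<in> carrier R" "x \<in> carrier R" if "x \<in> set (u # Us)" for x
      using that \<open>v \<in> _\<close> E_sub uc Uc by auto
    show ?thesis
      using finsum_insert[OF finite_set un(1), of "\<lambda>x. x \<otimes> a \<otimes> v x"] c a by (auto simp: Pi_def)
  qed
  have ext: "(\<Oplus>x\<in>set (u # Us). x \<otimes> a \<otimes> (v(u := w)) x) = u \<otimes> a \<otimes> w \<oplus> (\<Oplus>x\<in>set Us. x \<otimes> a \<otimes> v x)"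
    if v: "v \<in> set Us \<rightarrow> E\<^sub>2" and w: "w \<in> E\<^sub>2" for v w
  proof -
    have "(\<Oplus>x\<in>set Us. x \<otimes> a \<otimes> (v(u := w)) x) = (\<Oplus>x\<in>set Us. x \<otimes> a \<otimes> v x)"
      using v un E_sub Uc a by (intro finsum_cong') (auto simp: Pi_def subset_iff)
    then show ?thesis using v w by (subst split) auto
  qed
  have upd: "v(u := w) \<in> set (u # Us) \<rightarrow> E\<^sub>2" if "v \<in> set Us \<rightarrow> E\<^sub>2" "w \<in> E\<^sub>2" for v w
    using that by auto
  have "\<exists>Ls. independent K Ls \<and> length Ls = length Us * length Vs \<and> Span K Ls \<subseteq> combs a (set Us)"
  proof (rule Cons.IH[OF un(2) Uc(2)])
    fix v assume v: "v \<in> set Us \<rightarrow> E\<^sub>2" "(\<Oplus>u\<in>set Us. u \<otimes> a \<otimes> v u) = \<zero>"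
    have "\<forall>x\<in>set (u # Us). (v(u := \<zero>)) x = \<zero>"
      using ext[OF v(1) E2_closed(1)] v(2) uc a by (intro Cons.prems(3) upd v E2_closed) simp
    then show "\<forall>u\<in>set Us. v u = \<zero>" using un(1) by (metis fun_upd_other list.set_intros(2))
  qed
  then obtain Ls where Ls: "independent K Ls" "length Ls = length Us * length Vs" "Span K Ls \<subseteq> combs a (set Us)"
    by blast
  let ?T = "\<lambda>x. u \<otimes> a \<otimes> x"
  have T: "linear_over K ?T"
  proof -
    have "u \<otimes> a \<otimes> (c \<otimes> d) = c \<otimes> (u \<otimes> a \<otimes> d)" if cd: "c \<in> K" "d \<in> carrier R" for c d
    proof -
      have c: "c \<in> carrier R" "(u \<otimes> a) \<otimes> c = c \<otimes> (u \<otimes> a)" using K_comm[OF cd(1)] uc a by auto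
      have "u \<otimes> a \<otimes> (c \<otimes> d) = (u \<otimes> a) \<otimes> c \<otimes> d" using c(1) cd uc a by (simp add: m_assoc)
      then show ?thesis unfolding c(2) using c(1) cd uc a by (simp add: m_assoc)
    qed
    then show ?thesis using uc a by (auto simp: linear_over_def additive_def r_distr)
  qed
  have VsR: "set Vs \<subseteq> carrier R" by (rule independent_in_carrier[OF Vs(1)])
  have KR: "K \<subseteq> carrier R" using K_comm(2) by auto
  have SpB: "Span K (map ?T Vs) = ?T ` E\<^sub>2" using Span_map[OF T KR VsR] Vs(2) by simp
  have zero_fun: "(\<lambda>_. \<zero>) \<in> set Us \<rightarrow> E\<^sub>2" "(\<Oplus>x\<in>set Us. x \<otimes> a \<otimes> \<zero>) = \<zero>"
  proof -
    have "(\<Oplus>x\<in>set Us. x \<otimes> a \<otimes> \<zero>) = (\<Oplus>x\<in>set Us. \<zero>)"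
      using a Uc by (intro finsum_cong') auto
    then show "(\<Oplus>x\<in>set Us. x \<otimes> a \<otimes> \<zero>) = \<zero>" by simp
  qed (use E2_closed in auto)
  have iB: "independent K (map ?T Vs)"
  proof (rule independent_linear_image[OF T subK Vs(1)])
    fix x assume "x \<in> Span K Vs" "u \<otimes> a \<otimes> x = \<zero>"
    then have x: "x \<in> E\<^sub>2" "u \<otimes> a \<otimes> x = \<zero>" using Vs(2) by auto
    have "\<forall>y\<in>set (u # Us). ((\<lambda>_. \<zero>)(u := x)) y = \<zero>"
      using ext[OF zero_fun(1) x(1)] zero_fun(2) x(2) by (intro Cons.prems(3) upd zero_fun x) simp
    then show "x = \<zero>" by simp
  qed
  have "Span K (map ?T Vs) \<inter> Span K Ls = {\<zero>}"
  proof -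
    have "y = \<zero>" if y: "y \<in> Span K (map ?T Vs)" "y \<in> Span K Ls" for y
    proof -
      obtain x where x: "x \<in> E\<^sub>2" "y = u \<otimes> a \<otimes> x" using y(1) SpB by auto
      obtain v where v: "v \<in> set Us \<rightarrow> E\<^sub>2" "y = (\<Oplus>x\<in>set Us. x \<otimes> a \<otimes> v x)"
        using y(2) Ls(3) unfolding combs_def by blast
      have xc: "x \<in> carrier R" using x E_sub by auto
      have "(\<Oplus>z\<in>set (u # Us). z \<otimes> a \<otimes> (v(u := \<ominus> x)) z) = \<zero>"
        unfolding ext[OF v(1) E2_closed(5)[OF x(1)]] v(2)[symmetric] x(2)
        using xc uc a by (simp add: r_minus l_neg)
      then have "\<forall>z\<in>set (u # Us). (v(u := \<ominus> x)) z = \<zero>"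
        by (intro Cons.prems(3) upd v E2_closed x)
      then have "\<ominus> x = \<zero>" by simp
      then have "x = \<zero>" using xc by (metis minus_minus minus_zero)
      then show ?thesis using x uc a by simp
    qed
    moreover have "\<zero> \<in> Span K (map ?T Vs) \<inter> Span K Ls"
      using Span_subgroup_props(2)[OF subK] independent_in_carrier[OF iB] independent_in_carrier[OF Ls(1)] by blast
    ultimately show ?thesis by blast
  qed
  then have ind: "independent K (map ?T Vs @ Ls)" by (rule independent_append[OF subK iB Ls(1)])
  moreover have "length (map ?T Vs @ Ls) = length (u # Us) * length Vs" using Ls(2) by simp
  moreover have "Span K (map ?T Vs @ Ls) \<subseteq> combs a (set (u # Us))"
  proof
    fix y assume "y \<in> Span K (map ?T Vs @ Ls)"
    then obtain x z where xz: "x \<in> Span K (map ?T Vs)" "z \<in> Span K Ls" "y = x \<oplus> z"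
      using Span_append_eq_set_add[OF subK independent_in_carrier[OF iB] independent_in_carrier[OF Ls(1)]]
      by (auto simp: set_add_def')
    obtain w where w: "w \<in> E\<^sub>2" "x = u \<otimes> a \<otimes> w" using xz(1) SpB by auto
    obtain v where v: "v \<in> set Us \<rightarrow> E\<^sub>2" "z = (\<Oplus>x\<in>set Us. x \<otimes> a \<otimes> v x)"
      using xz(2) Ls(3) unfolding combs_def by blast
    have "y = (\<Oplus>x\<in>set (u # Us). x \<otimes> a \<otimes> (v(u := w)) x)"
      unfolding ext[OF v(1) w(1)] using xz w v by simp
    then show "y \<in> combs a (set (u # Us))" unfolding combs_def using upd[OF v(1) w(1)] by blast
  qed
  ultimately show ?case by blast
qed

lemma finsum_in_bspan:
  assumes a: "a \<in> carrier R" and "finite U" "U \<subseteq> E\<^sub>1" "v \<in> U \<rightarrow> E\<^sub>2"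
  shows "(\<Oplus>u\<in>U. u \<otimes> a \<otimes> v u) \<in> bspan E\<^sub>1 E\<^sub>2 a"
  using assms(2-)
proof (induction U)
  case empty then show ?case by (simp add: bspan.zero)
next
  case (insert u U)
  have "(\<Oplus>u\<in>insert u U. u \<otimes> a \<otimes> v u) = u \<otimes> a \<otimes> v u \<oplus> (\<Oplus>u\<in>U. u \<otimes> a \<otimes> v u)"
    using insert E_sub a by (intro finsum_insert) (auto simp: Pi_def subset_iff)
  then show ?case using insert by (auto intro!: bspan.step)
qed

text \<open>Choose a so that the sub-bimodule N generated by a has the largest possible dimension. If N is not
  everything, counting dimensions gives a nonzero tensor i that kills a, and hence N. Being nonzero,
  i does not kill D, and an equivariant projection Q onto N yields an element \<open>d\<^sub>1\<close> in the kernel of Q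
  that i does not kill. The sub-bimodule of \<open>a \<oplus> d\<^sub>1\<close> maps onto N under Q, and contains
  \<open>i (a \<oplus> d\<^sub>1) = i d\<^sub>1\<close>, a nonzero element of the kernel of Q; so its dimension is larger.\<close>

theorem cyclic_vector:
  assumes simple: "simple_ring R" and dim: "dimension (m * m) K (carrier R)"
    and dim1: "dimension m K E\<^sub>1" and dim2: "dimension m K E\<^sub>2"
  shows "\<exists>a\<in>carrier R. bspan E\<^sub>1 E\<^sub>2 a = carrier R"
proof -
  note one = subringE(3)[OF L.subE] subringE(3)[OF M.subE]
  obtain Us where Us: "independent K Us" "length Us = m" "Span K Us = E\<^sub>1"
    using exists_base[OF subK dim1] by auto
  obtain Vs where Vs: "independent K Vs" "length Vs = m" "Span K Vs = E\<^sub>2"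
    using exists_base[OF subK dim2] by auto
  have UsR: "set Us \<subseteq> carrier R" "set Us \<subseteq> E\<^sub>1"
    using independent_in_carrier[OF Us(1)] Span_base_incl[OF subK, of Us] Us(3) by auto
  have distU: "distinct Us" by (rule independent_distinct[OF subK Us(1)])
  define good where "good k a Ws \<longleftrightarrow>
    a \<in> carrier R \<and> independent K Ws \<and> set Ws \<subseteq> bspan E\<^sub>1 E\<^sub>2 a \<and> length Ws = k" for k a Ws
  have bound: "k \<le> m * m" if "good k a Ws" for k a Ws
    using that independent_length_le_dimension[OF subK dim, of Ws] independent_in_carrier[of K Ws]
    by (auto simp: good_def)
  have good0: "\<exists>a Ws. good 0 a Ws" by (intro exI[of _ \<zero>] exI[of _ "[]"]) (auto simp: good_def)
  define k where "k = (GREATEST k. \<exists>a Ws. good k a Ws)"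
  have bd: "\<And>k'. (\<exists>a Ws. good k' a Ws) \<Longrightarrow> k' \<le> m * m" using bound by blast
  have k: "\<exists>a Ws. good k a Ws" "\<And>k'. (\<exists>a Ws. good k' a Ws) \<Longrightarrow> k' \<le> k"
    unfolding k_def
    using GreatestI_nat[of "\<lambda>k. \<exists>a Ws. good k a Ws" 0 "m * m"] good0 bd
      Greatest_le_nat[of "\<lambda>k. \<exists>a Ws. good k a Ws" _ "m * m"] by auto
  then obtain a Ws where g: "good k a Ws" by blast
  then have a: "a \<in> carrier R" and Ws: "independent K Ws" "set Ws \<subseteq> bspan E\<^sub>1 E\<^sub>2 a" "length Ws = k"
    by (auto simp: good_def)
  let ?N = "bspan E\<^sub>1 E\<^sub>2"
  have m1: "u \<otimes> u' \<in> E\<^sub>1" if "u \<in> E\<^sub>1" "u' \<in> E\<^sub>1" for u u' using subringE(6)[OF L.subE] that by auto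
  have Nmult: "u \<otimes> z \<otimes> v \<in> ?N b" if "b \<in> carrier R" "u \<in> E\<^sub>1" "v \<in> E\<^sub>2" "z \<in> ?N b" for b u v z
    by (rule bspan_mult[OF E_sub that(1,4,2,3)]) (use that m1 E2_closed in auto)
  have Nc: "?N b \<subseteq> carrier R" if "b \<in> carrier R" for b using bspan_closed[OF E_sub that] by blast
  have KR: "K \<subseteq> carrier R" using K_comm(2) by auto
  have Nsub: "subalgebra K (?N b) R" if b: "b \<in> carrier R" for b
  proof (intro subalgebra.intro subalgebra_axioms.intro)
    show sm: "c \<otimes> v \<in> ?N b" if "c \<in> K" "v \<in> ?N b" for c v
      using Nmult[OF b, of c \<one> v] that L.KE one Nc[OF b] KR by (auto simp: subset_iff)
    show "subgroup (?N b) (add_monoid R)"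
    proof (rule add.subgroupI)
      fix x assume x: "x \<in> ?N b"
      have "\<ominus> \<one> \<otimes> x \<otimes> \<one> \<in> ?N b"
        using Nmult[OF b, of "\<ominus> \<one>" \<one> x] x one subringE(5)[OF L.subE] by auto
      moreover have "\<ominus> \<one> \<otimes> x \<otimes> \<one> = \<ominus> x" using x Nc[OF b] by (auto simp: l_minus subset_iff)
      ultimately show "\<ominus> x \<in> ?N b" by simp
    next
      show "?N b \<noteq> {}" using bspan.zero[of E\<^sub>1 E\<^sub>2 b] by blast
    qed (use Nc[OF b] bspan_add[OF E_sub b] in auto)
  qed
  have SpN: "Span K Ws = ?N a"
  proof
    show "Span K Ws \<subseteq> ?N a" by (rule subalgebra_Span_incl[OF subK Nsub[OF a] Ws(2)])
    show "?N a \<subseteq> Span K Ws"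
    proof (rule ccontr)
      assume "\<not> ?N a \<subseteq> Span K Ws"
      then obtain w where w: "w \<in> ?N a" "w \<notin> Span K Ws" by blast
      have "independent K (w # Ws)" using w Nc[OF a] Ws by (intro li_Cons) auto
      then have "good (Suc k) a (w # Ws)" using w Ws a by (auto simp: good_def)
      then show False using k(2)[of "Suc k"] by auto
    qed
  qed
  have "?N a = carrier R"
  proof (rule ccontr)
    assume ne: "?N a \<noteq> carrier R"
    have "\<exists>v. v \<in> set Us \<rightarrow> E\<^sub>2 \<and> (\<Oplus>u\<in>set Us. u \<otimes> a \<otimes> v u) = \<zero> \<and> (\<exists>u\<in>set Us. v u \<noteq> \<zero>)"
    proof (rule ccontr)
      assume "\<not> ?thesis"
      then obtain Ls where Ls: "independent K Ls" "length Ls = length Us * length Vs" "Span K Ls \<subseteq> combs a (set Us)"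
        using independent_products[OF a distU UsR(2) Vs(1,3)] by blast
      have "Span K Ls = carrier R"
        using independent_length_eq_dimension[OF subK dim Ls(1) independent_in_carrier[OF Ls(1)]] Ls(2) Us(2) Vs(2)
        by simp
      moreover have "combs a (set Us) \<subseteq> ?N a"
        using finsum_in_bspan[OF a finite_set UsR(2)] by (auto simp: combs_def)
      ultimately show False using Ls(3) Nc[OF a] ne by blast
    qed
    then obtain v where v: "v \<in> set Us \<rightarrow> E\<^sub>2" "(\<Oplus>u\<in>set Us. u \<otimes> a \<otimes> v u) = \<zero>" "\<exists>u\<in>set Us. v u \<noteq> \<zero>"
      by blast
    have vc: "v u \<in> carrier R" if "u \<in> set Us" for u using v that E_sub by auto
    \<comment> \<open>The action of the tensor that annihilates a.\<close>
    define i where "i x = (\<Oplus>u\<in>set Us. u \<otimes> x \<otimes> v u)" for x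
    have ic: "i x \<in> carrier R" if "x \<in> carrier R" for x
      unfolding i_def using that vc UsR by (intro finsum_closed) auto
    obtain d where d: "d \<in> carrier R" "i d \<noteq> \<zero>"
    proof -
      have "v \<in> set Us \<rightarrow> carrier R" using vc by auto
      then have "\<not> (\<forall>d\<in>carrier R. i d = \<zero>)"
        using faithful_two_sided_action[OF simple, of Us v] Us(1) v(3) L.K_center by (auto simp: i_def)
      then show ?thesis using that by blast
    qed
    have i_add: "i (x \<oplus> y) = i x \<oplus> i y" if "x \<in> carrier R" "y \<in> carrier R" for x y
    proof -
      have "i (x \<oplus> y) = (\<Oplus>u\<in>set Us. u \<otimes> x \<otimes> v u \<oplus> u \<otimes> y \<otimes> v u)"
        unfolding i_def using that vc UsR by (intro finsum_cong') (auto simp: l_distr r_distr subset_iff)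
      also have "\<dots> = i x \<oplus> i y"
        unfolding i_def using that vc UsR by (intro finsum_addf) auto
      finally show ?thesis .
    qed
    have i_mult: "i (s \<otimes> x \<otimes> t) = s \<otimes> i x \<otimes> t" if st: "s \<in> E\<^sub>1" "t \<in> E\<^sub>2" and x: "x \<in> carrier R" for s t x
    proof -
      have c: "s \<in> carrier R" "t \<in> carrier R" using st E_sub by auto
      have "s \<otimes> i x \<otimes> t = (\<Oplus>u\<in>set Us. s \<otimes> (u \<otimes> x \<otimes> v u)) \<otimes> t"
        unfolding i_def using c x vc UsR by (subst finsum_rdistr) auto
      also have "\<dots> = (\<Oplus>u\<in>set Us. s \<otimes> (u \<otimes> x \<otimes> v u) \<otimes> t)"
        using c x vc UsR by (intro finsum_ldistr) auto
      also have "\<dots> = i (s \<otimes> x \<otimes> t)"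
        unfolding i_def
      proof (intro finsum_cong')
        fix u assume u: "u \<in> set Us"
        have uc: "u \<in> carrier R" "v u \<in> carrier R" using u UsR vc by auto
        have "s \<otimes> u = u \<otimes> s" "v u \<otimes> t = t \<otimes> v u"
          using L.commE[of s u] M.commE[of "v u" t] u UsR st v(1) by auto
        moreover have "s \<otimes> (u \<otimes> x \<otimes> v u) \<otimes> t = (s \<otimes> u) \<otimes> x \<otimes> (v u \<otimes> t)"
          using c uc x by (simp add: m_assoc)
        ultimately show "s \<otimes> (u \<otimes> x \<otimes> v u) \<otimes> t = u \<otimes> (s \<otimes> x \<otimes> t) \<otimes> v u"
          using c uc x by (simp add: m_assoc)
      qed (use c x vc UsR in auto)
      finally show ?thesis by simp
    qed
    have i0: "i \<zero> = \<zero>"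
      using i_add[OF zero_closed zero_closed] ic[OF zero_closed] by (metis add.l_cancel_one l_zero zero_closed)
    have iN: "i z = \<zero>" if "z \<in> ?N a" for z
      using that
    proof induction
      case (step s t z)
      then show ?case
        using i_add[of "s \<otimes> a \<otimes> t" z] i_mult[OF step(1,2) a] v(2) E_sub a Nc[OF a]
        by (auto simp: i_def subset_iff)
    qed (rule i0)
    obtain Q where Q: "linear_over K Q" "\<And>x. x \<in> carrier R \<Longrightarrow> Q x \<in> ?N a" "\<And>x. x \<in> ?N a \<Longrightarrow> Q x = x"
      "\<And>u v x. \<lbrakk>u \<in> E\<^sub>1; v \<in> E\<^sub>2; x \<in> carrier R\<rbrakk> \<Longrightarrow> u \<otimes> Q x \<otimes> v = Q (u \<otimes> x \<otimes> v)"
      using equivariant_projection_bspan[OF a Ws(1) SpN dim] by blast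
    note QD = linearD[OF Q(1)]
    define d\<^sub>1 where "d\<^sub>1 = d \<ominus> Q d"
    have d1: "d\<^sub>1 \<in> carrier R" using d QD by (auto simp: d\<^sub>1_def)
    have Qd1: "Q d\<^sub>1 = \<zero>"
      using QD(2)[of d "\<ominus> Q d"] linear_minus[OF Q(1), of "Q d"] Q(3)[OF Q(2)[OF d(1)]] d QD(1)
      by (simp add: d\<^sub>1_def a_minus_def r_neg)
    have "d = d\<^sub>1 \<oplus> Q d" using d QD(1) by (simp add: d\<^sub>1_def a_minus_def a_assoc l_neg)
    then have "i d = i d\<^sub>1 \<oplus> i (Q d)" using i_add[OF d1 QD(1)[OF d(1)]] by simp
    then have id1: "i d\<^sub>1 \<noteq> \<zero>" using d iN[OF Q(2)[OF d(1)]] ic[OF d1] by auto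
    define a' where "a' = a \<oplus> d\<^sub>1"
    have a': "a' \<in> carrier R" using a d1 by (simp add: a'_def)
    have aN: "a \<in> ?N a" using bspan_self[OF E_sub a one] a by simp
    have Qa': "Q a' = a" using QD(2)[OF a d1] Q(3)[OF aN] Qd1 a by (simp add: a'_def)
    have ia': "i a' = i d\<^sub>1" using i_add[OF a d1] v(2) ic[OF d1] by (simp add: a'_def i_def)
    have "i a' \<in> ?N a'"
      unfolding i_def by (rule finsum_in_bspan[OF a' finite_set UsR(2) v(1)])
    then have w0: "i d\<^sub>1 \<in> ?N a'" unfolding ia' .
    have Qi: "Q (i d\<^sub>1) = \<zero>"
    proof -
      have *: "Q (\<Oplus>u\<in>U. u \<otimes> d\<^sub>1 \<otimes> v u) = \<zero>" if "finite U" "U \<subseteq> set Us" for U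
        using that
      proof (induction U)
        case empty then show ?case using linear_zero[OF Q(1)] by simp
      next
        case (insert u U)
        have u: "u \<in> E\<^sub>1" "v u \<in> E\<^sub>2" "u \<in> carrier R" "v u \<in> carrier R" using insert UsR v vc by auto
        have "U \<subseteq> carrier R" "U \<subseteq> set Us" using insert UsR by auto
        then have f: "(\<lambda>u. u \<otimes> d\<^sub>1 \<otimes> v u) \<in> U \<rightarrow> carrier R" using vc d1 by (auto simp: subset_iff)
        have "(\<Oplus>u\<in>insert u U. u \<otimes> d\<^sub>1 \<otimes> v u) = u \<otimes> d\<^sub>1 \<otimes> v u \<oplus> (\<Oplus>u\<in>U. u \<otimes> d\<^sub>1 \<otimes> v u)"
          using insert f u d1 by (intro finsum_insert) auto
        moreover have "Q (u \<otimes> d\<^sub>1 \<otimes> v u) = \<zero>" using Q(4)[OF u(1,2) d1] Qd1 u by simp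
        ultimately show ?case
          using QD(2)[of "u \<otimes> d\<^sub>1 \<otimes> v u" "\<Oplus>u\<in>U. u \<otimes> d\<^sub>1 \<otimes> v u"] insert u d1 finsum_closed[OF f] by simp
      qed
      show ?thesis unfolding i_def using *[of "set Us"] by simp
    qed
    have lift: "\<exists>w'\<in>?N a'. Q w' = w" if "w \<in> ?N a" for w
      using that
    proof induction
      case zero then show ?case using linear_zero[OF Q(1)] bspan.zero by blast
    next
      case (step s t z)
      then obtain w' where w': "w' \<in> ?N a'" "Q w' = z" by blast
      have "Q (s \<otimes> a' \<otimes> t \<oplus> w') = s \<otimes> a \<otimes> t \<oplus> z"
        using QD(2)[of "s \<otimes> a' \<otimes> t" w'] Q(4)[OF step(1,2) a'] Qa' w' step E_sub a' Nc[OF a'] by auto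
      then show ?case using bspan.step[OF step(1,2) w'(1)] by blast
    qed
    then obtain g where g: "\<And>w. w \<in> ?N a \<Longrightarrow> g w \<in> ?N a' \<and> Q (g w) = w" by metis
    have gW: "set (map g Ws) \<subseteq> ?N a'" using g Ws(2) by auto
    then have gWc: "set (map g Ws) \<subseteq> carrier R" using Nc[OF a'] by blast
    have "map Q (map g Ws) = Ws" using g Ws(2) by (auto intro!: map_idI simp: subset_iff)
    then have pre: "independent K (map g Ws) \<and> (\<forall>x\<in>Span K (map g Ws). Q x = \<zero> \<longrightarrow> x = \<zero>)"
      using independent_linear_preimage[OF Q(1) subK gWc] Ws(1) by simp
    then have "independent K (i d\<^sub>1 # map g Ws)"
      using Qi id1 ic[OF d1] by (intro li_Cons) auto
    then have "good (Suc k) a' (i d\<^sub>1 # map g Ws)"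
      using a' w0 gW Ws(3) by (auto simp: good_def)
    then show False using k(2)[of "Suc k"] by auto
  qed
  then show ?thesis using a by blast
qed

end

section \<open>Separable elements and dual numbers\<close>

context cring begin

lemma horner_closed: "\<lbrakk>set p \<subseteq> carrier R; x \<in> carrier R\<rbrakk> \<Longrightarrow> horner p x \<in> carrier R"
  by (induction p) auto

lemma horner_deriv_closed: "\<lbrakk>set p \<subseteq> carrier R; x \<in> carrier R\<rbrakk> \<Longrightarrow> horner_deriv p x \<in> carrier R"
  by (induction p) (auto simp: horner_closed)

lemma eval_eq_horner: "\<lbrakk>set p \<subseteq> carrier R; x \<in> carrier R\<rbrakk> \<Longrightarrow> eval p x = horner (rev p) x"
proof (induction p rule: rev_induct)
  case (snoc a p)
  then show ?case using eval_append_aux[of p a x] eval_in_carrier[of p x]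
    by (simp add: m_comm a_comm)
qed simp

lemma horner_append_single:
  "\<lbrakk>set p \<subseteq> carrier R; a \<in> carrier R; x \<in> carrier R\<rbrakk> \<Longrightarrow> horner (p @ [a]) x = horner p x \<oplus> a \<otimes> x [^] length p"
proof (induction p)
  case (Cons b p)
  then have c: "horner p x \<in> carrier R" "b \<in> carrier R" by (auto intro: horner_closed)
  have "x \<otimes> (horner p x \<oplus> a \<otimes> x [^] length p) = x \<otimes> horner p x \<oplus> a \<otimes> (x [^] length p \<otimes> x)"
    using c Cons.prems by (simp add: r_distr m_ac)
  then show ?case using Cons c by (simp add: a_assoc nat_pow_Suc)
qed simp

lemma horner_deriv_append_single:
  assumes "set p \<subseteq> carrier R" "a \<in> carrier R" "x \<in> carrier R"
  shows "horner_deriv (p @ [a]) x =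
    horner_deriv p x \<oplus> ([length p] \<cdot> a) \<otimes> x [^] (length p - 1)"
  using assms
proof (induction p)
  case (Cons b p)
  then have c: "horner p x \<in> carrier R" "horner_deriv p x \<in> carrier R" "b \<in> carrier R"
    by (auto intro: horner_closed horner_deriv_closed)
  have x: "x \<otimes> (([length p] \<cdot> a) \<otimes> x [^] (length p - 1)) = ([length p] \<cdot> a) \<otimes> x [^] length p"
  proof (cases "length p")
    case (Suc k)
    have "x \<otimes> (([length p] \<cdot> a) \<otimes> x [^] k) = ([length p] \<cdot> a) \<otimes> (x [^] k \<otimes> x)"
      using Cons.prems by (simp add: m_ac)
    then show ?thesis using Suc Cons.prems by (simp add: nat_pow_Suc)
  next
    case 0
    then show ?thesis using Cons.prems by simp
  qed
  have "horner_deriv ((b # p) @ [a]) x = (horner p x \<oplus> a \<otimes> x [^] length p)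
     \<oplus> x \<otimes> (horner_deriv p x \<oplus> ([length p] \<cdot> a) \<otimes> x [^] (length p - 1))"
    using Cons horner_append_single[of p a x] by simp
  also have "\<dots> = (horner p x \<oplus> a \<otimes> x [^] length p)
     \<oplus> (x \<otimes> horner_deriv p x \<oplus> ([length p] \<cdot> a) \<otimes> x [^] length p)"
    using c Cons.prems by (simp add: r_distr x[simplified])
  also have "\<dots> = (horner p x \<oplus> x \<otimes> horner_deriv p x) \<oplus> ([length p] \<cdot> a \<oplus> a) \<otimes> x [^] length p"
    using c Cons.prems by (simp add: l_distr a_ac)
  finally show ?case using Cons.prems by (simp add: add.nat_pow_Suc)
qed simp

lemma eval_poly_deriv:
  assumes p: "set p \<subseteq> carrier R" and x: "x \<in> carrier R"
  shows "eval (poly_deriv R p) x = horner_deriv (rev p) x"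
proof -
  let ?d = "\<lambda>p. map (\<lambda>i. [i] \<cdot> coeff p i) (rev [1..<length p])"
  have dc: "set (?d p) \<subseteq> carrier R" if "set p \<subseteq> carrier R" for p
    using that by auto
  have "eval (?d p) x = horner_deriv (rev p) x"
    using p
  proof (induction p)
    case (Cons a p)
    have d: "?d (a # p) = (if p = [] then [] else ([length p] \<cdot> a) # ?d p)"
    proof (cases p)
      case (Cons b q)
      have "[1..<length (a # p)] = [1..<length p] @ [length p]" using Cons by simp
      then show ?thesis using Cons by auto
    qed simp
    show ?case
    proof (cases "p = []")
      case False
      have "length (?d p) = length p - 1" by simp
      then have "eval (?d (a # p)) x = ([length p] \<cdot> a) \<otimes> x [^] (length p - 1) \<oplus> eval (?d p) x"
        unfolding d using False by simp
      also have "\<dots> = horner_deriv (rev p) x \<oplus> ([length p] \<cdot> a) \<otimes> x [^] (length p - 1)"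
        using Cons x by (simp add: a_comm horner_deriv_closed)
      finally show ?thesis using horner_deriv_append_single[of "rev p" a x] Cons x by simp
    qed (use Cons x in simp)
  qed simp
  then show ?thesis unfolding poly_deriv_def using eval_normalize[OF dc[OF p] x] by simp
qed

end

lemma (in ring_hom_ring) horner_hom:
  "\<lbrakk>set p \<subseteq> carrier R; x \<in> carrier R\<rbrakk> \<Longrightarrow>
    h (R.horner p x) = S.horner (map h p) (h x) \<and> R.horner p x \<in> carrier R"
  by (induction p) auto

lemma (in ring_hom_ring) horner_deriv_hom:
  "\<lbrakk>set p \<subseteq> carrier R; x \<in> carrier R\<rbrakk> \<Longrightarrow>
    h (R.horner_deriv p x) = S.horner_deriv (map h p) (h x) \<and> R.horner_deriv p x \<in> carrier R"
  by (induction p) (auto simp: horner_hom)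

text \<open>In the ring of dual numbers a polynomial takes the value \<open>p(x) + p'(x) \<epsilon>\<close> at \<open>x + \<epsilon>\<close>. Derivatives
  of products and images under homomorphisms are thereby reduced to the fact that evaluation is a
  ring homomorphism.\<close>

definition dual_numbers :: "('a, 'c) ring_scheme \<Rightarrow> ('a \<times> 'a) ring" where
  "dual_numbers K = \<lparr>carrier = carrier K \<times> carrier K,
     monoid.mult = (\<lambda>(a, b) (c, d). (a \<otimes>\<^bsub>K\<^esub> c, a \<otimes>\<^bsub>K\<^esub> d \<oplus>\<^bsub>K\<^esub> b \<otimes>\<^bsub>K\<^esub> c)),
     one = (\<one>\<^bsub>K\<^esub>, \<zero>\<^bsub>K\<^esub>), ring.zero = (\<zero>\<^bsub>K\<^esub>, \<zero>\<^bsub>K\<^esub>),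
     add = (\<lambda>(a, b) (c, d). (a \<oplus>\<^bsub>K\<^esub> c, b \<oplus>\<^bsub>K\<^esub> d))\<rparr>"

lemma (in cring) dual_numbers_cring: "cring (dual_numbers R)"
proof (rule cringI)
  show "abelian_group (dual_numbers R)"
  proof (rule abelian_groupI)
    fix x assume "x \<in> carrier (dual_numbers R)"
    then obtain a b where "x = (a, b)" "a \<in> carrier R" "b \<in> carrier R" by (auto simp: dual_numbers_def)
    then show "\<exists>y\<in>carrier (dual_numbers R). y \<oplus>\<^bsub>dual_numbers R\<^esub> x = \<zero>\<^bsub>dual_numbers R\<^esub>"
      by (intro bexI[of _ "(\<ominus> a, \<ominus> b)"]) (auto simp: dual_numbers_def l_neg)
  qed (auto simp: dual_numbers_def a_ac)
  show "comm_monoid (dual_numbers R)"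
    by (rule comm_monoidI) (auto simp: dual_numbers_def m_ac a_ac l_distr r_distr)
  show "(x \<oplus>\<^bsub>dual_numbers R\<^esub> y) \<otimes>\<^bsub>dual_numbers R\<^esub> z =
      x \<otimes>\<^bsub>dual_numbers R\<^esub> z \<oplus>\<^bsub>dual_numbers R\<^esub> y \<otimes>\<^bsub>dual_numbers R\<^esub> z"
    if "x \<in> carrier (dual_numbers R)" "y \<in> carrier (dual_numbers R)" "z \<in> carrier (dual_numbers R)" for x y z
    using that by (auto simp: dual_numbers_def l_distr r_distr a_ac)
qed

lemma (in cring) horner_dual_numbers:
  assumes "set p \<subseteq> carrier R" "x \<in> carrier R"
  shows "ring.horner (dual_numbers R) (map (\<lambda>a. (a, \<zero>)) p) (x, \<one>) = (horner p x, horner_deriv p x)"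
proof -
  interpret D: cring "dual_numbers R" by (rule dual_numbers_cring)
  show ?thesis using assms
  proof (induction p)
    case Nil then show ?case by (simp, simp add: dual_numbers_def)
  next
    case (Cons a p)
    then have "horner p x \<in> carrier R" "horner_deriv p x \<in> carrier R"
      by (auto intro: horner_closed horner_deriv_closed)
    then show ?case using Cons by (simp, simp add: dual_numbers_def a_ac)
  qed
qed

lemma (in ring_hom_cring) poly_eval_hom:
  assumes "s \<in> carrier S"
  shows "(\<lambda>p. S.horner (rev (map h p)) s) \<in> ring_hom (poly_ring R) S"
proof -
  have H: "ring_hom_ring R S h"
    by (rule ring_hom_ringI2[OF R.ring_axioms S.ring_axioms homh])
  have c: "set p \<subseteq> carrier R" if "p \<in> carrier (poly_ring R)" for p
    using that R.polynomial_incl unfolding univ_poly_carrier[symmetric] by blast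
  have hc: "set (map h p) \<subseteq> carrier S" if "set p \<subseteq> carrier R" for p using that by auto
  have e: "S.horner (rev (map h p)) s = S.eval (map h p) s" if "set p \<subseteq> carrier R" for p
    using S.eval_eq_horner[OF hc[OF that] assms] by simp
  show ?thesis
  proof (rule ring_hom_memI)
    fix p assume p: "p \<in> carrier (poly_ring R)"
    show "S.horner (rev (map h p)) s \<in> carrier S"
      unfolding e[OF c[OF p]] using S.eval_in_carrier[OF hc[OF c[OF p]] assms] .
    fix q assume q: "q \<in> carrier (poly_ring R)"
    note cc = c[OF p] c[OF q] and hcc = hc[OF c[OF p]] hc[OF c[OF q]]
    have m: "set (R.poly_mult p q) \<subseteq> carrier R" "set (R.poly_add p q) \<subseteq> carrier R"
      using R.poly_mult_in_carrier[OF cc] R.poly_add_in_carrier[OF cc] by auto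
    have "S.eval (map h (R.poly_mult p q)) s = S.eval (S.normalize (map h (R.poly_mult p q))) s"
      using S.eval_normalize[OF hc[OF m(1)] assms] by simp
    also have "\<dots> = S.eval (map h p) s \<otimes>\<^bsub>S\<^esub> S.eval (map h q) s"
      unfolding ring_hom_ring.poly_mult_hom'[OF H cc] by (rule S.eval_poly_mult[OF hcc assms])
    finally show "S.horner (rev (map h (p \<otimes>\<^bsub>poly_ring R\<^esub> q))) s =
        S.horner (rev (map h p)) s \<otimes>\<^bsub>S\<^esub> S.horner (rev (map h q)) s"
      unfolding univ_poly_mult e[OF cc(1)] e[OF cc(2)] e[OF m(1)] .
    have "S.eval (map h (R.poly_add p q)) s = S.eval (S.normalize (map h (R.poly_add p q))) s"
      using S.eval_normalize[OF hc[OF m(2)] assms] by simp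
    also have "\<dots> = S.eval (map h p) s \<oplus>\<^bsub>S\<^esub> S.eval (map h q) s"
      unfolding ring_hom_ring.poly_add_hom'[OF H cc] by (rule S.eval_poly_add[OF hcc assms])
    finally show "S.horner (rev (map h (p \<oplus>\<^bsub>poly_ring R\<^esub> q))) s =
        S.horner (rev (map h p)) s \<oplus>\<^bsub>S\<^esub> S.horner (rev (map h q)) s"
      unfolding univ_poly_add e[OF cc(1)] e[OF cc(2)] e[OF m(2)] .
  next
    show "S.horner (rev (map h \<one>\<^bsub>poly_ring R\<^esub>)) s = \<one>\<^bsub>S\<^esub>"
      unfolding univ_poly_one using assms by simp
  qed
qed

lemma map_poly_ring_hom:
  assumes R: "field R" and S: "field S" and h: "h \<in> ring_hom R S"
  shows "map h \<in> ring_hom (poly_ring R) (poly_ring S)"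
proof -
  interpret R: field R by (rule R)
  interpret S: field S by (rule S)
  have H: "ring_hom_ring R S h" by (rule ring_hom_ringI2[OF R.ring_axioms S.ring_axioms h])
  have c: "set p \<subseteq> carrier R" if "p \<in> carrier (poly_ring R)" for p
    using that R.polynomial_incl unfolding univ_poly_carrier[symmetric] by blast
  note cl = polynomial_hom[OF h R S]
  have norm: "S.normalize (map h p) = map h p" if "p \<in> carrier (poly_ring R)" for p
    using cl[OF that] S.normalize_polynomial unfolding univ_poly_carrier[symmetric] by blast
  interpret PR: ring "poly_ring R" by (rule R.univ_poly_is_ring[OF R.carrier_is_subring])
  show ?thesis
  proof (rule ring_hom_memI)
    fix p q assume pq: "p \<in> carrier (poly_ring R)" "q \<in> carrier (poly_ring R)"
    show "map h (p \<otimes>\<^bsub>poly_ring R\<^esub> q) = map h p \<otimes>\<^bsub>poly_ring S\<^esub> map h q"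
      using norm[OF PR.m_closed[OF pq]] ring_hom_ring.poly_mult_hom'[OF H, OF c[OF pq(1)] c[OF pq(2)]]
      by (simp add: univ_poly_mult)
    show "map h (p \<oplus>\<^bsub>poly_ring R\<^esub> q) = map h p \<oplus>\<^bsub>poly_ring S\<^esub> map h q"
      using norm[OF PR.add.m_closed[OF pq]] ring_hom_ring.poly_add_hom'[OF H, OF c[OF pq(1)] c[OF pq(2)]]
      by (simp add: univ_poly_add)
  qed (use cl ring_hom_one[OF h] in \<open>auto simp: univ_poly_one\<close>)
qed

text \<open>The minimal polynomial f divides p, say p = q f, so \<open>p'(x) = q(x) f'(x)\<close> and \<open>f'(x)\<close> is not zero.
  Then f does not divide f', and is coprime to it because f is irreducible.\<close>

lemma (in field) Irr_separable:
  assumes K: "subfield K R" and x: "x \<in> carrier R" "(algebraic over K) x"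
    and p: "set p \<subseteq> K" "horner p x = \<zero>" "horner_deriv p x \<noteq> \<zero>"
  shows "separable_poly R K (Irr K x)"
proof -
  note Irr = IrrE[OF K x]
  interpret PK: principal_domain "K[X]" by (rule univ_poly_is_principal[OF K])
  have KR: "K \<subseteq> carrier R" by (rule subfieldE(3)[OF K])
  have subK: "subring K R" by (rule subfieldE(1)[OF K])
  have c: "set f \<subseteq> carrier R" "set f \<subseteq> K" if "f \<in> carrier (K[X])" for f
    using that KR polynomial_incl unfolding univ_poly_carrier[symmetric] by blast+
  interpret E: ring_hom_ring "K[X]" R "\<lambda>f. eval f x" by (rule eval_ring_hom[OF subK x(1)])
  let ?f = "Irr K x"
  have f'c: "poly_deriv R f \<in> carrier (K[X])" if f: "f \<in> carrier (K[X])" for f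
  proof -
    have "add_pow R (i::nat) a \<in> K" if "a \<in> K" for a i
      using that subringE[OF subK] by (induction i) (auto simp: add.nat_pow_Suc subset_iff add_pow_def)
    moreover have "coeff f i \<in> K" for i
      using c[OF f] subringE(2)[OF subK] by (induction f) auto
    ultimately show ?thesis
      unfolding poly_deriv_def univ_poly_carrier[symmetric] by (intro normalize_gives_polynomial) auto
  qed
  have "eval (poly_deriv R ?f) x \<noteq> \<zero>"
  proof
    assume z: "eval (poly_deriv R ?f) x = \<zero>"
    define g where "g = normalize (rev p)"
    have g: "g \<in> carrier (K[X])"
      using p(1) unfolding g_def univ_poly_carrier[symmetric] by (intro normalize_gives_polynomial) auto
    interpret D: cring "dual_numbers R" by (rule dual_numbers_cring)
    let ?\<iota> = "\<lambda>a. (a, \<zero>)"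
    have hom: "ring_hom_cring R (dual_numbers R) ?\<iota>"
      by unfold_locales (auto intro!: ring_hom_memI simp: dual_numbers_def)
    let ?\<Phi> = "\<lambda>f. D.horner (rev (map ?\<iota> f)) (x, \<one>)"
    have \<Phi>: "?\<Phi> \<in> ring_hom (poly_ring R) (dual_numbers R)"
      using x by (intro ring_hom_cring.poly_eval_hom[OF hom]) (auto simp: dual_numbers_def)
    have \<Phi>v: "?\<Phi> f = (eval f x, eval (poly_deriv R f) x)" if "set f \<subseteq> carrier R" for f
      using horner_dual_numbers[of "rev f" x] that x
      by (simp add: rev_map eval_poly_deriv eval_eq_horner)
    have "eval g x = \<zero>"
      unfolding g_def using eval_normalize[of "rev p" x] eval_eq_horner[of "rev p" x] p KR x by auto
    then have "?f pdivides g" by (rule Irr_minimal[OF K x g])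
    then obtain s where s: "s \<in> carrier (K[X])" "g = ?f \<otimes>\<^bsub>K[X]\<^esub> s"
      using pdivides_iff_shell[OF K Irr(1) g] unfolding factor_def by auto
    have mem: "f \<in> carrier (poly_ring R)" if "f \<in> carrier (K[X])" for f
      using that carrier_polynomial[OF subK] unfolding univ_poly_carrier[symmetric] by blast
    have gP: "g = ?f \<otimes>\<^bsub>poly_ring R\<^esub> s" using s(2) by (simp add: univ_poly_mult)
    have "?\<Phi> g = ?\<Phi> ?f \<otimes>\<^bsub>dual_numbers R\<^esub> ?\<Phi> s"
      using ring_hom_mult[OF \<Phi> mem[OF Irr(1)] mem[OF s(1)]] unfolding gP .
    then have "eval (poly_deriv R g) x = \<zero>"
      unfolding \<Phi>v[OF c(1)[OF g]] \<Phi>v[OF c(1)[OF Irr(1)]] \<Phi>v[OF c(1)[OF s(1)]]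
      using z Irr(4) E.hom_closed s(1) f'c[OF s(1)] by (simp add: dual_numbers_def)
    moreover have "eval (poly_deriv R g) x = horner_deriv p x"
    proof -
      have "(horner p x, horner_deriv p x) = D.horner (rev (map ?\<iota> (rev p))) (x, \<one>)"
        using horner_dual_numbers[of p x] p KR x by (simp add: rev_map)
      also have "\<dots> = D.eval (map ?\<iota> (rev p)) (x, \<one>)"
        using p KR x by (subst D.eval_eq_horner) (auto simp: dual_numbers_def)
      also have "\<dots> = D.eval (D.normalize (map ?\<iota> (rev p))) (x, \<one>)"
        using p KR x by (subst D.eval_normalize) (auto simp: dual_numbers_def)
      also have "D.normalize (map ?\<iota> (rev p)) = map ?\<iota> (normalize (rev p))"
      proof -
        have z: "\<zero>\<^bsub>dual_numbers R\<^esub> = (\<zero>, \<zero>)" by (simp add: dual_numbers_def)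
        have "D.normalize (map ?\<iota> q) = map ?\<iota> (normalize q)" for q
          by (induction q) (simp_all add: z)
        then show ?thesis .
      qed
      also have "D.eval (map ?\<iota> (normalize (rev p))) (x, \<one>) = ?\<Phi> g"
        using c(1)[OF g] x unfolding g_def[symmetric]
        by (subst D.eval_eq_horner) (auto simp: dual_numbers_def)
      finally have "(horner p x, horner_deriv p x) = ?\<Phi> g" unfolding g_def .
      then show ?thesis unfolding \<Phi>v[OF c(1)[OF g]] by simp
    qed
    ultimately show False using p(3) by simp
  qed
  note ne = this
  have ndiv: "\<not> ?f divides\<^bsub>K[X]\<^esub> poly_deriv R ?f"
  proof
    assume "?f divides\<^bsub>K[X]\<^esub> poly_deriv R ?f"
    then obtain s where "s \<in> carrier (K[X])" "poly_deriv R ?f = ?f \<otimes>\<^bsub>K[X]\<^esub> s" unfolding factor_def by auto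
    then have "eval (poly_deriv R ?f) x = \<zero>" using E.hom_mult[OF Irr(1)] Irr(4) by simp
    then show False using ne by simp
  qed
  let ?I = "PIdl\<^bsub>K[X]\<^esub> ?f" and ?J = "PIdl\<^bsub>K[X]\<^esub> (poly_deriv R ?f)"
  note d = f'c[OF Irr(1)]
  have idI: "ideal ?I (K[X])" "ideal ?J (K[X])" using Irr(1) d by (auto intro: PK.cgenideal_ideal)
  have "maximalideal ?I (K[X])"
    using PK.irreducible_imp_maximalideal[OF Irr(1)] Irr(2) unfolding ring_irreducible_def by auto
  moreover have idIJ: "ideal (?I <+>\<^bsub>K[X]\<^esub> ?J) (K[X])" by (rule PK.add_ideals[OF idI])
  moreover have "?I \<subseteq> ?I <+>\<^bsub>K[X]\<^esub> ?J"
  proof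
    fix j assume j: "j \<in> ?I"
    have "\<zero>\<^bsub>K[X]\<^esub> \<in> ?J" using additive_subgroup.zero_closed[OF ideal.axioms(1)[OF idI(2)]] .
    moreover have "j = j \<oplus>\<^bsub>K[X]\<^esub> \<zero>\<^bsub>K[X]\<^esub>" using ideal.Icarr[OF idI(1) j] by simp
    ultimately show "j \<in> ?I <+>\<^bsub>K[X]\<^esub> ?J" using j unfolding set_add_def' by blast
  qed
  ultimately have "?I <+>\<^bsub>K[X]\<^esub> ?J = ?I \<or> ?I <+>\<^bsub>K[X]\<^esub> ?J = carrier (K[X])"
    using maximalideal.I_maximal ideal.Icarr[OF idIJ] by (metis subsetI)
  moreover have "?J \<subseteq> ?I <+>\<^bsub>K[X]\<^esub> ?J"
  proof
    fix j assume j: "j \<in> ?J"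
    have "\<zero>\<^bsub>K[X]\<^esub> \<in> ?I" using additive_subgroup.zero_closed[OF ideal.axioms(1)[OF idI(1)]] .
    moreover have "j = \<zero>\<^bsub>K[X]\<^esub> \<oplus>\<^bsub>K[X]\<^esub> j" using ideal.Icarr[OF idI(2) j] by simp
    ultimately show "j \<in> ?I <+>\<^bsub>K[X]\<^esub> ?J" using j unfolding set_add_def' by blast
  qed
  moreover have "\<not> ?J \<subseteq> ?I"
  proof
    assume "?J \<subseteq> ?I"
    then have "poly_deriv R ?f \<in> ?I" using PK.cgenideal_self[OF d] by blast
    then obtain s where "s \<in> carrier (K[X])" "poly_deriv R ?f = s \<otimes>\<^bsub>K[X]\<^esub> ?f"
      unfolding cgenideal_def by blast
    then have "poly_deriv R ?f = ?f \<otimes>\<^bsub>K[X]\<^esub> s" using PK.m_comm Irr(1) by simp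
    then show False using ndiv \<open>s \<in> _\<close> unfolding factor_def by blast
  qed
  ultimately have "\<one>\<^bsub>K[X]\<^esub> \<in> ?I <+>\<^bsub>K[X]\<^esub> ?J" using PK.one_closed by blast
  then obtain u v where "u \<in> carrier (K[X])" "v \<in> carrier (K[X])"
    "\<one>\<^bsub>K[X]\<^esub> = u \<otimes>\<^bsub>K[X]\<^esub> ?f \<oplus>\<^bsub>K[X]\<^esub> v \<otimes>\<^bsub>K[X]\<^esub> poly_deriv R ?f"
    unfolding set_add_def' cgenideal_def by blast
  then show ?thesis unfolding separable_poly_def by metis
qed

abbreviation scalar :: "('k, 'a, 'e) module_scheme \<Rightarrow> 'k \<Rightarrow> 'a" where
  "scalar A c \<equiv> c \<odot>\<^bsub>A\<^esub> \<one>\<^bsub>A\<^esub>"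

locale field_ext = nonassoc_algebra F K + K: field K for F :: "('k, 'c) ring_scheme" (structure) and K :: "('k, 'a) module" (structure) +
  assumes finite_dim: "fin_dim F K"
begin

interpretation F: field F by (rule base_field)

definition base :: "'a set" where "base = scalar K ` carrier F"

lemma scalar_mult: "\<lbrakk>c \<in> carrier F; x \<in> carrier K\<rbrakk> \<Longrightarrow> c \<odot>\<^bsub>K\<^esub> x = scalar K c \<otimes>\<^bsub>K\<^esub> x"
  using scalar_left[of c "\<one>\<^bsub>K\<^esub>" x] by simp

lemma scalar_hom: "scalar K \<in> ring_hom F K"
proof (rule ring_hom_memI)
  fix x y assume "x \<in> carrier F" "y \<in> carrier F"
  then show "scalar K (x \<otimes>\<^bsub>F\<^esub> y) = scalar K x \<otimes>\<^bsub>K\<^esub> scalar K y"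
    using smult_assoc1[of x y "\<one>\<^bsub>K\<^esub>"] scalar_mult[of x "scalar K y"] by simp
qed (auto simp: smult_l_distr)

lemma scalar_ring_hom: "ring_hom_ring F K (scalar K)"
  by (rule ring_hom_ringI2[OF R.ring_axioms K.ring_axioms scalar_hom])

lemma base_subfield: "subfield base K"
  unfolding base_def
  using ring_hom_ring.img_is_subfield(2)[OF scalar_ring_hom F.carrier_is_subfield] by simp

lemma scalar_inj: "inj_on (scalar K) (carrier F)"
  using ring_hom_ring.img_is_subfield(1)[OF scalar_ring_hom F.carrier_is_subfield] by simp

lemma scalar_carrier: "set p \<subseteq> carrier F \<Longrightarrow> set (map (scalar K) p) \<subseteq> carrier K"
  by auto

lemma finite_base_dimension: "K.finite_dimension base (carrier K)"
proof -
  obtain B where B: "finite B" "B \<subseteq> carrier K" "carrier K \<subseteq> lspan F K B"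
    using finite_dim fin_dim_lspan[OF module_axioms] by auto
  obtain Bs where Bs: "set Bs = B" using finite_list[OF B(1)] by auto
  have BsK: "set Bs \<subseteq> carrier K" using Bs B by simp
  note sp = K.Span_subgroup_props[OF base_subfield BsK] K.Span_smult_closed[OF base_subfield BsK]
    K.Span_base_incl[OF base_subfield BsK]
  have "x \<in> K.Span base Bs" if "x \<in> lspan F K B" for x
    using that
  proof induction
    case (step c b x)
    then have "c \<odot>\<^bsub>K\<^esub> b = scalar K c \<otimes>\<^bsub>K\<^esub> b" "scalar K c \<in> base" "b \<in> K.Span base Bs"
      using scalar_mult[of c b] B Bs sp(6) unfolding base_def by blast+
    then have "c \<odot>\<^bsub>K\<^esub> b \<in> K.Span base Bs" using sp(5)[of "scalar K c" b] by metis
    then show ?case using sp(3) step.IH by blast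
  qed (rule sp)
  then have "carrier K = K.Span base Bs" using B sp by auto
  then show ?thesis using K.Span_finite_dimension[OF base_subfield BsK] by simp
qed

lemma algebraic: "t \<in> carrier K \<Longrightarrow> (K.algebraic over base) t"
  using K.finite_dimension_imp_algebraic[OF base_subfield K.carrier_is_subring finite_base_dimension] .

definition sep_witness :: "'a \<Rightarrow> 'k list \<Rightarrow> bool" where
  "sep_witness t p \<longleftrightarrow> set p \<subseteq> carrier F \<and> K.horner (map (scalar K) p) t = \<zero>\<^bsub>K\<^esub> \<and>
     K.horner_deriv (map (scalar K) p) t \<noteq> \<zero>\<^bsub>K\<^esub>"

lemma fin_sepI:
  assumes "\<And>t. t \<in> carrier K \<Longrightarrow> \<exists>p. sep_witness t p"
  shows "fin_sep_field_ext F K"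
proof -
  have "separable_poly K base (K.Irr base t)" if t: "t \<in> carrier K" for t
  proof -
    obtain p where p: "sep_witness t p" using assms[OF t] by blast
    show ?thesis
      using p K.Irr_separable[OF base_subfield t algebraic[OF t], of "map (scalar K) p"]
      by (auto simp: sep_witness_def base_def)
  qed
  then show ?thesis
    unfolding fin_sep_field_ext_def Let_def base_def
    using nonassoc_algebra_axioms K.field_axioms finite_dim by blast
qed

lemma Irr_lift:
  assumes t: "t \<in> carrier K"
  obtains q where "q \<in> carrier (poly_ring F)" "q \<noteq> []" "lead_coeff q = \<one>\<^bsub>F\<^esub>" "map (scalar K) q = K.Irr base t"
proof -
  let ?q = "K.Irr base t"
  note Irr = K.IrrE[OF base_subfield t algebraic[OF t]]
  have ne: "?q \<noteq> []" using K.pirreducible_degree[OF base_subfield Irr(1,2)] by auto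
  have "set ?q \<subseteq> base" using Irr(1) K.polynomial_incl unfolding univ_poly_carrier[symmetric] by blast
  moreover have "\<exists>q. set q \<subseteq> carrier F \<and> map (scalar K) q = f" if "set f \<subseteq> base" for f
    using that
  proof (induction f)
    case (Cons a f)
    then obtain q where q: "set q \<subseteq> carrier F" "map (scalar K) q = f" by auto
    obtain c where "c \<in> carrier F" "a = scalar K c" using Cons.prems by (auto simp: base_def)
    then show ?case using q by (intro exI[of _ "c # q"]) auto
  qed simp
  ultimately have "\<exists>q. set q \<subseteq> carrier F \<and> map (scalar K) q = ?q" by blast
  then obtain q where q: "set q \<subseteq> carrier F" "map (scalar K) q = ?q" by blast
  have qne: "q \<noteq> []" using ne q(2) by auto
  have "scalar K (lead_coeff q) = lead_coeff ?q" using q(2) qne by (metis hd_map)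
  also have "\<dots> = scalar K \<one>\<^bsub>F\<^esub>" using Irr(3) by simp
  finally have lc: "lead_coeff q = \<one>\<^bsub>F\<^esub>"
    using scalar_inj qne q(1) unfolding inj_on_def by (metis R.one_closed hd_in_set subsetD)
  then have "q \<in> carrier (poly_ring F)"
    using q(1) unfolding univ_poly_carrier[symmetric] polynomial_def by simp
  then show ?thesis using that qne lc q(2) by blast
qed

end

lemma fin_sep_field_ext_imp_field_ext: "fin_sep_field_ext F K \<Longrightarrow> field_ext F K"
  unfolding fin_sep_field_ext_def field_ext_def field_ext_axioms_def by blast

lemma (in field_ext) Irr_deriv:
  assumes sep: "fin_sep_field_ext F K" and t: "t \<in> carrier K"
  shows "K.horner_deriv (rev (K.Irr base t)) t \<noteq> \<zero>\<^bsub>K\<^esub>"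
proof
  assume z: "K.horner_deriv (rev (K.Irr base t)) t = \<zero>\<^bsub>K\<^esub>"
  let ?q = "K.Irr base t"
  note Irr = K.IrrE[OF base_subfield t algebraic[OF t]]
  have sub: "subring base K" by (rule subfieldE(1)[OF base_subfield])
  have c: "set f \<subseteq> carrier K" if "f \<in> carrier (univ_poly K base)" for f
    using that K.polynomial_incl subfieldE(3)[OF base_subfield] unfolding univ_poly_carrier[symmetric] by blast
  interpret E: ring_hom_ring "univ_poly K base" K "\<lambda>f. K.eval f t" by (rule K.eval_ring_hom[OF sub t])
  have "separable_poly K base ?q"
    using sep t unfolding fin_sep_field_ext_def Let_def base_def by blast
  then obtain u v where uv: "u \<in> carrier (univ_poly K base)" "v \<in> carrier (univ_poly K base)"
    "(u \<otimes>\<^bsub>univ_poly K base\<^esub> ?q) \<oplus>\<^bsub>univ_poly K base\<^esub> (v \<otimes>\<^bsub>univ_poly K base\<^esub> poly_deriv K ?q) = \<one>\<^bsub>univ_poly K base\<^esub>"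
    unfolding separable_poly_def by blast
  have d: "poly_deriv K ?q \<in> carrier (univ_poly K base)"
  proof -
    have "add_pow K (i::nat) a \<in> base" if "a \<in> base" for a i
      using that subringE[OF sub] by (induction i) (auto simp: M.add.nat_pow_Suc subset_iff add_pow_def)
    moreover have "set ?q \<subseteq> base"
      using Irr(1) K.polynomial_incl unfolding univ_poly_carrier[symmetric] by blast
    moreover have "K.coeff f i \<in> base" if "set f \<subseteq> base" for i f
      using that subringE(2)[OF sub] by (induction f) auto
    ultimately show ?thesis
      unfolding poly_deriv_def univ_poly_carrier[symmetric] by (intro K.normalize_gives_polynomial) auto
  qed
  have "K.eval (poly_deriv K ?q) t = \<zero>\<^bsub>K\<^esub>" using z K.eval_poly_deriv[OF c[OF Irr(1)] t] by simp
  then have "K.eval \<one>\<^bsub>univ_poly K base\<^esub> t = \<zero>\<^bsub>K\<^esub>"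
    unfolding uv(3)[symmetric] using uv(1,2) d Irr(1,4) by simp
  then show False using t by (simp add: univ_poly_one)
qed

lemma (in domain) finprod_not_zero:
  assumes "finite I" "\<And>i. i \<in> I \<Longrightarrow> f i \<in> carrier R" "\<And>i. i \<in> I \<Longrightarrow> f i \<noteq> \<zero>"
  shows "(\<Otimes>i\<in>I. f i) \<noteq> \<zero>"
  using assms
proof (induction I)
  case (insert x I)
  have "(\<Otimes>i\<in>insert x I. f i) = f x \<otimes> (\<Otimes>i\<in>I. f i)" using insert by (intro finprod_insert) auto
  moreover have "(\<Otimes>i\<in>I. f i) \<in> carrier R" using insert by (intro finprod_closed) auto
  moreover have "(\<Otimes>i\<in>I. f i) \<noteq> \<zero>" using insert by simp
  ultimately show ?case using insert.prems integral by (metis insertI1)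
qed simp

context galois_simple_ring begin

lemma CR_field: "field CR" using subfield_iff(2)[OF C_subfield] .

lemma aut_CR_hom: "i < n \<Longrightarrow> \<tau> i \<in> ring_hom CR CR"
  by (rule ring_hom_memI) auto

text \<open>Multiplying the distinct conjugates of a minimal polynomial over C gives a polynomial over
  the fixed field; the root stays simple because distinct monic irreducible polynomials have no
  common root.\<close>

lemma descend_sep_witness:
  fixes K :: "('d, 'k) module"
  assumes sep: "fin_sep_field_ext CR K" and t: "t \<in> carrier K"
  shows "\<exists>p. set p \<subseteq> Fix \<and> ring.horner K (map (scalar K) p) t = \<zero>\<^bsub>K\<^esub> \<and>
     ring.horner_deriv K (map (scalar K) p) t \<noteq> \<zero>\<^bsub>K\<^esub>"
proof -
  interpret CR: field CR by (rule CR_field)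
  interpret K: field_ext CR K by (rule fin_sep_field_ext_imp_field_ext[OF sep])
  interpret PC: domain "poly_ring CR" by (rule CR.univ_poly_is_domain[OF CR.carrier_is_subring])
  let ?P = "poly_ring CR" and ?q = "K.K.Irr K.base t"
  note base = K.base_subfield
  note Irr = K.K.IrrE[OF base t K.algebraic[OF t]]
  obtain q where q: "q \<in> carrier ?P" "q \<noteq> []" "lead_coeff q = \<one>" "map (scalar K) q = ?q"
    using K.Irr_lift[OF t] by auto
  have Pc: "set f \<subseteq> C" if "f \<in> carrier ?P" for f
    using that CR.polynomial_incl unfolding univ_poly_carrier[symmetric] by fastforce
  define conj where "conj j = map (\<tau> j) q" for j
  define S where "S = conj ` {..<n}"
  have mhom: "map (\<tau> j) \<in> ring_hom ?P ?P" if "j < n" for j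
    by (rule map_poly_ring_hom[OF CR_field CR_field aut_CR_hom[OF that]])
  have conjP: "conj j \<in> carrier ?P" if "j < n" for j
    using ring_hom_closed[OF mhom[OF that] q(1)] by (simp add: conj_def)
  have finS: "finite S" and SP: "S \<subseteq> carrier ?P" using conjP by (auto simp: S_def)
  have conj_comp: "map (\<tau> l) (conj j) = conj ((l + j) mod n)" if "l < n" "j < n" for l j
    using that Pc[OF q(1)] by (auto simp: conj_def aut_comp subset_iff)
  have conj0: "conj 0 = q"
    unfolding conj_def using Pc[OF q(1)] by (intro map_idI) (auto simp: aut_zero)
  have qS: "q \<in> S" using conj0 n_pos by (auto simp: S_def image_iff intro!: bexI[of _ 0])
  define p where "p = (\<Otimes>\<^bsub>?P\<^esub>r\<in>S. r)"
  have pP: "p \<in> carrier ?P" unfolding p_def using SP by (intro PC.finprod_closed) auto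
  have inv: "map (\<tau> l) p = p" if l: "l < n" for l
  proof -
    interpret h: ring_hom_cring ?P ?P "map (\<tau> l)"
      by (intro ring_hom_cring.intro PC.is_cring ring_hom_cring_axioms.intro mhom l)
    have "map (\<tau> l) ` S \<subseteq> S" using conj_comp[OF l] n_pos by (auto simp: S_def)
    moreover have inj: "inj_on (map (\<tau> l)) S"
    proof -
      have "inj_on (\<tau> l) (\<Union>(set ` S))"
        using aut_inj[OF l] SP Pc unfolding inj_on_def by (metis C_carrier UN_E subsetD)
      then show ?thesis by (rule inj_on_mapI)
    qed
    ultimately have img: "map (\<tau> l) ` S = S"
      by (intro card_subset_eq finS) (auto simp: card_image)
    have "map (\<tau> l) p = (\<Otimes>\<^bsub>?P\<^esub>r\<in>S. map (\<tau> l) r)"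
      unfolding p_def using h.hom_finprod[of "\<lambda>r. r" S] SP by (auto simp: comp_def)
    also have "\<dots> = (\<Otimes>\<^bsub>?P\<^esub>r\<in>map (\<tau> l) ` S. r)"
      using SP img inj by (intro PC.finprod_reindex[symmetric]) auto
    finally show ?thesis unfolding img p_def .
  qed
  have pFix: "set p \<subseteq> Fix"
  proof
    fix c assume c: "c \<in> set p"
    have "\<tau> l c = c" if "l < n" for l
      using inv[OF that] c by (metis map_eq_conv map_ident)
    then show "c \<in> Fix" using c Pc[OF pP] unfolding Fix_def by blast
  qed
  interpret DK: cring "dual_numbers K" by (rule K.K.dual_numbers_cring)
  have \<phi>: "ring_hom_cring CR K (scalar K)"
    by (intro ring_hom_cring.intro CR.is_cring K.K.is_cring ring_hom_cring_axioms.intro K.scalar_hom)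
  let ?\<psi> = "\<lambda>f. K.K.horner (rev (map (scalar K) f)) t"
  have \<psi>: "?\<psi> \<in> ring_hom ?P K" by (rule ring_hom_cring.poly_eval_hom[OF \<phi> t])
  interpret \<psi>: ring_hom_cring ?P K ?\<psi>
    by (intro ring_hom_cring.intro PC.is_cring K.K.is_cring ring_hom_cring_axioms.intro \<psi>)
  let ?h = "\<lambda>c. (scalar K c, \<zero>\<^bsub>K\<^esub>)"
  have hh: "ring_hom_cring CR (dual_numbers K) ?h"
  proof (intro ring_hom_cring.intro CR.is_cring DK.is_cring ring_hom_cring_axioms.intro ring_hom_memI)
    fix x y assume "x \<in> carrier CR" "y \<in> carrier CR"
    then show "?h (x \<otimes>\<^bsub>CR\<^esub> y) = ?h x \<otimes>\<^bsub>dual_numbers K\<^esub> ?h y" "?h (x \<oplus>\<^bsub>CR\<^esub> y) = ?h x \<oplus>\<^bsub>dual_numbers K\<^esub> ?h y"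
      using ring_hom_mult[OF K.scalar_hom] ring_hom_add[OF K.scalar_hom] ring_hom_closed[OF K.scalar_hom]
      by (auto simp: dual_numbers_def)
  qed (use ring_hom_closed[OF K.scalar_hom] ring_hom_one[OF K.scalar_hom] in \<open>auto simp: dual_numbers_def\<close>)
  let ?\<Phi> = "\<lambda>f. DK.horner (rev (map ?h f)) (t, \<one>\<^bsub>K\<^esub>)"
  have \<Phi>: "?\<Phi> \<in> ring_hom ?P (dual_numbers K)"
    using t by (intro ring_hom_cring.poly_eval_hom[OF hh]) (auto simp: dual_numbers_def)
  have \<Phi>v: "?\<Phi> f = (?\<psi> f, K.K.horner_deriv (rev (map (scalar K) f)) t)" if "f \<in> carrier ?P" for f
  proof -
    have "set (rev (map (scalar K) f)) \<subseteq> carrier K" using Pc[OF that] K.scalar_carrier[of f] by simp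
    then show ?thesis
      using K.K.horner_dual_numbers[of "rev (map (scalar K) f)" t] t by (simp add: rev_map comp_def)
  qed
  have root: "?\<psi> q = \<zero>\<^bsub>K\<^esub>"
  proof -
    have "set ?q \<subseteq> carrier K" using K.scalar_carrier[of q] Pc[OF q(1)] q(4) by simp
    then show ?thesis unfolding q(4) using K.K.eval_eq_horner[of ?q t] Irr(4) t by simp
  qed
  have other: "?\<psi> r \<noteq> \<zero>\<^bsub>K\<^esub>" if r: "r \<in> S" "r \<noteq> q" for r
  proof
    assume z: "?\<psi> r = \<zero>\<^bsub>K\<^esub>"
    obtain j where j: "j < n" "r = conj j" using r by (auto simp: S_def)
    have rP: "r \<in> carrier ?P" using SP r by auto
    let ?r = "map (scalar K) r"
    have lr: "length ?r = length ?q" using j q(4)[symmetric] by (simp add: conj_def)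
    have rne: "r \<noteq> []" using j q(2) by (simp add: conj_def)
    have lead: "lead_coeff ?r = \<one>\<^bsub>K\<^esub>"
      using rne j q(2,3) K.smult_one[OF K.unit_closed] by (simp add: hd_map conj_def)
    have rb: "?r \<in> carrier (univ_poly K K.base)"
      using Pc[OF rP] lead unfolding univ_poly_carrier[symmetric] polynomial_def
      by (auto simp: K.base_def)
    have rc: "set ?r \<subseteq> carrier K" using K.scalar_carrier[of r] Pc[OF rP] by simp
    have "K.K.eval ?r t = \<zero>\<^bsub>K\<^esub>" using z K.K.eval_eq_horner[OF rc t] by simp
    then have "?q pdivides\<^bsub>K\<^esub> ?r"
      by (rule K.K.Irr_minimal[OF base t K.algebraic[OF t] rb])
    then obtain s where s: "s \<in> carrier (univ_poly K K.base)" "?r = K.K.poly_mult ?q s"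
      using K.K.pdivides_iff_shell[OF base Irr(1) rb] unfolding factor_def univ_poly_mult by auto
    note sub = subfieldE(1)[OF base]
    have sne: "s \<noteq> []" using s(2) rne by (metis K.K.poly_mult_zero(2) Irr(1) Nil_is_map_conv K.K.polynomial_in_carrier[OF sub] univ_poly_carrier)
    have qne: "?q \<noteq> []" using q(2,4) by (metis Nil_is_map_conv)
    have "degree ?r = degree ?q + degree s"
      using K.K.poly_mult_degree_eq[OF sub, of ?q s] Irr(1) s sne qne by (simp add: univ_poly_carrier)
    then have "degree s = 0" using lr by simp
    then obtain c where c: "s = [c]" using sne by (cases s) auto
    have "set s \<subseteq> K.base" using s(1) K.K.polynomial_incl unfolding univ_poly_carrier[symmetric] by blast
    then have cK: "c \<in> carrier K" using c subfieldE(3)[OF base] by auto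
    have "lead_coeff ?r = lead_coeff ?q \<otimes>\<^bsub>K\<^esub> lead_coeff s"
      unfolding s(2) using K.K.poly_mult_lead_coeff[OF sub, of ?q s] Irr(1) s sne qne by (simp add: univ_poly_carrier)
    then have "c = \<one>\<^bsub>K\<^esub>" using lead Irr(3) c cK by simp
    then have "?r = ?q" using s(2) c K.K.poly_mult_one(2)[OF sub] Irr(1) by (simp add: univ_poly_carrier)
    then have "map (scalar K) r = map (scalar K) q" using q(4) by simp
    moreover have "inj_on (scalar K) (set r \<union> set q)"
      using K.scalar_inj Pc[OF rP] Pc[OF q(1)] by (auto intro: inj_on_subset)
    ultimately have "r = q" by (metis inj_on_map_eq_map)
    then show False using r by simp
  qed
  define z where "z = (\<Otimes>\<^bsub>?P\<^esub>r\<in>S - {q}. r)"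
  have zP: "z \<in> carrier ?P" unfolding z_def using SP by (intro PC.finprod_closed) auto
  have pz: "p = q \<otimes>\<^bsub>?P\<^esub> z"
  proof -
    have "S = insert q (S - {q})" using qS by auto
    then have "p = (\<Otimes>\<^bsub>?P\<^esub>r\<in>insert q (S - {q}). r)" unfolding p_def by simp
    also have "\<dots> = q \<otimes>\<^bsub>?P\<^esub> z" unfolding z_def using finS SP q(1) by (intro PC.finprod_insert) auto
    finally show ?thesis .
  qed
  have z0: "?\<psi> z \<noteq> \<zero>\<^bsub>K\<^esub>"
  proof -
    have "?\<psi> z = (\<Otimes>\<^bsub>K\<^esub>r\<in>S - {q}. ?\<psi> r)"
      unfolding z_def using \<psi>.hom_finprod[of "\<lambda>r. r" "S - {q}"] SP by (auto simp: comp_def)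
    moreover have "\<dots> \<noteq> \<zero>\<^bsub>K\<^esub>"
      using finS other SP \<psi>.hom_closed by (intro K.K.finprod_not_zero) auto
    ultimately show ?thesis by simp
  qed
  have "?\<Phi> p = ?\<Phi> q \<otimes>\<^bsub>dual_numbers K\<^esub> ?\<Phi> z" unfolding pz by (rule ring_hom_mult[OF \<Phi> q(1) zP])
  moreover have hd: "K.K.horner_deriv (rev (map (scalar K) f)) t \<in> carrier K" if "f \<in> carrier ?P" for f
    using K.K.horner_deriv_closed[of "rev (map (scalar K) f)" t] K.scalar_carrier[of f] Pc[OF that] t by simp
  ultimately have "?\<psi> p = \<zero>\<^bsub>K\<^esub>"
    "K.K.horner_deriv (rev (map (scalar K) p)) t = K.K.horner_deriv (rev ?q) t \<otimes>\<^bsub>K\<^esub> ?\<psi> z"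
    unfolding \<Phi>v[OF pP] \<Phi>v[OF q(1)] \<Phi>v[OF zP] root q(4)
    using hd[OF zP] hd[OF q(1)] \<psi>.hom_closed[OF zP] root[unfolded q(4)] by (auto simp: dual_numbers_def q(4))
  moreover have "K.K.horner_deriv (rev ?q) t \<otimes>\<^bsub>K\<^esub> ?\<psi> z \<noteq> \<zero>\<^bsub>K\<^esub>"
    using K.Irr_deriv[OF sep t] z0 hd[OF q(1)] \<psi>.hom_closed[OF zP] K.K.integral unfolding q(4) by blast
  ultimately show ?thesis using pFix by (intro exI[of _ "rev p"]) (simp add: rev_map)
qed

end

section \<open>Etale algebras over C and over the fixed field\<close>

text \<open>The factors of an etale algebra have to live on the type of the algebra itself. Copying them
  along an injection allows the type to change.\<close>

definition transport :: "('a \<Rightarrow> 'b) \<Rightarrow> ('k, 'a) module \<Rightarrow> ('k, 'b) module" where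
  "transport \<iota> K = \<lparr>carrier = \<iota> ` carrier K,
     monoid.mult = (\<lambda>x y. \<iota> (inv_into UNIV \<iota> x \<otimes>\<^bsub>K\<^esub> inv_into UNIV \<iota> y)), one = \<iota> \<one>\<^bsub>K\<^esub>, ring.zero = \<iota> \<zero>\<^bsub>K\<^esub>,
     add = (\<lambda>x y. \<iota> (inv_into UNIV \<iota> x \<oplus>\<^bsub>K\<^esub> inv_into UNIV \<iota> y)), smult = (\<lambda>c x. \<iota> (c \<odot>\<^bsub>K\<^esub> inv_into UNIV \<iota> x))\<rparr>"

lemma transport_nonassoc_algebra:
  assumes inj: "inj \<iota>" and K: "nonassoc_algebra F K"
  shows "nonassoc_algebra F (transport \<iota> K)"
proof -
  interpret K: nonassoc_algebra F K by (rule K)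
  note d = transport_def inv_f_f[OF inj]
  have ab: "abelian_group (transport \<iota> K)"
  proof (rule abelian_groupI)
    fix x assume "x \<in> carrier (transport \<iota> K)"
    then obtain y where "y \<in> carrier K" "x = \<iota> y" by (auto simp: d)
    then show "\<exists>z\<in>carrier (transport \<iota> K). z \<oplus>\<^bsub>transport \<iota> K\<^esub> x = \<zero>\<^bsub>transport \<iota> K\<^esub>"
      by (intro bexI[of _ "\<iota> (\<ominus>\<^bsub>K\<^esub> y)"]) (auto simp: d K.M.l_neg)
  qed (auto simp: d K.M.a_ac)
  have "module F (transport \<iota> K)"
    by (rule moduleI[OF K.R.is_cring ab])
      (auto simp: d K.smult_l_distr K.smult_r_distr K.smult_assoc1)
  then show ?thesis
    by (intro nonassoc_algebra.intro nonassoc_algebra_axioms.intro K.base_field)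
      (auto simp: d K.mult_closed K.unit_closed K.unit_left K.unit_right K.distrib_left K.distrib_right
        K.scalar_left K.scalar_right)
qed

lemma transport_hom:
  assumes "inj \<iota>"
  shows "\<iota> \<in> ring_hom K (transport \<iota> K)"
  using inv_f_f[OF assms] by (auto simp: transport_def intro!: ring_hom_memI)

lemma transport_field_ext:
  assumes inj: "inj \<iota>" and K: "field_ext F K"
  shows "field_ext F (transport \<iota> K)"
proof -
  interpret K: field_ext F K by (rule K)
  note d = transport_def inv_f_f[OF inj]
  have "\<iota> \<in> ring_iso K (transport \<iota> K)"
    using transport_hom[OF inj] inj by (auto simp: ring_iso_def bij_betw_def transport_def intro: inj_on_subset)
  from K.K.ring_iso_imp_img_field[OF this] have fld: "field (transport \<iota> K)" by (simp add: transport_def)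
  have na: "nonassoc_algebra F (transport \<iota> K)"
    by (rule transport_nonassoc_algebra[OF inj K.nonassoc_algebra_axioms])
  then interpret T: nonassoc_algebra F "transport \<iota> K" .
  obtain B where B: "finite B" "B \<subseteq> carrier K" "carrier K \<subseteq> lspan F K B"
    using K.finite_dim fin_dim_lspan[OF K.module_axioms] by auto
  have "\<iota> x \<in> lspan F (transport \<iota> K) (\<iota> ` B)" if "x \<in> lspan F K B" for x
    using that
  proof induction
    case zero
    then show ?case using lspan.zero[of "transport \<iota> K"] by (simp add: transport_def)
  next
    case (step c b x)
    then have "c \<odot>\<^bsub>transport \<iota> K\<^esub> \<iota> b \<oplus>\<^bsub>transport \<iota> K\<^esub> \<iota> x \<in> lspan F (transport \<iota> K) (\<iota> ` B)"
      by (intro lspan.step) auto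
    then show ?case by (simp add: d)
  qed
  then have "fin_dim F (transport \<iota> K)"
    unfolding fin_dim_lspan[OF T.module_axioms] using B by (intro exI[of _ "\<iota> ` B"]) (auto simp: d)
  then show ?thesis using na fld by (simp add: field_ext_def field_ext_axioms_def)
qed

lemma (in nonassoc_algebra) restrict_scalars:
  assumes K: "subfield K F"
  shows "nonassoc_algebra (F\<lparr>carrier := K\<rparr>) A"
proof -
  have c: "x \<in> carrier F" if "x \<in> K" for x using subfieldE(3)[OF K] that by auto
  have f: "field (F\<lparr>carrier := K\<rparr>)" using R.subfield_iff(2)[OF K] .
  have "module (F\<lparr>carrier := K\<rparr>) A"
    by (rule moduleI) (use f c in \<open>auto simp: field_def domain_def smult_l_distr smult_r_distr smult_assoc1 M.abelian_group_axioms\<close>)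
  then show ?thesis
    by (intro nonassoc_algebra.intro nonassoc_algebra_axioms.intro f)
      (auto simp: c mult_closed unit_closed unit_left unit_right distrib_left distrib_right scalar_left scalar_right)
qed

lemma subalgebra_nonassoc:
  fixes A :: "('k, 'a) module"
  assumes "nonassoc_algebra F A" and S: "subalg F A S"
  shows "nonassoc_algebra F (A\<lparr>carrier := S\<rparr>)"
proof -
  interpret nonassoc_algebra F A by fact
  interpret S: additive_subgroup S A using S by (simp add: subalg_def)
  have c: "x \<in> carrier A" if "x \<in> S" for x using S.a_subset that by auto
  have "abelian_group (A\<lparr>carrier := S\<rparr>)"
  proof (rule abelian_groupI)
    fix x assume "x \<in> carrier (A\<lparr>carrier := S\<rparr>)"
    then show "\<exists>y\<in>carrier (A\<lparr>carrier := S\<rparr>). y \<oplus>\<^bsub>A\<lparr>carrier := S\<rparr>\<^esub> x = \<zero>\<^bsub>A\<lparr>carrier := S\<rparr>\<^esub>"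
      using S.a_inv_closed c M.l_neg by (intro bexI[of _ "\<ominus>\<^bsub>A\<^esub> x"]) auto
  qed (use c in \<open>auto simp: M.a_ac\<close>)
  then have "module F (A\<lparr>carrier := S\<rparr>)"
    by (intro moduleI) (use c S in \<open>auto simp: subalg_def smult_l_distr smult_r_distr smult_assoc1 R.is_cring\<close>)
  then show ?thesis
    using S by (intro nonassoc_algebra.intro nonassoc_algebra_axioms.intro base_field)
      (auto simp: subalg_def c unit_left unit_right distrib_left distrib_right scalar_left scalar_right)
qed

lemma (in ring) horner_consistent:
  assumes "subring E R"
  shows "ring.horner (R\<lparr>carrier := E\<rparr>) p x = horner p x"
    "ring.horner_deriv (R\<lparr>carrier := E\<rparr>) p x = horner_deriv p x"
proof -
  interpret E: ring "R\<lparr>carrier := E\<rparr>" by (rule subring_is_ring[OF assms])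
  have h: "E.horner p x = horner p x" for p by (induction p) auto
  show "E.horner p x = horner p x" by (rule h)
  show "E.horner_deriv p x = horner_deriv p x" by (induction p) (auto simp: h)
qed

text \<open>Elements with a single nonzero component generate an etale algebra. If such a component t
  has minimal polynomial f, then X f has the element as a simple root: its derivative is t f'(t) in
  the component of t and f(0) in the others.\<close>

lemma (in ring) etale_sep_subalgebra:
  assumes simple: "simple_ring R"
    and et: "etale_subalg (R\<lparr>carrier := center R\<rparr>) (self_alg R) E"
    and dim: "dimension m (center R) E"
  shows "\<exists>G. sep_subalgebra R (center R) E G"
proof -
  let ?C = "center R" and ?CR = "R\<lparr>carrier := center R\<rparr>"
  have subC: "subfield ?C R" by (rule simple_center_subfield[OF simple])
  have sa: "subalg ?CR (self_alg R) E" and etE: "etale ?CR ((self_alg R)\<lparr>carrier := E\<rparr>)"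
    using et by (auto simp: etale_subalg_def)
  have ag: "subgroup E (add_monoid R)"
    using sa unfolding subalg_def additive_subgroup_def by (simp add: self_alg_def subgroup_def m_inv_def)
  have E1: "\<one> \<in> E" and Em: "\<And>x y. \<lbrakk>x \<in> E; y \<in> E\<rbrakk> \<Longrightarrow> x \<otimes> y \<in> E" and Es: "\<And>c x. \<lbrakk>c \<in> ?C; x \<in> E\<rbrakk> \<Longrightarrow> c \<otimes> x \<in> E"
    using sa by (auto simp: subalg_def self_alg_def)
  have subE: "subring E R"
    by (intro subring.intro ag submonoid.intro) (use subgroup.subset[OF ag] E1 Em in auto)
  have Ec: "x \<in> carrier R" if "x \<in> E" for x using subringE(1)[OF subE] that by auto
  have CE: "?C \<subseteq> E"
  proof
    fix c assume c: "c \<in> ?C"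
    then show "c \<in> E" using Es[OF c E1] center_carrier[OF c] by simp
  qed
  let ?RE = "R\<lparr>carrier := E\<rparr>"
  interpret RE: ring ?RE by (rule subring_is_ring[OF subE])
  obtain r :: nat and K :: "nat \<Rightarrow> ('a, 'a) module" and h where
    K: "\<And>i. i < r \<Longrightarrow> fin_sep_field_ext ?CR (K i)"
    and h: "\<And>i. i < r \<Longrightarrow> h i \<in> alg_hom ?CR ((self_alg R)\<lparr>carrier := E\<rparr>) (K i)"
    and bij: "bij_betw (\<lambda>x. \<lambda>i\<in>{..<r}. h i x) E (\<Pi>\<^sub>E i\<in>{..<r}. carrier (K i))"
    using etE unfolding etale_def by auto
  have hom: "h i \<in> ring_hom ?RE (K i)" if "i < r" for i
    using h[OF that] by (auto simp: alg_hom_def ring_hom_def self_alg_def)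
  have hs: "h i (c \<otimes> x) = c \<odot>\<^bsub>K i\<^esub> h i x" if "i < r" "c \<in> ?C" "x \<in> E" for i c x
    using h[OF that(1)] that(2,3) by (auto simp: alg_hom_def self_alg_def)
  have fe: "field_ext ?CR (K i)" if "i < r" for i
    by (rule fin_sep_field_ext_imp_field_ext[OF K[OF that]])
  have fK: "field (K i)" if "i < r" for i using fe[OF that] by (simp add: field_ext_def)
  have rK: "ring (K i)" if "i < r" for i using fK[OF that] by (rule field.is_ring)
  have hh: "ring_hom_ring ?RE (K i) (h i)" if "i < r" for i
    by (rule ring_hom_ringI2[OF RE.ring_axioms rK[OF that] hom[OF that]])
  have hc: "h i x \<in> carrier (K i)" if "i < r" "x \<in> E" for i x
    using ring_hom_closed[OF hom[OF that(1)], of x] that by simp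
  have hm: "h i (x \<otimes> y) = h i x \<otimes>\<^bsub>K i\<^esub> h i y" if "i < r" "x \<in> E" "y \<in> E" for i x y
    using ring_hom_mult[OF hom[OF that(1)], of x y] that by simp
  have h1: "h i \<one> = \<one>\<^bsub>K i\<^esub>" if "i < r" for i
    using ring_hom_one[OF hom[OF that]] by simp
  have h0: "h i \<zero> = \<zero>\<^bsub>K i\<^esub>" if "i < r" for i
    using ring_hom_zero[OF hom[OF that] RE.ring_axioms rK[OF that]] by simp
  have inj: "x = y" if "x \<in> E" "y \<in> E" "\<And>i. i < r \<Longrightarrow> h i x = h i y" for x y
  proof -
    have "(\<lambda>i\<in>{..<r}. h i x) = (\<lambda>i\<in>{..<r}. h i y)" using that(3) by auto
    then show ?thesis using bij that(1,2) unfolding bij_betw_def inj_on_def by blast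
  qed
  have ex: "\<exists>x\<in>E. \<forall>i<r. h i x = t i" if t: "\<And>i. i < r \<Longrightarrow> t i \<in> carrier (K i)" for t
  proof -
    have "(\<lambda>i\<in>{..<r}. t i) \<in> (\<Pi>\<^sub>E i\<in>{..<r}. carrier (K i))" using t by auto
    then obtain x where x: "x \<in> E" "(\<lambda>i\<in>{..<r}. h i x) = (\<lambda>i\<in>{..<r}. t i)"
      using bij unfolding bij_betw_def by (metis (no_types, lifting) imageE)
    have "h i x = t i" if "i < r" for i
      using fun_cong[OF x(2), of i] that by simp
    then show ?thesis using x by auto
  qed
  have commE: "x \<otimes> y = y \<otimes> x" if xy: "x \<in> E" "y \<in> E" for x y
  proof (rule inj)
    fix i assume i: "i < r"
    interpret Ki: field "K i" by (rule fK[OF i])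
    show "h i (x \<otimes> y) = h i (y \<otimes> x)"
      using hm[OF i] hc[OF i] xy Ki.m_comm by simp
  qed (use xy Em in auto)
  obtain Us where Us: "set Us \<subseteq> carrier R" "Span ?C Us = E"
    using exists_base[OF subC dim] by auto
  have UsE: "u \<in> E" if "u \<in> set Us" for u using Span_base_incl[OF subC Us(1)] Us(2) that by auto
  have ex_comp: "\<exists>x. x \<in> E \<and> h i x = h i u \<and> (\<forall>j<r. j \<noteq> i \<longrightarrow> h j x = \<zero>\<^bsub>K j\<^esub>)" if iu: "i < r" "u \<in> E" for i u
  proof -
    have "\<exists>x\<in>E. \<forall>j<r. h j x = (if j = i then h i u else \<zero>\<^bsub>K j\<^esub>)"
      using hc iu rK by (intro ex) (auto intro: ring.ring_simprules(2))
    then obtain x where "x \<in> E" "\<forall>j<r. h j x = (if j = i then h i u else \<zero>\<^bsub>K j\<^esub>)" by blast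
    then show ?thesis using iu by (intro exI[of _ x] conjI) auto
  qed
  define comp where "comp i u = (SOME x. x \<in> E \<and> h i x = h i u \<and> (\<forall>j<r. j \<noteq> i \<longrightarrow> h j x = \<zero>\<^bsub>K j\<^esub>))" for i u
  note comp' = someI_ex[OF ex_comp, folded comp_def]
  have comp: "\<And>i u. \<lbrakk>i < r; u \<in> E\<rbrakk> \<Longrightarrow> comp i u \<in> E"
    "\<And>i u. \<lbrakk>i < r; u \<in> E\<rbrakk> \<Longrightarrow> h i (comp i u) = h i u"
    "\<And>i u j. \<lbrakk>i < r; u \<in> E; j < r; j \<noteq> i\<rbrakk> \<Longrightarrow> h j (comp i u) = \<zero>\<^bsub>K j\<^esub>"
    using comp' by blast+
  define G where "G = (\<lambda>(i, u). comp i u) ` ({..<r} \<times> set Us)"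
  have GE: "G \<subseteq> E" using comp UsE by (auto simp: G_def)
  have gen: "E \<subseteq> V" if V: "subalgebra ?C V R" "G \<subseteq> V" for V
  proof -
    have Vs: "subgroup V (add_monoid R)" using V(1) by (simp add: subalgebra_def)
    have fV: "(\<Oplus>i\<in>I. f i) \<in> V" if "finite I" "\<And>i. i \<in> I \<Longrightarrow> f i \<in> V" for f and I :: "nat set"
      using that
    proof (induction I)
      case empty then show ?case using subgroup.one_closed[OF Vs] by simp
    next
      case (insert i I)
      have "(\<Oplus>i\<in>insert i I. f i) = f i \<oplus> (\<Oplus>i\<in>I. f i)"
        using insert subgroup.subset[OF Vs] by (intro finsum_insert) auto
      then show ?case using insert subgroup.m_closed[OF Vs] by auto
    qed
    have "u \<in> V" if u: "u \<in> set Us" for u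
    proof -
      have uE: "u \<in> E" by (rule UsE[OF u])
      define s where "s = (\<Oplus>\<^bsub>?RE\<^esub>i\<in>{..<r}. comp i u)"
      have fin: "(\<lambda>i. comp i u) \<in> {..<r} \<rightarrow> carrier ?RE" using comp(1) uE by auto
      have sE: "s \<in> E" using RE.finsum_closed[OF fin] by (simp add: s_def)
      have "h j s = h j u" if j: "j < r" for j
      proof -
        interpret Kj: field "K j" by (rule fK[OF j])
        have "h j s = (\<Oplus>\<^bsub>K j\<^esub>i\<in>{..<r}. h j (comp i u))"
          unfolding s_def using fin by (intro RE.finsum_ring_hom[OF rK[OF j] hom[OF j]]) auto
        also have "\<dots> = (\<Oplus>\<^bsub>K j\<^esub>i\<in>{..<r}. if j = i then h j u else \<zero>\<^bsub>K j\<^esub>)"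
          using comp uE j hc[OF j uE] by (intro Kj.finsum_cong') auto
        also have "\<dots> = h j u" using j hc[OF j uE] by (intro Kj.finsum_singleton) auto
        finally show ?thesis .
      qed
      then have "s = u" by (rule inj[OF sE uE])
      moreover have "s = (\<Oplus>i\<in>{..<r}. comp i u)"
      proof -
        have *: "(\<Oplus>\<^bsub>?RE\<^esub>i\<in>I. comp i u) = (\<Oplus>i\<in>I. comp i u)" if "finite I" "I \<subseteq> {..<r}" for I
          using that
        proof (induction I)
          case (insert i I)
          have "(\<Oplus>\<^bsub>?RE\<^esub>i\<in>insert i I. comp i u) = comp i u \<oplus>\<^bsub>?RE\<^esub> (\<Oplus>\<^bsub>?RE\<^esub>i\<in>I. comp i u)"
            using insert comp(1) uE by (intro RE.finsum_insert) auto
          moreover have "(\<Oplus>i\<in>insert i I. comp i u) = comp i u \<oplus> (\<Oplus>i\<in>I. comp i u)"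
            using insert comp(1) uE Ec by (intro finsum_insert) auto
          ultimately show ?case using insert by simp
        qed simp
        show ?thesis unfolding s_def by (rule *) auto
      qed
      moreover have "comp i u \<in> V" if "i \<in> {..<r}" for i
      proof -
        have "(\<lambda>(i, u). comp i u) (i, u) \<in> G" unfolding G_def using that u by (intro imageI) simp
        then show ?thesis using V(2) by auto
      qed
      ultimately show ?thesis using fV[of "{..<r}" "\<lambda>i. comp i u"] by simp
    qed
    then show ?thesis using subalgebra_Span_incl[OF subC V(1), of Us] Us(2) by auto
  qed
  have sep: "sep_elem ?C E x" if "x \<in> G" for x
  proof -
    obtain i u where iu: "i < r" "u \<in> E" "x = comp i u" using \<open>x \<in> G\<close> UsE by (auto simp: G_def)
    have xE: "x \<in> E" using comp(1) iu by simp
    interpret CRf: field ?CR using subfield_iff(2)[OF subC] .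
    interpret Ki: field_ext ?CR "K i" by (rule fe[OF iu(1)])
    let ?t = "h i x"
    have t: "?t \<in> carrier (K i)" by (rule hc[OF iu(1) xE])
    have xj: "h j x = \<zero>\<^bsub>K j\<^esub>" if "j < r" "j \<noteq> i" for j using comp(3) iu that by auto
    have hmap: "map (h j) p = map (scalar (K j)) p" if j: "j < r" and p: "set p \<subseteq> ?C" for j p
    proof (rule map_cong[OF refl])
      fix c assume "c \<in> set p"
      then have c: "c \<in> ?C" using p by auto
      show "h j c = scalar (K j) c" using hs[OF j c E1] h1[OF j] center_carrier[OF c] by simp
    qed
    have hev: "h j (horner p x) = ring.horner (K j) (map (scalar (K j)) p) (h j x)" "horner p x \<in> E"
      "h j (horner_deriv p x) = ring.horner_deriv (K j) (map (scalar (K j)) p) (h j x)" "horner_deriv p x \<in> E"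
      if j: "j < r" and p: "set p \<subseteq> ?C" for j p
    proof -
      have "set p \<subseteq> carrier ?RE" using p CE by auto
      from ring_hom_ring.horner_hom[OF hh[OF j] this, of x] ring_hom_ring.horner_deriv_hom[OF hh[OF j] this, of x]
      show "h j (horner p x) = ring.horner (K j) (map (scalar (K j)) p) (h j x)" "horner p x \<in> E"
        "h j (horner_deriv p x) = ring.horner_deriv (K j) (map (scalar (K j)) p) (h j x)" "horner_deriv p x \<in> E"
        using xE horner_consistent[OF subE] hmap[OF j p] by auto
    qed
    have z: "\<zero> \<in> ?C" using subringE(2)[OF center_subring] .
    show ?thesis
    proof (cases "?t = \<zero>\<^bsub>K i\<^esub>")
      case True
      have "x = \<zero>"
      proof (rule inj[OF xE subringE(2)[OF subE]])
        show "h j x = h j \<zero>" if "j < r" for j using True xj h0 that by (cases "j = i") auto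
      qed
      then have "horner [\<zero>, \<one>] x = \<zero>" "horner_deriv [\<zero>, \<one>] x \<otimes> \<one> = \<one>" by auto
      then show ?thesis unfolding sep_elem_def
        using E1 z subringE(3)[OF center_subring] by (intro exI[of _ "[\<zero>, \<one>]"] bexI[of _ \<one>]) auto
    next
      case False
      let ?f = "Ki.K.Irr Ki.base ?t"
      note base = Ki.base_subfield
      note Irr = Ki.K.IrrE[OF base t Ki.algebraic[OF t]]
      obtain q where q: "q \<in> carrier (poly_ring ?CR)" "q \<noteq> []" "map (scalar (K i)) q = ?f"
        using Ki.Irr_lift[OF t] by metis
      have qC: "set q \<subseteq> ?C"
        using q(1) CRf.polynomial_incl unfolding univ_poly_carrier[symmetric] by fastforce
      define p where "p = \<zero> # rev q"
      have pC: "set p \<subseteq> ?C" "set (rev q) \<subseteq> ?C" using qC z by (auto simp: p_def)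
      have rq: "map (scalar (K i)) (rev q) = rev ?f" using q(3) by (simp add: rev_map[symmetric])
      have fK': "set ?f \<subseteq> carrier (K i)" using Ki.scalar_carrier[of q] qC q(3) by simp
      have f0: "Ki.K.horner (rev ?f) ?t = \<zero>\<^bsub>K i\<^esub>"
        using Irr(4) Ki.K.eval_eq_horner[OF fK' t] by simp
      have sc0: "scalar (K j) \<zero> = \<zero>\<^bsub>K j\<^esub>" if "j < r" for j
        using hs[OF that z E1] h0[OF that] h1[OF that] by simp
      have const: "last q \<noteq> \<zero>"
      proof
        assume l: "last q = \<zero>"
        define g where "g = butlast ?f"
        have fne: "?f \<noteq> []" using q(2,3) by (metis Nil_is_map_conv)
        have "last ?f = \<zero>\<^bsub>K i\<^esub>" using l q(2) sc0[OF iu(1)] unfolding q(3)[symmetric] by (simp add: last_map)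
        then have fg: "?f = g @ [\<zero>\<^bsub>K i\<^esub>]" unfolding g_def using fne by (metis append_butlast_last_id)
        have gc: "set g \<subseteq> carrier (K i)" using fK' fg by auto
        have ev: "Ki.K.eval g ?t \<in> carrier (K i)" by (rule Ki.K.eval_in_carrier[OF gc t])
        have "Ki.K.eval g ?t \<otimes>\<^bsub>K i\<^esub> ?t = \<zero>\<^bsub>K i\<^esub>"
          using Irr(4) Ki.K.eval_append_aux[OF gc Ki.M.zero_closed t] ev t unfolding fg by simp
        then have g0: "Ki.K.eval g ?t = \<zero>\<^bsub>K i\<^esub>" using False ev t Ki.K.integral by blast
        have gne: "g \<noteq> []"
          using fg Irr(3) by auto
        then have "g \<in> carrier (univ_poly (K i) Ki.base)"
          using Irr(1,3) fg unfolding univ_poly_carrier[symmetric] polynomial_def by auto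
        then have "degree ?f \<le> degree g"
          using Ki.K.pdivides_imp_degree_le[OF subfieldE(1)[OF base] Irr(1) _ gne]
            Ki.K.Irr_minimal[OF base t Ki.algebraic[OF t] _ g0] by blast
        then show False using fg gne by (metis One_nat_def Suc_n_not_le_n Suc_pred diff_Suc_1 length_append_singleton length_greater_0_conv)
      qed
      have hz: "horner p x = \<zero>"
      proof (rule inj)
        show "h j (horner p x) = h j \<zero>" if j: "j < r" for j
        proof (cases "j = i")
          case True
          have "Ki.K.horner (map (scalar (K i)) p) ?t = \<zero>\<^bsub>K i\<^esub>"
            using f0 t sc0[OF iu(1)] by (simp add: p_def rq)
          then show ?thesis using hev(1)[OF j pC(1)] h0[OF j] True by simp
        next
          case False
          interpret Kj: field_ext ?CR "K j" by (rule fe[OF j])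
          have "Kj.K.horner (map (scalar (K j)) (rev q)) \<zero>\<^bsub>K j\<^esub> \<in> carrier (K j)"
            using Kj.scalar_carrier[of "rev q"] qC by (intro Kj.K.horner_closed) auto
          then have "Kj.K.horner (map (scalar (K j)) p) \<zero>\<^bsub>K j\<^esub> = \<zero>\<^bsub>K j\<^esub>"
            using sc0[OF j] by (simp add: p_def)
          then show ?thesis using hev(1)[OF j pC(1)] h0[OF j] xj[OF j False] by simp
        qed
      qed (use hev(2)[OF iu(1) pC(1)] subringE(2)[OF subE] in auto)
      have nz: "h j (horner_deriv p x) \<noteq> \<zero>\<^bsub>K j\<^esub>" if j: "j < r" for j
      proof (cases "j = i")
        case True
        have d: "Ki.K.horner_deriv (rev ?f) ?t \<noteq> \<zero>\<^bsub>K i\<^esub>" by (rule Ki.Irr_deriv[OF K[OF iu(1)] t])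
        have dc: "Ki.K.horner_deriv (rev ?f) ?t \<in> carrier (K i)"
          using fK' t by (intro Ki.K.horner_deriv_closed) auto
        have "Ki.K.horner_deriv (map (scalar (K i)) p) ?t = ?t \<otimes>\<^bsub>K i\<^esub> Ki.K.horner_deriv (rev ?f) ?t"
          using f0 t dc by (simp add: p_def rq)
        moreover have "\<dots> \<noteq> \<zero>\<^bsub>K i\<^esub>" using Ki.K.integral[OF _ t dc] False d by blast
        ultimately show ?thesis using hev(3)[OF j pC(1)] True by simp
      next
        case False
        interpret Kj: field_ext ?CR "K j" by (rule fe[OF j])
        have mc: "set (map (scalar (K j)) (rev q)) \<subseteq> carrier (K j)"
          using Kj.scalar_carrier[of "rev q"] qC by simp
        obtain q' where q': "rev q = last q # q'" using q(2) by (metis append_butlast_last_id rev_eq_Cons_iff rev_rev_ident)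
        have lc: "last q \<in> ?C" using qC q(2) by auto
        have cc: "Kj.K.horner (map (scalar (K j)) q') \<zero>\<^bsub>K j\<^esub> \<in> carrier (K j)"
          "scalar (K j) (last q) \<in> carrier (K j)"
          using mc q' by (auto intro!: Kj.K.horner_closed)
        have dc: "Kj.K.horner_deriv (map (scalar (K j)) (rev q)) \<zero>\<^bsub>K j\<^esub> \<in> carrier (K j)"
          using mc by (intro Kj.K.horner_deriv_closed) auto
        have "Kj.K.horner_deriv (map (scalar (K j)) p) \<zero>\<^bsub>K j\<^esub> = Kj.K.horner (map (scalar (K j)) (rev q)) \<zero>\<^bsub>K j\<^esub>"
          using dc Kj.K.horner_closed[OF mc Kj.M.zero_closed] by (simp add: p_def)
        also have "\<dots> = scalar (K j) (last q)" unfolding q' using cc by simp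
        finally have e: "h j (horner_deriv p x) = scalar (K j) (last q)"
          using hev(3)[OF j pC(1)] xj[OF j False] by simp
        show ?thesis
        proof
          assume "h j (horner_deriv p x) = \<zero>\<^bsub>K j\<^esub>"
          then have "scalar (K j) (last q) = scalar (K j) \<zero>" using e sc0[OF j] by simp
          then show False using Kj.scalar_inj lc z const unfolding inj_on_def by auto
        qed
      qed
      have "\<exists>w\<in>E. \<forall>j<r. h j w = inv\<^bsub>K j\<^esub> (h j (horner_deriv p x))"
      proof (rule ex)
        fix j assume j: "j < r"
        interpret Kj: field "K j" by (rule fK[OF j])
        show "inv\<^bsub>K j\<^esub> (h j (horner_deriv p x)) \<in> carrier (K j)"
          using nz[OF j] hc[OF j hev(4)[OF j pC(1)]] by (auto simp: Kj.field_Units)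
      qed
      then obtain w where w: "w \<in> E" "\<And>j. j < r \<Longrightarrow> h j w = inv\<^bsub>K j\<^esub> (h j (horner_deriv p x))" by blast
      have "horner_deriv p x \<otimes> w = \<one>"
      proof (rule inj)
        fix j assume j: "j < r"
        interpret Kj: field "K j" by (rule fK[OF j])
        show "h j (horner_deriv p x \<otimes> w) = h j \<one>"
          using hm[OF j hev(4)[OF j pC(1)] w(1)] w(2)[OF j] nz[OF j] hc[OF j hev(4)[OF j pC(1)]] h1[OF j]
          by (simp add: Kj.field_Units)
      qed (use w hev(4)[OF iu(1) pC(1)] Em E1 in auto)
      then show ?thesis unfolding sep_elem_def using pC(1) w(1) hz by blast
    qed
  qed
  have "finite G" by (simp add: G_def)
  then have "sep_subalgebra R ?C E G"
    by - (rule sep_subalgebra.intro[OF ring_axioms sep_subalgebra_axioms.intro[OF refl subC subE CE commE _ GE sep gen]])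
  then show ?thesis by blast
qed

context galois_simple_ring begin

text \<open>A finite separable extension of C is one of the fixed field: finiteness multiplies along the
  tower, and separability descends element by element.\<close>

lemma fin_sep_transport_Fix:
  fixes K :: "('d, 'k) module"
  assumes sep: "fin_sep_field_ext CR K" and inj: "inj \<iota>"
  shows "fin_sep_field_ext FixR (transport \<iota> K)"
proof -
  interpret CR: field CR by (rule CR_field)
  interpret CK: field_ext CR K by (rule fin_sep_field_ext_imp_field_ext[OF sep])
  have FC: "subfield Fix CR"
  proof (rule CR.subfield_iff(1))
    show "field (CR\<lparr>carrier := Fix\<rparr>)" using subfield_iff(2)[OF Fix_subfield] by simp
  qed auto
  have na: "nonassoc_algebra FixR K"
    using nonassoc_algebra.restrict_scalars[OF CK.nonassoc_algebra_axioms FC] by simp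
  interpret FK: nonassoc_algebra FixR K by (rule na)
  obtain B where B: "finite B" "B \<subseteq> carrier K" "carrier K \<subseteq> lspan CR K B"
    using CK.finite_dim fin_dim_lspan[OF CK.module_axioms] by auto
  obtain B' where B': "finite B'" "B' \<subseteq> C" "C \<subseteq> lspan FixR (self_alg CR) B'"
    using C_fin_gen_Fix by auto
  define B2 where "B2 = (\<lambda>(c, b). c \<odot>\<^bsub>K\<^esub> b) ` (B' \<times> B)"
  have B2: "finite B2" "B2 \<subseteq> carrier K" using B B' by (auto simp: B2_def subset_iff)
  have 1: "c \<odot>\<^bsub>K\<^esub> b \<in> lspan FixR K B2" if b: "b \<in> B" and c: "c \<in> lspan FixR (self_alg CR) B'" for b c
    using c
  proof induction
    case zero
    have "\<zero> \<odot>\<^bsub>K\<^esub> b = \<zero>\<^bsub>K\<^esub>"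
      using CK.smult_l_null[of b] b B(2) by auto
    then show ?case using lspan.zero[of K] by (simp add: self_alg_def)
  next
    case (step f c' x)
    have c: "f \<in> Fix" "c' \<in> C" "b \<in> carrier K" using step b B B' by auto
    have xC: "x \<in> C"
      using step(3) by (induction) (use B' in \<open>auto simp: self_alg_def\<close>)
    have "f \<odot>\<^bsub>K\<^esub> (c' \<odot>\<^bsub>K\<^esub> b) \<oplus>\<^bsub>K\<^esub> x \<odot>\<^bsub>K\<^esub> b \<in> lspan FixR K B2"
      using step b by (intro lspan.step) (auto simp: B2_def)
    moreover have "(f \<otimes> c' \<oplus> x) \<odot>\<^bsub>K\<^esub> b = f \<odot>\<^bsub>K\<^esub> (c' \<odot>\<^bsub>K\<^esub> b) \<oplus>\<^bsub>K\<^esub> x \<odot>\<^bsub>K\<^esub> b"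
      using CK.smult_l_distr[of "f \<otimes> c'" x b] CK.smult_assoc1[of f c' b] c xC by simp
    ultimately show ?case by (simp add: self_alg_def)
  qed
  have "x \<in> lspan FixR K B2" if "x \<in> lspan CR K B" for x
    using that
  proof induction
    case zero then show ?case by (rule lspan.zero)
  next
    case (step c b x)
    have "c \<odot>\<^bsub>K\<^esub> b \<in> lspan FixR K B2" using 1[OF step(2)] step(1) B'(3) by auto
    then show ?case using FK.lspan_add[OF B2(2) _ step.IH] by blast
  qed
  then have "fin_dim FixR K"
    unfolding fin_dim_lspan[OF FK.module_axioms] using B2 B by blast
  then have "field_ext FixR K"
    using na CK.K.field_axioms by (simp add: field_ext_def field_ext_axioms_def)
  from transport_field_ext[OF inj this] interpret T: field_ext FixR "transport \<iota> K" .
  have hom: "\<iota> \<in> ring_hom K (transport \<iota> K)" by (rule transport_hom[OF inj])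
  have hr: "ring_hom_ring K (transport \<iota> K) \<iota>"
    by (rule ring_hom_ringI2[OF CK.K.ring_axioms T.K.ring_axioms hom])
  show ?thesis
  proof (rule T.fin_sepI)
    fix s assume "s \<in> carrier (transport \<iota> K)"
    then obtain t where t: "t \<in> carrier K" "s = \<iota> t" by (auto simp: transport_def)
    obtain p where p: "set p \<subseteq> Fix" "CK.K.horner (map (scalar K) p) t = \<zero>\<^bsub>K\<^esub>"
      "CK.K.horner_deriv (map (scalar K) p) t \<noteq> \<zero>\<^bsub>K\<^esub>"
      using descend_sep_witness[OF sep t(1)] by blast
    have pc: "set (map (scalar K) p) \<subseteq> carrier K" using CK.scalar_carrier[of p] p(1) by auto
    have m: "map \<iota> (map (scalar K) p) = map (scalar (transport \<iota> K)) p"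
      using inv_f_f[OF inj] by (simp add: transport_def)
    have "T.K.horner (map (scalar (transport \<iota> K)) p) s = \<iota> \<zero>\<^bsub>K\<^esub>"
      using ring_hom_ring.horner_hom[OF hr pc t(1)] p(2) unfolding m t(2) by simp
    moreover have "T.K.horner_deriv (map (scalar (transport \<iota> K)) p) s = \<iota> (CK.K.horner_deriv (map (scalar K) p) t)"
      using ring_hom_ring.horner_deriv_hom[OF hr pc t(1)] unfolding m t(2) by simp
    moreover have z0: "\<zero>\<^bsub>transport \<iota> K\<^esub> = \<iota> \<zero>\<^bsub>K\<^esub>" by (simp add: transport_def)
    ultimately have "T.sep_witness s p"
      using p(1,3) injD[OF inj] unfolding T.sep_witness_def by auto
    then show "\<exists>p. T.sep_witness s p" by blast
  qed
qed

lemma etale_image_Fix: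
  fixes A :: "('d, 'b) module" and \<iota> :: "'d \<Rightarrow> 'b"
  assumes et: "etale CR ((self_alg D)\<lparr>carrier := E\<rparr>)" and inj: "inj \<iota>"
    and na: "nonassoc_algebra FixR (A\<lparr>carrier := e ` E\<rparr>)" and einj: "inj_on e E"
    and E: "\<And>x y. \<lbrakk>x \<in> E; y \<in> E\<rbrakk> \<Longrightarrow> x \<otimes> y \<in> E" "\<And>x y. \<lbrakk>x \<in> E; y \<in> E\<rbrakk> \<Longrightarrow> x \<oplus> y \<in> E" "\<one> \<in> E"
      "\<And>c x. \<lbrakk>c \<in> Fix; x \<in> E\<rbrakk> \<Longrightarrow> c \<otimes> x \<in> E"
    and e: "\<And>x y. \<lbrakk>x \<in> E; y \<in> E\<rbrakk> \<Longrightarrow> e x \<otimes>\<^bsub>A\<^esub> e y = e (x \<otimes> y)"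
      "\<And>x y. \<lbrakk>x \<in> E; y \<in> E\<rbrakk> \<Longrightarrow> e x \<oplus>\<^bsub>A\<^esub> e y = e (x \<oplus> y)" "\<one>\<^bsub>A\<^esub> = e \<one>"
      "\<And>c x. \<lbrakk>c \<in> Fix; x \<in> E\<rbrakk> \<Longrightarrow> c \<odot>\<^bsub>A\<^esub> e x = e (c \<otimes> x)"
  shows "etale FixR (A\<lparr>carrier := e ` E\<rparr>)"
proof -
  let ?B = "(self_alg D)\<lparr>carrier := E\<rparr>"
  obtain r :: nat and K :: "nat \<Rightarrow> ('d, 'd) module" and h where
    K: "\<And>i. i < r \<Longrightarrow> fin_sep_field_ext CR (K i)"
    and h: "\<And>i. i < r \<Longrightarrow> h i \<in> alg_hom CR ?B (K i)"
    and bij: "bij_betw (\<lambda>x. \<lambda>i\<in>{..<r}. h i x) E (\<Pi>\<^sub>E i\<in>{..<r}. carrier (K i))"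
    using et unfolding etale_def by auto
  define g where "g = inv_into E e"
  have g: "g (e x) = x" if "x \<in> E" for x using that einj by (simp add: g_def)
  define h' where "h' i y = \<iota> (h i (g y))" for i y
  have hc: "h i x \<in> carrier (K i)" if "i < r" "x \<in> E" for i x
    using h[OF that(1)] that by (auto simp: alg_hom_def ring_hom_def)
  have "h' i \<in> alg_hom FixR (A\<lparr>carrier := e ` E\<rparr>) (transport \<iota> (K i))" if i: "i < r" for i
    using h[OF i] hc[OF i] E e unfolding alg_hom_def ring_hom_def
    by (auto simp: h'_def g transport_def inv_f_f[OF inj] self_alg_def)
  moreover have "fin_sep_field_ext FixR (transport \<iota> (K i))" if "i < r" for i
    by (rule fin_sep_transport_Fix[OF K[OF that] inj])
  moreover have "bij_betw (\<lambda>y. \<lambda>i\<in>{..<r}. h' i y) (e ` E) (\<Pi>\<^sub>E i\<in>{..<r}. carrier (transport \<iota> (K i)))"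
    unfolding bij_betw_def
  proof
    show "inj_on (\<lambda>y. \<lambda>i\<in>{..<r}. h' i y) (e ` E)"
    proof (rule inj_onI)
      fix y z assume yz: "y \<in> e ` E" "z \<in> e ` E" "(\<lambda>i\<in>{..<r}. h' i y) = (\<lambda>i\<in>{..<r}. h' i z)"
      then obtain a b where ab: "a \<in> E" "b \<in> E" "y = e a" "z = e b" by blast
      have "h i a = h i b" if "i < r" for i
        using fun_cong[OF yz(3), of i] that ab injD[OF inj] by (auto simp: h'_def g)
      then have "(\<lambda>i\<in>{..<r}. h i a) = (\<lambda>i\<in>{..<r}. h i b)" by auto
      then show "y = z" using bij ab unfolding bij_betw_def inj_on_def by blast
    qed
    show "(\<lambda>y. \<lambda>i\<in>{..<r}. h' i y) ` e ` E = (\<Pi>\<^sub>E i\<in>{..<r}. carrier (transport \<iota> (K i)))"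
    proof (intro equalityI subsetI)
      fix f assume "f \<in> (\<lambda>y. \<lambda>i\<in>{..<r}. h' i y) ` e ` E"
      then show "f \<in> (\<Pi>\<^sub>E i\<in>{..<r}. carrier (transport \<iota> (K i)))"
        using hc by (auto simp: h'_def g transport_def split: if_splits)
    next
      fix f assume f: "f \<in> (\<Pi>\<^sub>E i\<in>{..<r}. carrier (transport \<iota> (K i)))"
      have "(\<lambda>i\<in>{..<r}. inv_into UNIV \<iota> (f i)) \<in> (\<Pi>\<^sub>E i\<in>{..<r}. carrier (K i))"
        using PiE_mem[OF f] inv_f_f[OF inj] by (force simp: transport_def)
      then obtain x where x: "x \<in> E" "(\<lambda>i\<in>{..<r}. h i x) = (\<lambda>i\<in>{..<r}. inv_into UNIV \<iota> (f i))"
        using bij unfolding bij_betw_def by (metis (no_types, lifting) imageE)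
      have "f = (\<lambda>i\<in>{..<r}. h' i (e x))"
      proof
        fix i show "f i = (\<lambda>i\<in>{..<r}. h' i (e x)) i"
        proof (cases "i < r")
          case True
          then have "f i \<in> range \<iota>" using PiE_mem[OF f, of i] by (auto simp: transport_def)
          then show ?thesis
            using True fun_cong[OF x(2), of i] x(1) by (auto simp: h'_def g f_inv_into_f)
        next
          case False
          then show ?thesis using PiE_arb[OF f, of i] by simp
        qed
      qed
      then show "f \<in> (\<lambda>y. \<lambda>i\<in>{..<r}. h' i y) ` e ` E" using x(1) by blast
    qed
  qed
  ultimately show ?thesis
    unfolding etale_def using na by (intro conjI exI[of _ r] exI[of _ "\<lambda>i. transport \<iota> (K i)"] exI[of _ h']) auto
qed

end

section \<open>The nucleus of a nonassociative algebra\<close>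

context nonassoc_algebra begin

lemma scaled_zero: "x \<in> carrier A \<Longrightarrow> \<zero>\<^bsub>F\<^esub> \<odot>\<^bsub>A\<^esub> x = \<zero>\<^bsub>A\<^esub>"
  by (rule smult_l_null)

lemma scaled_minus: "x \<in> carrier A \<Longrightarrow> (\<ominus>\<^bsub>F\<^esub> \<one>\<^bsub>F\<^esub>) \<odot>\<^bsub>A\<^esub> x = \<ominus>\<^bsub>A\<^esub> x"
  using smult_l_minus[of "\<one>\<^bsub>F\<^esub>" x] by simp

lemma associator_zero_iff:
  assumes "x \<in> carrier A" "y \<in> carrier A" "z \<in> carrier A"
  shows "associator A x y z = \<zero>\<^bsub>A\<^esub> \<longleftrightarrow> (x \<otimes>\<^bsub>A\<^esub> y) \<otimes>\<^bsub>A\<^esub> z = x \<otimes>\<^bsub>A\<^esub> (y \<otimes>\<^bsub>A\<^esub> z)"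
proof -
  note c = assms mult_closed
  have "(x \<otimes>\<^bsub>A\<^esub> y) \<otimes>\<^bsub>A\<^esub> z = x \<otimes>\<^bsub>A\<^esub> (y \<otimes>\<^bsub>A\<^esub> z)" if "associator A x y z = \<zero>\<^bsub>A\<^esub>"
    using M.minus_equality[of "(x \<otimes>\<^bsub>A\<^esub> y) \<otimes>\<^bsub>A\<^esub> z" "\<ominus>\<^bsub>A\<^esub> (x \<otimes>\<^bsub>A\<^esub> (y \<otimes>\<^bsub>A\<^esub> z))"] that c
    by (simp add: associator_def M.minus_eq M.a_comm)
  then show ?thesis using c by (auto simp: associator_def M.minus_eq M.r_neg)
qed

lemma nucleus_iff:
  "x \<in> nucleus A \<longleftrightarrow> x \<in> carrier A \<and> (\<forall>y\<in>carrier A. \<forall>z\<in>carrier A.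
     (x \<otimes>\<^bsub>A\<^esub> y) \<otimes>\<^bsub>A\<^esub> z = x \<otimes>\<^bsub>A\<^esub> (y \<otimes>\<^bsub>A\<^esub> z) \<and> (y \<otimes>\<^bsub>A\<^esub> x) \<otimes>\<^bsub>A\<^esub> z = y \<otimes>\<^bsub>A\<^esub> (x \<otimes>\<^bsub>A\<^esub> z) \<and>
     (y \<otimes>\<^bsub>A\<^esub> z) \<otimes>\<^bsub>A\<^esub> x = y \<otimes>\<^bsub>A\<^esub> (z \<otimes>\<^bsub>A\<^esub> x))"
  unfolding nucleus_def nuc_l_def nuc_m_def nuc_r_def using associator_zero_iff by auto

lemma nucleus_carrier: "x \<in> nucleus A \<Longrightarrow> x \<in> carrier A"
  by (simp add: nucleus_iff)

lemma nucleus_add: assumes "x \<in> nucleus A" "y \<in> nucleus A" shows "x \<oplus>\<^bsub>A\<^esub> y \<in> nucleus A"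
  using assms unfolding nucleus_iff by (simp add: distrib_left distrib_right mult_closed)

lemma nucleus_smult: assumes "a \<in> carrier F" "x \<in> nucleus A" shows "a \<odot>\<^bsub>A\<^esub> x \<in> nucleus A"
  using assms unfolding nucleus_iff by (simp add: scalar_left scalar_right mult_closed)

lemma nucleus_one: "\<one>\<^bsub>A\<^esub> \<in> nucleus A"
  unfolding nucleus_iff by (simp add: unit_left unit_right mult_closed unit_closed)

lemma nucleus_zero: "\<zero>\<^bsub>A\<^esub> \<in> nucleus A"
  using nucleus_smult[OF R.zero_closed nucleus_one] scaled_zero unit_closed by simp

lemma nucleus_minus: "x \<in> nucleus A \<Longrightarrow> \<ominus>\<^bsub>A\<^esub> x \<in> nucleus A"
  using nucleus_smult[OF R.a_inv_closed[OF R.one_closed], of x] scaled_minus[OF nucleus_carrier, of x] by simp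

lemma nucleus_mult: assumes "x \<in> nucleus A" "y \<in> nucleus A" shows "x \<otimes>\<^bsub>A\<^esub> y \<in> nucleus A"
proof -
  note nx = assms(1)[unfolded nucleus_iff] and ny = assms(2)[unfolded nucleus_iff]
  have c: "x \<in> carrier A" "y \<in> carrier A" using nx ny by auto
  note m = mult_closed
  have "((x \<otimes>\<^bsub>A\<^esub> y) \<otimes>\<^bsub>A\<^esub> a) \<otimes>\<^bsub>A\<^esub> b = (x \<otimes>\<^bsub>A\<^esub> y) \<otimes>\<^bsub>A\<^esub> (a \<otimes>\<^bsub>A\<^esub> b)
      \<and> (a \<otimes>\<^bsub>A\<^esub> (x \<otimes>\<^bsub>A\<^esub> y)) \<otimes>\<^bsub>A\<^esub> b = a \<otimes>\<^bsub>A\<^esub> ((x \<otimes>\<^bsub>A\<^esub> y) \<otimes>\<^bsub>A\<^esub> b)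
      \<and> (a \<otimes>\<^bsub>A\<^esub> b) \<otimes>\<^bsub>A\<^esub> (x \<otimes>\<^bsub>A\<^esub> y) = a \<otimes>\<^bsub>A\<^esub> (b \<otimes>\<^bsub>A\<^esub> (x \<otimes>\<^bsub>A\<^esub> y))"
    if ab: "a \<in> carrier A" "b \<in> carrier A" for a b
  proof (intro conjI)
    show "((x \<otimes>\<^bsub>A\<^esub> y) \<otimes>\<^bsub>A\<^esub> a) \<otimes>\<^bsub>A\<^esub> b = (x \<otimes>\<^bsub>A\<^esub> y) \<otimes>\<^bsub>A\<^esub> (a \<otimes>\<^bsub>A\<^esub> b)"
      using nx ny ab m by auto
    have "(a \<otimes>\<^bsub>A\<^esub> (x \<otimes>\<^bsub>A\<^esub> y)) \<otimes>\<^bsub>A\<^esub> b = ((a \<otimes>\<^bsub>A\<^esub> x) \<otimes>\<^bsub>A\<^esub> y) \<otimes>\<^bsub>A\<^esub> b" using nx ny ab by metis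
    also have "\<dots> = (a \<otimes>\<^bsub>A\<^esub> x) \<otimes>\<^bsub>A\<^esub> (y \<otimes>\<^bsub>A\<^esub> b)" using ny ab c m by blast
    also have "\<dots> = a \<otimes>\<^bsub>A\<^esub> (x \<otimes>\<^bsub>A\<^esub> (y \<otimes>\<^bsub>A\<^esub> b))" using nx ab c m by blast
    also have "x \<otimes>\<^bsub>A\<^esub> (y \<otimes>\<^bsub>A\<^esub> b) = (x \<otimes>\<^bsub>A\<^esub> y) \<otimes>\<^bsub>A\<^esub> b" using nx ab c by metis
    finally show "(a \<otimes>\<^bsub>A\<^esub> (x \<otimes>\<^bsub>A\<^esub> y)) \<otimes>\<^bsub>A\<^esub> b = a \<otimes>\<^bsub>A\<^esub> ((x \<otimes>\<^bsub>A\<^esub> y) \<otimes>\<^bsub>A\<^esub> b)" .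
    have "(a \<otimes>\<^bsub>A\<^esub> b) \<otimes>\<^bsub>A\<^esub> (x \<otimes>\<^bsub>A\<^esub> y) = ((a \<otimes>\<^bsub>A\<^esub> b) \<otimes>\<^bsub>A\<^esub> x) \<otimes>\<^bsub>A\<^esub> y" using ny ab c m by metis
    also have "(a \<otimes>\<^bsub>A\<^esub> b) \<otimes>\<^bsub>A\<^esub> x = a \<otimes>\<^bsub>A\<^esub> (b \<otimes>\<^bsub>A\<^esub> x)" using nx ab by blast
    also have "(a \<otimes>\<^bsub>A\<^esub> (b \<otimes>\<^bsub>A\<^esub> x)) \<otimes>\<^bsub>A\<^esub> y = a \<otimes>\<^bsub>A\<^esub> ((b \<otimes>\<^bsub>A\<^esub> x) \<otimes>\<^bsub>A\<^esub> y)" using ny ab c m by blast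
    also have "(b \<otimes>\<^bsub>A\<^esub> x) \<otimes>\<^bsub>A\<^esub> y = b \<otimes>\<^bsub>A\<^esub> (x \<otimes>\<^bsub>A\<^esub> y)" using ny ab c by blast
    finally show "(a \<otimes>\<^bsub>A\<^esub> b) \<otimes>\<^bsub>A\<^esub> (x \<otimes>\<^bsub>A\<^esub> y) = a \<otimes>\<^bsub>A\<^esub> (b \<otimes>\<^bsub>A\<^esub> (x \<otimes>\<^bsub>A\<^esub> y))" .
  qed
  then show ?thesis unfolding nucleus_iff using m[OF c] by simp
qed

lemma nucleus_subgroup: "additive_subgroup (nucleus A) A"
proof (rule additive_subgroup.intro, rule M.add.subgroupI)
  show "nucleus A \<noteq> {}" using nucleus_zero by blast
qed (auto intro: nucleus_carrier nucleus_add nucleus_minus)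

lemma nucleus_ring: "ring (A\<lparr>carrier := nucleus A\<rparr>)"
proof (rule ringI)
  show "abelian_group (A\<lparr>carrier := nucleus A\<rparr>)"
  proof (rule abelian_groupI)
    fix x assume "x \<in> carrier (A\<lparr>carrier := nucleus A\<rparr>)"
    then have "\<ominus>\<^bsub>A\<^esub> x \<in> nucleus A \<and> \<ominus>\<^bsub>A\<^esub> x \<oplus>\<^bsub>A\<^esub> x = \<zero>\<^bsub>A\<^esub>"
      using nucleus_minus nucleus_carrier M.l_neg by simp
    then show "\<exists>y\<in>carrier (A\<lparr>carrier := nucleus A\<rparr>). y \<oplus>\<^bsub>A\<lparr>carrier := nucleus A\<rparr>\<^esub> x = \<zero>\<^bsub>A\<lparr>carrier := nucleus A\<rparr>\<^esub>"
      by auto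
  qed (auto simp: nucleus_add nucleus_zero nucleus_carrier M.a_assoc M.a_comm M.a_lcomm)
  show "monoid (A\<lparr>carrier := nucleus A\<rparr>)"
  proof (rule monoidI)
    fix x y z
    assume "x \<in> carrier (A\<lparr>carrier := nucleus A\<rparr>)" "y \<in> carrier (A\<lparr>carrier := nucleus A\<rparr>)"
      "z \<in> carrier (A\<lparr>carrier := nucleus A\<rparr>)"
    then have "x \<in> nucleus A" "y \<in> carrier A" "z \<in> carrier A" by (simp_all add: nucleus_carrier)
    then show "(x \<otimes>\<^bsub>A\<lparr>carrier := nucleus A\<rparr>\<^esub> y) \<otimes>\<^bsub>A\<lparr>carrier := nucleus A\<rparr>\<^esub> z =
        x \<otimes>\<^bsub>A\<lparr>carrier := nucleus A\<rparr>\<^esub> (y \<otimes>\<^bsub>A\<lparr>carrier := nucleus A\<rparr>\<^esub> z)"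
      unfolding nucleus_iff[of x] by simp
  qed (simp_all add: nucleus_mult nucleus_one nucleus_carrier unit_left unit_right)
qed (auto simp: distrib_left distrib_right nucleus_carrier)

end

lemma subalg_nucleus:
  fixes A :: "('k, 'a) module"
  assumes A: "nonassoc_algebra F A" and S: "subalg F A S" and sub: "S \<subseteq> nucleus A"
  shows "subalg F (A\<lparr>carrier := nucleus A\<rparr>) S"
proof -
  interpret A: nonassoc_algebra F A by (rule A)
  have "subgroup S (add_monoid A)" "subgroup (nucleus A) (add_monoid A)"
    using S A.nucleus_subgroup by (auto simp: subalg_def additive_subgroup_def)
  then have "subgroup S ((add_monoid A)\<lparr>carrier := nucleus A\<rparr>)"
    using sub by (rule A.M.add.subgroup_incl)
  then have "additive_subgroup S (A\<lparr>carrier := nucleus A\<rparr>)" by (simp add: additive_subgroup_def)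
  then show ?thesis using S by (simp add: subalg_def)
qed

section \<open>Generalized Menichetti algebras\<close>

locale menichetti = galois_simple_ring D "\<lambda>j. \<sigma> ^^ j" n
  for D :: "'d ring" (structure) and \<sigma> :: "'d \<Rightarrow> 'd" and n :: nat +
  fixes k :: "nat \<Rightarrow> 'd"
  assumes k_unit: "i < n \<Longrightarrow> k i \<in> Units CR"
begin

abbreviation "\<tau> j \<equiv> \<sigma> ^^ j"
abbreviation "M \<equiv> Men D \<sigma> n k"
abbreviation "c \<equiv> men_coeff D n k"

lemma carrier_M: "carrier M = {..<n} \<rightarrow>\<^sub>E carrier D" by (simp add: Men_def)

lemma M_mem [simp]: "x \<in> carrier M \<Longrightarrow> s < n \<Longrightarrow> x s \<in> carrier D"
  by (auto simp: carrier_M)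

lemma M_eqI: "\<lbrakk>x \<in> carrier M; y \<in> carrier M; \<And>s. s < n \<Longrightarrow> x s = y s\<rbrakk> \<Longrightarrow> x = y"
  unfolding carrier_M by (rule PiE_ext) auto

lemma M_memI: "\<lbrakk>\<And>s. s < n \<Longrightarrow> f s \<in> carrier D\<rbrakk> \<Longrightarrow> (\<lambda>s\<in>{..<n}. f s) \<in> carrier M"
  by (auto simp: carrier_M)

lemma M_add: "x \<oplus>\<^bsub>M\<^esub> y = (\<lambda>s\<in>{..<n}. x s \<oplus> y s)" by (simp add: Men_def)
lemma M_zero: "\<zero>\<^bsub>M\<^esub> = (\<lambda>s\<in>{..<n}. \<zero>)" by (simp add: Men_def)
lemma M_one: "\<one>\<^bsub>M\<^esub> = (\<lambda>s\<in>{..<n}. if s = 0 then \<one> else \<zero>)" by (simp add: Men_def)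
lemma M_smult: "a \<odot>\<^bsub>M\<^esub> x = (\<lambda>s\<in>{..<n}. a \<otimes> x s)" by (simp add: Men_def)

lemma coeff_unit: assumes "i < n" "j < n" shows "c i j \<in> C" "c i j \<noteq> \<zero>"
proof -
  interpret CR: field CR by (rule CR_field)
  have u: "(\<Otimes>\<^bsub>CR\<^esub>l\<in>A. f l) \<in> Units CR" if "finite A" "\<And>l. l \<in> A \<Longrightarrow> f l \<in> Units CR" for A :: "nat set" and f
    using that
  proof (induction A)
    case (insert l A)
    have "(\<Otimes>\<^bsub>CR\<^esub>l\<in>insert l A. f l) = f l \<otimes>\<^bsub>CR\<^esub> (\<Otimes>\<^bsub>CR\<^esub>l\<in>A. f l)"
      using insert CR.Units_closed by (intro CR.finprod_insert) auto
    then show ?case using insert CR.Units_m_closed by auto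
  next
    case empty
    then show ?case using CR.Units_one_closed by (simp del: CR.Units_one_closed)
  qed
  have "c i j \<in> Units CR"
  proof (cases "i = 0 \<or> j = 0")
    case True
    then show ?thesis unfolding men_coeff_def Let_def using CR.Units_one_closed by (simp del: CR.Units_one_closed)
  next
    case False
    have "(\<Otimes>\<^bsub>CR\<^esub>l\<in>{..<j}. inv\<^bsub>CR\<^esub> k l) \<in> Units CR"
      by (rule u) (use k_unit assms in auto)
    moreover have "(\<Otimes>\<^bsub>CR\<^esub>l\<in>{..<j}. k ((i + l) mod n)) \<in> Units CR"
      by (rule u) (use k_unit n_pos in auto)
    ultimately show ?thesis
      unfolding men_coeff_def Let_def using False CR.Units_m_closed by auto
  qed
  then show "c i j \<in> C" "c i j \<noteq> \<zero>" by (auto simp: CR.field_Units)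
qed

lemma coeff_zero [simp]: "c 0 j = \<one>" "c i 0 = \<one>" by (simp_all add: men_coeff_def)

text \<open>Since i is determined by j and s, the product is a sum over j alone.\<close>

definition lix :: "nat \<Rightarrow> nat \<Rightarrow> nat" where "lix s j = (s + n - j) mod n"

lemma lix: assumes "s < n" "j < n" shows "lix s j < n" "(lix s j + j) mod n = s" "(j + lix s j) mod n = s"
  using assms n_pos by (auto simp: lix_def mod_if)

lemma lix_unique: assumes "i < n" "j < n" "(i + j) mod n = s" shows "i = lix s j"
proof (cases "i + j < n")
  case True
  then have "s + n - j = i + n" using assms by simp
  then show ?thesis using assms by (simp add: lix_def)
next
  case False
  then have "(i + j) mod n = (i + j - n) mod n" "i + j - n < n" using assms by (auto simp: le_mod_geq)
  then have "s = i + j - n" using assms(3) by simp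
  then have "s + n - j = i" using False by simp
  then show ?thesis using assms by (simp add: lix_def)
qed

lemma lix_0 [simp]: "s < n \<Longrightarrow> lix s 0 = s" by (simp add: lix_def)
lemma lix_self [simp]: "s < n \<Longrightarrow> lix s s = 0" by (simp add: lix_def)

definition mterm :: "(nat \<Rightarrow> 'd) \<Rightarrow> (nat \<Rightarrow> 'd) \<Rightarrow> nat \<Rightarrow> nat \<Rightarrow> 'd" where
  "mterm x y s j = c (lix s j) j \<otimes> \<tau> j (x (lix s j)) \<otimes> y j"

lemma mterm_closed [simp]:
  "\<lbrakk>x \<in> carrier M; y \<in> carrier M; s < n; j < n\<rbrakk> \<Longrightarrow> mterm x y s j \<in> carrier D"
  using coeff_unit lix by (auto simp: mterm_def)

lemma M_mult:
  assumes xy: "x \<in> carrier M" "y \<in> carrier M" and s: "s < n"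
  shows "(x \<otimes>\<^bsub>M\<^esub> y) s = (\<Oplus>j\<in>{..<n}. mterm x y s j)"
proof -
  let ?A = "{(i, j). i < n \<and> j < n \<and> (i + j) mod n = s}"
  let ?f = "\<lambda>j. (lix s j, j)"
  let ?g = "\<lambda>p. case p of (i, j) \<Rightarrow> c i j \<otimes> \<tau> j (x i) \<otimes> y j"
  have A: "?A = ?f ` {..<n}"
    using lix s lix_unique by (auto simp: image_iff)
  have "(x \<otimes>\<^bsub>M\<^esub> y) s = finsum D ?g ?A" using s by (simp add: Men_def)
  also have "\<dots> = (\<Oplus>j\<in>{..<n}. ?g (?f j))"
    unfolding A using coeff_unit lix s xy by (intro finsum_reindex) (auto simp: inj_on_def)
  finally show ?thesis by (simp add: mterm_def)
qed

lemma M_mult_closed: assumes "x \<in> carrier M" "y \<in> carrier M" shows "x \<otimes>\<^bsub>M\<^esub> y \<in> carrier M"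
proof -
  have "(x \<otimes>\<^bsub>M\<^esub> y) s \<in> carrier D" if "s < n" for s
    unfolding M_mult[OF assms that] using assms that by (intro finsum_closed) auto
  moreover have "(x \<otimes>\<^bsub>M\<^esub> y) s = undefined" if "\<not> s < n" for s using that by (simp add: Men_def)
  ultimately show ?thesis by (auto simp: carrier_M PiE_iff extensional_def)
qed

lemma M_add_closed: "\<lbrakk>x \<in> carrier M; y \<in> carrier M\<rbrakk> \<Longrightarrow> x \<oplus>\<^bsub>M\<^esub> y \<in> carrier M"
  unfolding M_add by (intro M_memI) simp

lemma M_smult_closed: "\<lbrakk>a \<in> carrier D; x \<in> carrier M\<rbrakk> \<Longrightarrow> a \<odot>\<^bsub>M\<^esub> x \<in> carrier M"
  unfolding M_smult by (intro M_memI) simp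

abbreviation "single \<equiv> (\<lambda>j d. \<lambda>s\<in>{..<n}. if s = j then d else \<zero>)"

lemma single_closed: "d \<in> carrier D \<Longrightarrow> single j d \<in> carrier M" by (intro M_memI) auto

lemma single_0: "men_embed D n = single 0" by (auto simp: men_embed_def fun_eq_iff)

lemma mult_single:
  assumes x: "x \<in> carrier M" and j: "j < n" and d: "d \<in> carrier D" and s: "s < n"
  shows "(x \<otimes>\<^bsub>M\<^esub> single j d) s = c (lix s j) j \<otimes> \<tau> j (x (lix s j)) \<otimes> d"
proof -
  have cc: "c (lix s i) i \<in> carrier D" "\<tau> i (x (lix s i)) \<in> carrier D" if "i < n" for i
    using coeff_unit lix[OF s that] that x by auto
  have "(x \<otimes>\<^bsub>M\<^esub> single j d) s = (\<Oplus>i\<in>{..<n}. mterm x (single j d) s i)"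
    by (rule M_mult[OF x single_closed[OF d] s])
  also have "\<dots> = (\<Oplus>i\<in>{..<n}. if j = i then c (lix s i) i \<otimes> \<tau> i (x (lix s i)) \<otimes> d else \<zero>)"
    using cc d by (intro finsum_cong') (auto simp: mterm_def)
  also have "\<dots> = c (lix s j) j \<otimes> \<tau> j (x (lix s j)) \<otimes> d"
    using j cc d by (intro finsum_singleton) auto
  finally show ?thesis .
qed

lemma single_mult:
  assumes y: "y \<in> carrier M" and i: "i < n" and d: "d \<in> carrier D" and s: "s < n"
  shows "(single i d \<otimes>\<^bsub>M\<^esub> y) s = c i (lix s i) \<otimes> \<tau> (lix s i) d \<otimes> y (lix s i)"
proof -
  have bb: "lix s (lix s i) = i"
    using lix[OF s i] i lix_unique[of i "lix s i" s] by simp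
  have eq: "lix s j = i \<longleftrightarrow> j = lix s i" if "j < n" for j
    using that bb lix[OF s that] lix_unique[of j "lix s j" s] by (auto simp: add.commute)
  have cc: "c i j \<in> carrier D" "\<tau> j d \<in> carrier D" "y j \<in> carrier D" "c (lix s j) j \<in> carrier D" if "j < n" for j
    using coeff_unit[OF i that] coeff_unit[OF lix(1)[OF s that] that] that d y by auto
  have "(single i d \<otimes>\<^bsub>M\<^esub> y) s = (\<Oplus>j\<in>{..<n}. mterm (single i d) y s j)"
    by (rule M_mult[OF single_closed[OF d] y s])
  also have "\<dots> = (\<Oplus>j\<in>{..<n}. if lix s i = j then c i j \<otimes> \<tau> j d \<otimes> y j else \<zero>)"
  proof (intro finsum_cong' refl)
    fix j assume "j \<in> {..<n}"
    then have j: "j < n" by simp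
    show "mterm (single i d) y s j = (if lix s i = j then c i j \<otimes> \<tau> j d \<otimes> y j else \<zero>)"
    proof (cases "lix s i = j")
      case True
      then have "lix s j = i" using bb by simp
      then show ?thesis using True i by (simp add: mterm_def)
    next
      case False
      then have "lix s j \<noteq> i" using eq[OF j] by auto
      then show ?thesis using False cc[OF j] lix[OF s j] j by (simp add: mterm_def)
    qed
  qed (use cc in auto)
  also have "\<dots> = c i (lix s i) \<otimes> \<tau> (lix s i) d \<otimes> y (lix s i)"
    using lix[OF s i] cc by (intro finsum_singleton) auto
  finally show ?thesis .
qed

lemma mult_embed: "\<lbrakk>x \<in> carrier M; d \<in> carrier D; s < n\<rbrakk> \<Longrightarrow> (x \<otimes>\<^bsub>M\<^esub> single 0 d) s = x s \<otimes> d"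
  using mult_single[of x 0 d s] n_pos by simp

lemma embed_mult: "\<lbrakk>x \<in> carrier M; d \<in> carrier D; s < n\<rbrakk> \<Longrightarrow> (single 0 d \<otimes>\<^bsub>M\<^esub> x) s = \<tau> s d \<otimes> x s"
  using single_mult[of x 0 d s] n_pos by simp

lemma single_mult_single:
  assumes "i < n" "j < n" "d \<in> carrier D" "e \<in> carrier D"
  shows "single i d \<otimes>\<^bsub>M\<^esub> single j e = single ((i + j) mod n) (c i j \<otimes> \<tau> j d \<otimes> e)"
proof (rule M_eqI)
  show cl: "single ((i + j) mod n) (c i j \<otimes> \<tau> j d \<otimes> e) \<in> carrier M"
    using assms coeff_unit by (intro single_closed) auto
  fix s assume s: "s < n"
  have cc: "c (lix s j) j \<in> carrier D" using coeff_unit lix[OF s] assms by auto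
  have "lix s j = i \<longleftrightarrow> s = (i + j) mod n" using lix[OF s assms(2)] lix_unique[OF assms(1,2)] by auto
  then show "(single i d \<otimes>\<^bsub>M\<^esub> single j e) s = single ((i + j) mod n) (c i j \<otimes> \<tau> j d \<otimes> e) s"
    using mult_single[OF single_closed[OF assms(3)] assms(2,4) s, of i] s assms cc lix[OF s assms(2)] by auto
qed (use assms in \<open>auto intro!: M_mult_closed single_closed\<close>)

lemma Fix_eq: "Fix = {x \<in> carrier D. \<sigma> x = x} \<inter> C" if "n > 1"
proof -
  have "(\<sigma> ^^ i) x = x" if "\<sigma> x = x" for i x using that by (induction i) auto
  note pow = this
  have one: "\<sigma> x = x" if "x \<in> Fix" for x
    using Fix_aut[OF that \<open>n > 1\<close>] by simp
  have "x \<in> Fix" if "x \<in> C" "\<sigma> x = x" for x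
    unfolding Fix_def using that(1) pow[OF that(2)] by blast
  then show ?thesis using one Fix_C C_carrier by blast
qed

theorem M_nonassoc_algebra: "nonassoc_algebra FixR M"
proof -
  have F: "field FixR" using subfield_iff(2)[OF Fix_subfield] .
  have Fc: "a \<in> carrier D" if "a \<in> Fix" for a using that by auto
  note cl = M_add_closed M_mult_closed M_smult_closed
  have one: "\<one>\<^bsub>M\<^esub> = single 0 \<one>" by (simp add: M_one)
  have zc: "\<zero>\<^bsub>M\<^esub> \<in> carrier M" unfolding M_zero by (intro M_memI) simp
  have ab: "abelian_group M"
  proof (rule abelian_groupI)
    fix x assume x: "x \<in> carrier M"
    then have "(\<lambda>s\<in>{..<n}. \<ominus> x s) \<in> carrier M" by (intro M_memI) simp
    moreover from this have "(\<lambda>s\<in>{..<n}. \<ominus> x s) \<oplus>\<^bsub>M\<^esub> x = \<zero>\<^bsub>M\<^esub>"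
      by (intro M_eqI cl x zc) (auto simp: M_add M_zero x l_neg)
    ultimately show "\<exists>y\<in>carrier M. y \<oplus>\<^bsub>M\<^esub> x = \<zero>\<^bsub>M\<^esub>" by blast
  next
    fix x y z assume xyz: "x \<in> carrier M" "y \<in> carrier M" "z \<in> carrier M"
    then show "x \<oplus>\<^bsub>M\<^esub> y \<oplus>\<^bsub>M\<^esub> z = x \<oplus>\<^bsub>M\<^esub> (y \<oplus>\<^bsub>M\<^esub> z)"
      by (intro M_eqI cl) (auto simp: M_add a_assoc)
  next
    fix x y assume xy: "x \<in> carrier M" "y \<in> carrier M"
    then show "x \<oplus>\<^bsub>M\<^esub> y = y \<oplus>\<^bsub>M\<^esub> x" by (intro M_eqI cl) (auto simp: M_add a_comm)
  next
    fix x assume "x \<in> carrier M"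
    then show "\<zero>\<^bsub>M\<^esub> \<oplus>\<^bsub>M\<^esub> x = x" by (intro M_eqI cl zc) (auto simp: M_add M_zero)
  qed (use cl zc in auto)
  have "module FixR M"
  proof (rule moduleI[OF _ ab])
    show "cring FixR" using F by (simp add: field_def domain_def)
    show "a \<odot>\<^bsub>M\<^esub> x \<in> carrier M" if "a \<in> carrier FixR" "x \<in> carrier M" for a x using that cl by auto
    show "(a \<oplus>\<^bsub>FixR\<^esub> b) \<odot>\<^bsub>M\<^esub> x = a \<odot>\<^bsub>M\<^esub> x \<oplus>\<^bsub>M\<^esub> b \<odot>\<^bsub>M\<^esub> x"
      if "a \<in> carrier FixR" "b \<in> carrier FixR" "x \<in> carrier M" for a b x
      using that by (intro M_eqI cl) (auto simp: M_add M_smult l_distr)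
    show "a \<odot>\<^bsub>M\<^esub> (x \<oplus>\<^bsub>M\<^esub> y) = a \<odot>\<^bsub>M\<^esub> x \<oplus>\<^bsub>M\<^esub> a \<odot>\<^bsub>M\<^esub> y"
      if "a \<in> carrier FixR" "x \<in> carrier M" "y \<in> carrier M" for a x y
      using that by (intro M_eqI cl) (auto simp: M_add M_smult r_distr)
    show "(a \<otimes>\<^bsub>FixR\<^esub> b) \<odot>\<^bsub>M\<^esub> x = a \<odot>\<^bsub>M\<^esub> (b \<odot>\<^bsub>M\<^esub> x)"
      if "a \<in> carrier FixR" "b \<in> carrier FixR" "x \<in> carrier M" for a b x
      using that by (intro M_eqI cl) (auto simp: M_smult m_assoc)
    show "\<one>\<^bsub>FixR\<^esub> \<odot>\<^bsub>M\<^esub> x = x" if "x \<in> carrier M" for x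
      using that by (intro M_eqI cl) (auto simp: M_smult)
  qed
  then show ?thesis
  proof (intro nonassoc_algebra.intro nonassoc_algebra_axioms.intro F cl)
    show "\<one>\<^bsub>M\<^esub> \<in> carrier M" unfolding one by (intro single_closed) simp
    then show "\<one>\<^bsub>M\<^esub> \<otimes>\<^bsub>M\<^esub> x = x" "x \<otimes>\<^bsub>M\<^esub> \<one>\<^bsub>M\<^esub> = x" if x: "x \<in> carrier M" for x
      using x unfolding one
      by (auto intro!: M_eqI M_mult_closed simp: mult_embed embed_mult simp del: restrict_apply)
  next
    fix x y z assume xyz: "x \<in> carrier M" "y \<in> carrier M" "z \<in> carrier M"
    have yz: "y \<oplus>\<^bsub>M\<^esub> z \<in> carrier M" "x \<oplus>\<^bsub>M\<^esub> y \<in> carrier M" using xyz cl by auto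
    show "x \<otimes>\<^bsub>M\<^esub> (y \<oplus>\<^bsub>M\<^esub> z) = (x \<otimes>\<^bsub>M\<^esub> y) \<oplus>\<^bsub>M\<^esub> (x \<otimes>\<^bsub>M\<^esub> z)"
    proof (rule M_eqI)
      fix s assume s: "s < n"
      have "mterm x (y \<oplus>\<^bsub>M\<^esub> z) s j = mterm x y s j \<oplus> mterm x z s j" if "j < n" for j
        using that xyz coeff_unit lix[OF s that] by (simp add: mterm_def M_add r_distr)
      then have "(\<Oplus>j\<in>{..<n}. mterm x (y \<oplus>\<^bsub>M\<^esub> z) s j) = (\<Oplus>j\<in>{..<n}. mterm x y s j \<oplus> mterm x z s j)"
        using xyz s by (intro finsum_cong') auto
      also have "\<dots> = (\<Oplus>j\<in>{..<n}. mterm x y s j) \<oplus> (\<Oplus>j\<in>{..<n}. mterm x z s j)"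
        using xyz s by (intro finsum_addf) auto
      finally show "(x \<otimes>\<^bsub>M\<^esub> (y \<oplus>\<^bsub>M\<^esub> z)) s = ((x \<otimes>\<^bsub>M\<^esub> y) \<oplus>\<^bsub>M\<^esub> (x \<otimes>\<^bsub>M\<^esub> z)) s"
        using xyz yz s M_mult by (simp add: M_add[of "x \<otimes>\<^bsub>M\<^esub> y"])
    qed (use xyz yz cl in auto)
    show "(x \<oplus>\<^bsub>M\<^esub> y) \<otimes>\<^bsub>M\<^esub> z = (x \<otimes>\<^bsub>M\<^esub> z) \<oplus>\<^bsub>M\<^esub> (y \<otimes>\<^bsub>M\<^esub> z)"
    proof (rule M_eqI)
      fix s assume s: "s < n"
      have "mterm (x \<oplus>\<^bsub>M\<^esub> y) z s j = mterm x z s j \<oplus> mterm y z s j" if "j < n" for j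
        using that xyz coeff_unit lix[OF s that] by (simp add: mterm_def M_add r_distr l_distr)
      then have "(\<Oplus>j\<in>{..<n}. mterm (x \<oplus>\<^bsub>M\<^esub> y) z s j) = (\<Oplus>j\<in>{..<n}. mterm x z s j \<oplus> mterm y z s j)"
        using xyz s by (intro finsum_cong') auto
      also have "\<dots> = (\<Oplus>j\<in>{..<n}. mterm x z s j) \<oplus> (\<Oplus>j\<in>{..<n}. mterm y z s j)"
        using xyz s by (intro finsum_addf) auto
      finally show "((x \<oplus>\<^bsub>M\<^esub> y) \<otimes>\<^bsub>M\<^esub> z) s = ((x \<otimes>\<^bsub>M\<^esub> z) \<oplus>\<^bsub>M\<^esub> (y \<otimes>\<^bsub>M\<^esub> z)) s"
        using xyz yz s M_mult by (simp add: M_add[of "x \<otimes>\<^bsub>M\<^esub> z"])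
    qed (use xyz yz cl in auto)
  next
    fix a x y assume a: "a \<in> carrier FixR" and xy: "x \<in> carrier M" "y \<in> carrier M"
    have aF: "a \<in> Fix" "a \<in> carrier D" using a by auto
    have ay: "a \<odot>\<^bsub>M\<^esub> y \<in> carrier M" "a \<odot>\<^bsub>M\<^esub> x \<in> carrier M" using aF xy cl by auto
    have comm: "d \<otimes> a = a \<otimes> d" if "d \<in> carrier D" for d using C_comm[of a d] aF that by simp
    have r: "(\<Oplus>j\<in>{..<n}. a \<otimes> mterm x y s j) = a \<otimes> (\<Oplus>j\<in>{..<n}. mterm x y s j)" if "s < n" for s
      using xy aF that by (intro finsum_rdistr[symmetric]) auto
    show "(a \<odot>\<^bsub>M\<^esub> x) \<otimes>\<^bsub>M\<^esub> y = a \<odot>\<^bsub>M\<^esub> (x \<otimes>\<^bsub>M\<^esub> y)"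
    proof (rule M_eqI)
      fix s assume s: "s < n"
      have "mterm (a \<odot>\<^bsub>M\<^esub> x) y s j = a \<otimes> mterm x y s j" if j: "j < n" for j
      proof -
        have cc: "c (lix s j) j \<in> carrier D" using coeff_unit lix[OF s j] j by auto
        have "c (lix s j) j \<otimes> (a \<otimes> \<tau> j (x (lix s j))) = a \<otimes> (c (lix s j) j \<otimes> \<tau> j (x (lix s j)))"
          using cc aF comm[OF cc] j xy lix[OF s j] by (simp flip: m_assoc)
        then show ?thesis using cc aF j xy lix[OF s j] by (simp add: mterm_def M_smult m_assoc)
      qed
      then have "(\<Oplus>j\<in>{..<n}. mterm (a \<odot>\<^bsub>M\<^esub> x) y s j) = (\<Oplus>j\<in>{..<n}. a \<otimes> mterm x y s j)"
        using xy s aF by (intro finsum_cong') auto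
      then show "((a \<odot>\<^bsub>M\<^esub> x) \<otimes>\<^bsub>M\<^esub> y) s = (a \<odot>\<^bsub>M\<^esub> (x \<otimes>\<^bsub>M\<^esub> y)) s"
        using xy ay s M_mult r by (simp add: M_smult[of a "x \<otimes>\<^bsub>M\<^esub> y"])
    qed (use xy ay cl aF in auto)
    show "x \<otimes>\<^bsub>M\<^esub> (a \<odot>\<^bsub>M\<^esub> y) = a \<odot>\<^bsub>M\<^esub> (x \<otimes>\<^bsub>M\<^esub> y)"
    proof (rule M_eqI)
      fix s assume s: "s < n"
      have "mterm x (a \<odot>\<^bsub>M\<^esub> y) s j = a \<otimes> mterm x y s j" if j: "j < n" for j
      proof -
        have cc: "c (lix s j) j \<otimes> \<tau> j (x (lix s j)) \<in> carrier D" using coeff_unit lix[OF s j] j xy by auto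
        show ?thesis using comm[OF cc] cc aF j xy by (simp add: mterm_def M_smult flip: m_assoc)
      qed
      then have "(\<Oplus>j\<in>{..<n}. mterm x (a \<odot>\<^bsub>M\<^esub> y) s j) = (\<Oplus>j\<in>{..<n}. a \<otimes> mterm x y s j)"
        using xy s aF by (intro finsum_cong') auto
      then show "(x \<otimes>\<^bsub>M\<^esub> (a \<odot>\<^bsub>M\<^esub> y)) s = (a \<odot>\<^bsub>M\<^esub> (x \<otimes>\<^bsub>M\<^esub> y)) s"
        using xy ay s M_mult r by (simp add: M_smult[of a "x \<otimes>\<^bsub>M\<^esub> y"])
    qed (use xy ay cl aF in auto)
  qed
qed

end

context menichetti begin

sublocale M: nonassoc_algebra FixR M by (rule M_nonassoc_algebra)

lemmas M_closed = M.mult_closed M_add_closed M_smult_closed single_closed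

lemma single_mult_single_eq:
  assumes "i < n" "j < n" "d \<in> carrier D" "e \<in> carrier D" "(i + j) mod n = l" "c i j \<otimes> \<tau> j d \<otimes> e = f"
  shows "single i d \<otimes>\<^bsub>M\<^esub> single j e = single l f"
  unfolding assms(5,6)[symmetric] by (rule single_mult_single[OF assms(1-4)])

lemma singles_span:
  assumes "\<zero>\<^bsub>M\<^esub> \<in> U" "\<And>x y. \<lbrakk>x \<in> U; y \<in> U\<rbrakk> \<Longrightarrow> x \<oplus>\<^bsub>M\<^esub> y \<in> U"
    and single: "\<And>j d. \<lbrakk>j < n; d \<in> carrier D\<rbrakk> \<Longrightarrow> single j d \<in> U"
  shows "carrier M \<subseteq> U"
proof
  fix x assume x: "x \<in> carrier M"
  have "(\<lambda>s\<in>{..<n}. if s < l then x s else \<zero>) \<in> U" if "l \<le> n" for l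
    using that
  proof (induction l)
    case 0
    have "(\<lambda>s\<in>{..<n}. if s < (0::nat) then x s else \<zero>) = \<zero>\<^bsub>M\<^esub>" unfolding M_zero by auto
    then show ?case using assms(1) by (simp only:)
  next
    case (Suc l)
    have eq: "(\<lambda>s\<in>{..<n}. if s < Suc l then x s else \<zero>) = single l (x l) \<oplus>\<^bsub>M\<^esub> (\<lambda>s\<in>{..<n}. if s < l then x s else \<zero>)"
      unfolding M_add using x Suc.prems by (auto simp: fun_eq_iff less_Suc_eq)
    have "single l (x l) \<in> U" using Suc.prems x by (intro single) auto
    moreover have "(\<lambda>s\<in>{..<n}. if s < l then x s else \<zero>) \<in> U" using Suc.prems by (intro Suc.IH) simp
    ultimately show ?case unfolding eq by (rule assms(2))
  qed
  moreover have "(\<lambda>s\<in>{..<n}. if s < n then x s else \<zero>) = x"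
    by (rule M_eqI[OF M_memI x]) (use x in auto)
  ultimately show "x \<in> U" by (metis order_refl)
qed

lemma mterm_embed:
  assumes xy: "x \<in> carrier M" "y \<in> carrier M" and d: "d \<in> carrier D" and s: "s < n" and j: "j < n"
  shows "mterm (single 0 d \<otimes>\<^bsub>M\<^esub> x) y s j = \<tau> s d \<otimes> mterm x y s j"
    "mterm (x \<otimes>\<^bsub>M\<^esub> single 0 d) y s j = mterm x (single 0 d \<otimes>\<^bsub>M\<^esub> y) s j"
    "mterm x (y \<otimes>\<^bsub>M\<^esub> single 0 d) s j = mterm x y s j \<otimes> d"
proof -
  let ?l = "lix s j"
  note l = lix[OF s j]
  have cl: "c ?l j \<in> carrier D" "x ?l \<in> carrier D" "y j \<in> carrier D" "\<tau> j (x ?l) \<in> carrier D"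
    "\<tau> j d \<in> carrier D" "\<tau> s d \<in> carrier D" "\<tau> ?l d \<in> carrier D"
    using coeff_unit[OF l(1) j] xy l j d s by auto
  have cc: "c ?l j \<otimes> e = e \<otimes> c ?l j" if "e \<in> carrier D" for e
    using C_comm[OF coeff_unit(1)[OF l(1) j] that] .
  have "\<tau> j (\<tau> ?l d) = \<tau> s d" using aut_comp[OF j l(1) d] l(3) by simp
  then have "mterm (single 0 d \<otimes>\<^bsub>M\<^esub> x) y s j = c ?l j \<otimes> (\<tau> s d \<otimes> \<tau> j (x ?l)) \<otimes> y j"
    using embed_mult[OF xy(1) d l(1)] cl d j l by (simp add: mterm_def)
  also have "\<dots> = (c ?l j \<otimes> \<tau> s d) \<otimes> \<tau> j (x ?l) \<otimes> y j" using cl by (simp add: m_assoc)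
  also have "\<dots> = \<tau> s d \<otimes> mterm x y s j"
    unfolding cc[OF cl(6)] mterm_def using cl by (simp add: m_assoc)
  finally show "mterm (single 0 d \<otimes>\<^bsub>M\<^esub> x) y s j = \<tau> s d \<otimes> mterm x y s j" .
  show "mterm (x \<otimes>\<^bsub>M\<^esub> single 0 d) y s j = mterm x (single 0 d \<otimes>\<^bsub>M\<^esub> y) s j"
    using mult_embed[OF xy(1) d l(1)] embed_mult[OF xy(2) d j] cl d j by (simp add: mterm_def m_assoc)
  show "mterm x (y \<otimes>\<^bsub>M\<^esub> single 0 d) s j = mterm x y s j \<otimes> d"
    using mult_embed[OF xy(2) d j] cl d by (simp add: mterm_def m_assoc)
qed

text \<open>A factor d in position 0 passes through every term of a product: on the left of x it acts on
  \<open>x s\<close> by \<open>\<tau> s d\<close>, on the right by d, and \<open>\<tau> j\<close> is multiplicative. The coefficients are central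
  and do not interfere. This holds for all of D, in particular for E.\<close>

theorem embed_nuclei:
  assumes d: "d \<in> carrier D"
  shows "single 0 d \<in> nuc_l M" "single 0 d \<in> nuc_m M" "single 0 d \<in> nuc_r M"
proof -
  note dM = single_closed[OF d, of 0]
  have sums: "(\<Oplus>j\<in>{..<n}. f j) = (\<Oplus>j\<in>{..<n}. g j)"
    if "\<And>j. j < n \<Longrightarrow> f j = g j" "\<And>j. j < n \<Longrightarrow> g j \<in> carrier D" for f g :: "nat \<Rightarrow> 'd"
    using that by (intro finsum_cong') auto
  have "(single 0 d \<otimes>\<^bsub>M\<^esub> x) \<otimes>\<^bsub>M\<^esub> y = single 0 d \<otimes>\<^bsub>M\<^esub> (x \<otimes>\<^bsub>M\<^esub> y)"
    if xy: "x \<in> carrier M" "y \<in> carrier M" for x y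
  proof (rule M_eqI)
    fix s assume s: "s < n"
    have "((single 0 d \<otimes>\<^bsub>M\<^esub> x) \<otimes>\<^bsub>M\<^esub> y) s = (\<Oplus>j\<in>{..<n}. \<tau> s d \<otimes> mterm x y s j)"
      unfolding M_mult[OF M.mult_closed[OF dM xy(1)] xy(2) s]
      using mterm_embed(1)[OF xy d s] s d xy by (intro sums) auto
    also have "\<dots> = \<tau> s d \<otimes> (\<Oplus>j\<in>{..<n}. mterm x y s j)"
      using s d xy by (intro finsum_rdistr[symmetric]) auto
    also have "\<dots> = (single 0 d \<otimes>\<^bsub>M\<^esub> (x \<otimes>\<^bsub>M\<^esub> y)) s"
      unfolding embed_mult[OF M.mult_closed[OF xy] d s] M_mult[OF xy s] ..
    finally show "((single 0 d \<otimes>\<^bsub>M\<^esub> x) \<otimes>\<^bsub>M\<^esub> y) s = (single 0 d \<otimes>\<^bsub>M\<^esub> (x \<otimes>\<^bsub>M\<^esub> y)) s" .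
  qed (use dM xy in \<open>auto intro!: M.mult_closed\<close>)
  then show "single 0 d \<in> nuc_l M" using dM by (auto simp: nuc_l_def M.associator_zero_iff)
  have "(x \<otimes>\<^bsub>M\<^esub> single 0 d) \<otimes>\<^bsub>M\<^esub> y = x \<otimes>\<^bsub>M\<^esub> (single 0 d \<otimes>\<^bsub>M\<^esub> y)"
    if xy: "x \<in> carrier M" "y \<in> carrier M" for x y
  proof (rule M_eqI)
    fix s assume s: "s < n"
    show "((x \<otimes>\<^bsub>M\<^esub> single 0 d) \<otimes>\<^bsub>M\<^esub> y) s = (x \<otimes>\<^bsub>M\<^esub> (single 0 d \<otimes>\<^bsub>M\<^esub> y)) s"
      unfolding M_mult[OF M.mult_closed[OF xy(1) dM] xy(2) s] M_mult[OF xy(1) M.mult_closed[OF dM xy(2)] s]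
      using mterm_embed(2)[OF xy d s] s d xy dM by (intro sums) (auto intro!: mterm_closed M.mult_closed)
  qed (use dM xy in \<open>auto intro!: M.mult_closed\<close>)
  then show "single 0 d \<in> nuc_m M" using dM by (auto simp: nuc_m_def M.associator_zero_iff)
  have "(x \<otimes>\<^bsub>M\<^esub> y) \<otimes>\<^bsub>M\<^esub> single 0 d = x \<otimes>\<^bsub>M\<^esub> (y \<otimes>\<^bsub>M\<^esub> single 0 d)"
    if xy: "x \<in> carrier M" "y \<in> carrier M" for x y
  proof (rule M_eqI)
    fix s assume s: "s < n"
    have "(x \<otimes>\<^bsub>M\<^esub> (y \<otimes>\<^bsub>M\<^esub> single 0 d)) s = (\<Oplus>j\<in>{..<n}. mterm x y s j \<otimes> d)"
      unfolding M_mult[OF xy(1) M.mult_closed[OF xy(2) dM] s]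
      using mterm_embed(3)[OF xy d s] s d xy by (intro sums) auto
    also have "\<dots> = (\<Oplus>j\<in>{..<n}. mterm x y s j) \<otimes> d"
      using s d xy by (intro finsum_ldistr[symmetric]) auto
    also have "\<dots> = ((x \<otimes>\<^bsub>M\<^esub> y) \<otimes>\<^bsub>M\<^esub> single 0 d) s"
      unfolding mult_embed[OF M.mult_closed[OF xy] d s] M_mult[OF xy s] ..
    finally show "((x \<otimes>\<^bsub>M\<^esub> y) \<otimes>\<^bsub>M\<^esub> single 0 d) s = (x \<otimes>\<^bsub>M\<^esub> (y \<otimes>\<^bsub>M\<^esub> single 0 d)) s" ..
  qed (use dM xy in \<open>auto intro!: M.mult_closed\<close>)
  then show "single 0 d \<in> nuc_r M" using dM by (auto simp: nuc_r_def M.associator_zero_iff)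
qed

lemma embed_nucleus: "d \<in> carrier D \<Longrightarrow> single 0 d \<in> nucleus M"
  using embed_nuclei by (simp add: nucleus_def)

lemma embed_assoc:
  assumes "d \<in> carrier D" "x \<in> carrier M" "e \<in> carrier D" "s < n"
  shows "((single 0 d \<otimes>\<^bsub>M\<^esub> x) \<otimes>\<^bsub>M\<^esub> single 0 e) s = \<tau> s d \<otimes> x s \<otimes> e"
  using mult_embed[OF M.mult_closed[OF single_closed[OF assms(1)] assms(2)] assms(3,4)] embed_mult[OF assms(2,1,4)]
  by simp

text \<open>As a bimodule over D the algebra splits into components on which C acts from the left through
  different automorphisms. Independence of these automorphisms extracts the j-th component of x, and
  simplicity of D then provides every element in the j-th position.\<close>

lemma subbimodule_component:
  assumes N: "N \<subseteq> carrier M" "\<zero>\<^bsub>M\<^esub> \<in> N" "\<And>x y. \<lbrakk>x \<in> N; y \<in> N\<rbrakk> \<Longrightarrow> x \<oplus>\<^bsub>M\<^esub> y \<in> N"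
    "\<And>d x. \<lbrakk>d \<in> carrier D; x \<in> N\<rbrakk> \<Longrightarrow> single 0 d \<otimes>\<^bsub>M\<^esub> x \<in> N"
    "\<And>d x. \<lbrakk>d \<in> carrier D; x \<in> N\<rbrakk> \<Longrightarrow> x \<otimes>\<^bsub>M\<^esub> single 0 d \<in> N"
    and x: "x \<in> N" and j: "j < n" "x j \<noteq> \<zero>" and d: "d \<in> carrier D"
  shows "single j d \<in> N"
proof -
  have xM: "x \<in> carrier M" using N x by auto
  have "(\<lambda>s\<in>{..<n}. g s \<otimes> x s) \<in> N" if "g \<in> characters" for g
    using that
  proof induction
    case (zero g)
    then have "(\<lambda>s\<in>{..<n}. g s \<otimes> x s) = \<zero>\<^bsub>M\<^esub>" using xM unfolding M_zero by auto
    then show ?case using N by simp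
  next
    case (step h c c' g)
    have cc: "c \<in> carrier D" "c' \<in> carrier D" using step by auto
    have hM: "(\<lambda>s\<in>{..<n}. h s \<otimes> x s) \<in> carrier M" by (rule subsetD[OF N(1) step.IH])
    have y: "(single 0 c \<otimes>\<^bsub>M\<^esub> x) \<otimes>\<^bsub>M\<^esub> single 0 c' \<in> N" using N x cc by auto
    have eq: "(\<lambda>s\<in>{..<n}. g s \<otimes> x s) = ((single 0 c \<otimes>\<^bsub>M\<^esub> x) \<otimes>\<^bsub>M\<^esub> single 0 c') \<oplus>\<^bsub>M\<^esub> (\<lambda>s\<in>{..<n}. h s \<otimes> x s)"
    proof (rule M_eqI)
      show "(\<lambda>s\<in>{..<n}. g s \<otimes> x s) \<in> carrier M"
        using step(4) cc xM characters_C[OF step(1)] by (intro M_memI) auto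
      show "((single 0 c \<otimes>\<^bsub>M\<^esub> x) \<otimes>\<^bsub>M\<^esub> single 0 c') \<oplus>\<^bsub>M\<^esub> (\<lambda>s\<in>{..<n}. h s \<otimes> x s) \<in> carrier M"
        using y N(1) hM by (intro M_add_closed) auto
      fix s assume s: "s < n"
      have "x s \<otimes> c' = c' \<otimes> x s" using C_comm[OF step(3), of "x s"] xM s by simp
      then have "g s \<otimes> x s = \<tau> s c \<otimes> x s \<otimes> c' \<oplus> h s \<otimes> x s"
        using step(4)[OF s] cc xM s characters_C[OF step(1) s] by (simp add: l_distr m_assoc)
      then show "(\<lambda>s\<in>{..<n}. g s \<otimes> x s) s =
          (((single 0 c \<otimes>\<^bsub>M\<^esub> x) \<otimes>\<^bsub>M\<^esub> single 0 c') \<oplus>\<^bsub>M\<^esub> (\<lambda>s\<in>{..<n}. h s \<otimes> x s)) s"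
        using s embed_assoc[OF cc(1) xM cc(2) s] by (simp add: M_add)
    qed
    show ?case unfolding eq by (rule N(3)[OF y step.IH])
  qed
  from this[OF characters_delta[OF j(1)]]
  have "(\<lambda>s\<in>{..<n}. (if s = j then \<one> else \<zero>) \<otimes> x s) \<in> N" .
  moreover have "(\<lambda>s\<in>{..<n}. (if s = j then \<one> else \<zero>) \<otimes> x s) = single j (x j)"
    using xM j by (auto simp: fun_eq_iff)
  ultimately have xj: "single j (x j) \<in> N" by simp
  let ?I = "{d \<in> carrier D. single j d \<in> N}"
  have "ideal ?I D"
  proof (rule idealI[OF ring_axioms])
    show "subgroup ?I (add_monoid D)"
    proof (rule add.subgroupI)
      have "single j \<zero> = \<zero>\<^bsub>M\<^esub>" unfolding M_zero by auto
      then show "?I \<noteq> {}" using N(2) by (auto intro!: exI[of _ \<zero>])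
    next
      fix a assume a: "a \<in> ?I"
      have "single j a \<otimes>\<^bsub>M\<^esub> single 0 (\<ominus> \<one>) \<in> N" using N a by auto
      moreover have "single j a \<otimes>\<^bsub>M\<^esub> single 0 (\<ominus> \<one>) = single j (\<ominus> a)"
      proof -
        have "c j 0 \<otimes> \<tau> 0 a \<otimes> \<ominus> \<one> = \<ominus> a" using a by (simp add: r_minus)
        moreover have "(j + 0) mod n = j" using j by simp
        ultimately show ?thesis
          using j(1) a n_pos by (intro single_mult_single_eq) auto
      qed
      ultimately show "\<ominus> a \<in> ?I" using a by simp
    next
      fix a b assume ab: "a \<in> ?I" "b \<in> ?I"
      have "single j (a \<oplus> b) = single j a \<oplus>\<^bsub>M\<^esub> single j b" unfolding M_add by auto
      then show "a \<oplus> b \<in> ?I" using ab N(3) by auto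
    qed auto
  next
    fix a u assume a: "a \<in> ?I" and u: "u \<in> carrier D"
    obtain v where v: "v \<in> carrier D" "\<tau> j v = u" using aut_surj[OF j(1) u] by blast
    have "single 0 v \<otimes>\<^bsub>M\<^esub> single j a = single j (u \<otimes> a)"
    proof -
      have "c 0 j \<otimes> \<tau> j v \<otimes> a = u \<otimes> a" using a u v by simp
      moreover have "(0 + j) mod n = j" using j by simp
      ultimately show ?thesis
        using v(1) j(1) a n_pos by (intro single_mult_single_eq) auto
    qed
    then show "u \<otimes> a \<in> ?I" using N(4)[OF v(1), of "single j a"] a u by simp
    have "single j a \<otimes>\<^bsub>M\<^esub> single 0 u = single j (a \<otimes> u)"
    proof -
      have "c j 0 \<otimes> \<tau> 0 a \<otimes> u = a \<otimes> u" using a u by simp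
      moreover have "(j + 0) mod n = j" using j by simp
      ultimately show ?thesis
        using u j(1) a n_pos by (intro single_mult_single_eq) auto
    qed
    then show "a \<otimes> u \<in> ?I" using N(5)[OF u, of "single j a"] a u by simp
  qed
  moreover have "x j \<in> ?I" using xj xM j by simp
  ultimately have "?I = carrier D" using simple j(2) unfolding simple_ring_def by blast
  then show ?thesis using d by blast
qed

lemma scalar_M: "a \<in> carrier D \<Longrightarrow> scalar M a = single 0 a"
  by (auto simp: M_smult M_one fun_eq_iff)

text \<open>If x is central, then \<open>\<tau> s d \<otimes> x s = x s \<otimes> d\<close> for all d. An element d of C moved by \<open>\<tau> s\<close> shows
  that \<open>x s = \<zero>\<close> unless s is 0, and \<open>x 0\<close> lies in C; commuting with the other basis vectors
  then makes \<open>x 0\<close> fixed.\<close>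

theorem M_central: "central FixR M"
proof -
  have "center M \<subseteq> single 0 ` Fix"
  proof
    fix x assume "x \<in> center M"
    then have x: "x \<in> carrier M" and comm: "\<And>y. y \<in> carrier M \<Longrightarrow> x \<otimes>\<^bsub>M\<^esub> y = y \<otimes>\<^bsub>M\<^esub> x"
      by (auto simp: center_def nucleus_def nuc_l_def)
    have e: "x s \<otimes> d = \<tau> s d \<otimes> x s" if "s < n" "d \<in> carrier D" for s d
      using fun_cong[OF comm[OF single_closed[OF that(2), of 0]], of s] mult_embed[OF x that(2,1)] embed_mult[OF x that(2,1)] by simp
    have z: "x s = \<zero>" if s: "s < n" "s \<noteq> 0" for s
    proof -
      obtain d where d: "d \<in> C" "\<tau> s d \<noteq> d" using aut_faithful[of s] s by auto
      have "\<tau> s d \<ominus> d \<noteq> \<zero>" using d s by (simp add: r_right_minus_eq)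
      then obtain w where w: "w \<in> C" "w \<otimes> (\<tau> s d \<ominus> d) = \<one>"
        using C_inv[of "\<tau> s d \<ominus> d"] d s by auto
      have xs: "x s \<in> carrier D" using x s by simp
      have "(\<tau> s d \<ominus> d) \<otimes> x s = \<zero>"
        using e[OF s(1), of d] C_comm[OF d(1) xs] d s xs by (simp add: a_minus_def l_distr l_minus r_neg)
      then have "w \<otimes> ((\<tau> s d \<ominus> d) \<otimes> x s) = \<zero>" using w by simp
      moreover have "(w \<otimes> (\<tau> s d \<ominus> d)) \<otimes> x s = w \<otimes> ((\<tau> s d \<ominus> d) \<otimes> x s)"
        using w(1) d s xs by (intro m_assoc) auto
      ultimately have "(w \<otimes> (\<tau> s d \<ominus> d)) \<otimes> x s = \<zero>" by simp
      then show ?thesis using w xs by simp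
    qed
    have x0: "x = single 0 (x 0)"
      by (rule M_eqI[OF x]) (use x n_pos z in \<open>auto intro!: single_closed\<close>)
    have x0D: "x 0 \<in> carrier D" using x n_pos by simp
    have "x 0 \<otimes> d = d \<otimes> x 0" if "d \<in> carrier D" for d using e[OF n_pos that] that by simp
    then have "x 0 \<in> C" by (rule center_memI[OF x0D])
    moreover have "\<tau> s (x 0) = x 0" if s: "s < n" for s
    proof -
      have o: "single s \<one> \<in> carrier M" by (rule single_closed) simp
      have "(x \<otimes>\<^bsub>M\<^esub> single s \<one>) s = (single s \<one> \<otimes>\<^bsub>M\<^esub> x) s" using comm[OF o] by simp
      moreover have "(x \<otimes>\<^bsub>M\<^esub> single s \<one>) s = \<tau> s (x 0)"
        using mult_single[OF x s one_closed s] s x0D coeff_unit by simp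
      moreover have "(single s \<one> \<otimes>\<^bsub>M\<^esub> x) s = x 0"
        using single_mult[OF x s one_closed s] s x0D n_pos by simp
      ultimately show ?thesis by simp
    qed
    ultimately have "x 0 \<in> Fix" unfolding Fix_def by blast
    then show "x \<in> single 0 ` Fix" using x0 by blast
  qed
  moreover have "single 0 a \<in> center M" if a: "a \<in> Fix" for a
  proof -
    have aD: "a \<in> carrier D" using a by simp
    have "single 0 a \<otimes>\<^bsub>M\<^esub> y = y \<otimes>\<^bsub>M\<^esub> single 0 a" if y: "y \<in> carrier M" for y
    proof (rule M_eqI)
      show "(single 0 a \<otimes>\<^bsub>M\<^esub> y) s = (y \<otimes>\<^bsub>M\<^esub> single 0 a) s" if s: "s < n" for s
        using mult_embed[OF y aD s] embed_mult[OF y aD s] C_comm[of a "y s"] a y s by simp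
    qed (use y aD in \<open>auto intro!: M_closed\<close>)
    then show ?thesis using embed_nucleus[OF aD] by (auto simp: center_def)
  qed
  moreover have "scalar M ` carrier FixR = single 0 ` Fix"
    using scalar_M by (intro image_cong) auto
  ultimately show ?thesis unfolding central_def by auto
qed

lemma M_fin_dim:
  assumes dim: "dimension m C (carrier D)"
  shows "fin_dim FixR M"
proof -
  obtain Ds where Ds: "set Ds \<subseteq> carrier D" "Span C Ds = carrier D"
    using exists_base[OF C_subfield dim] by auto
  obtain B' where B': "finite B'" "B' \<subseteq> C" "C \<subseteq> lspan FixR (self_alg CR) B'"
    using C_fin_gen_Fix by auto
  define B where "B = (\<lambda>(j, b, d). single j (b \<otimes> d)) ` ({..<n} \<times> B' \<times> set Ds)"
  have B: "finite B" "B \<subseteq> carrier M"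
  proof -
    show "finite B" using B'(1) by (simp add: B_def)
    have "single j (b \<otimes> d) \<in> carrier M" if "b \<in> B'" "d \<in> set Ds" for j b d
      using that B'(2) Ds(1) by (intro single_closed m_closed) auto
    then show "B \<subseteq> carrier M" unfolding B_def by force
  qed
  have single_add: "single j (a \<oplus> b) = single j a \<oplus>\<^bsub>M\<^esub> single j b" for j a b unfolding M_add by auto
  have sm: "f \<odot>\<^bsub>M\<^esub> single j d = single j (f \<otimes> d)" if "f \<in> carrier D" for f j d
    unfolding M_smult using that by (auto simp: fun_eq_iff)
  let ?L = "lspan FixR M B"
  have 1: "single j (b \<otimes> d) \<in> ?L" if j: "j < n" and d: "d \<in> set Ds" and b: "b \<in> lspan FixR (self_alg CR) B'" for j d b
    using b
  proof induction
    case zero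
    have z: "\<zero>\<^bsub>self_alg CR\<^esub> = \<zero>" by (simp add: self_alg_def)
    have "single j (\<zero> \<otimes> d) = \<zero>\<^bsub>M\<^esub>" using d Ds(1) unfolding M_zero by (auto simp: subset_iff)
    then show ?case unfolding z using lspan.zero[of M FixR B] by metis
  next
    case (step f b x)
    have cl: "f \<in> carrier D" "b \<in> carrier D" "d \<in> carrier D" using step(1,2) B'(2) d Ds(1) by auto
    have xC: "x \<in> C"
      using step(3) by (induction) (use B' in \<open>auto simp: self_alg_def\<close>)
    have "f \<odot>\<^bsub>M\<^esub> single j (b \<otimes> d) \<oplus>\<^bsub>M\<^esub> single j (x \<otimes> d) \<in> ?L"
    proof (rule lspan.step)
      have "(\<lambda>(j, b, d). single j (b \<otimes> d)) (j, b, d) \<in> B"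
        unfolding B_def using j d step(2) by (intro imageI) auto
      then show "single j (b \<otimes> d) \<in> B" by simp
      show "single j (x \<otimes> d) \<in> ?L" by (rule step.IH)
    qed (use step in simp)
    moreover have "single j ((f \<otimes> b \<oplus> x) \<otimes> d) = f \<odot>\<^bsub>M\<^esub> single j (b \<otimes> d) \<oplus>\<^bsub>M\<^esub> single j (x \<otimes> d)"
    proof -
      have "(f \<otimes> b \<oplus> x) \<otimes> d = f \<otimes> (b \<otimes> d) \<oplus> x \<otimes> d" using cl xC by (simp add: l_distr m_assoc)
      then show ?thesis unfolding sm[OF cl(1)] single_add[symmetric] by (rule arg_cong)
    qed
    moreover have "(f \<odot>\<^bsub>self_alg CR\<^esub> b) \<oplus>\<^bsub>self_alg CR\<^esub> x = f \<otimes> b \<oplus> x" by (simp add: self_alg_def)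
    ultimately show ?case by (simp only:)
  qed
  have 2: "single j d \<in> ?L" if j: "j < n" and d: "d \<in> carrier D" for j d
  proof -
    define V where "V = {d \<in> carrier D. \<forall>c\<in>C. single j (c \<otimes> d) \<in> ?L}"
    have "subalgebra C V D"
    proof (intro subalgebra.intro subalgebra_axioms.intro)
      show "subgroup V (add_monoid D)"
      proof (rule add.subgroupI)
        have "single j \<zero> = \<zero>\<^bsub>M\<^esub>" unfolding M_zero by auto
        then have "single j (c \<otimes> \<zero>) \<in> ?L" if "c \<in> C" for c
          using lspan.zero[of M FixR B] r_null[OF C_carrier[OF that]] by (simp only:)
        then have "\<zero> \<in> V" by (simp add: V_def)
        then show "V \<noteq> {}" by blast
      next
        fix a assume a: "a \<in> V"
        have "single j (c \<otimes> \<ominus> a) \<in> ?L" if c: "c \<in> C" for c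
        proof -
          have "single j ((\<ominus> c) \<otimes> a) \<in> ?L" using a c by (simp add: V_def)
          moreover have "\<ominus> c \<otimes> a = c \<otimes> \<ominus> a" using a c by (simp add: V_def l_minus r_minus)
          ultimately show ?thesis by metis
        qed
        then show "\<ominus> a \<in> V" using a by (simp add: V_def)
      next
        fix a b assume ab: "a \<in> V" "b \<in> V"
        have "single j (c \<otimes> (a \<oplus> b)) \<in> ?L" if c: "c \<in> C" for c
        proof -
          have "single j (c \<otimes> a) \<oplus>\<^bsub>M\<^esub> single j (c \<otimes> b) \<in> ?L"
            using ab c by (intro M.lspan_add[OF B(2)]) (auto simp: V_def)
          moreover have "c \<otimes> (a \<oplus> b) = c \<otimes> a \<oplus> c \<otimes> b" using ab c by (simp add: V_def r_distr)
          ultimately show ?thesis unfolding single_add[symmetric] by metis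
        qed
        then show "a \<oplus> b \<in> V" using ab by (simp add: V_def)
      qed (auto simp: V_def)
      fix c d assume cd: "c \<in> C" "d \<in> V"
      have "single j (c' \<otimes> (c \<otimes> d)) \<in> ?L" if c': "c' \<in> C" for c'
      proof -
        have "single j ((c' \<otimes> c) \<otimes> d) \<in> ?L" using cd c' by (simp add: V_def)
        moreover have "(c' \<otimes> c) \<otimes> d = c' \<otimes> (c \<otimes> d)" using cd c' by (simp add: V_def m_assoc)
        ultimately show ?thesis by metis
      qed
      then show "c \<otimes> d \<in> V" using cd by (simp add: V_def)
    qed
    moreover have "set Ds \<subseteq> V" using 1[OF j] B'(3) Ds(1) by (auto simp: V_def)
    ultimately have "carrier D \<subseteq> V" using subalgebra_Span_incl[OF C_subfield] Ds(2) by metis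
    then have "single j (\<one> \<otimes> d) \<in> ?L" using d unfolding V_def by blast
    then show ?thesis unfolding l_one[OF d] .
  qed
  have "carrier M \<subseteq> ?L"
    using lspan.zero[of M FixR B] M.lspan_add[OF B(2)] 2 by (rule singles_span)
  then show ?thesis unfolding fin_dim_lspan[OF M.module_axioms] using B by blast
qed

end

section \<open>The bimodule structure over an etale subalgebra\<close>

context
  fixes A :: "('a, 'c) ring_scheme" (structure) and a :: 'a and S :: "('a \<times> 'a) set"
  assumes ab: "abelian_group A"
    and cl: "\<And>p. p \<in> S \<Longrightarrow> (fst p \<otimes> a) \<otimes> snd p \<in> carrier A"
begin

interpretation A: abelian_group A by (rule ab)

lemma frag_act_superset:
  assumes "finite T" "Poly_Mapping.keys f \<subseteq> T" "T \<subseteq> S"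
  shows "frag_act A f a = (\<Oplus>p\<in>T. [Poly_Mapping.lookup f p] \<cdot> ((fst p \<otimes> a) \<otimes> snd p))"
  unfolding frag_act_def
proof (rule A.add.finprod_mono_neutral_cong_left)
  fix p assume "p \<in> T - Poly_Mapping.keys f"
  then show "[Poly_Mapping.lookup f p] \<cdot> ((fst p \<otimes> a) \<otimes> snd p) = \<zero>"
    by (simp add: in_keys_iff add_pow_def)
qed (use assms cl in \<open>auto simp: subset_iff\<close>)

lemma frag_act_closed: "Poly_Mapping.keys f \<subseteq> S \<Longrightarrow> frag_act A f a \<in> carrier A"
  unfolding frag_act_def using cl by (intro A.finsum_closed) (auto simp: subset_iff)

lemma frag_act_add:
  assumes f: "Poly_Mapping.keys f \<subseteq> S" and g: "Poly_Mapping.keys g \<subseteq> S"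
  shows "frag_act A (f + g) a = frag_act A f a \<oplus> frag_act A g a"
proof -
  let ?T = "Poly_Mapping.keys f \<union> Poly_Mapping.keys g"
  have T: "finite ?T" "?T \<subseteq> S" using f g by auto
  have c: "(fst p \<otimes> a) \<otimes> snd p \<in> carrier A" if "p \<in> ?T" for p using T that by (intro cl) auto
  have "frag_act A (f + g) a = (\<Oplus>p\<in>?T. [Poly_Mapping.lookup (f + g) p] \<cdot> ((fst p \<otimes> a) \<otimes> snd p))"
    using T keys_add[of f g] by (intro frag_act_superset) auto
  also have "\<dots> = (\<Oplus>p\<in>?T. [Poly_Mapping.lookup f p] \<cdot> ((fst p \<otimes> a) \<otimes> snd p)
      \<oplus> [Poly_Mapping.lookup g p] \<cdot> ((fst p \<otimes> a) \<otimes> snd p))"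
    using c by (intro A.finsum_cong') (auto simp: lookup_add A.add.int_pow_mult)
  also have "\<dots> = (\<Oplus>p\<in>?T. [Poly_Mapping.lookup f p] \<cdot> ((fst p \<otimes> a) \<otimes> snd p))
      \<oplus> (\<Oplus>p\<in>?T. [Poly_Mapping.lookup g p] \<cdot> ((fst p \<otimes> a) \<otimes> snd p))"
    using c by (intro A.finsum_addf) auto
  also have "\<dots> = frag_act A f a \<oplus> frag_act A g a"
    using frag_act_superset[of ?T f] frag_act_superset[of ?T g] T by auto
  finally show ?thesis .
qed

lemma frag_act_zero: "frag_act A 0 a = \<zero>"
  by (simp add: frag_act_def)

lemma frag_act_minus:
  assumes f: "Poly_Mapping.keys f \<subseteq> S" shows "frag_act A (- f) a = \<ominus> frag_act A f a"
proof -
  have "frag_act A (- f) a \<oplus> frag_act A f a = \<zero>"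
    using frag_act_add[of "- f" f] f frag_act_zero by simp
  then show ?thesis using frag_act_closed[of f] frag_act_closed[of "- f"] f by (simp add: A.minus_equality)
qed

lemma frag_act_of: "p \<in> S \<Longrightarrow> frag_act A (frag_of p) a = (fst p \<otimes> a) \<otimes> snd p"
  unfolding frag_act_def using cl[of p] by simp

end

context menichetti begin

definition emb :: "'d \<Rightarrow> nat \<Rightarrow> 'd" where "emb = single 0"

lemma emb_closed: "d \<in> carrier D \<Longrightarrow> emb d \<in> carrier M"
  by (simp add: emb_def single_closed)

lemma emb_inj: assumes "d \<in> carrier D" "e \<in> carrier D" "emb d = emb e" shows "d = e"
  using fun_cong[OF assms(3), of 0] n_pos by (simp add: emb_def)

lemma emb_add: "emb (a \<oplus> b) = emb a \<oplus>\<^bsub>M\<^esub> emb b" unfolding emb_def M_add by auto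

lemma emb_mult: "\<lbrakk>a \<in> carrier D; b \<in> carrier D\<rbrakk> \<Longrightarrow> emb a \<otimes>\<^bsub>M\<^esub> emb b = emb (a \<otimes> b)"
  unfolding emb_def using n_pos by (intro single_mult_single_eq) auto

lemma emb_smult: "f \<in> carrier D \<Longrightarrow> f \<odot>\<^bsub>M\<^esub> emb d = emb (f \<otimes> d)"
  unfolding M_smult emb_def by (auto simp: fun_eq_iff)

lemma emb_one: "emb \<one> = \<one>\<^bsub>M\<^esub>" by (simp add: emb_def M_one)
lemma emb_zero: "emb \<zero> = \<zero>\<^bsub>M\<^esub>" unfolding emb_def M_zero by auto

lemma emb_act:
  assumes "d \<in> carrier D" "x \<in> carrier M" "e \<in> carrier D"
  shows "s < n \<Longrightarrow> ((emb d \<otimes>\<^bsub>M\<^esub> x) \<otimes>\<^bsub>M\<^esub> emb e) s = \<tau> s d \<otimes> x s \<otimes> e"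
    "(emb d \<otimes>\<^bsub>M\<^esub> x) \<otimes>\<^bsub>M\<^esub> emb e \<in> carrier M"
  using embed_assoc[OF assms] assms unfolding emb_def by (auto intro!: M_closed)

end

locale menichetti_etale = menichetti D \<sigma> n k
  for D :: "'d ring" (structure) and \<sigma> n k +
  fixes E :: "'d set" and m :: nat
  assumes E_etale: "etale_subalg CR (self_alg D) E"
    and E_dim: "dimension m C E"
    and D_dim: "dimension (m * m) C (carrier D)"
begin

lemma E_subgroup: "subgroup E (add_monoid D)"
  using E_etale unfolding etale_subalg_def subalg_def additive_subgroup_def
  by (simp add: self_alg_def subgroup_def m_inv_def)

lemma E_carrier [simp]: "x \<in> E \<Longrightarrow> x \<in> carrier D"
  using subgroup.subset[OF E_subgroup] by auto

lemma E_closed: "\<one> \<in> E" "\<zero> \<in> E" "\<lbrakk>x \<in> E; y \<in> E\<rbrakk> \<Longrightarrow> x \<otimes> y \<in> E" "\<lbrakk>x \<in> E; y \<in> E\<rbrakk> \<Longrightarrow> x \<oplus> y \<in> E"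
  "x \<in> E \<Longrightarrow> \<ominus> x \<in> E" "\<lbrakk>a \<in> C; x \<in> E\<rbrakk> \<Longrightarrow> a \<otimes> x \<in> E"
  using E_etale subgroup.one_closed[OF E_subgroup] subgroup.m_closed[OF E_subgroup]
    subgroup.m_inv_closed[OF E_subgroup, folded a_inv_def]
  unfolding etale_subalg_def subalg_def by (auto simp: self_alg_def)

abbreviation "EM \<equiv> emb ` E"

lemma EM_etale: "etale FixR (M\<lparr>carrier := EM\<rparr>)" and EM_subalg: "subalg FixR M EM"
proof -
  have "additive_subgroup EM M"
  proof (rule additive_subgroup.intro, rule M.M.add.subgroupI)
    show "EM \<subseteq> carrier M" using emb_closed by auto
    show "EM \<noteq> {}" using E_closed by auto
    fix x assume "x \<in> EM"
    then obtain d where d: "d \<in> E" "x = emb d" by blast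
    have "emb (\<ominus> d) \<oplus>\<^bsub>M\<^esub> emb d = \<zero>\<^bsub>M\<^esub>"
      unfolding emb_add[symmetric] using d by (simp add: l_neg emb_zero)
    then have "\<ominus>\<^bsub>M\<^esub> x = emb (\<ominus> d)"
      using M.M.minus_equality[of "emb (\<ominus> d)" x] d emb_closed by simp
    then show "\<ominus>\<^bsub>M\<^esub> x \<in> EM" using d E_closed by blast
    fix y assume "y \<in> EM"
    then obtain d' where d': "d' \<in> E" "y = emb d'" by blast
    show "x \<oplus>\<^bsub>M\<^esub> y \<in> EM"
      unfolding d(2) d'(2) emb_add[symmetric] using E_closed(4)[OF d(1) d'(1)] by (rule imageI)
  qed
  then show sub: "subalg FixR M EM"
    unfolding subalg_def using E_closed(1,3,6) by (auto simp: emb_mult emb_smult emb_one[symmetric])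
  have inj: "inj (\<lambda>d. \<lambda>s::nat. d)" by (auto simp: inj_def fun_eq_iff)
  show "etale FixR (M\<lparr>carrier := EM\<rparr>)"
  proof (rule etale_image_Fix[OF _ inj])
    show "etale CR (self_alg D\<lparr>carrier := E\<rparr>)" using E_etale by (simp add: etale_subalg_def)
    show "nonassoc_algebra FixR (M\<lparr>carrier := EM\<rparr>)"
      by (rule subalgebra_nonassoc[OF M_nonassoc_algebra sub])
    show "inj_on emb E" using emb_inj by (auto simp: inj_on_def)
  qed (use E_closed in \<open>auto simp: emb_mult emb_add emb_one emb_smult\<close>)
qed

lemma twisted_sep_subalgebra:
  assumes G: "sep_subalgebra D C E G" and j: "j < n"
  shows "sep_subalgebra D C (\<tau> j ` E) (\<tau> j ` G)" "dimension m C (\<tau> j ` E)"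
proof -
  interpret S: sep_subalgebra D C E G by (rule G)
  interpret h: ring_hom_ring D D "\<tau> j" by (rule aut_hom[OF j])
  have hC: "\<tau> j ` C = C"
  proof
    show "\<tau> j ` C \<subseteq> C" using j by auto
    show "C \<subseteq> \<tau> j ` C"
    proof
      fix c assume c: "c \<in> C"
      have l: "lix 0 j < n" "(j + lix 0 j) mod n = 0" using lix[OF n_pos j] by auto
      have "\<tau> j (\<tau> (lix 0 j) c) = c" using aut_comp[OF j l(1), of c] l(2) c by (simp add: aut_zero)
      then show "c \<in> \<tau> j ` C" using aut_C[OF l(1) c] by (metis imageI)
    qed
  qed
  have inj: "inj_on (\<tau> j) (carrier D)" using aut_bij[OF j] by (simp add: bij_betw_def)
  show "dimension m C (\<tau> j ` E)"
    using h.inj_hom_dimension[OF C_subfield one_neq_zero _ E_dim] hC inj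
    by (metis E_carrier inj_on_subset subsetI)
  show "sep_subalgebra D C (\<tau> j ` E) (\<tau> j ` G)"
  proof (rule sep_subalgebra.intro[OF ring_axioms sep_subalgebra_axioms.intro[OF refl C_subfield]])
    show "subring (\<tau> j ` E) D" by (rule h.img_is_subring[OF S.subE])
    show "C \<subseteq> \<tau> j ` E" using hC S.KE by blast
    show "x \<otimes> y = y \<otimes> x" if "x \<in> \<tau> j ` E" "y \<in> \<tau> j ` E" for x y
    proof -
      obtain a b where "a \<in> E" "x = \<tau> j a" "b \<in> E" "y = \<tau> j b"
        using \<open>x \<in> \<tau> j ` E\<close> \<open>y \<in> \<tau> j ` E\<close> by blast
      then show ?thesis using S.commE[of a b] aut_simps(5)[OF j, of a b] aut_simps(5)[OF j, of b a] by simp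
    qed
    show "finite (\<tau> j ` G)" using S.finG by simp
    show "\<tau> j ` G \<subseteq> \<tau> j ` E" using S.GE by blast
    show "sep_elem C (\<tau> j ` E) x" if "x \<in> \<tau> j ` G" for x
    proof -
      obtain g where g: "g \<in> G" "x = \<tau> j g" using \<open>x \<in> \<tau> j ` G\<close> by blast
      obtain p w where p: "w \<in> E" "set p \<subseteq> C" "horner p g = \<zero>" "horner_deriv p g \<otimes> w = \<one>"
        using S.sepG[OF g(1)] unfolding sep_elem_def by blast
      have gD: "g \<in> carrier D" "set p \<subseteq> carrier D" "w \<in> carrier D" using g S.GE p by (auto simp: subset_iff)
      have "horner (map (\<tau> j) p) x = \<zero>"
        using h.horner_hom[OF gD(2,1)] p(3) g(2) j by simp
      moreover have "horner_deriv (map (\<tau> j) p) x \<otimes> \<tau> j w = \<one>"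
        using h.horner_deriv_hom[OF gD(2,1)] p(4) g(2) j gD(3) aut_simps(5)[OF j, of "horner_deriv p g" w]
        by simp
      moreover have "set (map (\<tau> j) p) \<subseteq> C" using p(2) j by auto
      ultimately show ?thesis unfolding sep_elem_def using p(1) by blast
    qed
    show "\<tau> j ` E \<subseteq> V" if V: "subalgebra C V D" "\<tau> j ` G \<subseteq> V" for V
    proof -
      define W where "W = {x \<in> carrier D. \<tau> j x \<in> V}"
      have Vs: "subgroup V (add_monoid D)" and Vm: "\<And>c v. \<lbrakk>c \<in> C; v \<in> V\<rbrakk> \<Longrightarrow> c \<otimes> v \<in> V"
        using V(1) by (auto simp: subalgebra_def subalgebra_axioms_def)
      have Vi: "\<ominus> v \<in> V" if "v \<in> V" for v
        using subgroup.m_inv_closed[OF Vs that, folded a_inv_def] .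
      have Va: "u \<oplus> v \<in> V" if "u \<in> V" "v \<in> V" for u v
        using subgroup.m_closed[OF Vs that] by simp
      have V0: "\<zero> \<in> V" using subgroup.one_closed[OF Vs] by simp
      have "subalgebra C W D"
      proof (intro subalgebra.intro subalgebra_axioms.intro)
        show "subgroup W (add_monoid D)"
        proof (rule add.subgroupI)
          show "W \<noteq> {}" using V0 j by (auto simp: W_def intro!: exI[of _ \<zero>])
        qed (use Vi Va j in \<open>auto simp: W_def\<close>)
        show "c \<otimes> v \<in> W" if "c \<in> C" "v \<in> W" for c v
          using that Vm j by (auto simp: W_def)
      qed
      moreover have "G \<subseteq> W" using V(2) S.GE by (auto simp: W_def)
      ultimately have "E \<subseteq> W" by (rule S.genG)
      then show ?thesis by (auto simp: W_def)
    qed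
  qed
qed

abbreviation "EA \<equiv> M\<lparr>carrier := EM\<rparr>"
abbreviation "GF \<equiv> free_Abelian_group (EM \<times> EM)"
abbreviation "Rels \<equiv> tensor_relations FixR EA EA"
definition H where "H = generate GF Rels"
definition T :: "'d \<Rightarrow> 'd \<Rightarrow> ((nat \<Rightarrow> 'd) \<times> (nat \<Rightarrow> 'd)) \<Rightarrow>\<^sub>0 int" where
  "T u v = frag_of (emb u, emb v)"

interpretation GF: comm_group GF by (rule abelian_free_Abelian_group)

lemma Rels_cases:
  assumes "r \<in> Rels"
  obtains (left) u u' v where "u \<in> E" "u' \<in> E" "v \<in> E" "r = T (u \<oplus> u') v - T u v - T u' v"
  | (right) u v v' where "u \<in> E" "v \<in> E" "v' \<in> E" "r = T u (v \<oplus> v') - T u v - T u v'"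
  | (scal) f u v where "f \<in> Fix" "u \<in> E" "v \<in> E" "r = T (f \<otimes> u) v - T u (f \<otimes> v)"
  using assms unfolding tensor_relations_def T_def
  by (auto simp: emb_add emb_smult)

lemma Rels_I:
  assumes "u \<in> E" "v \<in> E"
  shows "u' \<in> E \<Longrightarrow> T (u \<oplus> u') v - T u v - T u' v \<in> Rels"
    "v' \<in> E \<Longrightarrow> T u (v \<oplus> v') - T u v - T u v' \<in> Rels"
    "f \<in> Fix \<Longrightarrow> T (f \<otimes> u) v - T u (f \<otimes> v) \<in> Rels"
proof -
  have U: "emb u \<in> carrier EA" "emb v \<in> carrier EA" using assms by auto
  show "T (u \<oplus> u') v - T u v - T u' v \<in> Rels" if u': "u' \<in> E"
  proof -
    have U': "emb u' \<in> carrier EA" using u' by auto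
    have e: "T (u \<oplus> u') v - T u v - T u' v =
        frag_of (emb u \<oplus>\<^bsub>EA\<^esub> emb u', emb v) - frag_of (emb u, emb v) - frag_of (emb u', emb v)"
      by (simp add: T_def emb_add)
    show ?thesis unfolding tensor_relations_def e using U U' by blast
  qed
  show "T u (v \<oplus> v') - T u v - T u v' \<in> Rels" if v': "v' \<in> E"
  proof -
    have U': "emb v' \<in> carrier EA" using v' by auto
    have e: "T u (v \<oplus> v') - T u v - T u v' =
        frag_of (emb u, emb v \<oplus>\<^bsub>EA\<^esub> emb v') - frag_of (emb u, emb v) - frag_of (emb u, emb v')"
      by (simp add: T_def emb_add)
    show ?thesis unfolding tensor_relations_def e using U U' by blast
  qed
  show "T (f \<otimes> u) v - T u (f \<otimes> v) \<in> Rels" if f: "f \<in> Fix"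
  proof -
    have e: "T (f \<otimes> u) v - T u (f \<otimes> v) = frag_of (f \<odot>\<^bsub>EA\<^esub> emb u, emb v) - frag_of (emb u, f \<odot>\<^bsub>EA\<^esub> emb v)"
      using f by (simp add: T_def emb_smult)
    have "f \<in> carrier FixR" using f by simp
    then show ?thesis unfolding tensor_relations_def e using U by blast
  qed
qed

lemma T_carrier: "\<lbrakk>u \<in> E; v \<in> E\<rbrakk> \<Longrightarrow> T u v \<in> carrier GF" by (simp add: T_def)

lemma GF_diff: "\<lbrakk>x \<in> carrier GF; y \<in> carrier GF\<rbrakk> \<Longrightarrow> x - y \<in> carrier GF"
proof -
  assume xy: "x \<in> carrier GF" "y \<in> carrier GF"
  then have "x - y = x \<otimes>\<^bsub>GF\<^esub> inv\<^bsub>GF\<^esub> y" by simp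
  then show ?thesis using GF.m_closed[OF xy(1) GF.inv_closed[OF xy(2)]] by argo
qed

lemma Rels_carrier: "Rels \<subseteq> carrier GF"
proof
  fix r assume "r \<in> Rels"
  then show "r \<in> carrier GF"
    by (cases rule: Rels_cases) (auto intro!: GF_diff T_carrier E_closed simp del: carrier_free_Abelian_group_iff)
qed

lemma H_subgroup: "subgroup H GF" unfolding H_def by (rule GF.generate_is_subgroup[OF Rels_carrier])

lemma H_closed: "0 \<in> H" "\<lbrakk>x \<in> H; y \<in> H\<rbrakk> \<Longrightarrow> x + y \<in> H" "x \<in> H \<Longrightarrow> - x \<in> H" "\<lbrakk>x \<in> H; y \<in> H\<rbrakk> \<Longrightarrow> x - y \<in> H"
  "x \<in> H \<Longrightarrow> x \<in> carrier GF"
proof -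
  show c: "x \<in> carrier GF" if "x \<in> H" for x using subgroup.subset[OF H_subgroup] that by blast
  show "0 \<in> H" using subgroup.one_closed[OF H_subgroup] by simp
  show p: "x + y \<in> H" if "x \<in> H" "y \<in> H" for x y using subgroup.m_closed[OF H_subgroup that] by simp
  show i: "- x \<in> H" if "x \<in> H" for x
    using subgroup.m_inv_closed[OF H_subgroup that] c[OF that] by simp
  show "x - y \<in> H" if "x \<in> H" "y \<in> H" for x y using p[OF that(1) i[OF that(2)]] by simp
qed

lemma Rels_H: "r \<in> Rels \<Longrightarrow> r \<in> H" unfolding H_def by (rule generate.incl)

lemma act_closed: "\<lbrakk>x \<in> carrier M; p \<in> EM \<times> EM\<rbrakk> \<Longrightarrow> (fst p \<otimes>\<^bsub>M\<^esub> x) \<otimes>\<^bsub>M\<^esub> snd p \<in> carrier M"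
  using emb_act(2) by auto

lemma frag_act_M:
  assumes "x \<in> carrier M"
  shows "f \<in> carrier GF \<Longrightarrow> frag_act M f x \<in> carrier M"
    "\<lbrakk>f \<in> carrier GF; g \<in> carrier GF\<rbrakk> \<Longrightarrow> frag_act M (f + g) x = frag_act M f x \<oplus>\<^bsub>M\<^esub> frag_act M g x"
    "f \<in> carrier GF \<Longrightarrow> frag_act M (- f) x = \<ominus>\<^bsub>M\<^esub> frag_act M f x"
    "\<lbrakk>u \<in> E; v \<in> E\<rbrakk> \<Longrightarrow> frag_act M (T u v) x = (emb u \<otimes>\<^bsub>M\<^esub> x) \<otimes>\<^bsub>M\<^esub> emb v"
    "frag_act M 0 x = \<zero>\<^bsub>M\<^esub>"
proof -
  note a = M.M.abelian_group_axioms act_closed[OF assms]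
  show "f \<in> carrier GF \<Longrightarrow> frag_act M f x \<in> carrier M"
    using frag_act_closed[OF a] by simp
  show "\<lbrakk>f \<in> carrier GF; g \<in> carrier GF\<rbrakk> \<Longrightarrow> frag_act M (f + g) x = frag_act M f x \<oplus>\<^bsub>M\<^esub> frag_act M g x"
    using frag_act_add[OF a] by simp
  show "f \<in> carrier GF \<Longrightarrow> frag_act M (- f) x = \<ominus>\<^bsub>M\<^esub> frag_act M f x"
    using frag_act_minus[OF a] by simp
  show "\<lbrakk>u \<in> E; v \<in> E\<rbrakk> \<Longrightarrow> frag_act M (T u v) x = (emb u \<otimes>\<^bsub>M\<^esub> x) \<otimes>\<^bsub>M\<^esub> emb v"
    using frag_act_of[OF a] by (simp add: T_def)
  show "frag_act M 0 x = \<zero>\<^bsub>M\<^esub>" using frag_act_zero[OF a] .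
qed

lemma frag_act_H:
  assumes x: "x \<in> carrier M" and h: "h \<in> H"
  shows "frag_act M h x = \<zero>\<^bsub>M\<^esub>"
proof -
  note fa = frag_act_M[OF x]
  have d: "frag_act M (f - g) x = \<zero>\<^bsub>M\<^esub>" if "f \<in> carrier GF" "g \<in> carrier GF" "frag_act M f x = frag_act M g x" for f g
  proof -
    have "- g \<in> carrier GF" using that(2) by simp
    then have "frag_act M (f + - g) x = frag_act M g x \<oplus>\<^bsub>M\<^esub> \<ominus>\<^bsub>M\<^esub> frag_act M g x"
      using fa(2)[of f "- g"] fa(3)[of g] that by simp
    then show ?thesis using M.M.r_neg[OF fa(1)[OF that(2)]] by simp
  qed
  have rel: "frag_act M r x = \<zero>\<^bsub>M\<^esub>" if "r \<in> Rels" for r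
    using that
  proof (cases rule: Rels_cases)
    case (left u u' v)
    have "frag_act M (T (u \<oplus> u') v) x = frag_act M (T u v + T u' v) x"
    proof -
      have "(emb (u \<oplus> u') \<otimes>\<^bsub>M\<^esub> x) \<otimes>\<^bsub>M\<^esub> emb v = ((emb u \<otimes>\<^bsub>M\<^esub> x) \<otimes>\<^bsub>M\<^esub> emb v) \<oplus>\<^bsub>M\<^esub> ((emb u' \<otimes>\<^bsub>M\<^esub> x) \<otimes>\<^bsub>M\<^esub> emb v)"
        unfolding emb_add using left x emb_closed by (simp add: M.distrib_right M.mult_closed)
      then show ?thesis using left fa(2)[of "T u v" "T u' v"] fa(4) E_closed T_carrier by simp
    qed
    then have "frag_act M (T (u \<oplus> u') v - (T u v + T u' v)) x = \<zero>\<^bsub>M\<^esub>"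
      using left E_closed T_carrier GF.m_closed[of "T u v" "T u' v"] by (intro d) auto
    then show ?thesis unfolding left(4) diff_diff_add .
  next
    case (right u v v')
    have "frag_act M (T u (v \<oplus> v')) x = frag_act M (T u v + T u v') x"
    proof -
      have "(emb u \<otimes>\<^bsub>M\<^esub> x) \<otimes>\<^bsub>M\<^esub> emb (v \<oplus> v') = ((emb u \<otimes>\<^bsub>M\<^esub> x) \<otimes>\<^bsub>M\<^esub> emb v) \<oplus>\<^bsub>M\<^esub> ((emb u \<otimes>\<^bsub>M\<^esub> x) \<otimes>\<^bsub>M\<^esub> emb v')"
        unfolding emb_add using right x emb_closed by (simp add: M.distrib_left M.mult_closed)
      then show ?thesis using right fa(2)[of "T u v" "T u v'"] fa(4) E_closed T_carrier by simp
    qed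
    then have "frag_act M (T u (v \<oplus> v') - (T u v + T u v')) x = \<zero>\<^bsub>M\<^esub>"
      using right E_closed T_carrier GF.m_closed[of "T u v" "T u v'"] by (intro d) auto
    then show ?thesis unfolding right(4) diff_diff_add .
  next
    case (scal f u v)
    have fE: "f \<otimes> u \<in> E" "f \<otimes> v \<in> E" using scal E_closed(6) Fix_C by auto
    have "(emb (f \<otimes> u) \<otimes>\<^bsub>M\<^esub> x) \<otimes>\<^bsub>M\<^esub> emb v = (emb u \<otimes>\<^bsub>M\<^esub> x) \<otimes>\<^bsub>M\<^esub> emb (f \<otimes> v)"
      using scal x emb_closed M.scalar_left[of f] M.scalar_right[of f]
      by (simp add: emb_smult[symmetric] M.mult_closed)
    then have "frag_act M (T (f \<otimes> u) v) x = frag_act M (T u (f \<otimes> v)) x"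
      using scal fE fa(4) by simp
    then show ?thesis unfolding scal(4) using scal fE T_carrier by (intro d) auto
  qed
  have "h \<in> carrier GF \<and> frag_act M h x = \<zero>\<^bsub>M\<^esub>" using h unfolding H_def
  proof induction
    case one then show ?case using fa(5) by simp
  next
    case (incl h) then show ?case using rel Rels_carrier by blast
  next
    case (inv h)
    then have hc: "h \<in> carrier GF" using Rels_carrier by blast
    then show ?case using fa(3)[OF hc] rel[OF inv] by simp
  next
    case (eng h1 h2)
    then show ?case using fa(2)[of h1 h2] GF.m_closed[of h1 h2] by simp
  qed
  then show ?thesis by simp
qed

abbreviation "TP \<equiv> tensor FixR EA EA"

lemma TP_carrier: "t \<in> carrier TP \<longleftrightarrow> (\<exists>f\<in>carrier GF. t = H #>\<^bsub>GF\<^esub> f)"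
  by (auto simp: tensor_def Let_def FactGroup_def RCOSETS_def H_def)

lemma TP_one: "\<one>\<^bsub>TP\<^esub> = H"
  by (simp add: tensor_def Let_def FactGroup_def H_def)

lemma tensor_act_coset:
  assumes f: "f \<in> carrier GF" and x: "x \<in> carrier M"
  shows "tensor_act M (H #>\<^bsub>GF\<^esub> f) x = frag_act M f x"
proof -
  have eq: "frag_act M g x = frag_act M f x" if "g \<in> H #>\<^bsub>GF\<^esub> f" for g
  proof -
    obtain h where h: "h \<in> H" "g = h + f"
      using \<open>g \<in> H #>\<^bsub>GF\<^esub> f\<close> by (auto simp: r_coset_def)
    then show ?thesis
      using frag_act_M(2)[OF x H_closed(5)[OF h(1)] f] frag_act_H[OF x h(1)] frag_act_M(1)[OF x f] by simp
  qed
  have "f \<in> H #>\<^bsub>GF\<^esub> f" using H_closed(1) by (force simp: r_coset_def)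
  then have "(\<lambda>_. frag_act M f x) ` (H #>\<^bsub>GF\<^esub> f) = {frag_act M f x}" by (rule image_constant)
  moreover have "(\<lambda>g. frag_act M g x) ` (H #>\<^bsub>GF\<^esub> f) = (\<lambda>_. frag_act M f x) ` (H #>\<^bsub>GF\<^esub> f)"
    by (rule image_cong[OF refl eq])
  ultimately have "(\<lambda>g. frag_act M g x) ` (H #>\<^bsub>GF\<^esub> f) = {frag_act M f x}" by (rule trans[rotated])
  then show ?thesis unfolding tensor_act_def by (simp only: the_elem_eq)
qed

end


section \<open>Semiassociativity\<close>

context menichetti_etale begin

interpretation GF: comm_group GF by (rule abelian_free_Abelian_group)

text \<open>In position j the bimodule is D with \<open>\<tau> j ` E\<close> acting from the left and E from the right, two
  separable subalgebras of the same dimension, so every component has a cyclic vector.\<close>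

lemma component_cyclic_vectors:
  "\<exists>a\<in>carrier M. \<forall>j<n. bspan (\<tau> j ` E) E (a j) = carrier D"
proof -
  obtain G where G: "sep_subalgebra D C E G"
    using etale_sep_subalgebra[OF simple E_etale E_dim] by blast
  have "\<exists>a\<in>carrier D. bspan (\<tau> j ` E) E a = carrier D" if j: "j < n" for j
  proof -
    interpret two_sep_subalgebras D C "\<tau> j ` E" "\<tau> j ` G" E G
      by (intro two_sep_subalgebras.intro twisted_sep_subalgebra(1)[OF G j] G)
    show ?thesis by (rule cyclic_vector[OF simple D_dim twisted_sep_subalgebra(2)[OF G j] E_dim])
  qed
  then obtain a where a: "\<And>j. j < n \<Longrightarrow> a j \<in> carrier D \<and> bspan (\<tau> j ` E) E (a j) = carrier D" by metis
  have "(\<lambda>j\<in>{..<n}. a j) \<in> carrier M" using a by (intro M_memI) auto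
  moreover have "bspan (\<tau> j ` E) E ((\<lambda>j\<in>{..<n}. a j) j) = carrier D" if "j < n" for j
    using a[OF that] that by simp
  ultimately show ?thesis by blast
qed

text \<open>The action of \<open>C \<otimes> C\<close> inside \<open>E \<otimes> E\<close> separates the components, so a vector whose components
  are all cyclic is itself cyclic.\<close>

lemma EM_cyclic: "cyclic_bimodule FixR M EM"
proof -
  obtain a where a: "a \<in> carrier M" and cyc: "\<And>j. j < n \<Longrightarrow> bspan (\<tau> j ` E) E (a j) = carrier D"
    using component_cyclic_vectors by blast
  define W where "W = {frag_act M f a |f. f \<in> carrier GF}"
  note fa = frag_act_M[OF a]
  have W_M: "W \<subseteq> carrier M" using fa(1) by (auto simp: W_def)
  have W_zero: "\<zero>\<^bsub>M\<^esub> \<in> W" unfolding W_def using fa(5) GF.one_closed by (metis (mono_tags, lifting) mem_Collect_eq one_free_Abelian_group)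
  have W_add: "x \<oplus>\<^bsub>M\<^esub> y \<in> W" if "x \<in> W" "y \<in> W" for x y
  proof -
    obtain f g where fg: "f \<in> carrier GF" "g \<in> carrier GF" "x = frag_act M f a" "y = frag_act M g a"
      using \<open>x \<in> W\<close> \<open>y \<in> W\<close> unfolding W_def by blast
    have "f + g \<in> carrier GF" using GF.m_closed[OF fg(1,2)] by simp
    then show ?thesis unfolding W_def fg(3,4) fa(2)[OF fg(1,2), symmetric] by blast
  qed
  have W_act: "(\<lambda>s\<in>{..<n}. \<tau> s u \<otimes> a s \<otimes> v) \<in> W" if uv: "u \<in> E" "v \<in> E" for u v
  proof -
    have "(emb u \<otimes>\<^bsub>M\<^esub> a) \<otimes>\<^bsub>M\<^esub> emb v = (\<lambda>s\<in>{..<n}. \<tau> s u \<otimes> a s \<otimes> v)"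
      using emb_act[OF E_carrier[OF uv(1)] a E_carrier[OF uv(2)]] uv a
      by (intro M_eqI M_memI) auto
    then show ?thesis unfolding W_def using fa(4)[OF uv] T_carrier[OF uv] by (metis (mono_tags, lifting) mem_Collect_eq)
  qed
  have sumW: "(\<lambda>s\<in>{..<n}. x s \<oplus> y s) \<in> W" if "(\<lambda>s\<in>{..<n}. x s) \<in> W" "(\<lambda>s\<in>{..<n}. y s) \<in> W" for x y
  proof -
    have "(\<lambda>s\<in>{..<n}. x s) \<oplus>\<^bsub>M\<^esub> (\<lambda>s\<in>{..<n}. y s) = (\<lambda>s\<in>{..<n}. x s \<oplus> y s)" unfolding M_add by auto
    then show ?thesis using W_add[OF that] by (simp only:)
  qed
  have char: "(\<lambda>s\<in>{..<n}. g s \<otimes> (\<tau> s u \<otimes> a s \<otimes> v)) \<in> W" if uv: "u \<in> E" "v \<in> E" and g: "g \<in> characters" for u v g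
    using g
  proof induction
    case (zero g)
    have "(\<lambda>s\<in>{..<n}. g s \<otimes> (\<tau> s u \<otimes> a s \<otimes> v)) = \<zero>\<^bsub>M\<^esub>"
      unfolding M_zero using zero uv a by auto
    then show ?case using W_zero by (simp only:)
  next
    case (step h b b' g)
    have E': "b \<otimes> u \<in> E" "b' \<otimes> v \<in> E" using step uv E_closed(6) by auto
    have "g s \<otimes> (\<tau> s u \<otimes> a s \<otimes> v) = \<tau> s (b \<otimes> u) \<otimes> a s \<otimes> (b' \<otimes> v) \<oplus> h s \<otimes> (\<tau> s u \<otimes> a s \<otimes> v)"
      if s: "s < n" for s
    proof -
      have cl: "\<tau> s b \<in> carrier D" "b' \<in> carrier D" "h s \<in> carrier D" "\<tau> s u \<in> carrier D" "v \<in> carrier D"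
        "a s \<in> carrier D" "b \<in> carrier D" "u \<in> carrier D"
        using step(2,3) uv a s characters_C[OF step(1) s] by auto
      have "b' \<otimes> (\<tau> s u \<otimes> a s) = (\<tau> s u \<otimes> a s) \<otimes> b'" using cl by (intro C_comm[OF step(3)]) auto
      then have "\<tau> s b \<otimes> b' \<otimes> (\<tau> s u \<otimes> a s \<otimes> v) = \<tau> s b \<otimes> ((\<tau> s u \<otimes> a s) \<otimes> b') \<otimes> v"
        using cl by (metis m_assoc m_closed)
      then show ?thesis using cl s step(4)[OF s] by (simp add: l_distr m_assoc)
    qed
    then have eq: "(\<lambda>s\<in>{..<n}. g s \<otimes> (\<tau> s u \<otimes> a s \<otimes> v)) =
      (\<lambda>s\<in>{..<n}. \<tau> s (b \<otimes> u) \<otimes> a s \<otimes> (b' \<otimes> v) \<oplus> h s \<otimes> (\<tau> s u \<otimes> a s \<otimes> v))"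
      by (intro restrict_ext) simp
    show ?case unfolding eq by (rule sumW[OF W_act[OF E'] step.IH])
  qed
  have single_W: "single j d \<in> W" if j: "j < n" and d: "d \<in> carrier D" for j d
  proof -
    have "d \<in> bspan (\<tau> j ` E) E (a j)" using cyc[OF j] d by simp
    then show ?thesis
    proof induction
      case zero
      have "single j \<zero> = \<zero>\<^bsub>M\<^esub>" unfolding M_zero by auto
      then show ?case using W_zero by (simp only:)
    next
      case (step u' v z)
      then obtain u where u: "u \<in> E" "u' = \<tau> j u" by blast
      have "(\<lambda>s\<in>{..<n}. (if s = j then \<one> else \<zero>) \<otimes> (\<tau> s u \<otimes> a s \<otimes> v)) \<in> W"
        by (rule char[OF u(1) step(2) characters_delta[OF j]])
      moreover have "(\<lambda>s\<in>{..<n}. (if s = j then \<one> else \<zero>) \<otimes> (\<tau> s u \<otimes> a s \<otimes> v)) = single j (u' \<otimes> a j \<otimes> v)"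
        using u step(2) a by (intro restrict_ext) auto
      ultimately have "single j (u' \<otimes> a j \<otimes> v) \<in> W" by (simp only:)
      moreover have "single j (u' \<otimes> a j \<otimes> v \<oplus> z) = single j (u' \<otimes> a j \<otimes> v) \<oplus>\<^bsub>M\<^esub> single j z"
        unfolding M_add by auto
      ultimately show ?case using W_add[OF _ step.IH] by (simp only:)
    qed
  qed
  have "carrier M = W" using singles_span[OF W_zero W_add single_W] W_M by blast
  also have "W = (\<lambda>t. tensor_act M t a) ` carrier TP"
  proof
    show "W \<subseteq> (\<lambda>t. tensor_act M t a) ` carrier TP"
    proof
      fix w assume "w \<in> W"
      then obtain f where f: "f \<in> carrier GF" "w = frag_act M f a" unfolding W_def by blast
      have "H #>\<^bsub>GF\<^esub> f \<in> carrier TP" unfolding TP_carrier by (rule bexI[where x = f, OF _ f(1)]) (rule refl)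
      moreover have "w = tensor_act M (H #>\<^bsub>GF\<^esub> f) a" unfolding f(2) tensor_act_coset[OF f(1) a] ..
      ultimately show "w \<in> (\<lambda>t. tensor_act M t a) ` carrier TP" by (intro image_eqI)
    qed
    show "(\<lambda>t. tensor_act M t a) ` carrier TP \<subseteq> W"
    proof
      fix w assume "w \<in> (\<lambda>t. tensor_act M t a) ` carrier TP"
      then obtain t where t: "t \<in> carrier TP" "w = tensor_act M t a" by (rule imageE)
      obtain f where f: "f \<in> carrier GF" "t = H #>\<^bsub>GF\<^esub> f" using TP_carrier[THEN iffD1, OF t(1)] by (elim bexE)
      show "w \<in> W" unfolding t(2) f(2) tensor_act_coset[OF f(1) a] unfolding W_def by (rule CollectI, rule exI[of _ f]) (use f(1) in simp)
    qed
  qed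
  finally show ?thesis unfolding cyclic_bimodule_def Let_def using a by blast
qed

lemma T_zero: "v \<in> E \<Longrightarrow> T \<zero> v \<in> H" "u \<in> E \<Longrightarrow> T u \<zero> \<in> H"
proof -
  show "T \<zero> v \<in> H" if v: "v \<in> E"
    using H_closed(3)[OF Rels_H[OF Rels_I(1)[OF E_closed(2) v E_closed(2)]]] by simp
  show "T u \<zero> \<in> H" if u: "u \<in> E"
    using H_closed(3)[OF Rels_H[OF Rels_I(2)[OF u E_closed(2) E_closed(2)]]] by simp
qed

lemma T_minus: "\<lbrakk>u \<in> E; v \<in> E\<rbrakk> \<Longrightarrow> T (\<ominus> u) v + T u v \<in> H"
proof -
  assume uv: "u \<in> E" "v \<in> E"
  have "T (\<ominus> u \<oplus> u) v - T (\<ominus> u) v - T u v \<in> H"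
    by (rule Rels_H[OF Rels_I(1)[OF E_closed(5)[OF uv(1)] uv(2,1)]])
  from H_closed(4)[OF T_zero(1)[OF uv(2)] this] have "T \<zero> v - (T \<zero> v - T (\<ominus> u) v - T u v) \<in> H"
    using uv by (simp add: l_neg)
  then show ?thesis by (simp add: algebra_simps)
qed

lemma T_finsum:
  assumes "finite I" "\<And>i. i \<in> I \<Longrightarrow> u i \<in> E" "v \<in> E"
  shows "(\<Oplus>i\<in>I. u i) \<in> E \<and> T (\<Oplus>i\<in>I. u i) v - (\<Sum>i\<in>I. T (u i) v) \<in> H"
  using assms(1,2)
proof (induction I)
  case empty
  then show ?case using T_zero(1)[OF assms(3)] E_closed(2) by simp
next
  case (insert i I)
  have s: "(\<Oplus>i\<in>insert i I. u i) = u i \<oplus> (\<Oplus>i\<in>I. u i)"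
    using insert by (intro finsum_insert) auto
  have IH: "(\<Oplus>i\<in>I. u i) \<in> E" "T (\<Oplus>i\<in>I. u i) v - (\<Sum>i\<in>I. T (u i) v) \<in> H" using insert by auto
  have ui: "u i \<in> E" using insert.prems by simp
  have "T (u i \<oplus> (\<Oplus>i\<in>I. u i)) v - T (u i) v - T (\<Oplus>i\<in>I. u i) v \<in> H"
    by (rule Rels_H[OF Rels_I(1)[OF ui assms(3) IH(1)]])
  from H_closed(2)[OF this IH(2)]
  have "T (u i \<oplus> (\<Oplus>i\<in>I. u i)) v - (T (u i) v + (\<Sum>i\<in>I. T (u i) v)) \<in> H" by (simp add: algebra_simps)
  then show ?case unfolding s using insert(1,2) E_closed(4)[OF ui IH(1)] by simp
qed

definition represents :: "nat set \<Rightarrow> (nat \<Rightarrow> 'd) \<Rightarrow> (nat \<Rightarrow> 'd) \<Rightarrow> ((nat \<Rightarrow> 'd) \<times> (nat \<Rightarrow> 'd) \<Rightarrow>\<^sub>0 int) \<Rightarrow> bool" where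
  "represents I b y f \<longleftrightarrow> finite I \<and> (\<forall>i\<in>I. b i \<in> E \<and> y i \<in> E) \<and> f - (\<Sum>i\<in>I. T (b i) (y i)) \<in> H"

text \<open>Negative coefficients are absorbed into the left factors, so that a tensor becomes a sum of pure
  tensors. This form is what the minimality argument below needs.\<close>

lemma exists_representation:
  assumes "f \<in> carrier GF"
  shows "\<exists>I b y. represents I b y f"
proof -
  define repr where "repr f ps \<longleftrightarrow> set ps \<subseteq> E \<times> E \<and> f - (\<Sum>(u, v)\<leftarrow>ps. T u v) \<in> H" for f ps
  have negate: "\<exists>rs. set rs \<subseteq> E \<times> E \<and> (\<Sum>(u, v)\<leftarrow>rs. T u v) + (\<Sum>(u, v)\<leftarrow>qs. T u v) \<in> H"
    if "set qs \<subseteq> E \<times> E" for qs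
    using that
  proof (induction qs)
    case Nil
    then show ?case using H_closed(1) by (intro exI[of _ "[]"]) simp
  next
    case (Cons p qs)
    obtain u v where p: "p = (u, v)" "u \<in> E" "v \<in> E" using Cons.prems by auto
    obtain rs where rs: "set rs \<subseteq> E \<times> E" "(\<Sum>(u, v)\<leftarrow>rs. T u v) + (\<Sum>(u, v)\<leftarrow>qs. T u v) \<in> H"
      using Cons by auto
    have "set ((\<ominus> u, v) # rs) \<subseteq> E \<times> E" using rs(1) E_closed(5)[OF p(2)] p(3) by simp
    moreover have "(\<Sum>(u, v)\<leftarrow>(\<ominus> u, v) # rs. T u v) + (\<Sum>(u, v)\<leftarrow>p # qs. T u v) \<in> H"
      using H_closed(2)[OF T_minus[OF p(2,3)] rs(2)] p(1) by (simp add: algebra_simps)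
    ultimately show ?case by blast
  qed
  have "Poly_Mapping.keys f \<subseteq> EM \<times> EM" using assms by simp
  then have "\<exists>ps. repr f ps"
  proof (induction rule: frag_induction)
    case zero then show ?case using H_closed(1) by (intro exI[of _ "[]"]) (simp add: repr_def)
  next
    case (diff f g)
    then obtain ps qs where pq: "repr f ps" "repr g qs" by blast
    obtain rs where neg: "set rs \<subseteq> E \<times> E" "(\<Sum>(u, v)\<leftarrow>rs. T u v) + (\<Sum>(u, v)\<leftarrow>qs. T u v) \<in> H"
      using negate[of qs] pq(2) by (auto simp: repr_def)
    have "(f - (\<Sum>(u, v)\<leftarrow>ps. T u v)) - (g - (\<Sum>(u, v)\<leftarrow>qs. T u v)) - ((\<Sum>(u, v)\<leftarrow>rs. T u v) + (\<Sum>(u, v)\<leftarrow>qs. T u v)) \<in> H"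
      by (rule H_closed(4)[OF H_closed(4) neg(2)]) (use pq in \<open>simp_all add: repr_def\<close>)
    then have "repr (f - g) (ps @ rs)"
      using pq neg(1) unfolding repr_def by (simp add: algebra_simps)
    then show ?case by blast
  next
    case (one p)
    then obtain u v where uv: "u \<in> E" "v \<in> E" "p = (emb u, emb v)" by auto
    then have "repr (frag_of p) [(u, v)]" using H_closed(1) by (simp add: repr_def T_def)
    then show ?case by blast
  qed
  then obtain ps where ps: "repr f ps" by blast
  have "(\<Sum>(u, v)\<leftarrow>ps. T u v) = (\<Sum>i<length ps. T (fst (ps ! i)) (snd (ps ! i)))"
    by (simp add: sum_list_sum_nth case_prod_unfold atLeast0LessThan)
  then have "represents {..<length ps} (\<lambda>i. fst (ps ! i)) (\<lambda>i. snd (ps ! i)) f"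
    using ps nth_mem unfolding represents_def repr_def by (fastforce simp: mem_Times_iff)
  then show ?thesis by blast
qed

text \<open>A dependent left factor is a combination of the others, and moving its coefficients across
  the tensor sign removes one summand.\<close>

lemma drop_dependent:
  assumes r: "represents I b y f" and l: "l \<in> I" and g: "g \<in> I \<rightarrow> Fix" "(\<Oplus>i\<in>I. g i \<otimes> b i) = \<zero>" "g l \<noteq> \<zero>"
  shows "\<exists>y'. represents (I - {l}) b y' f"
proof -
  let ?J = "I - {l}"
  have fin: "finite ?J" "finite I" and bE: "\<And>i. i \<in> I \<Longrightarrow> b i \<in> E" and yE: "\<And>i. i \<in> I \<Longrightarrow> y i \<in> E"
    and f: "f - (\<Sum>i\<in>I. T (b i) (y i)) \<in> H"
    using r by (auto simp: represents_def)
  have gF: "g i \<in> Fix" if "i \<in> I" for i using g(1) that by auto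
  define w where "w = inv (g l)"
  have w: "w \<in> Fix" "w \<otimes> g l = \<one>"
    using Fix_inv[OF gF[OF l] g(3)] C_inv[OF Fix_C[OF gF[OF l]] g(3)] by (auto simp: w_def)
  define q where "q i = \<ominus> (w \<otimes> g i)" for i
  have q: "q i \<in> Fix" if "i \<in> I" for i using gF[OF that] w(1) by (auto simp: q_def)
  have bl: "b l = (\<Oplus>i\<in>?J. q i \<otimes> b i)"
  proof -
    have cl: "g i \<in> carrier D" "b i \<in> carrier D" "w \<in> carrier D" if "i \<in> I" for i using gF[OF that] bE[OF that] w(1) by auto
    have s: "(\<Oplus>i\<in>?J. g i \<otimes> b i) \<in> carrier D" using cl by (intro finsum_closed) auto
    have "I = insert l ?J" using l by auto
    then have "(\<Oplus>i\<in>insert l ?J. g i \<otimes> b i) = \<zero>" using g(2) by simp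
    moreover have "(\<Oplus>i\<in>insert l ?J. g i \<otimes> b i) = g l \<otimes> b l \<oplus> (\<Oplus>i\<in>?J. g i \<otimes> b i)"
      using fin cl l by (intro finsum_insert) auto
    ultimately have "g l \<otimes> b l \<oplus> (\<Oplus>i\<in>?J. g i \<otimes> b i) = \<zero>" by simp
    then have "g l \<otimes> b l = \<ominus> (\<Oplus>i\<in>?J. g i \<otimes> b i)"
      using minus_equality[of "g l \<otimes> b l" "\<Oplus>i\<in>?J. g i \<otimes> b i"] s cl[OF l] by simp
    then have "w \<otimes> (g l \<otimes> b l) = w \<otimes> (\<ominus> (\<Oplus>i\<in>?J. g i \<otimes> b i))" by simp
    then have "b l = \<ominus> w \<otimes> (\<Oplus>i\<in>?J. g i \<otimes> b i)"
      using w(2) cl[OF l] s by (simp add: r_minus l_minus flip: m_assoc)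
    also have "\<dots> = (\<Oplus>i\<in>?J. \<ominus> w \<otimes> (g i \<otimes> b i))" using fin cl l by (intro finsum_rdistr) auto
    also have "\<dots> = (\<Oplus>i\<in>?J. q i \<otimes> b i)"
      using cl by (intro finsum_cong') (auto simp: q_def l_minus m_assoc)
    finally show ?thesis .
  qed
  have qb: "q i \<otimes> b i \<in> E" "q i \<otimes> y l \<in> E" if "i \<in> I" for i using q[OF that] bE[OF that] yE[OF l] E_closed(6) by auto
  define y' where "y' i = y i \<oplus> q i \<otimes> y l" for i
  have y'E: "y' i \<in> E" if "i \<in> I" for i using yE[OF that] qb[OF that] E_closed(4) by (simp add: y'_def)
  have 1: "T (b l) (y l) - (\<Sum>i\<in>?J. T (q i \<otimes> b i) (y l)) \<in> H"
    using T_finsum[of ?J "\<lambda>i. q i \<otimes> b i" "y l"] fin qb yE[OF l] bl by auto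
  have sumH: "(\<Sum>i\<in>?J. F i) \<in> H" if "\<And>i. i \<in> I \<Longrightarrow> F i \<in> H" for F :: "nat \<Rightarrow> _"
  proof -
    have "(\<Sum>i\<in>S. F i) \<in> H" if "finite S" "S \<subseteq> I" for S
      using that
    proof (induction S)
      case (insert i S)
      then show ?case using H_closed(2)[of "F i" "sum F S"] \<open>\<And>i. i \<in> I \<Longrightarrow> F i \<in> H\<close> by auto
    qed (simp add: H_closed)
    then show ?thesis using fin by blast
  qed
  have 2: "(\<Sum>i\<in>?J. T (q i \<otimes> b i) (y l) - T (b i) (q i \<otimes> y l)) \<in> H"
    by (rule sumH, rule Rels_H, rule Rels_I(3)) (use bE yE l q in auto)
  have 3: "(\<Sum>i\<in>?J. T (b i) (y' i) - T (b i) (y i) - T (b i) (q i \<otimes> y l)) \<in> H"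
    unfolding y'_def by (rule sumH, rule Rels_H, rule Rels_I(2)) (use bE yE qb in auto)
  have split: "(\<Sum>i\<in>I. T (b i) (y i)) = T (b l) (y l) + (\<Sum>i\<in>?J. T (b i) (y i))"
    using fin(2) l by (rule sum.remove)
  have "(f - (\<Sum>i\<in>I. T (b i) (y i))) + (T (b l) (y l) - (\<Sum>i\<in>?J. T (q i \<otimes> b i) (y l)))
     + (\<Sum>i\<in>?J. T (q i \<otimes> b i) (y l) - T (b i) (q i \<otimes> y l))
     - (\<Sum>i\<in>?J. T (b i) (y' i) - T (b i) (y i) - T (b i) (q i \<otimes> y l)) \<in> H"
    by (intro H_closed(2,4) f 1 2 3)
  then have "f - (\<Sum>i\<in>?J. T (b i) (y' i)) \<in> H"
    unfolding split sum_subtractf by (simp add: algebra_simps)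
  then have "represents ?J b y' f" using fin bE y'E by (auto simp: represents_def)
  then show ?thesis by blast
qed

lemma frag_act_represents:
  assumes r: "represents I b y f" and f: "f \<in> carrier GF" and x: "x \<in> carrier M" and s: "s < n"
  shows "frag_act M f x s = (\<Oplus>i\<in>I. \<tau> s (b i) \<otimes> x s \<otimes> y i)"
proof -
  note fa = frag_act_M[OF x]
  have fin: "finite I" and E: "\<And>i. i \<in> I \<Longrightarrow> b i \<in> E" "\<And>i. i \<in> I \<Longrightarrow> y i \<in> E"
    and h: "f - (\<Sum>i\<in>I. T (b i) (y i)) \<in> H"
    using r by (auto simp: represents_def)
  have *: "(\<Sum>i\<in>J. T (b i) (y i)) \<in> carrier GF \<and>
      frag_act M (\<Sum>i\<in>J. T (b i) (y i)) x s = (\<Oplus>i\<in>J. \<tau> s (b i) \<otimes> x s \<otimes> y i)" if "finite J" "J \<subseteq> I" for J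
    using that
  proof (induction J)
    case empty
    then show ?case using fa(5) s by (simp add: M_zero)
  next
    case (insert i J)
    have i: "b i \<in> E" "y i \<in> E" and IH: "(\<Sum>i\<in>J. T (b i) (y i)) \<in> carrier GF"
      "frag_act M (\<Sum>i\<in>J. T (b i) (y i)) x s = (\<Oplus>i\<in>J. \<tau> s (b i) \<otimes> x s \<otimes> y i)"
      using insert E by auto
    have "(\<Oplus>i\<in>insert i J. \<tau> s (b i) \<otimes> x s \<otimes> y i) = \<tau> s (b i) \<otimes> x s \<otimes> y i \<oplus> (\<Oplus>i\<in>J. \<tau> s (b i) \<otimes> x s \<otimes> y i)"
      using insert E s x by (intro finsum_insert) (auto simp: Pi_def subset_iff)
    moreover have "frag_act M (T (b i) (y i) + (\<Sum>i\<in>J. T (b i) (y i))) x s =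
        \<tau> s (b i) \<otimes> x s \<otimes> y i \<oplus> (\<Oplus>i\<in>J. \<tau> s (b i) \<otimes> x s \<otimes> y i)"
      unfolding fa(2)[OF T_carrier[OF i] IH(1)] fa(4)[OF i] M_add
      using emb_act(1)[OF E_carrier[OF i(1)] x E_carrier[OF i(2)] s] IH(2) s by simp
    moreover have "T (b i) (y i) + (\<Sum>i\<in>J. T (b i) (y i)) \<in> carrier GF"
      using GF.m_closed[OF T_carrier[OF i] IH(1)] by simp
    ultimately show ?case using insert(1,2) by (simp del: carrier_free_Abelian_group_iff)
  qed
  let ?S = "\<Sum>i\<in>I. T (b i) (y i)"
  have S: "?S \<in> carrier GF" "frag_act M ?S x s = (\<Oplus>i\<in>I. \<tau> s (b i) \<otimes> x s \<otimes> y i)" using *[OF fin] by auto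
  have "frag_act M ((f - ?S) + ?S) x = \<zero>\<^bsub>M\<^esub> \<oplus>\<^bsub>M\<^esub> frag_act M ?S x"
    unfolding fa(2)[OF H_closed(5)[OF h] S(1)] frag_act_H[OF x h] ..
  then have "frag_act M f x = frag_act M ?S x" using fa(1)[OF S(1)] by simp
  then show ?thesis using S(2) by simp
qed

text \<open>In a shortest representation of a tensor the left factors are independent over the fixed field.
  If the tensor acts as zero, faithfulness of the twisted action kills the right factors.\<close>

lemma EM_faithful: "faithful_bimodule FixR M EM"
proof -
  have "f \<in> H" if f: "f \<in> carrier GF" and z: "\<And>x. x \<in> carrier M \<Longrightarrow> frag_act M f x = \<zero>\<^bsub>M\<^esub>" for f
  proof -
    define P where "P k \<longleftrightarrow> (\<exists>I b y. represents I b y f \<and> card I = k)" for k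
    have "\<exists>k. P k" using exists_representation[OF f] by (auto simp: P_def)
    then have "P (LEAST k. P k)" by (rule LeastI_ex)
    then obtain I b y where r: "represents I b y f" "card I = (LEAST k. P k)" by (auto simp: P_def)
    have small: "\<not> represents J b' y' f" if "card J < card I" for J b' y'
      using not_less_Least[of "card J" P] that r(2) by (auto simp: P_def)
    have fin: "finite I" and E: "\<And>i. i \<in> I \<Longrightarrow> b i \<in> E" "\<And>i. i \<in> I \<Longrightarrow> y i \<in> E"
      using r by (auto simp: represents_def)
    have less: "card (I - {l}) < card I" if "l \<in> I" for l using fin that by (rule card_Diff1_less)
    have indep: "\<forall>i\<in>I. g i = \<zero>" if g: "g \<in> I \<rightarrow> Fix" "(\<Oplus>i\<in>I. g i \<otimes> b i) = \<zero>" for g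
      using drop_dependent[OF r(1) _ g] small less by blast
    have yz: "\<forall>i\<in>I. y i = \<zero>"
    proof (rule faithful_twisted_action[OF fin _ indep])
      fix j d assume jd: "j < n" "d \<in> carrier D"
      have "frag_act M f (single j d) j = \<zero>" using z[OF single_closed[OF jd(2), of j]] jd by (simp add: M_zero)
      then show "(\<Oplus>i\<in>I. \<tau> j (b i) \<otimes> d \<otimes> y i) = \<zero>"
        using frag_act_represents[OF r(1) f single_closed[OF jd(2), of j] jd(1)] jd by simp
    qed (use E in auto)
    have "(\<Sum>i\<in>J. T (b i) (y i)) \<in> H" if "finite J" "J \<subseteq> I" for J
      using that
    proof (induction J)
      case (insert i J)
      have "y i = \<zero>" "b i \<in> E" using insert yz E by auto
      then have "T (b i) (y i) \<in> H" using T_zero(2) by simp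
      then show ?case using insert H_closed(2) by auto
    qed (simp add: H_closed)
    then have S: "(\<Sum>i\<in>I. T (b i) (y i)) \<in> H" using fin by blast
    have "f - (\<Sum>i\<in>I. T (b i) (y i)) \<in> H" using r(1) by (simp add: represents_def)
    from H_closed(2)[OF this S] show ?thesis by simp
  qed
  note key = this
  have "t = \<one>\<^bsub>TP\<^esub>" if t: "t \<in> carrier TP" "\<forall>a\<in>carrier M. tensor_act M t a = \<zero>\<^bsub>M\<^esub>" for t
  proof -
    obtain f where f: "f \<in> carrier GF" "t = H #>\<^bsub>GF\<^esub> f" using t(1) TP_carrier by blast
    have "frag_act M f x = \<zero>\<^bsub>M\<^esub>" if "x \<in> carrier M" for x
      using t(2) tensor_act_coset[OF f(1) that] that f(2) by simp
    then have "f \<in> H" by (rule key[OF f(1)])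
    then show ?thesis unfolding f(2) TP_one by (rule GF.coset_join2[OF f(1) H_subgroup])
  qed
  then show ?thesis unfolding faithful_bimodule_def Let_def by blast
qed

theorem M_semiassociative: "semiassociative FixR M"
proof -
  have nuc: "EM \<subseteq> nucleus M" using embed_nucleus by (auto simp: emb_def)
  have "subalg FixR (M\<lparr>carrier := nucleus M\<rparr>) EM" by (rule subalg_nucleus[OF M_nonassoc_algebra EM_subalg nuc])
  then have "etale_subalg FixR (M\<lparr>carrier := nucleus M\<rparr>) EM"
    using EM_etale by (simp add: etale_subalg_def)
  then show ?thesis
    unfolding semiassociative_def
    using M_nonassoc_algebra M_fin_dim[OF D_dim] M_central EM_cyclic EM_faithful by blast
qed

end

section \<open>The radical and the atom of a simple ring\<close>

context ring begin

lemma left_idealI: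
  assumes "I \<subseteq> carrier R" "\<zero> \<in> I" "\<And>x y. \<lbrakk>x \<in> I; y \<in> I\<rbrakk> \<Longrightarrow> x \<oplus> y \<in> I"
    and "\<And>r x. \<lbrakk>r \<in> carrier R; x \<in> I\<rbrakk> \<Longrightarrow> r \<otimes> x \<in> I"
  shows "left_ideal R I"
  unfolding left_ideal_def
proof (intro conjI ballI assms(4))
  show "additive_subgroup I R"
  proof (rule additive_subgroup.intro, rule add.subgroupI)
    fix x assume x: "x \<in> I"
    then have "\<ominus> \<one> \<otimes> x \<in> I" by (intro assms(4)) auto
    then show "\<ominus> x \<in> I" using x assms(1) by (auto simp: l_minus)
  qed (use assms in auto)
qed auto

lemma left_idealD:
  assumes "left_ideal R I"
  shows "I \<subseteq> carrier R" "\<zero> \<in> I" "\<lbrakk>x \<in> I; y \<in> I\<rbrakk> \<Longrightarrow> x \<oplus> y \<in> I"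
    "\<lbrakk>r \<in> carrier R; x \<in> I\<rbrakk> \<Longrightarrow> r \<otimes> x \<in> I" "\<one> \<in> I \<Longrightarrow> I = carrier R"
proof -
  interpret additive_subgroup I R using assms by (simp add: left_ideal_def)
  show I: "I \<subseteq> carrier R" "\<zero> \<in> I" "\<lbrakk>x \<in> I; y \<in> I\<rbrakk> \<Longrightarrow> x \<oplus> y \<in> I" using a_subset by auto
  show l: "\<lbrakk>r \<in> carrier R; x \<in> I\<rbrakk> \<Longrightarrow> r \<otimes> x \<in> I" for r x using assms by (simp add: left_ideal_def)
  show "I = carrier R" if "\<one> \<in> I" using l[OF _ that] I(1) by auto
qed

lemma maximal_left_ideal_exists:
  assumes "\<one> \<noteq> \<zero>" shows "\<exists>L. maximal_left_ideal R L"
proof -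
  define P where "P = {I. left_ideal R I \<and> \<one> \<notin> I}"
  have P: "left_ideal R I" "\<one> \<notin> I" if "I \<in> P" for I using that by (auto simp: P_def)
  have "left_ideal R {\<zero>}" by (rule left_idealI) auto
  then have ne: "P \<noteq> {}" using assms by (auto simp: P_def)
  have "\<exists>L\<in>P. \<forall>J\<in>P. L \<subseteq> J \<longrightarrow> J = L"
  proof (rule subset_Zorn_nonempty[OF ne])
    fix \<C> assume \<C>: "\<C> \<noteq> {}" "subset.chain P \<C>"
    then have sub: "\<C> \<subseteq> P" and chain: "\<And>I J. \<lbrakk>I \<in> \<C>; J \<in> \<C>\<rbrakk> \<Longrightarrow> I \<subseteq> J \<or> J \<subseteq> I"
      by (auto simp: subset.chain_def)
    have "left_ideal R (\<Union>\<C>)"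
    proof (rule left_idealI)
      show "\<Union>\<C> \<subseteq> carrier R" using sub left_idealD(1)[OF P(1)] by blast
      show "\<zero> \<in> \<Union>\<C>" using \<C>(1) sub left_idealD(2)[OF P(1)] by blast
      show "r \<otimes> x \<in> \<Union>\<C>" if "r \<in> carrier R" "x \<in> \<Union>\<C>" for r x
        using that sub left_idealD(4)[OF P(1)] by blast
      fix x y assume "x \<in> \<Union>\<C>" "y \<in> \<Union>\<C>"
      then obtain I J where IJ: "x \<in> I" "I \<in> \<C>" "y \<in> J" "J \<in> \<C>" by blast
      then obtain K where "K \<in> \<C>" "x \<in> K" "y \<in> K" using chain[of I J] by blast
      then show "x \<oplus> y \<in> \<Union>\<C>" using sub left_idealD(3)[OF P(1)] by blast
    qed
    moreover have "\<one> \<notin> \<Union>\<C>" using sub P(2) by blast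
    ultimately show "\<Union>\<C> \<in> P" by (simp add: P_def)
  qed
  then obtain L where L: "L \<in> P" "\<And>J. \<lbrakk>J \<in> P; L \<subseteq> J\<rbrakk> \<Longrightarrow> J = L" by blast
  have "J = L \<or> J = carrier R" if "left_ideal R J" "L \<subseteq> J" for J
    using L(2)[of J] that left_idealD(5)[OF that(1)] by (auto simp: P_def)
  moreover have "L \<noteq> carrier R" using P(2)[OF L(1)] by auto
  ultimately have "maximal_left_ideal R L" using P(1)[OF L(1)] by (auto simp: maximal_left_ideal_def)
  then show ?thesis by blast
qed

text \<open>This is what makes the radical closed under right multiplication. If K lies strictly above the
  transporter of r, then \<open>K r + L\<close> is everything, so \<open>r = k \<otimes> r \<oplus> l\<close>; thus \<open>\<one> \<ominus> k\<close> lies in the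
  transporter, hence in K, and K contains 1.\<close>

lemma transporter_maximal:
  assumes L: "maximal_left_ideal R L" and r: "r \<in> carrier R"
  shows "{x \<in> carrier R. x \<otimes> r \<in> L} = carrier R \<or> maximal_left_ideal R {x \<in> carrier R. x \<otimes> r \<in> L}"
    (is "?T = _ \<or> _")
proof -
  have L': "left_ideal R L" and max: "\<And>J. \<lbrakk>left_ideal R J; L \<subseteq> J\<rbrakk> \<Longrightarrow> J = L \<or> J = carrier R"
    using L by (auto simp: maximal_left_ideal_def)
  note Li = left_idealD[OF L']
  have T: "left_ideal R ?T"
    using r Li by (intro left_idealI) (auto simp: l_distr m_assoc)
  have "K = ?T \<or> K = carrier R" if K: "left_ideal R K" "?T \<subseteq> K" for K
  proof (cases "K \<subseteq> ?T")
    case False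
    note Ki = left_idealD[OF K(1)]
    have KR: "k \<in> carrier R" if "k \<in> K" for k using that Ki(1) by blast
    have LR: "l \<in> carrier R" if "l \<in> L" for l using that Li(1) by blast
    obtain y where y: "y \<in> K" "y \<otimes> r \<notin> L" using False KR by blast
    let ?S = "{k \<otimes> r \<oplus> l |k l. k \<in> K \<and> l \<in> L}"
    have "left_ideal R ?S"
    proof (rule left_idealI)
      show "?S \<subseteq> carrier R" using KR LR r by auto
      have "\<zero> \<otimes> r \<oplus> \<zero> \<in> ?S" using Ki(2) Li(2) by blast
      then show "\<zero> \<in> ?S" using r by simp
      fix u v assume "u \<in> ?S"
      then obtain k l where u: "u = k \<otimes> r \<oplus> l" "k \<in> K" "l \<in> L" by blast
      { assume "v \<in> ?S"
        then obtain k' l' where v: "v = k' \<otimes> r \<oplus> l'" "k' \<in> K" "l' \<in> L" by blast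
        have "u \<oplus> v = (k \<oplus> k') \<otimes> r \<oplus> (l \<oplus> l')"
          using u v KR LR r by (simp add: l_distr a_ac)
        then show "u \<oplus> v \<in> ?S" using Ki(3)[OF u(2) v(2)] Li(3)[OF u(3) v(3)] by blast }
    next
      fix s u assume s: "s \<in> carrier R" and "u \<in> ?S"
      then obtain k l where u: "u = k \<otimes> r \<oplus> l" "k \<in> K" "l \<in> L" by blast
      have "s \<otimes> u = (s \<otimes> k) \<otimes> r \<oplus> s \<otimes> l" using u s KR LR r by (simp add: r_distr m_assoc)
      then show "s \<otimes> u \<in> ?S" using Ki(4)[OF s u(2)] Li(4)[OF s u(3)] by blast
    qed
    moreover have "L \<subseteq> ?S"
    proof
      fix l assume l: "l \<in> L"
      have "\<zero> \<otimes> r \<oplus> l \<in> ?S" using Ki(2) l by blast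
      then show "l \<in> ?S" using r l LR by simp
    qed
    moreover have "?S \<noteq> L"
    proof -
      have "y \<otimes> r \<oplus> \<zero> \<in> ?S" using y(1) Li(2) by blast
      then show ?thesis using y KR r by auto
    qed
    ultimately have "r \<in> ?S" using max r by blast
    then obtain k l where kl: "r = k \<otimes> r \<oplus> l" "k \<in> K" "l \<in> L" by blast
    have k: "k \<in> carrier R" and l: "l \<in> carrier R" using kl KR LR by auto
    have "(\<one> \<ominus> k) \<otimes> r = (k \<otimes> r \<oplus> l) \<ominus> k \<otimes> r"
      using k r kl(1) by (simp add: a_minus_def l_distr l_minus)
    also have "\<dots> = l" using k l r by (simp add: a_minus_def a_ac r_neg2 r_neg)
    finally have "(\<one> \<ominus> k) \<otimes> r = l" .
    then have "\<one> \<ominus> k \<in> K" using K(2) kl(3) k by auto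
    then have "(\<one> \<ominus> k) \<oplus> k \<in> K" using kl(2) by (rule Ki(3))
    then have "\<one> \<in> K" using k by (simp add: a_minus_def a_assoc l_neg)
    then show ?thesis using Ki(5) by blast
  qed (use K in blast)
  then show ?thesis using T unfolding maximal_left_ideal_def by blast
qed

text \<open>The radical is a two-sided ideal, and it is proper because a maximal left ideal exists.\<close>

lemma jacobson_radical_of_simple:
  assumes "simple_ring R" shows "jacobson_radical R = {\<zero>}"
proof -
  have simple: "\<And>I. ideal I R \<Longrightarrow> I = {\<zero>} \<or> I = carrier R" and "\<one> \<noteq> \<zero>"
    using assms one_zeroD unfolding simple_ring_def by blast+
  then obtain L where L: "maximal_left_ideal R L" using maximal_left_ideal_exists by blast
  let ?J = "jacobson_radical R"
  have max: "left_ideal R I" if "maximal_left_ideal R I" for I using that by (simp add: maximal_left_ideal_def)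
  have J: "x \<in> ?J \<longleftrightarrow> x \<in> carrier R \<and> (\<forall>I. maximal_left_ideal R I \<longrightarrow> x \<in> I)" for x
    by (auto simp: jacobson_radical_def)
  have left: "left_ideal R ?J"
    using left_idealD[OF max] by (intro left_idealI) (auto simp: J)
  have right: "x \<otimes> r \<in> ?J" if x: "x \<in> ?J" and r: "r \<in> carrier R" for x r
  proof -
    have "x \<otimes> r \<in> I" if "maximal_left_ideal R I" for I
      using transporter_maximal[OF that r] x by (auto simp: J)
    then show ?thesis using x r by (simp add: J)
  qed
  have "ideal ?J R"
    using left right by (intro idealI) (auto simp: left_ideal_def additive_subgroup_def ring_axioms)
  moreover have "?J \<noteq> carrier R"
  proof
    assume "?J = carrier R"
    then have "\<one> \<in> L" using L J by blast
    then show False using left_idealD(5)[OF max[OF L]] L by (simp add: maximal_left_ideal_def)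
  qed
  ultimately show ?thesis using simple by blast
qed

end

text \<open>Passing to cosets of the zero ideal only replaces x by \<open>{x}\<close>. The result is simple, hence its own
  unique component, and its center is a copy of the center of A.\<close>

lemma atom_of_simple:
  fixes A :: "('k, 'a) module" and F :: "('k, 'c) ring_scheme"
  assumes simple: "simple_ring A"
    and scalars: "\<And>c. c \<in> carrier F \<Longrightarrow> c \<odot>\<^bsub>A\<^esub> \<one>\<^bsub>A\<^esub> \<in> carrier A"
  shows "\<exists>B\<in>simple_components (quot_alg A {\<zero>\<^bsub>A\<^esub>}).
    central F B \<longrightarrow> center A \<subseteq> (\<lambda>c. c \<odot>\<^bsub>A\<^esub> \<one>\<^bsub>A\<^esub>) ` carrier F"
proof -
  interpret ring A using simple by (simp add: simple_ring_def)
  have trivial_ideals: "\<And>I. ideal I A \<Longrightarrow> I = {\<zero>\<^bsub>A\<^esub>} \<or> I = carrier A" and nonzero: "carrier A \<noteq> {\<zero>\<^bsub>A\<^esub>}"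
    using simple unfolding simple_ring_def by blast+
  let ?Q = "quot_alg A {\<zero>\<^bsub>A\<^esub>}" and ?h = "\<lambda>x. {x}"
  have coset: "{\<zero>\<^bsub>A\<^esub>} +>\<^bsub>A\<^esub> x = {x}" if "x \<in> carrier A" for x
    using that by (simp add: a_r_coset_def')
  have car: "carrier ?Q = ?h ` carrier A"
    using coset by (auto simp: quot_alg_def FactRing_def A_RCOSETS_def' image_iff)
  have ops: "{x} \<otimes>\<^bsub>?Q\<^esub> {y} = {x \<otimes>\<^bsub>A\<^esub> y}" "{x} \<oplus>\<^bsub>?Q\<^esub> {y} = {x \<oplus>\<^bsub>A\<^esub> y}"
    if "x \<in> carrier A" "y \<in> carrier A" for x y
    using that coset by (simp_all add: quot_alg_def FactRing_def rcoset_mult_def set_add_def')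
  have one: "\<one>\<^bsub>?Q\<^esub> = {\<one>\<^bsub>A\<^esub>}" and zero: "\<zero>\<^bsub>?Q\<^esub> = {\<zero>\<^bsub>A\<^esub>}"
    using coset by (simp_all add: quot_alg_def FactRing_def)
  have smult_one: "c \<odot>\<^bsub>?Q\<^esub> \<one>\<^bsub>?Q\<^esub> = {c \<odot>\<^bsub>A\<^esub> \<one>\<^bsub>A\<^esub>}" if "c \<in> carrier F" for c
    unfolding one using coset[OF scalars[OF that]] by (simp add: quot_alg_def)
  have h: "?h \<in> ring_iso A ?Q"
    using car ops one by (auto simp: ring_iso_def ring_hom_def bij_betw_def inj_on_def)
  have "ring (?Q\<lparr>zero := ?h \<zero>\<^bsub>A\<^esub>\<rparr>)" by (rule ring_iso_imp_img_ring[OF h])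
  then have ringQ: "ring ?Q" using zero by (metis ring.surjective ring.update_convs(1))
  interpret Q: ring ?Q by (rule ringQ)
  interpret h: ring_hom_ring A ?Q ?h
    using h by (intro ring_hom_ringI2 ring_axioms ringQ) (simp add: ring_iso_def)
  have "J = {\<zero>\<^bsub>?Q\<^esub>} \<or> J = carrier ?Q" if J: "ideal J ?Q" for J
  proof -
    have "{x \<in> carrier A. {x} \<in> J} = {\<zero>\<^bsub>A\<^esub>} \<or> {x \<in> carrier A. {x} \<in> J} = carrier A"
      by (rule trivial_ideals[OF h.ideal_vimage[OF J]])
    moreover have "J = ?h ` {x \<in> carrier A. {x} \<in> J}"
      using additive_subgroup.a_subset[OF ideal.axioms(1)[OF J]] unfolding car by blast
    ultimately show ?thesis unfolding car zero by (elim disjE) (simp_all only: image_insert image_empty simp_thms)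
  qed
  moreover have "carrier ?Q \<noteq> {\<zero>\<^bsub>?Q\<^esub>}"
  proof
    assume "carrier ?Q = {\<zero>\<^bsub>?Q\<^esub>}"
    then have "carrier A \<subseteq> {\<zero>\<^bsub>A\<^esub>}" unfolding car zero by blast
    then show False using nonzero zero_closed by blast
  qed
  ultimately have min: "minimal_ideal ?Q (carrier ?Q)"
    using Q.oneideal unfolding minimal_ideal_def by blast
  let ?e = "THE e. e \<in> carrier ?Q \<and> (\<forall>x\<in>carrier ?Q. e \<otimes>\<^bsub>?Q\<^esub> x = x \<and> x \<otimes>\<^bsub>?Q\<^esub> e = x)"
  have e: "?e = \<one>\<^bsub>?Q\<^esub>"
  proof (rule the_equality)
    show "\<one>\<^bsub>?Q\<^esub> \<in> carrier ?Q \<and> (\<forall>x\<in>carrier ?Q. \<one>\<^bsub>?Q\<^esub> \<otimes>\<^bsub>?Q\<^esub> x = x \<and> x \<otimes>\<^bsub>?Q\<^esub> \<one>\<^bsub>?Q\<^esub> = x)"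
      using Q.one_closed Q.l_one Q.r_one by blast
    fix e assume "e \<in> carrier ?Q \<and> (\<forall>x\<in>carrier ?Q. e \<otimes>\<^bsub>?Q\<^esub> x = x \<and> x \<otimes>\<^bsub>?Q\<^esub> e = x)"
    then have "e \<in> carrier ?Q" "e \<otimes>\<^bsub>?Q\<^esub> \<one>\<^bsub>?Q\<^esub> = \<one>\<^bsub>?Q\<^esub>" using Q.one_closed by blast+
    then show "e = \<one>\<^bsub>?Q\<^esub>" using Q.r_one[of e] by (simp only:)
  qed
  have "?Q\<lparr>carrier := carrier ?Q, one := ?e\<rparr> \<in> simple_components ?Q"
    unfolding simple_components_def by (rule CollectI, rule exI[of _ "carrier ?Q"], rule conjI[OF refl min])
  moreover have "B\<lparr>carrier := carrier B, one := \<one>\<^bsub>B\<^esub>\<rparr> = B" for B :: "('k, 'a set) module" by (cases B) simp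
  ultimately have comp: "?Q \<in> simple_components ?Q" unfolding e by (simp only:)
  have "center A \<subseteq> (\<lambda>c. c \<odot>\<^bsub>A\<^esub> \<one>\<^bsub>A\<^esub>) ` carrier F" if F: "central F ?Q"
  proof
    fix z assume z: "z \<in> center A"
    have "{z} \<in> center ?Q"
    proof (rule Q.center_memI)
      note zA = center_carrier[OF z]
      show "{z} \<in> carrier ?Q" unfolding car using zA by (rule imageI)
      fix y assume "y \<in> carrier ?Q"
      then obtain x where x: "x \<in> carrier A" "y = {x}" unfolding car by blast
      show "{z} \<otimes>\<^bsub>?Q\<^esub> y = y \<otimes>\<^bsub>?Q\<^esub> {z}"
        unfolding x(2) ops(1)[OF zA x(1)] ops(1)[OF x(1) zA] center_comm[OF z x(1)] ..
    qed
    then obtain c where c: "c \<in> carrier F" "{z} = c \<odot>\<^bsub>?Q\<^esub> \<one>\<^bsub>?Q\<^esub>"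
      using F unfolding central_def by blast
    have "{z} = {c \<odot>\<^bsub>A\<^esub> \<one>\<^bsub>A\<^esub>}" unfolding c(2) by (rule smult_one[OF c(1)])
    then have "z = c \<odot>\<^bsub>A\<^esub> \<one>\<^bsub>A\<^esub>" by (rule singleton_inject)
    then show "z \<in> (\<lambda>c. c \<odot>\<^bsub>A\<^esub> \<one>\<^bsub>A\<^esub>) ` carrier F" using c(1) by (rule image_eqI)
  qed
  then show ?thesis using comp by blast
qed

section \<open>The nucleus of a Menichetti algebra is simple but not central\<close>

context menichetti begin

abbreviation "N \<equiv> M\<lparr>carrier := nucleus M\<rparr>"

lemma nucleus_component:
  assumes "x \<in> nucleus M" "j < n" "x j \<noteq> \<zero>" "d \<in> carrier D"
  shows "single j d \<in> nucleus M"
proof (rule subbimodule_component[OF _ _ _ _ _ assms])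
  show "nucleus M \<subseteq> carrier M" using M.nucleus_carrier by blast
qed (auto intro: M.nucleus_zero M.nucleus_add M.nucleus_mult embed_nucleus)

definition support :: "nat set" where
  "support = {j. j < n \<and> single j \<one> \<in> nucleus M}"

lemma support_iff: "\<lbrakk>x \<in> nucleus M; j < n; x j \<noteq> \<zero>\<rbrakk> \<Longrightarrow> j \<in> support"
  unfolding support_def using nucleus_component[of x j \<one>] by simp

lemma support_single: "\<lbrakk>j \<in> support; d \<in> carrier D\<rbrakk> \<Longrightarrow> single j d \<in> nucleus M"
  unfolding support_def using nucleus_component[of "single j \<one>" j d] one_neq_zero by simp

lemma single_one_mult:
  assumes "i < n" "j < n"
  obtains u where "u \<in> carrier D" "u \<noteq> \<zero>" "single i \<one> \<otimes>\<^bsub>M\<^esub> single j \<one> = single ((i + j) mod n) u"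
proof
  show "single i \<one> \<otimes>\<^bsub>M\<^esub> single j \<one> = single ((i + j) mod n) (c i j)"
    using coeff_unit(1)[OF assms] assms by (intro single_mult_single_eq) simp_all
qed (use coeff_unit[OF assms] in auto)

text \<open>Since a nonzero component of an element of the nucleus may be replaced by any element of D, the
  nucleus consists of the components with index in the support, a subgroup of the integers modulo n.\<close>

lemma support_closed:
  assumes i: "i \<in> support" and j: "j \<in> support" shows "(i + j) mod n \<in> support"
proof -
  have ij: "i < n" "j < n" "single i \<one> \<in> nucleus M" "single j \<one> \<in> nucleus M"
    using i j by (auto simp: support_def)
  obtain u where u: "u \<noteq> \<zero>" "single i \<one> \<otimes>\<^bsub>M\<^esub> single j \<one> = single ((i + j) mod n) u"
    using single_one_mult[OF ij(1,2)] by blast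
  show ?thesis
  proof (rule support_iff)
    show "single ((i + j) mod n) u \<in> nucleus M" using M.nucleus_mult[OF ij(3,4)] unfolding u(2) .
  qed (use u(1) n_pos in simp_all)
qed

lemma support_zero: "0 \<in> support"
  using n_pos embed_nucleus[of \<one>] by (simp add: support_def)

lemma full_support_associative:
  assumes "support = {..<n}" shows "associative M"
proof -
  have "carrier M \<subseteq> nucleus M"
    using assms by (intro singles_span M.nucleus_zero M.nucleus_add support_single) auto
  then have "(x \<otimes>\<^bsub>M\<^esub> y) \<otimes>\<^bsub>M\<^esub> z = x \<otimes>\<^bsub>M\<^esub> (y \<otimes>\<^bsub>M\<^esub> z)"
    if "x \<in> carrier M" "y \<in> carrier M" "z \<in> carrier M" for x y z
    using that M.nucleus_iff[of x] by blast
  then show ?thesis unfolding associative_def using M.associator_zero_iff by blast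
qed

text \<open>A nonzero ideal contains, up to a unit, some basis vector; its powers return to the identity
  element.\<close>

lemma nucleus_simple: "simple_ring N"
proof -
  interpret N: ring N by (rule M.nucleus_ring)
  have "I = carrier N" if I: "ideal I N" "I \<noteq> {\<zero>\<^bsub>M\<^esub>}" for I
  proof -
    interpret I: ideal I N by (rule I(1))
    have IN: "I \<subseteq> nucleus M" using I.a_subset by simp
    have I_add: "x \<oplus>\<^bsub>M\<^esub> y \<in> I" if "x \<in> I" "y \<in> I" for x y using I.a_closed[OF that] by simp
    have I_mult: "x \<otimes>\<^bsub>M\<^esub> y \<in> I" "y \<otimes>\<^bsub>M\<^esub> x \<in> I" if "x \<in> I" "y \<in> nucleus M" for x y
      using I.I_l_closed[OF that(1), of y] I.I_r_closed[OF that(1), of y] that(2) by simp_all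
    have I_zero: "\<zero>\<^bsub>M\<^esub> \<in> I" using I.zero_closed by simp
    have comp: "single j d \<in> I" if "x \<in> I" "j < n" "x j \<noteq> \<zero>" "d \<in> carrier D" for x j d
    proof (rule subbimodule_component[OF _ I_zero I_add _ _ that])
      show "I \<subseteq> carrier M" using IN M.nucleus_carrier by blast
    qed (auto intro: I_mult embed_nucleus)
    obtain x where x: "x \<in> I" "x \<noteq> \<zero>\<^bsub>M\<^esub>" using I(2) I_zero by blast
    have "\<exists>j<n. x j \<noteq> \<zero>"
    proof (rule ccontr)
      assume "\<not> ?thesis"
      then have "x = \<zero>\<^bsub>M\<^esub>"
        using x(1) IN M.nucleus_carrier M.M.zero_closed by (intro M_eqI) (auto simp: M_zero)
      then show False using x(2) by simp
    qed
    then obtain j where j: "j < n" "x j \<noteq> \<zero>" by blast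
    have s: "single j \<one> \<in> I" by (rule comp[OF x(1) j]) simp
    \<comment> \<open>Up to units, the powers of the j-th basis vector run through the multiples of j modulo n,
      and so reach the identity element.\<close>
    have "single ((Suc l * j) mod n) \<one> \<in> I" for l
    proof (induction l)
      case 0
      have "(Suc 0 * j) mod n = j" using j(1) by simp
      then show ?case using s by (simp only:)
    next
      case (Suc l)
      let ?a = "(Suc l * j) mod n"
      have a: "?a < n" using n_pos by simp
      obtain u where u: "u \<noteq> \<zero>" "single ?a \<one> \<otimes>\<^bsub>M\<^esub> single j \<one> = single ((?a + j) mod n) u"
        using single_one_mult[OF a j(1)] by blast
      have "single ((?a + j) mod n) u \<in> I"
        using I_mult(1)[OF Suc.IH subsetD[OF IN s]] unfolding u(2) .
      then have "single ((?a + j) mod n) \<one> \<in> I"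
        by (rule comp) (use u(1) n_pos in simp_all)
      moreover have "(?a + j) mod n = (Suc (Suc l) * j) mod n"
        by (simp add: mod_add_right_eq add.commute)
      ultimately show ?case by (simp only:)
    qed
    from this[of "n - 1"] have "single 0 \<one> \<in> I" using n_pos by simp
    then have "\<one>\<^bsub>N\<^esub> \<in> I" using emb_one by (simp add: emb_def)
    then show ?thesis by (rule I.one_imp_carrier)
  qed
  moreover have "\<one>\<^bsub>M\<^esub> \<noteq> \<zero>\<^bsub>M\<^esub>"
    using emb_inj[of \<one> \<zero>] one_neq_zero by (auto simp: emb_one emb_zero)
  then have "carrier N \<noteq> {\<zero>\<^bsub>N\<^esub>}" using M.nucleus_one by auto
  ultimately show ?thesis unfolding simple_ring_def using N.ring_axioms by auto
qed

lemma support_fixed_center: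
  assumes a: "a \<in> C" and fixed: "\<And>j. j \<in> support \<Longrightarrow> \<tau> j a = a"
  shows "emb a \<in> center N"
proof (rule ring.center_memI[OF M.nucleus_ring])
  show "emb a \<in> carrier N" using a embed_nucleus by (simp add: emb_def)
  fix x assume "x \<in> carrier N"
  then have x: "x \<in> nucleus M" "x \<in> carrier M" using M.nucleus_carrier by auto
  have "(emb a \<otimes>\<^bsub>M\<^esub> x) s = (x \<otimes>\<^bsub>M\<^esub> emb a) s" if s: "s < n" for s
  proof -
    have "\<tau> s a \<otimes> x s = x s \<otimes> a"
    proof (cases "x s = \<zero>")
      case False
      then show ?thesis using fixed[OF support_iff[OF x(1) s]] C_comm[OF a] x(2) s by simp
    qed (use a s in simp)
    then show ?thesis using embed_mult[OF x(2) _ s] mult_embed[OF x(2) _ s] a by (simp add: emb_def)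
  qed
  then have "emb a \<otimes>\<^bsub>M\<^esub> x = x \<otimes>\<^bsub>M\<^esub> emb a"
    using x(2) a emb_closed by (intro M_eqI M.mult_closed) auto
  then show "emb a \<otimes>\<^bsub>N\<^esub> x = x \<otimes>\<^bsub>N\<^esub> emb a" by simp
qed

text \<open>The nucleus is simple, so it is the only atom. If the algebra is not associative, the support is a
  proper subgroup and fixes an element of C outside the fixed field. That element is central in the
  nucleus, so the atom is not central.\<close>

theorem M_not_homogeneous:
  assumes "\<not> associative M" shows "\<not> homogeneous FixR M"
proof
  assume "homogeneous FixR M"
  then have central: "\<And>B. B \<in> atoms M \<Longrightarrow> central FixR B"
    by (simp add: homogeneous_def semicentral_def)
  have scalar: "f \<odot>\<^bsub>M\<^esub> \<one>\<^bsub>M\<^esub> = emb f" if "f \<in> Fix" for f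
    using emb_smult[of f \<one>] that by (simp add: emb_one)
  obtain B where B: "B \<in> atoms M"
    and cB: "central FixR B \<longrightarrow> center N \<subseteq> (\<lambda>f. f \<odot>\<^bsub>N\<^esub> \<one>\<^bsub>N\<^esub>) ` carrier FixR"
  proof -
    have "\<exists>B\<in>simple_components (quot_alg N {\<zero>\<^bsub>N\<^esub>}).
        central FixR B \<longrightarrow> center N \<subseteq> (\<lambda>f. f \<odot>\<^bsub>N\<^esub> \<one>\<^bsub>N\<^esub>) ` carrier FixR"
      using scalar embed_nucleus by (intro atom_of_simple nucleus_simple) (simp add: emb_def)
    moreover have "jacobson_radical N = {\<zero>\<^bsub>N\<^esub>}"
      by (rule ring.jacobson_radical_of_simple[OF M.nucleus_ring nucleus_simple])
    ultimately show ?thesis using that unfolding atoms_def Let_def by auto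
  qed
  have "support \<noteq> {..<n}" using full_support_associative assms by blast
  then obtain l where l: "l < n" "l \<notin> support" by (auto simp: support_def)
  have "support \<subseteq> {..<n}" by (auto simp: support_def)
  then obtain a where a: "a \<in> C" "\<And>j. j \<in> support \<Longrightarrow> \<tau> j a = a" "\<tau> l a \<noteq> a"
    using proper_subgroup_fixes_more[OF _ support_zero support_closed l] by blast
  obtain f where "f \<in> Fix" "emb a = emb f"
    using support_fixed_center[OF a(1,2)] cB central[OF B] scalar by auto
  then have "a \<in> Fix" using emb_inj[of a f] a(1) by simp
  then show False using a(3) l(1) by simp
qed

end

section \<open>Powers of an automorphism of given order on the center\<close>

lemma ring_aut_group:
  fixes R (structure)
  assumes "ring R" shows "group (ring_aut R)"
proof -
  interpret ring R by (rule assms)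
  let ?S = "carrier R"
  interpret B: group "BijGroup ?S" by (rule group_BijGroup)
  have inv: "restrict (inv_into ?S f) ?S \<in> ring_iso R R \<inter> Bij ?S" if f: "f \<in> ring_iso R R" "f \<in> Bij ?S" for f
  proof -
    define g where "g = restrict (inv_into ?S f) ?S"
    have g: "g \<in> Bij ?S" unfolding g_def by (rule restrict_inv_into_Bij[OF f(2)])
    then have gc: "g x \<in> ?S" if "x \<in> ?S" for x using Bij_imp_funcset that by blast
    have fS: "f ` ?S = ?S" "inj_on f ?S" using f(2) by (auto simp: Bij_def bij_betw_def)
    have fg: "f (g x) = x" if "x \<in> ?S" for x
      using that fS(1) f_inv_into_f[of x f ?S] by (simp add: g_def)
    have eq: "g x = y" if "x \<in> ?S" "y \<in> ?S" "f y = x" for x y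
      using inj_onD[OF fS(2), of "g x" y] fg gc that by auto
    have hom: "f \<in> ring_hom R R" using f(1) by (simp add: ring_iso_def)
    have "g \<in> ring_hom R R"
    proof (rule ring_hom_memI)
      fix x y assume xy: "x \<in> ?S" "y \<in> ?S"
      show "g x \<in> ?S" by (rule gc[OF xy(1)])
      show "g (x \<otimes> y) = g x \<otimes> g y"
        using ring_hom_mult[OF hom gc[OF xy(1)] gc[OF xy(2)]] gc fg xy by (intro eq) auto
      show "g (x \<oplus> y) = g x \<oplus> g y"
        using ring_hom_add[OF hom gc[OF xy(1)] gc[OF xy(2)]] gc fg xy by (intro eq) auto
    next
      show "g \<one> = \<one>" using ring_hom_one[OF hom] by (intro eq) auto
    qed
    then show ?thesis using g unfolding g_def by (simp add: ring_iso_def Bij_def)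
  qed
  have comp: "compose ?S f g \<in> ring_iso R R \<inter> Bij ?S"
    if "f \<in> ring_iso R R" "f \<in> Bij ?S" "g \<in> ring_iso R R" "g \<in> Bij ?S" for f g
  proof -
    have h: "f \<in> ring_hom R R" "g \<in> ring_hom R R" using that by (auto simp: ring_iso_def)
    have "compose ?S f g \<in> ring_hom R R"
      using ring_hom_memE[OF h(1)] ring_hom_memE[OF h(2)] by (intro ring_hom_memI) (simp_all add: compose_def)
    then show ?thesis using compose_Bij[OF that(2,4)] by (simp add: ring_iso_def Bij_def)
  qed
  have id: "(\<lambda>x\<in>?S. x) \<in> ring_iso R R \<inter> Bij ?S"
    using id_Bij[of ?S] by (auto simp: ring_iso_def Bij_def intro!: ring_hom_memI)
  have "subgroup (ring_iso R R \<inter> Bij ?S) (BijGroup ?S)"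
  proof (rule B.subgroupI)
    show "ring_iso R R \<inter> Bij ?S \<subseteq> carrier (BijGroup ?S)" by (simp add: BijGroup_def)
    show "ring_iso R R \<inter> Bij ?S \<noteq> {}" using id by blast
    show "inv\<^bsub>BijGroup ?S\<^esub> f \<in> ring_iso R R \<inter> Bij ?S" if "f \<in> ring_iso R R \<inter> Bij ?S" for f
      using inv[of f] inv_BijGroup[of f ?S] that by auto
    show "f \<otimes>\<^bsub>BijGroup ?S\<^esub> g \<in> ring_iso R R \<inter> Bij ?S"
      if "f \<in> ring_iso R R \<inter> Bij ?S" "g \<in> ring_iso R R \<inter> Bij ?S" for f g
      using comp[of f g] that by (auto simp: BijGroup_def)
  qed
  then show ?thesis unfolding ring_aut_def by (rule B.subgroup_imp_group)
qed

lemma ring_aut_mult: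
  "\<lbrakk>f \<in> Bij (carrier R); g \<in> Bij (carrier R)\<rbrakk> \<Longrightarrow> f \<otimes>\<^bsub>ring_aut R\<^esub> g = compose (carrier R) f g"
  by (simp add: ring_aut_def BijGroup_def)

lemma ring_aut_pow:
  assumes "f \<in> Bij (carrier R)"
  shows "f [^]\<^bsub>ring_aut R\<^esub> (i::nat) \<in> Bij (carrier R)"
    and "x \<in> carrier R \<Longrightarrow> (f [^]\<^bsub>ring_aut R\<^esub> i) x = (f ^^ i) x"
proof -
  have "f [^]\<^bsub>ring_aut R\<^esub> i \<in> Bij (carrier R) \<and> (\<forall>x\<in>carrier R. (f [^]\<^bsub>ring_aut R\<^esub> i) x = (f ^^ i) x)"
  proof (induction i)
    case 0
    have "f [^]\<^bsub>ring_aut R\<^esub> (0::nat) = (\<lambda>x\<in>carrier R. x)" by (simp add: nat_pow_def ring_aut_def BijGroup_def)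
    then show ?case using id_Bij[of "carrier R"] by (simp only:) simp
  next
    case (Suc i)
    have "f [^]\<^bsub>ring_aut R\<^esub> Suc i = compose (carrier R) (f [^]\<^bsub>ring_aut R\<^esub> i) f"
      using ring_aut_mult[of "f [^]\<^bsub>ring_aut R\<^esub> i" R f] Suc assms by (simp add: nat_pow_def)
    moreover have "compose (carrier R) (f [^]\<^bsub>ring_aut R\<^esub> i) f \<in> Bij (carrier R)"
      using Suc assms by (intro compose_Bij) auto
    moreover have "compose (carrier R) (f [^]\<^bsub>ring_aut R\<^esub> i) f x = (f ^^ Suc i) x" if "x \<in> carrier R" for x
      using Suc that Bij_imp_funcset[OF assms] by (simp add: compose_def funpow_swap1 Pi_iff)
    ultimately show ?case by (simp only: simp_thms ball_simps) blast
  qed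
  then show "f [^]\<^bsub>ring_aut R\<^esub> i \<in> Bij (carrier R)" "x \<in> carrier R \<Longrightarrow> (f [^]\<^bsub>ring_aut R\<^esub> i) x = (f ^^ i) x"
    by blast+
qed

lemma (in ring) restrict_center_aut:
  assumes "f \<in> carrier (ring_aut R)"
  shows "restrict f (center R) \<in> carrier (ring_aut (R\<lparr>carrier := center R\<rparr>))"
    and "c \<in> center R \<Longrightarrow> f c \<in> center R"
proof -
  have iso: "f \<in> ring_iso R R" using assms by (simp add: ring_aut_def)
  then have hom: "f \<in> ring_hom R R" and bij: "bij_betw f (carrier R) (carrier R)" by (auto simp: ring_iso_def)
  note h = ring_hom_memE[OF hom]
  have surj: "\<exists>x\<in>carrier R. f x = y" if "y \<in> carrier R" for y
    using bij that unfolding bij_betw_def by (metis imageE)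
  have inj: "x = y" if "x \<in> carrier R" "y \<in> carrier R" "f x = f y" for x y
    using bij that unfolding bij_betw_def inj_on_def by blast
  have iff: "f x \<in> center R \<longleftrightarrow> x \<in> center R" if x: "x \<in> carrier R" for x
  proof
    assume c: "x \<in> center R"
    show "f x \<in> center R"
    proof (rule center_memI[OF h(1)[OF x]])
      fix y assume "y \<in> carrier R"
      then obtain z where z: "z \<in> carrier R" "f z = y" using surj by blast
      show "f x \<otimes> y = y \<otimes> f x"
        using h(2)[OF x z(1)] h(2)[OF z(1) x] center_comm[OF c z(1)] z(2) by metis
    qed
  next
    assume c: "f x \<in> center R"
    show "x \<in> center R"
    proof (rule center_memI[OF x])
      fix y assume y: "y \<in> carrier R"
      show "x \<otimes> y = y \<otimes> x"
      proof (rule inj)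
        show "f (x \<otimes> y) = f (y \<otimes> x)"
          using h(2)[OF x y] h(2)[OF y x] center_comm[OF c h(1)[OF y]] by (simp only:)
      qed (use x y in auto)
    qed
  qed
  then show closed: "c \<in> center R \<Longrightarrow> f c \<in> center R" for c using center_carrier by blast
  have "bij_betw f (center R) (center R)"
    unfolding bij_betw_def
  proof
    show "inj_on f (center R)" by (rule inj_onI, rule inj) (simp_all add: center_carrier)
    show "f ` center R = center R"
    proof (intro equalityI subsetI)
      fix y assume y: "y \<in> center R"
      then obtain x where "x \<in> carrier R" "f x = y" using surj center_carrier by blast
      then show "y \<in> f ` center R" using iff y by blast
    qed (use closed in blast)
  qed
  then have "bij_betw (restrict f (center R)) (center R) (center R)" by simp
  moreover have "restrict f (center R) \<in> ring_hom (R\<lparr>carrier := center R\<rparr>) (R\<lparr>carrier := center R\<rparr>)"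
    using closed h center_carrier subringE[OF center_subring]
    by (intro ring_hom_memI) simp_all
  ultimately show "restrict f (center R) \<in> carrier (ring_aut (R\<lparr>carrier := center R\<rparr>))"
    by (simp add: ring_aut_def ring_iso_def Bij_def)
qed

text \<open>The order of the restriction to the center, together with the subgroup condition, makes the first
  n powers of the automorphism a cyclic group that acts faithfully on the center.\<close>

lemma menichetti_locale:
  fixes D :: "'d ring" and \<sigma> :: "'d \<Rightarrow> 'd"
  assumes simple: "simple_ring D" and aut: "\<sigma> \<in> carrier (ring_aut D)"
    and ord: "group.ord (ring_aut (D\<lparr>carrier := center D\<rparr>)) (restrict \<sigma> (center D)) = n" "n > 0"
    and subgrp: "subgroup {\<sigma> [^]\<^bsub>ring_aut D\<^esub> i |i. i < n} (ring_aut D)"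
    and k: "\<And>i. i < n \<Longrightarrow> k i \<in> Units (D\<lparr>carrier := center D\<rparr>)"
  shows "menichetti D \<sigma> n k"
    and "galois_simple_ring.Fix D (\<lambda>j. \<sigma> ^^ j) n = {x \<in> carrier D. \<sigma> x = x} \<inter> center D"
proof -
  interpret ring D using simple by (simp add: simple_ring_def)
  let ?C = "center D" and ?CR = "D\<lparr>carrier := center D\<rparr>" and ?G = "ring_aut D"
  note closed = restrict_center_aut(2)[OF aut]
  have Bij: "\<sigma> \<in> Bij (carrier D)" "\<sigma> \<in> ring_iso D D" using aut by (auto simp: ring_aut_def)
  note pow = ring_aut_pow[OF Bij(1)]
  have fixes_C: "(\<forall>c\<in>?C. (\<sigma> ^^ i) c = c) \<longleftrightarrow> n dvd i" for i
  proof -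
    interpret G: group "ring_aut ?CR"
      by (intro ring_aut_group subring_is_ring center_subring)
    let ?r = "restrict \<sigma> ?C"
    have r: "?r \<in> carrier (ring_aut ?CR)" by (rule restrict_center_aut(1)[OF aut])
    then have rB: "?r \<in> Bij (carrier ?CR)" by (simp add: ring_aut_def)
    have iter: "(\<sigma> ^^ j) c \<in> ?C \<and> (?r ^^ j) c = (\<sigma> ^^ j) c" if "c \<in> ?C" for j c
      using that closed by (induction j) auto
    have "n dvd i \<longleftrightarrow> ?r [^]\<^bsub>ring_aut ?CR\<^esub> i = \<one>\<^bsub>ring_aut ?CR\<^esub>"
      using G.pow_eq_id[OF r] ord(1) by simp
    also have "\<dots> \<longleftrightarrow> (\<forall>c\<in>?C. (?r [^]\<^bsub>ring_aut ?CR\<^esub> i) c = c)"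
    proof
      assume "\<forall>c\<in>?C. (?r [^]\<^bsub>ring_aut ?CR\<^esub> i) c = c"
      then show "?r [^]\<^bsub>ring_aut ?CR\<^esub> i = \<one>\<^bsub>ring_aut ?CR\<^esub>"
        using Bij_imp_extensional[OF ring_aut_pow(1)[OF rB, of i]]
        by (intro extensionalityI[of _ ?C]) (simp_all add: ring_aut_def BijGroup_def)
    qed (simp add: ring_aut_def BijGroup_def)
    also have "\<dots> \<longleftrightarrow> (\<forall>c\<in>?C. (\<sigma> ^^ i) c = c)"
      using ring_aut_pow(2)[OF rB, of _ i] iter by simp
    finally show ?thesis by blast
  qed
  \<comment> \<open>The n-th power of the automorphism is one of the earlier ones, and only the identity fixes C.\<close>
  have pow_mem: "\<sigma> [^]\<^bsub>?G\<^esub> i \<in> {\<sigma> [^]\<^bsub>?G\<^esub> i |i. i < n}" if "i < n" for i using that by blast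
  have period: "(\<sigma> ^^ n) x = x" if n: "n > 1" and x: "x \<in> carrier D" for x
  proof -
    have "\<sigma> [^]\<^bsub>?G\<^esub> (n - 1) \<otimes>\<^bsub>?G\<^esub> \<sigma> [^]\<^bsub>?G\<^esub> (1::nat) \<in> {\<sigma> [^]\<^bsub>?G\<^esub> i |i. i < n}"
      using n by (intro subgroup.m_closed[OF subgrp] pow_mem) auto
    from this[unfolded mem_Collect_eq] obtain i where i: "i < n" "\<sigma> [^]\<^bsub>?G\<^esub> (n - 1) \<otimes>\<^bsub>?G\<^esub> \<sigma> [^]\<^bsub>?G\<^esub> (1::nat) = \<sigma> [^]\<^bsub>?G\<^esub> i" by blast
    have "(\<sigma> ^^ n) y = (\<sigma> ^^ i) y" if y: "y \<in> carrier D" for y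
    proof -
      have sy: "\<sigma> y \<in> carrier D" using y Bij_imp_funcset[OF Bij(1)] by blast
      have "\<sigma> [^]\<^bsub>?G\<^esub> (n - 1) \<otimes>\<^bsub>?G\<^esub> \<sigma> [^]\<^bsub>?G\<^esub> (1::nat) =
          compose (carrier D) (\<sigma> [^]\<^bsub>?G\<^esub> (n - 1)) (\<sigma> [^]\<^bsub>?G\<^esub> (1::nat))"
        by (rule ring_aut_mult[OF pow(1) pow(1)])
      then have "(\<sigma> [^]\<^bsub>?G\<^esub> i) y = (\<sigma> [^]\<^bsub>?G\<^esub> (n - 1)) ((\<sigma> [^]\<^bsub>?G\<^esub> (1::nat)) y)"
        using y by (simp add: i(2)[symmetric] compose_def)
      also have "\<dots> = (\<sigma> ^^ (n - 1)) (\<sigma> y)"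
        using pow(2)[OF y, of 1] pow(2)[OF sy, of "n - 1"] by simp
      also have "\<dots> = (\<sigma> ^^ n) y" using n by (cases n) (simp_all add: funpow_swap1)
      finally show ?thesis using pow(2)[OF y, of i] by simp
    qed
    note eq = this
    then have "\<forall>c\<in>?C. (\<sigma> ^^ i) c = c" using fixes_C[of n] center_carrier by (metis dvd_refl)
    then have "i = 0" using fixes_C[of i] i(1) by (meson dvd_imp_le gr0I leD)
    then show ?thesis using eq[OF x] by simp
  qed
  show men: "menichetti D \<sigma> n k"
  proof (intro menichetti.intro galois_simple_ring.intro galois_simple_ring_axioms.intro
      menichetti_axioms.intro ring_axioms simple ord(2) k)
    show "\<sigma> ^^ i \<in> ring_iso D D" for i
    proof (induction i)
      case 0
      then show ?case using ring_iso_set_refl by (simp add: id_def)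
    next
      case (Suc i)
      then show ?case using ring_iso_set_trans[OF Suc Bij(2)] by (simp add: o_def)
    qed
    show "(\<sigma> ^^ i) ((\<sigma> ^^ j) d) = (\<sigma> ^^ ((i + j) mod n)) d"
      if "i < n" "j < n" "d \<in> carrier D" for i j d
    proof (cases "n > 1")
      case True
      then show ?thesis using funpow_mod_eq[OF period[OF True that(3)]] by (simp add: funpow_add)
    next
      case False
      then have "i = 0" "j = 0" using that by auto
      then show ?thesis by simp
    qed
    show "\<exists>c\<in>?C. (\<sigma> ^^ i) c \<noteq> c" if "0 < i" "i < n" for i
      using fixes_C[of i] that by (meson dvd_imp_le leD)
  qed simp
  interpret menichetti D \<sigma> n k by (rule men)
  show "galois_simple_ring.Fix D (\<lambda>j. \<sigma> ^^ j) n = {x \<in> carrier D. \<sigma> x = x} \<inter> ?C"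
  proof (cases "n > 1")
    case True
    then show ?thesis by (rule Fix_eq)
  next
    case False
    then have "n = 1" using ord(2) by simp
    then show ?thesis unfolding Fix_def using fixes_C[of 1] center_carrier by auto
  qed
qed

theorem lemma2p12:
  fixes D :: "'d ring" and \<sigma> :: "'d \<Rightarrow> 'd" and k :: "nat \<Rightarrow> 'd"
    and C E :: "'d set" and F :: "'d ring" and m n :: nat
  assumes D: "csa_of_degree m D"
    and C: "C = center D"
    and aut: "\<sigma> \<in> carrier (ring_aut D)"
    and order: "group.ord (ring_aut (D\<lparr>carrier := C\<rparr>)) (restrict \<sigma> C) = n" "n > 0"
    and subgrp: "subgroup {\<sigma> [^]\<^bsub>ring_aut D\<^esub> i |i. i < n} (ring_aut D)"
    and F: "F = D\<lparr>carrier := {x \<in> carrier D. \<sigma> x = x} \<inter> C\<rparr>"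
    and k: "\<And>i. i < n \<Longrightarrow> k i \<in> Units (D\<lparr>carrier := C\<rparr>)"
    and E: "maximal_etale_subalg (D\<lparr>carrier := C\<rparr>) (self_alg D) E"
    and dim: "ring.dimension D m C E"
  shows "men_embed D n ` E \<subseteq> nuc_l (Men D \<sigma> n k) \<and>
     men_embed D n ` E \<subseteq> nuc_m (Men D \<sigma> n k) \<and>
     men_embed D n ` E \<subseteq> nuc_r (Men D \<sigma> n k) \<and>
     semiassociative F (Men D \<sigma> n k) \<and>
     (\<not> associative (Men D \<sigma> n k) \<longrightarrow> \<not> homogeneous F (Men D \<sigma> n k))"
proof -
  have simple: "simple_ring D" and Ddim: "ring.dimension D (m * m) (center D) (carrier D)"
    using D by (auto simp: csa_of_degree_def power2_eq_square)
  note men = menichetti_locale[OF simple aut order[unfolded C] subgrp k[unfolded C]]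
  interpret menichetti D \<sigma> n k by (rule men(1))
  interpret menichetti_etale D \<sigma> n k E m
    using E dim Ddim unfolding C maximal_etale_subalg_def by unfold_locales auto
  have Fix: "Fix = {x \<in> carrier D. \<sigma> x = x} \<inter> center D" by (rule men(2))
  have F: "F = FixR" unfolding F C by (simp only: Fix)
  have "men_embed D n ` E \<subseteq> nuc_l M \<and> men_embed D n ` E \<subseteq> nuc_m M \<and> men_embed D n ` E \<subseteq> nuc_r M"
    unfolding single_0 using embed_nuclei E_carrier by blast
  then show ?thesis unfolding F using M_semiassociative M_not_homogeneous by blast
qed

end
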